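(* Assume $M_*=1$ (MISO/SIMO, including SISO). The optimal distortion exponent is $$\Delta^*(b,\nu)=\begin{cases}\max\{\nu,b\} & \text{for } b\le\max\{M^*,\nu\},\\ M^*+\nu\left(1-\frac{M^*}{b}\right) & \text{for } b>\max\{M^*,\nu\},\end{cases}$$ and it is achieved by BS-LD in the limit of infinitely many layers.
   Context: All logarithms are base 2. Let $M_t,M_r\ge1$ be integers, $M^*=\max\{M_t,M_r\}$, $M_*=\min\{M_t,M_r\}$. A block $S^m$ of i.i.d. $\mathcal{CN}(0,1)$ source samples must be sent over one block of $n$ uses of the channel $\mathbf Y_i=\sqrt{\rho/M_t}\,\mathbf H\mathbf x_i+\mathbf N_i$, SNR $\rho>0$, $\mathbf H\in\mathbb C^{M_r\times M_t}$ with i.i.d. $\mathcal{CN}(0,1)$ entries constant over the block, $\mathbf N_i\sim\mathcal{CN}(0,\mathbf I)$ i.i.d., power constraint $\sum_i\mathrm{Tr}\,\mathbb E[\mathbf X_i^H\mathbf X_i]\le nM_t$. The receiver also observes $T^m=\sqrt{\rho_s}\Gamma_cS^m+Z^m$, $\Gamma_c\sim\mathcal{CN}(0,1)$ constant over the block, unit-variance Gaussian noise; $\Gamma=|\Gamma_c|^2$ has density $e^{-\gamma}$. All random quantities independent; receiver knows $\mathbf H,\gamma$, transmitter only their distributions. $b=n/m$. Encoders map $S^m$ to $\mathbf X^n$, decoders map $(\mathbf Y^n,T^m,\mathbf H,\gamma)$ to $\hat S^m$, $D=\frac1m\sum_i|S_i-\hat S_i|^2$, $ED^*=\lim_{n,m\to\infty}\min\mathbb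 E[D]$ over pairs with $n\le mb$. With $\rho_s\doteq\rho^\nu$, $\nu\ge0$, the distortion exponent of $\mathbb E[D]$ is $-\lim_{\rho\to\infty}\log\mathbb E[D]/\log\rho$; $\Delta^*(b,\nu)$ is that of $ED^*$. Let $D_d(R,\gamma)=(\rho_s\gamma+2^R)^{-1}$. BS-LD scheme with $L$ layers: Gaussian successive-refinement (Wyner–Ziv) layers with rates $bR_l$ per source sample, $R_l=r_l\log\rho$, sent by superposition of i.i.d. Gaussian codebooks with powers $\rho^{\xi_{l-1}}-\rho^{\xi_l}$, $1=\xi_0\ge\xi_1\ge\dots\ge\xi_L\ge0$, decoded successively by list decoding (later layers as noise). With $\bar R_l=\sum_{i\le l}R_i$, layer $l$ is in outage if $b\log\frac{\det(\mathbf I+\rho^{\xi_{l-1}}\mathbf H\mathbf H^H/M_* )}{\det(\mathbf I+\rho^{\xi_l}\mathbf H\mathbf H^H/M_* )}\le\log\frac{2^{b\bar R_l}+\gamma\rho_s}{2^{b\bar R_{l-1}}+\gamma\rho_s}$; with $N$ the largest $l$ such that layers $1,\dots,l$ are not in outage, the distortion is $D_d(b\bar R_N,\gamma)$, averaged over $\mathbf H,\Gamma$. "Achieved by BS-LD in the limit of infinitely many layers" means the supremum (over rates and power exponents) of the BS-LD distortion exponent with $L$ layers tends to the stated value as $L\to\infty$. *)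

theory Defs
  imports "HOL-Probability.Probability" "Jordan_Normal_Form.Determinant"
begin

definition cgauss :: "complex measure" where
  "cgauss = density lborel (\<lambda>z. ennreal (exp (- (cmod z)\<^sup>2) / pi))"

type_synonym cvec = "nat \<Rightarrow> complex"
type_synonym cmat = "nat \<times> nat \<Rightarrow> complex"

definition iid_cvec :: "nat \<Rightarrow> cvec measure" where
  "iid_cvec k = PiM {..<k} (\<lambda>_. cgauss)"

definition iid_cmat :: "nat \<Rightarrow> nat \<Rightarrow> cmat measure" where
  "iid_cmat a c = PiM ({..<a} \<times> {..<c}) (\<lambda>_. cgauss)"

text \<open>Joint experiment for block lengths m (source) and n (channel):
  source S^m, channel matrix H (Mr x Mt), channel noise N (entries N(i,r), i<n, r<Mr),
  side-information fading Gamma_c, side-information noise Z^m; all independent.\<close>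
definition joint_space ::
  "nat \<Rightarrow> nat \<Rightarrow> nat \<Rightarrow> nat \<Rightarrow> (cvec \<times> cmat \<times> cmat \<times> complex \<times> cvec) measure" where
  "joint_space Mt Mr m n =
     iid_cvec m \<Otimes>\<^sub>M (iid_cmat Mr Mt \<Otimes>\<^sub>M (iid_cmat n Mr \<Otimes>\<^sub>M (cgauss \<Otimes>\<^sub>M iid_cvec m)))"

text \<open>Channel output Y(i,r) = sqrt(rho/Mt) (H x_i)_r + N(i,r), for channel uses i<n,
  receive antennas r<Mr; X(i,t) is the symbol of antenna t<Mt at channel use i.\<close>
definition chan_out :: "nat \<Rightarrow> nat \<Rightarrow> nat \<Rightarrow> real \<Rightarrow> cmat \<Rightarrow> cmat \<Rightarrow> cmat \<Rightarrow> cmat" where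
  "chan_out Mt Mr n \<rho> H X N =
     restrict (\<lambda>(i,r). complex_of_real (sqrt (\<rho> / real Mt)) * (\<Sum>t<Mt. H (r,t) * X (i,t)) + N (i,r))
              ({..<n} \<times> {..<Mr})"

definition side_out :: "nat \<Rightarrow> real \<Rightarrow> complex \<Rightarrow> cvec \<Rightarrow> cvec \<Rightarrow> cvec" where
  "side_out m \<rho>s Gc S Z = restrict (\<lambda>j. complex_of_real (sqrt \<rho>s) * Gc * S j + Z j) {..<m}"

definition distortion :: "nat \<Rightarrow> cvec \<Rightarrow> cvec \<Rightarrow> real" where
  "distortion m S Shat = (\<Sum>j<m. (cmod (S j - Shat j))\<^sup>2) / real m"

text \<open>Observation space of the decoder: (Y^n, T^m, H, gamma).\<close>
definition obs_space :: "nat \<Rightarrow> nat \<Rightarrow> nat \<Rightarrow> nat \<Rightarrow> (cmat \<times> cvec \<times> cmat \<times> real) measure" where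
  "obs_space Mt Mr m n =
     PiM ({..<n} \<times> {..<Mr}) (\<lambda>_. borel) \<Otimes>\<^sub>M
       (PiM {..<m} (\<lambda>_. borel) \<Otimes>\<^sub>M (PiM ({..<Mr} \<times> {..<Mt}) (\<lambda>_. borel) \<Otimes>\<^sub>M borel))"

definition exp_dist ::
  "nat \<Rightarrow> nat \<Rightarrow> real \<Rightarrow> real \<Rightarrow> nat \<Rightarrow> nat \<Rightarrow> (cvec \<Rightarrow> cmat)
    \<Rightarrow> (cmat \<Rightarrow> cvec \<Rightarrow> cmat \<Rightarrow> real \<Rightarrow> cvec) \<Rightarrow> ennreal" where
  "exp_dist Mt Mr \<rho> \<rho>s m n f g =
     (\<integral>\<^sup>+ \<omega>. (case \<omega> of (S, H, N, Gc, Z) \<Rightarrow>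
         ennreal (distortion m S
           (g (chan_out Mt Mr n \<rho> H (f S) N) (side_out m \<rho>s Gc S Z)
              (restrict H ({..<Mr} \<times> {..<Mt})) ((cmod Gc)\<^sup>2))))
      \<partial>joint_space Mt Mr m n)"

definition admissible ::
  "nat \<Rightarrow> nat \<Rightarrow> real \<Rightarrow> nat \<Rightarrow> nat \<Rightarrow> (cvec \<Rightarrow> cmat)
    \<Rightarrow> (cmat \<Rightarrow> cvec \<Rightarrow> cmat \<Rightarrow> real \<Rightarrow> cvec) \<Rightarrow> bool" where
  "admissible Mt Mr b m n f g \<longleftrightarrow>
     real n \<le> real m * b \<and>
     (\<forall>i<n. \<forall>t<Mt. (\<lambda>S. f S (i,t)) \<in> borel_measurable (iid_cvec m)) \<and>
     (\<forall>j<m. (\<lambda>(y,tt,h,\<gamma>). g y tt h \<gamma> j) \<in> borel_measurable (obs_space Mt Mr m n)) \<and>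
     (\<integral>\<^sup>+ S. ennreal (\<Sum>i<n. \<Sum>t<Mt. (cmod (f S (i,t)))\<^sup>2) \<partial>iid_cvec m)
        \<le> ennreal (real n * real Mt)"

definition opt_dist :: "nat \<Rightarrow> nat \<Rightarrow> real \<Rightarrow> real \<Rightarrow> real \<Rightarrow> nat \<Rightarrow> ennreal" where
  "opt_dist Mt Mr b \<rho> \<rho>s m =
     (INF p \<in> {(n, f, g). admissible Mt Mr b m n f g}.
        (case p of (n, f, g) \<Rightarrow> exp_dist Mt Mr \<rho> \<rho>s m n f g))"

definition ED_star :: "nat \<Rightarrow> nat \<Rightarrow> real \<Rightarrow> real \<Rightarrow> real \<Rightarrow> real" where
  "ED_star Mt Mr b \<rho> \<rho>s = lim (\<lambda>m. enn2real (opt_dist Mt Mr b \<rho> \<rho>s m))"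

definition gram_det :: "nat \<Rightarrow> nat \<Rightarrow> cmat \<Rightarrow> real \<Rightarrow> real" where
  "gram_det Mt Mr H x =
     Re (Determinant.det (Matrix.mat Mr Mr (\<lambda>(i,j).
        (if i = j then 1 else 0)
        + complex_of_real (x / real (min Mt Mr)) * (\<Sum>t<Mt. H (i,t) * cnj (H (j,t))))))"

definition cum_rate :: "real \<Rightarrow> (nat \<Rightarrow> real) \<Rightarrow> nat \<Rightarrow> real" where
  "cum_rate \<rho> r l = (\<Sum>i\<in>{1..l}. r i * log 2 \<rho>)"

definition bsld_outage ::
  "nat \<Rightarrow> nat \<Rightarrow> real \<Rightarrow> real \<Rightarrow> real \<Rightarrow> (nat \<Rightarrow> real) \<Rightarrow> (nat \<Rightarrow> real) \<Rightarrow> cmat \<Rightarrow> real \<Rightarrow> nat \<Rightarrow> bool" where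
  "bsld_outage Mt Mr b \<rho> \<rho>s r \<xi> H \<gamma> l \<longleftrightarrow>
     b * log 2 (gram_det Mt Mr H (\<rho> powr \<xi> (l - 1)) / gram_det Mt Mr H (\<rho> powr \<xi> l))
     \<le> log 2 ((2 powr (b * cum_rate \<rho> r l) + \<gamma> * \<rho>s)
              / (2 powr (b * cum_rate \<rho> r (l - 1)) + \<gamma> * \<rho>s))"

definition bsld_layers ::
  "nat \<Rightarrow> nat \<Rightarrow> real \<Rightarrow> real \<Rightarrow> real \<Rightarrow> nat \<Rightarrow> (nat \<Rightarrow> real) \<Rightarrow> (nat \<Rightarrow> real) \<Rightarrow> cmat \<Rightarrow> real \<Rightarrow> nat" where
  "bsld_layers Mt Mr b \<rho> \<rho>s L r \<xi> H \<gamma> =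
     Max {l. l \<le> L \<and> (\<forall>k\<in>{1..l}. \<not> bsld_outage Mt Mr b \<rho> \<rho>s r \<xi> H \<gamma> k)}"

definition D_d :: "real \<Rightarrow> real \<Rightarrow> real \<Rightarrow> real" where
  "D_d \<rho>s R \<gamma> = 1 / (\<rho>s * \<gamma> + 2 powr R)"

definition bsld_exp_dist ::
  "nat \<Rightarrow> nat \<Rightarrow> real \<Rightarrow> real \<Rightarrow> real \<Rightarrow> nat \<Rightarrow> (nat \<Rightarrow> real) \<Rightarrow> (nat \<Rightarrow> real) \<Rightarrow> real" where
  "bsld_exp_dist Mt Mr b \<rho> \<rho>s L r \<xi> = enn2real
     (\<integral>\<^sup>+ \<omega>. (case \<omega> of (H, Gc) \<Rightarrow>
        ennreal (D_d \<rho>s (b * cum_rate \<rho> r (bsld_layers Mt Mr b \<rho> \<rho>s L r \<xi> H ((cmod Gc)\<^sup>2)))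
                      ((cmod Gc)\<^sup>2)))
      \<partial>(iid_cmat Mr Mt \<Otimes>\<^sub>M cgauss))"

text \<open>Distortion exponent of BS-LD with given rate exponents r and power exponents xi
  (as a liminf, i.e. the exponent guaranteed by the scheme; equals the limit when it exists).\<close>
definition bsld_exponent ::
  "nat \<Rightarrow> nat \<Rightarrow> real \<Rightarrow> (real \<Rightarrow> real) \<Rightarrow> nat \<Rightarrow> (nat \<Rightarrow> real) \<Rightarrow> (nat \<Rightarrow> real) \<Rightarrow> ereal" where
  "bsld_exponent Mt Mr b \<rho>s L r \<xi> =
     Liminf at_top (\<lambda>\<rho>. ereal (- ln (bsld_exp_dist Mt Mr b \<rho> (\<rho>s \<rho>) L r \<xi>) / ln \<rho>))"

definition bsld_params :: "nat \<Rightarrow> (nat \<Rightarrow> real) \<Rightarrow> (nat \<Rightarrow> real) \<Rightarrow> bool" where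
  "bsld_params L r \<xi> \<longleftrightarrow> \<xi> 0 = 1 \<and> (\<forall>l\<in>{1..L}. \<xi> l \<le> \<xi> (l - 1)) \<and> 0 \<le> \<xi> L
     \<and> (\<forall>l\<in>{1..L}. 0 \<le> r l)"

definition bsld_best_exponent :: "nat \<Rightarrow> nat \<Rightarrow> real \<Rightarrow> (real \<Rightarrow> real) \<Rightarrow> nat \<Rightarrow> ereal" where
  "bsld_best_exponent Mt Mr b \<rho>s L =
     (SUP p \<in> {(r, \<xi>). bsld_params L r \<xi>}. (case p of (r, \<xi>) \<Rightarrow> bsld_exponent Mt Mr b \<rho>s L r \<xi>))"

definition Delta_formula :: "nat \<Rightarrow> nat \<Rightarrow> real \<Rightarrow> real \<Rightarrow> real" where
  "Delta_formula Mt Mr b \<nu> =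
     (let Ms = real (max Mt Mr) in
      if b \<le> max Ms \<nu> then max \<nu> b else Ms + \<nu> * (1 - Ms / b))"

end

theory Submission
  imports Defs "HOL-Computational_Algebra.Polynomial"
begin

text \<open>
  Write \<open>M = max Mt Mr\<close>. The formula equals both the maximum of \<open>b \<theta> + \<nu> (1 - \<theta>)\<close> over
  \<open>\<theta> \<in> [0, 1]\<close> with \<open>b \<theta> \<le> M\<close> and the minimum of \<open>M \<alpha> + max {\<nu>, b (1 - \<alpha>)}\<close> over
  \<open>\<alpha> \<in> [0, 1]\<close>.

  Converse: with probability of order \<open>\<rho>\<^sup>-\<^sup>M\<^sup>\<alpha>\<close> the channel gain is below \<open>\<rho>\<^sup>-\<^sup>\<alpha>\<close>, and the
  channel then carries about \<open>b (1 - \<alpha>) log \<rho>\<close> bits per source sample. Neither the encoder nor the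
  channel output depends on the side information quality \<open>\<gamma>\<close>, so the distortions at an increasing
  ladder of qualities obey a single rate inequality of Heegard-Berger type; averaged over \<open>\<gamma>\<close> it
  yields a distortion of order at least \<open>min {1/\<rho>\<^sub>s, \<rho>\<^sup>-\<^sup>b\<^sup>(\<^sup>1\<^sup>-\<^sup>\<alpha>\<^sup>)}\<close>. The layers of BS-LD satisfy the
  same ladder inequality by telescoping.

  Achievability: a concatenation argument makes \<open>m D\<close> subadditive in the block length, so that any
  fixed code bounds the limit. The code used here interleaves the digits of the source coordinates and
  transmits them in base \<open>2 B\<close> instead of \<open>B\<close>: channel errors of size \<open>\<epsilon>\<close> become source errors of
  size \<open>\<epsilon>\<^sup>\<kappa>\<close> with \<open>\<kappa>\<close> arbitrarily close to \<open>b\<close>. The decoder uses the better of this reconstruction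
  and the side information, and \<open>min {x, y} \<le> x\<^sup>\<theta> y\<^sup>1\<^sup>-\<^sup>\<theta>\<close> gives the exponent \<open>b \<theta> + \<nu> (1 - \<theta>)\<close>.
  As the decoder does not see the phase of the side information channel, one channel use sends a
  source sample uncoded.
\<close>

section \<open>Complex Gaussian variables\<close>

text \<open>The limit over block lengths sits inside the limit over \<rho>, so factors independent
  of the block length cost nothing and exponents may be missed by an arbitrarily small amount. This
  is why no random coding occurs: one block of fixed size with a Hoelder continuous inverse already
  reaches the exponent. The obstacle is integrability. The natural error bounds
  \<open>1 / (\<rho>s * \<gamma>)\<close> and
  \<open>(\<rho> * frob Mt Mr H) powr (- \<kappa>)\<close> need not have finite means:
  \<open>1 / \<gamma>\<close> is not integrable at 0, and \<open>frob\<close> has negative moments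
  only below the order \<open>Mr * Mt\<close>. So every estimate is first weakened to fractional
  powers, with \<mu> < 1 and \<open>\<kappa> * \<theta> < Mr * Mt\<close>, and the loss is removed
  at the end by letting the parameters tend to their limits. The hypothesis
  \<open>min Mt Mr = 1\<close> gives rank one, so the squared norm \<open>frob\<close> is the only
  channel parameter in both converses, and it gives \<open>Mr * Mt = max Mt Mr\<close>, so the
  number of channel entries is the diversity. The phase error has to vanish at fixed \<rho>; a power
  constraint on the block average allows this, since a single use may take a growing share.\<close>

lemma cgauss_density_lborel:
  "cgauss = density lborel (\<lambda>z. ennreal (normal_density 0 (1 / sqrt 2) (Re z)) * ennreal (normal_density 0 (1 / sqrt 2) (Im z)))"
  unfolding cgauss_def
proof (rule arg_cong[where f="density lborel"], rule ext)
  fix z :: complex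
  have "exp (- (cmod z)\<^sup>2) / pi = normal_density 0 (1 / sqrt 2) (Re z) * normal_density 0 (1 / sqrt 2) (Im z)"
    by (simp add: normal_density_def power_divide cmod_power2 exp_add[symmetric])
  then show "ennreal (exp (- (cmod z)\<^sup>2) / pi) = ennreal (normal_density 0 (1 / sqrt 2) (Re z)) * ennreal (normal_density 0 (1 / sqrt 2) (Im z))"
    by (simp add: ennreal_mult)
qed

lemma space_cgauss [simp]: "space cgauss = UNIV"
  and sets_cgauss [simp, measurable_cong]: "sets cgauss = sets borel"
  by (simp_all add: cgauss_def)

lemma nn_integral_lborel_complex_Re_Im:
  assumes [measurable]: "f \<in> borel_measurable borel" "g \<in> borel_measurable borel"
  shows "(\<integral>\<^sup>+z. f (Re z) * g (Im z) \<partial>lborel) = (\<integral>\<^sup>+x. f x \<partial>lborel) * (\<integral>\<^sup>+x. g x \<partial>lborel)"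
proof -
  have "(\<integral>\<^sup>+z. (\<Prod>b\<in>Basis. (if b = 1 then f else g) (z \<bullet> b)) \<partial>(lborel :: complex measure))
      = (\<Prod>b\<in>Basis. (\<integral>\<^sup>+x. (if b = (1::complex) then f else g) x \<partial>lborel))"
    by (rule nn_integral_lborel_prod) auto
  then show ?thesis
    by (simp add: Basis_complex_def inner_complex_def)
qed

lemma nn_integral_cgauss_Re_Im:
  assumes [measurable]: "f \<in> borel_measurable borel" "g \<in> borel_measurable borel"
  shows "(\<integral>\<^sup>+z. f (Re z) * g (Im z) \<partial>cgauss)
    = (\<integral>\<^sup>+x. f x * ennreal (normal_density 0 (1 / sqrt 2) x) \<partial>lborel)
      * (\<integral>\<^sup>+x. g x * ennreal (normal_density 0 (1 / sqrt 2) x) \<partial>lborel)"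
  unfolding cgauss_density_lborel
  by (subst nn_integral_density) (auto simp: nn_integral_lborel_complex_Re_Im[symmetric] mult_ac)

lemma nn_integral_normal_density_1:
  "(\<integral>\<^sup>+x. ennreal (normal_density 0 (1 / sqrt 2) x) \<partial>lborel) = 1"
  by (simp add: nn_integral_eq_integral normal_density_nonneg)

lemma prob_space_cgauss: "prob_space cgauss"
proof (rule prob_spaceI)
  have "(\<integral>\<^sup>+z. (\<lambda>_. 1) (Re z) * (\<lambda>_. 1) (Im z) \<partial>cgauss) = 1"
    by (subst nn_integral_cgauss_Re_Im) (auto simp: nn_integral_normal_density_1)
  then show "emeasure cgauss (space cgauss) = 1"
    by simp
qed

interpretation cgauss: prob_space cgauss
  by (rule prob_space_cgauss)

lemma nn_integral_normal_shift_square: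
  "(\<integral>\<^sup>+x. ennreal ((c + x)\<^sup>2) * ennreal (normal_density 0 (1 / sqrt 2) x) \<partial>lborel) = ennreal (c\<^sup>2 + 1/2)"
proof -
  let ?n = "normal_density 0 (1 / sqrt 2)"
  have 0: "has_bochner_integral lborel ?n 1"
    by (simp add: has_bochner_integral_iff)
  have 1: "has_bochner_integral lborel (\<lambda>x. ?n x * x) 0"
    using normal_moment_nz_1[of "1 / sqrt 2" 0] by simp
  have 2: "has_bochner_integral lborel (\<lambda>x. ?n x * x^2) (1/2)"
    using normal_moment_even[of "1 / sqrt 2" 0 1] by (simp add: power_divide)
  have "has_bochner_integral lborel (\<lambda>x. c\<^sup>2 * ?n x + 2 * c * (?n x * x) + ?n x * x^2) (c\<^sup>2 * 1 + 2 * c * 0 + 1/2)"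
    by (intro has_bochner_integral_add has_bochner_integral_mult_right 0 1 2)
  then have *: "has_bochner_integral lborel (\<lambda>x. (c + x)\<^sup>2 * ?n x) (c\<^sup>2 + 1/2)"
    by (simp add: power2_eq_square algebra_simps)
  have "(\<integral>\<^sup>+x. ennreal ((c + x)\<^sup>2 * ?n x) \<partial>lborel) = ennreal (c\<^sup>2 + 1/2)"
    using * by (subst nn_integral_eq_integral) (auto simp: has_bochner_integral_iff)
  then show ?thesis
    by (simp add: ennreal_mult)
qed

lemma nn_integral_cgauss_shift_square:
  "(\<integral>\<^sup>+z. ennreal ((cmod (a + z))\<^sup>2) \<partial>cgauss) = ennreal ((cmod a)\<^sup>2 + 1)"
proof -
  have "(\<integral>\<^sup>+z. ennreal ((cmod (a + z))\<^sup>2) \<partial>cgauss) =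
     (\<integral>\<^sup>+z. ennreal ((Re a + Re z)\<^sup>2) * 1 + 1 * ennreal ((Im a + Im z)\<^sup>2) \<partial>cgauss)"
    by (intro nn_integral_cong) (simp add: cmod_power2)
  also have "\<dots> = (\<integral>\<^sup>+z. (\<lambda>x. ennreal ((Re a + x)\<^sup>2)) (Re z) * (\<lambda>_. 1) (Im z) \<partial>cgauss)
     + (\<integral>\<^sup>+z. (\<lambda>_. 1) (Re z) * (\<lambda>x. ennreal ((Im a + x)\<^sup>2)) (Im z) \<partial>cgauss)"
    by (subst nn_integral_add) auto
  also have "\<dots> = ennreal ((Re a)\<^sup>2 + 1/2) + ennreal ((Im a)\<^sup>2 + 1/2)"
    by (subst (1 2) nn_integral_cgauss_Re_Im)
       (simp_all add: nn_integral_normal_shift_square nn_integral_normal_density_1)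
  also have "\<dots> = ennreal ((cmod a)\<^sup>2 + 1)"
    by (simp add: cmod_power2 flip: ennreal_plus)
  finally show ?thesis .
qed

text \<open>The width \<open>w\<close> is the variance of both real components together: each has
  standard deviation \<open>sqrt (w / 2)\<close> and contributes a factor
  \<open>sqrt (pi * w)\<close>.\<close>

lemma nn_integral_lborel_gaussian:
  assumes "0 < w"
  shows "(\<integral>\<^sup>+z. ennreal (exp (- ((cmod (z - \<mu>))\<^sup>2 / w))) \<partial>lborel) = ennreal (pi * w)"
proof -
  have *: "(\<integral>\<^sup>+x. ennreal (exp (- ((x - c)\<^sup>2 / w))) \<partial>lborel) = ennreal (sqrt (pi * w))" for c
  proof -
    have "(\<integral>\<^sup>+x. ennreal (exp (- ((x - c)\<^sup>2 / w))) \<partial>lborel)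
       = (\<integral>\<^sup>+x. ennreal (sqrt (pi * w)) * ennreal (normal_density c (sqrt (w / 2)) x) \<partial>lborel)"
      using assms by (intro nn_integral_cong) (auto simp: normal_density_def simp flip: ennreal_mult)
    also have "\<dots> = ennreal (sqrt (pi * w)) * 1"
      using assms by (subst nn_integral_cmult) (auto simp: nn_integral_eq_integral normal_density_nonneg)
    finally show ?thesis by simp
  qed
  have "(\<integral>\<^sup>+z. ennreal (exp (- ((cmod (z - \<mu>))\<^sup>2 / w))) \<partial>lborel)
     = (\<integral>\<^sup>+z. (\<lambda>x. ennreal (exp (- ((x - Re \<mu>)\<^sup>2 / w)))) (Re z) * (\<lambda>x. ennreal (exp (- ((x - Im \<mu>)\<^sup>2 / w)))) (Im z) \<partial>lborel)"
    by (intro nn_integral_cong) (simp add: cmod_power2 add_divide_distrib diff_divide_distrib flip: ennreal_mult exp_add)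
  also have "\<dots> = ennreal (sqrt (pi * w)) * ennreal (sqrt (pi * w))"
    by (subst nn_integral_lborel_complex_Re_Im) (auto simp: *)
  also have "\<dots> = ennreal (pi * w)"
    using assms by (simp flip: ennreal_mult)
  finally show ?thesis .
qed

section \<open>Moments and small-ball probabilities of a complex Gaussian\<close>

lemma nn_integral_cgauss_exp_half:
  "(\<integral>\<^sup>+z. ennreal (exp ((cmod z)\<^sup>2 / 2)) \<partial>cgauss) = 2"
proof -
  have "(\<integral>\<^sup>+z. ennreal (exp ((cmod z)\<^sup>2 / 2)) \<partial>cgauss)
     = (\<integral>\<^sup>+z. ennreal (1 / pi) * ennreal (exp (- ((cmod (z - 0))\<^sup>2 / 2))) \<partial>lborel)"
    unfolding cgauss_def by (subst nn_integral_density)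
      (auto intro!: nn_integral_cong arg_cong[where f=ennreal] simp flip: ennreal_mult exp_add)
  also have "\<dots> = ennreal (1 / pi) * ennreal (pi * 2)"
    by (subst nn_integral_cmult) (use nn_integral_lborel_gaussian[of 2 0] in auto)
  also have "\<dots> = 2"
    by (simp flip: ennreal_mult)
  finally show ?thesis .
qed

text \<open>Every power is dominated by a multiple of \<open>exp ((cmod z)\<^sup>2 / 2)\<close>,
  which uses up only half of the Gaussian decay and so still has finite mean.\<close>

lemma cgauss_moment_finite:
  assumes "0 \<le> p"
  shows "\<exists>C. 0 < C \<and> (\<integral>\<^sup>+z. ennreal (cmod z powr p) \<partial>cgauss) \<le> ennreal C"
proof -
  define n where "n = nat \<lceil>p\<rceil>"
  have n: "p \<le> real n" unfolding n_def by linarith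
  \<comment> \<open>The 1 covers arguments below 1; \<open>2 ^ n * fact n\<close> clears the
    denominators of the n-th term of the series of \<open>exp (x\<^sup>2 / 2)\<close>, which
    dominates the powers above 1.\<close>
  define K :: real where "K = 1 + 2 ^ n * fact n"
  have K: "0 < K" unfolding K_def by (simp add: add_pos_pos)
  have bnd: "x powr p \<le> K * exp (x\<^sup>2 / 2)" if "0 \<le> x" for x :: real
  proof -
    have "(x\<^sup>2/2) ^ n / fact n \<le> exp (x\<^sup>2/2)"
    proof -
      have s: "(\<lambda>i. (x\<^sup>2/2) ^ i / fact i) sums exp (x\<^sup>2/2)"
        using exp_converges[of "x\<^sup>2/2"] by (simp only: real_scaleR_def divide_inverse_commute)
      have "(\<Sum>i\<in>{n}. (x\<^sup>2/2) ^ i / fact i) \<le> (\<Sum>i. (x\<^sup>2/2) ^ i / fact i)"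
        by (intro sum_le_suminf) (use s in \<open>auto simp: sums_iff\<close>)
      then show ?thesis using s by (simp add: sums_iff)
    qed
    then have 1: "x ^ (2 * n) \<le> 2 ^ n * fact n * exp (x\<^sup>2/2)"
      unfolding power_mult[of x 2 n] by (simp add: power_divide field_simps)
    have 2: "x powr p \<le> 1 + x ^ (2 * n)"
    proof (cases "x \<le> 1")
      case True
      have "x powr p \<le> 1 powr p" using True that assms by (intro powr_mono2) auto
      then show ?thesis using that by (simp add: add_increasing2)
    next
      case False
      then have "x powr p \<le> x powr real (2 * n)" using n by (intro powr_mono) auto
      also have "\<dots> = x ^ (2 * n)" using False by (simp add: powr_realpow del: of_nat_mult)
      finally show ?thesis by simp
    qed
    have "1 \<le> exp (x\<^sup>2/2)" by simp
    then show ?thesis using 1 2 unfolding K_def distrib_right by linarith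
  qed
  have "(\<integral>\<^sup>+z. ennreal (cmod z powr p) \<partial>cgauss) \<le> (\<integral>\<^sup>+z. ennreal K * ennreal (exp ((cmod z)\<^sup>2 / 2)) \<partial>cgauss)"
    using bnd K by (intro nn_integral_mono) (auto simp flip: ennreal_mult)
  also have "\<dots> = ennreal (K * 2)"
    using K by (subst nn_integral_cmult) (auto simp: nn_integral_cgauss_exp_half ennreal_mult)
  finally show ?thesis using K by (intro exI[of _ "K * 2"]) auto
qed

text \<open>The normal density is at most 1, so the position \<open>c\<close> of the singularity is
  irrelevant: within distance 1 of it the power alone integrates to at most
  \<open>2 / (1 - q)\<close>, and farther away the power is at most 1 and the density integrates to
  1. The value at the singularity is set to \<infinity> because \<open>0 powr x\<close> is 0, which
  would spoil products of two such factors.\<close>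

lemma nn_integral_normal_shift_powr:
  assumes "0 \<le> q" "q < 1"
  shows "(\<integral>\<^sup>+x. (if c + x = 0 then \<infinity> else ennreal (\<bar>c + x\<bar> powr (- q))) * ennreal (normal_density 0 (1 / sqrt 2) x) \<partial>lborel)
     \<le> ennreal (2 / (1 - q) + 1)"
proof -
  let ?n = "normal_density 0 (1 / sqrt 2)"
  define \<phi> :: "real \<Rightarrow> ennreal" where "\<phi> x = (if x = 0 then \<infinity> else ennreal (\<bar>x\<bar> powr (- q)))" for x
  have [measurable]: "\<phi> \<in> borel_measurable borel" unfolding \<phi>_def by measurable
  have n1: "?n x \<le> 1" for x
  proof -
    have "1 \<le> sqrt pi" using pi_ge_two by (simp add: real_le_rsqrt)
    moreover have "exp (- x\<^sup>2) \<le> 1" by simp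
    ultimately have "exp (- x\<^sup>2) \<le> sqrt pi" by linarith
    then show ?thesis unfolding normal_density_def
      using pi_gt_zero by (simp add: power_divide)
  qed
  have pint: "(\<integral>\<^sup>+x. ennreal (x powr (- q) * indicator {0..1} x) \<partial>lborel) = ennreal (1 / (1 - q))"
  proof -
    have h: "((\<lambda>x. x powr (- q)) has_integral (1 / (1 - q))) {0..1}"
      using has_integral_powr_from_0[of "- q" 1] assms by (simp add: add.commute)
    have "((\<lambda>x. x powr (- q) * indicator {0..1} x) has_integral (1 / (1 - q))) UNIV"
      using h[THEN has_integral_restrict_UNIV[THEN iffD2]]
      by (rule has_integral_eq[rotated]) (auto simp: indicator_def)
    then show ?thesis
      by (intro nn_integral_has_integral_lborel) auto
  qed
  have shift: "(\<integral>\<^sup>+x. \<phi> (c + x) * ennreal (?n x) \<partial>lborel) = (\<integral>\<^sup>+x. \<phi> x * ennreal (?n (x - c)) \<partial>lborel)"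
    using nn_integral_real_affine[where c=1 and t=c and f="\<lambda>x. \<phi> x * ennreal (?n (x - c))"]
    by (simp add: add.commute)
  let ?h = "\<lambda>x. x powr (- q) * indicator {0..1} x"
  have "(\<integral>\<^sup>+x. \<phi> x * ennreal (?n (x - c)) \<partial>lborel) \<le> (\<integral>\<^sup>+x. ennreal (?h x) + ennreal (?h (- x)) + ennreal (?n (x - c)) \<partial>lborel)"
  proof (rule nn_integral_mono_AE)
    show "AE x in lborel. \<phi> x * ennreal (?n (x - c)) \<le> ennreal (?h x) + ennreal (?h (- x)) + ennreal (?n (x - c))"
      using AE_lborel_singleton[of 0]
    proof eventually_elim
      case (elim x)
      have "\<bar>x\<bar> powr (- q) * ?n (x - c) \<le> ?h x + ?h (- x) + ?n (x - c)"
      proof (cases "\<bar>x\<bar> \<le> 1")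
        case True
        have "\<bar>x\<bar> powr (- q) * ?n (x - c) \<le> \<bar>x\<bar> powr (- q) * 1"
          by (intro mult_left_mono n1) auto
        also have "\<dots> \<le> ?h x + ?h (- x)" using True elim by (auto simp: indicator_def abs_if split: if_splits)
        finally show ?thesis by (smt (verit) normal_density_nonneg)
      next
        case False
        have "\<bar>x\<bar> powr (- q) \<le> \<bar>x\<bar> powr 0" using False assms by (intro powr_mono) auto
        then have "\<bar>x\<bar> powr (- q) * ?n (x - c) \<le> 1 * ?n (x - c)"
          using False by (intro mult_right_mono) (auto split: if_splits)
        also have "\<dots> \<le> ?h x + ?h (- x) + ?n (x - c)"
          by (simp add: indicator_def)
        finally show ?thesis .
      qed
      then show ?case using elim unfolding \<phi>_def
        by (auto simp: indicator_def simp flip: ennreal_mult ennreal_plus)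
    qed
  qed
  also have "\<dots> = (\<integral>\<^sup>+x. ennreal (?h x) \<partial>lborel) + (\<integral>\<^sup>+x. ennreal (?h (- x)) \<partial>lborel) + (\<integral>\<^sup>+x. ennreal (?n (x - c)) \<partial>lborel)"
    by (subst nn_integral_add, simp, simp, subst nn_integral_add) auto
  also have "(\<integral>\<^sup>+x. ennreal (?h (- x)) \<partial>lborel) = (\<integral>\<^sup>+x. ennreal (?h x) \<partial>lborel)"
    using nn_integral_real_affine[where c="-1" and t=0 and f="\<lambda>x. ennreal (?h x)"] by simp
  also have "(\<integral>\<^sup>+x. ennreal (?n (x - c)) \<partial>lborel) = 1"
    using nn_integral_real_affine[where c="1" and t="-c" and f="\<lambda>x. ennreal (?n x)"]
    by (simp add: nn_integral_normal_density_1)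
  also have "(\<integral>\<^sup>+x. ennreal (?h x) \<partial>lborel) + (\<integral>\<^sup>+x. ennreal (?h x) \<partial>lborel) + 1 = ennreal (2 / (1 - q) + 1)"
    using assms by (subst pint)+ (simp flip: ennreal_plus ennreal_1)
  finally show ?thesis using shift unfolding \<phi>_def by simp
qed

text \<open>The bound is uniform in the centre; it rests on \<open>|w|\<^sup>2 \<ge> 2 |Re w| |Im w|\<close>.\<close>
lemma cgauss_shift_negative_moment:
  assumes "0 \<le> p" "p < 2"
  shows "\<exists>C. 0 < C \<and> (\<forall>a. (\<integral>\<^sup>+z. ennreal (cmod (a + z) powr (- p)) \<partial>cgauss) \<le> ennreal C)"
proof (intro exI[of _ "(2 / (1 - p/2) + 1)^2"] conjI allI)
  have pos: "0 < 2 / (1 - p/2) + 1" using assms by (intro add_pos_pos divide_pos_pos) auto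
  then show "0 < (2 / (1 - p/2) + 1)^2" by simp
  fix a :: complex
  define \<phi> :: "real \<Rightarrow> ennreal" where "\<phi> x = (if x = 0 then \<infinity> else ennreal (\<bar>x\<bar> powr (- (p/2))))" for x
  have [measurable]: "\<phi> \<in> borel_measurable borel" unfolding \<phi>_def by measurable
  \<comment> \<open>On the axes one factor is infinite and the other positive, so the product bound
    holds pointwise; at the origin the left side is 0 by the convention for
    \<open>powr\<close>.\<close>
  have le: "ennreal (cmod w powr (- p)) \<le> \<phi> (Re w) * \<phi> (Im w)" for w
  proof (cases "Re w = 0 \<or> Im w = 0")
    case True
    show ?thesis
    proof (cases "w = 0")
      case False
      then show ?thesis using True unfolding \<phi>_def
        by (auto simp: complex_eq_iff ennreal_top_mult ennreal_mult_top)
    qed auto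
  next
    case False
    have "0 \<le> (\<bar>Re w\<bar> - \<bar>Im w\<bar>)\<^sup>2" by simp
    then have "2 * (\<bar>Re w\<bar> * \<bar>Im w\<bar>) \<le> (cmod w)\<^sup>2"
      by (simp add: cmod_power2 power2_diff)
    moreover have "0 \<le> \<bar>Re w\<bar> * \<bar>Im w\<bar>" by simp
    ultimately have "\<bar>Re w\<bar> * \<bar>Im w\<bar> \<le> (cmod w)\<^sup>2" by linarith
    then have "((cmod w)\<^sup>2) powr (- (p/2)) \<le> (\<bar>Re w\<bar> * \<bar>Im w\<bar>) powr (- (p/2))"
      using False assms by (intro powr_mono2') auto
    moreover have "((cmod w)\<^sup>2) powr (- (p/2)) = cmod w powr (- p)"
      using False powr_powr[of "cmod w" 2 "- (p/2)"] by (simp add: powr_numeral complex_eq_iff)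
    ultimately show ?thesis using False unfolding \<phi>_def
      by (auto simp: powr_mult simp flip: ennreal_mult)
  qed
  have "(\<integral>\<^sup>+z. ennreal (cmod (a + z) powr (- p)) \<partial>cgauss) \<le> (\<integral>\<^sup>+z. (\<lambda>x. \<phi> (Re a + x)) (Re z) * (\<lambda>x. \<phi> (Im a + x)) (Im z) \<partial>cgauss)"
    by (intro nn_integral_mono order_trans[OF le]) simp
  also have "\<dots> \<le> ennreal (2 / (1 - p/2) + 1) * ennreal (2 / (1 - p/2) + 1)"
    apply (subst nn_integral_cgauss_Re_Im)
    using nn_integral_normal_shift_powr[of "p/2"] assms
    unfolding \<phi>_def by (auto intro!: mult_mono)
  also have "\<dots> = ennreal ((2 / (1 - p/2) + 1)^2)"
    using pos by (simp add: power2_eq_square flip: ennreal_mult)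
  finally show "(\<integral>\<^sup>+z. ennreal (cmod (a + z) powr (- p)) \<partial>cgauss) \<le> ennreal ((2 / (1 - p/2) + 1)^2)" .
qed

text \<open>The annulus contains the rectangle with sides \<open>[sqrt a / 2, 4/5 * sqrt a]\<close>
  and \<open>[0, sqrt a / 2]\<close>, since 16/25 + 1/4 < 1. Its area is \<open>3/20 * a\<close>,
  the density on it is at least \<open>exp (- 1) / pi\<close>, hence at least 1/12, and the product
  is \<open>a / 80\<close>.\<close>

lemma cgauss_annulus_ge:
  assumes "0 < a" "a \<le> 1"
  shows "ennreal (a / 100) \<le> emeasure cgauss {z. a / 4 \<le> (cmod z)\<^sup>2 \<and> (cmod z)\<^sup>2 < a}"
proof -
  define l u where "l = Complex (sqrt a / 2) 0" and "u = Complex (4 / 5 * sqrt a) (sqrt a / 2)"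
  have sub: "cbox l u \<subseteq> {z. a / 4 \<le> (cmod z)\<^sup>2 \<and> (cmod z)\<^sup>2 < a}"
  proof
    fix z assume "z \<in> cbox l u"
    then have z: "sqrt a / 2 \<le> Re z" "Re z \<le> 4 / 5 * sqrt a" "0 \<le> Im z" "Im z \<le> sqrt a / 2"
      by (auto simp: l_def u_def in_cbox_complex_iff)
    have "(sqrt a / 2)\<^sup>2 \<le> (Re z)\<^sup>2" using z assms by (intro power_mono) auto
    moreover have "(Re z)\<^sup>2 \<le> (4 / 5 * sqrt a)\<^sup>2" using z assms by (intro power_mono) (auto intro: order_trans[rotated])
    moreover have "(Im z)\<^sup>2 \<le> (sqrt a / 2)\<^sup>2" using z assms by (intro power_mono) auto
    ultimately show "z \<in> {z. a / 4 \<le> (cmod z)\<^sup>2 \<and> (cmod z)\<^sup>2 < a}"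
      using assms by (auto simp: cmod_power2 power_divide power_mult_distrib add_increasing2)
  qed
  have em: "emeasure lborel (cbox l u) = ennreal (3/20 * a)"
    using assms by (subst emeasure_lborel_cbox)
     (auto simp: Basis_complex_def inner_complex_def l_def u_def field_simps)
  have e: "1 / 12 \<le> exp (- 1) / pi"
  proof -
    have "pi * exp 1 \<le> 4 * 3" using pi_less_4 exp_le by (intro mult_mono) auto
    then show ?thesis by (simp add: exp_minus field_simps)
  qed
  have "ennreal (a / 100) \<le> ennreal (1/12) * ennreal (3/20 * a)"
    using assms by (simp flip: ennreal_mult)
  also have "\<dots> = (\<integral>\<^sup>+z. ennreal (1/12) * indicator (cbox l u) z \<partial>lborel)"
    by (simp add: nn_integral_cmult em)
  also have "\<dots> \<le> (\<integral>\<^sup>+z. ennreal (exp (- (cmod z)\<^sup>2) / pi) * indicator {z. a / 4 \<le> (cmod z)\<^sup>2 \<and> (cmod z)\<^sup>2 < a} z \<partial>lborel)"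
  proof (intro nn_integral_mono)
    fix z :: complex
    show "ennreal (1/12) * indicator (cbox l u) z \<le> ennreal (exp (- (cmod z)\<^sup>2) / pi) * indicator {z. a / 4 \<le> (cmod z)\<^sup>2 \<and> (cmod z)\<^sup>2 < a} z"
    proof (cases "z \<in> cbox l u")
      case True
      then have "(cmod z)\<^sup>2 < a" "a / 4 \<le> (cmod z)\<^sup>2" using sub by auto
      then have "exp (- 1) / pi \<le> exp (- (cmod z)\<^sup>2) / pi" using assms by (intro divide_right_mono) auto
      with e have "1/12 \<le> exp (- (cmod z)\<^sup>2) / pi" by linarith
      then show ?thesis using True sub by (auto simp: indicator_def intro!: ennreal_leI)
    qed auto
  qed
  also have "\<dots> = emeasure cgauss {z. a / 4 \<le> (cmod z)\<^sup>2 \<and> (cmod z)\<^sup>2 < a}"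
    unfolding cgauss_def by (subst emeasure_density) auto
  finally show ?thesis .
qed

section \<open>A flat reference measure and the change of variables from noise to output\<close>

text \<open>Lebesgue measure divided by pi, so that \<open>cgauss\<close> has density
  \<open>exp (- (cmod z)\<^sup>2)\<close> and a Gaussian of variance \<open>w\<close> has
  normalising constant exactly \<open>w\<close>. All constants of the entropy computation become
  products of variances.\<close>

definition lscale :: "complex measure" where
  "lscale = density lborel (\<lambda>_. ennreal (1 / pi))"

lemma space_lscale [simp]: "space lscale = UNIV"
  and sets_lscale [simp, measurable_cong]: "sets lscale = sets borel"
  by (simp_all add: lscale_def)

lemma sigma_finite_lscale: "sigma_finite_measure lscale"
  unfolding lscale_def
  by (rule sigma_finite_measure.sigma_finite_iff_density_finite[THEN iffD2]) (auto intro: lborel.sigma_finite_measure_axioms)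

interpretation lscale: sigma_finite_measure lscale
  by (rule sigma_finite_lscale)

interpretation PL: product_sigma_finite "\<lambda>_. lscale"
  by standard

interpretation PG: product_sigma_finite "\<lambda>_. cgauss"
  by standard

lemma nn_integral_lscale_gaussian:
  assumes "0 < w"
  shows "(\<integral>\<^sup>+z. ennreal (exp (- ((cmod (z - \<mu>))\<^sup>2 / w))) \<partial>lscale) = ennreal w"
proof -
  have "(\<integral>\<^sup>+z. ennreal (exp (- ((cmod (z - \<mu>))\<^sup>2 / w))) \<partial>lscale) = ennreal (1 / pi) * ennreal (pi * w)"
    unfolding lscale_def
    by (subst nn_integral_density, simp, simp, subst nn_integral_cmult, simp)
       (simp only: nn_integral_lborel_gaussian[OF assms])
  then show ?thesis using assms by (simp flip: ennreal_mult)
qed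

lemma nn_integral_PiM_lscale_gaussian:
  assumes "finite I" "\<And>i. i \<in> I \<Longrightarrow> 0 < w i"
  shows "(\<integral>\<^sup>+x. ennreal (exp (- (\<Sum>i\<in>I. (cmod (x i - \<mu> i))\<^sup>2 / w i))) \<partial>PiM I (\<lambda>_. lscale)) = ennreal (\<Prod>i\<in>I. w i)"
proof -
  have "(\<integral>\<^sup>+x. ennreal (exp (- (\<Sum>i\<in>I. (cmod (x i - \<mu> i))\<^sup>2 / w i))) \<partial>PiM I (\<lambda>_. lscale))
     = (\<integral>\<^sup>+x. (\<Prod>i\<in>I. ennreal (exp (- ((cmod (x i - \<mu> i))\<^sup>2 / w i)))) \<partial>PiM I (\<lambda>_. lscale))"
    using assms by (intro nn_integral_cong) (auto simp: exp_sum prod_ennreal simp flip: sum_negf)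
  also have "\<dots> = (\<Prod>i\<in>I. ennreal (w i))"
    using assms by (subst PL.product_nn_integral_prod)
      (auto intro!: prod.cong simp: nn_integral_lscale_gaussian)
  also have "\<dots> = ennreal (\<Prod>i\<in>I. w i)"
    using assms by (intro prod_ennreal) (auto intro: less_imp_le)
  finally show ?thesis .
qed

text \<open>Cancelling the Gaussian weight leaves the flat measure, which does not see the
  translation by \<open>a\<close>. Thus averages over the noise turn into flat integrals over the
  noisy output, whatever the signal was.\<close>

lemma nn_integral_cgauss_change_of_measure:
  assumes [measurable]: "f \<in> borel_measurable borel"
  shows "(\<integral>\<^sup>+z. f (a + z) * ennreal (exp ((cmod z)\<^sup>2)) \<partial>cgauss) = (\<integral>\<^sup>+z. f z \<partial>lscale)"
proof -
  have "(\<integral>\<^sup>+z. f (a + z) * ennreal (exp ((cmod z)\<^sup>2)) \<partial>cgauss) = (\<integral>\<^sup>+z. ennreal (1 / pi) * f (a + z) \<partial>lborel)"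
    unfolding cgauss_def
    apply (subst nn_integral_density)
      apply measurable
    apply (intro nn_integral_cong)
    subgoal for z
      using ennreal_mult[of "exp (- (cmod z)\<^sup>2) / pi" "exp ((cmod z)\<^sup>2)"]
      by (simp add: mult.assoc[symmetric] mult.commute[of _ "f _"] exp_minus)
    done
  also have "\<dots> = (\<integral>\<^sup>+z. ennreal (1 / pi) * f z \<partial>distr lborel borel ((+) a))"
    by (subst nn_integral_distr) auto
  also have "\<dots> = (\<integral>\<^sup>+z. f z \<partial>lscale)"
    unfolding lborel_distr_plus lscale_def by (subst nn_integral_density) auto
  finally show ?thesis .
qed

text \<open>The integrand is not a product, so the one-dimensional identity is lifted through
  measures: the reweighted and shifted law is identified with the flat product measure on
  rectangles, where the integral does factorise.\<close>

lemma nn_integral_PiM_cgauss_change_of_measure: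
  assumes I: "finite I" and F: "F \<in> borel_measurable (PiM I (\<lambda>_. lscale))"
  shows "(\<integral>\<^sup>+x. F (\<lambda>i\<in>I. a i + x i) * ennreal (exp (\<Sum>i\<in>I. (cmod (x i))\<^sup>2)) \<partial>PiM I (\<lambda>_. cgauss))
     = (\<integral>\<^sup>+y. F y \<partial>PiM I (\<lambda>_. lscale))"
proof -
  let ?S = "\<lambda>x. \<lambda>i\<in>I. a i + x i"
  let ?d = "\<lambda>x. ennreal (exp (\<Sum>i\<in>I. (cmod (x i))\<^sup>2))"
  let ?D = "density (PiM I (\<lambda>_. cgauss)) ?d"
  have S[measurable]: "?S \<in> measurable (PiM I (\<lambda>_. cgauss)) (PiM I (\<lambda>_. lscale))"
    by measurable
  have d[measurable]: "?d \<in> borel_measurable (PiM I (\<lambda>_. cgauss))"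
    by measurable
  have "distr ?D (PiM I (\<lambda>_. lscale)) ?S = PiM I (\<lambda>_. lscale)"
  proof (rule PL.PiM_eqI[OF I])
    fix A assume A: "\<And>i. i \<in> I \<Longrightarrow> A i \<in> sets lscale"
    then have [measurable]: "i \<in> I \<Longrightarrow> A i \<in> sets borel" for i by simp
    have "emeasure (distr ?D (PiM I (\<lambda>_. lscale)) ?S) (Pi\<^sub>E I A)
       = emeasure ?D (?S -` Pi\<^sub>E I A \<inter> space (PiM I (\<lambda>_. cgauss)))"
      using A I by (subst emeasure_distr) (auto intro!: sets_PiM_I_finite)
    also have "\<dots> = (\<integral>\<^sup>+x. ?d x * indicator (?S -` Pi\<^sub>E I A \<inter> space (PiM I (\<lambda>_. cgauss))) x \<partial>PiM I (\<lambda>_. cgauss))"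
      using A I by (subst emeasure_density) (auto intro!: measurable_sets[OF S] sets_PiM_I_finite)
    also have "\<dots> = (\<integral>\<^sup>+x. (\<Prod>i\<in>I. indicator (A i) (a i + x i) * ennreal (exp ((cmod (x i))\<^sup>2))) \<partial>PiM I (\<lambda>_. cgauss))"
    proof (intro nn_integral_cong)
      fix x assume x: "x \<in> space (PiM I (\<lambda>_. cgauss))"
      have "?d x = (\<Prod>i\<in>I. ennreal (exp ((cmod (x i))\<^sup>2)))"
        using I by (simp add: exp_sum prod_ennreal)
      moreover have "indicator (?S -` Pi\<^sub>E I A \<inter> space (PiM I (\<lambda>_. cgauss))) x = (\<Prod>i\<in>I. indicator (A i) (a i + x i) :: ennreal)"
      proof (cases "\<forall>i\<in>I. a i + x i \<in> A i")
        case True then show ?thesis using x by (auto simp: indicator_def)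
      next
        case False
        then have "?S x \<notin> Pi\<^sub>E I A" by auto
        then show ?thesis using False I by (auto simp: indicator_def prod_zero_iff)
      qed
      ultimately show "?d x * indicator (?S -` Pi\<^sub>E I A \<inter> space (PiM I (\<lambda>_. cgauss))) x = (\<Prod>i\<in>I. indicator (A i) (a i + x i) * ennreal (exp ((cmod (x i))\<^sup>2)))"
        by (simp add: prod.distrib mult.commute)
    qed
    also have "\<dots> = (\<Prod>i\<in>I. \<integral>\<^sup>+z. indicator (A i) (a i + z) * ennreal (exp ((cmod z)\<^sup>2)) \<partial>cgauss)"
      by (subst PG.product_nn_integral_prod[OF I, where f="\<lambda>i z. indicator (A i) (a i + z) * ennreal (exp ((cmod z)\<^sup>2))"]) auto
    also have "\<dots> = (\<Prod>i\<in>I. emeasure lscale (A i))"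
      using A by (intro prod.cong refl, subst nn_integral_cgauss_change_of_measure) auto
    finally show "emeasure (distr ?D (PiM I (\<lambda>_. lscale)) ?S) (Pi\<^sub>E I A) = (\<Prod>i\<in>I. emeasure lscale (A i))" .
  qed simp
  then have "(\<integral>\<^sup>+y. F y \<partial>PiM I (\<lambda>_. lscale)) = (\<integral>\<^sup>+y. F y \<partial>distr ?D (PiM I (\<lambda>_. lscale)) ?S)"
    by simp
  also have "\<dots> = (\<integral>\<^sup>+x. F (?S x) \<partial>?D)"
    using F by (subst nn_integral_distr) auto
  also have "\<dots> = (\<integral>\<^sup>+x. ?d x * F (?S x) \<partial>PiM I (\<lambda>_. cgauss))"
    using measurable_compose[OF S F] by (subst nn_integral_density) auto
  finally show ?thesis by (simp add: mult.commute)
qed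

section \<open>Codes and their concatenation\<close>

lemma prob_space_iid_cvec: "prob_space (iid_cvec k)"
  unfolding iid_cvec_def by (rule prob_space_PiM) (rule prob_space_cgauss)

lemma prob_space_iid_cmat: "prob_space (iid_cmat a c)"
  unfolding iid_cmat_def by (rule prob_space_PiM) (rule prob_space_cgauss)

lemma sets_iid_cvec [measurable_cong]: "sets (iid_cvec k) = sets (PiM {..<k} (\<lambda>_. borel))"
  unfolding iid_cvec_def by (intro sets_PiM_cong) auto

lemma sets_iid_cmat [measurable_cong]: "sets (iid_cmat a c) = sets (PiM ({..<a} \<times> {..<c}) (\<lambda>_. borel))"
  unfolding iid_cmat_def by (intro sets_PiM_cong) auto

lemma measurable_iid_cvec_component [measurable]: "j < m \<Longrightarrow> (\<lambda>S. S j) \<in> borel_measurable (iid_cvec m)"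
  using measurable_component_singleton[of j "{..<m}" "\<lambda>_. borel"]
  by (simp cong: measurable_cong_sets add: measurable_cong_sets[OF sets_iid_cvec refl])

lemma measurable_iid_cmat_component [measurable]: "i < a \<Longrightarrow> j < c \<Longrightarrow> (\<lambda>N. N (i, j)) \<in> borel_measurable (iid_cmat a c)"
  using measurable_component_singleton[of "(i, j)" "{..<a} \<times> {..<c}" "\<lambda>_. borel"]
  by (simp add: measurable_cong_sets[OF sets_iid_cmat refl])

lemma prob_space_pair:
  assumes "prob_space M" "prob_space N"
  shows "prob_space (M \<Otimes>\<^sub>M N)"
proof -
  interpret M: prob_space M by fact
  interpret N: prob_space N by fact
  interpret pair_prob_space M N ..
  show ?thesis by unfold_locales
qed

section \<open>Restricting the experiment to a sub-block\<close>

definition pull_vec :: "(nat \<Rightarrow> nat) \<Rightarrow> nat \<Rightarrow> cvec \<Rightarrow> cvec" where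
  "pull_vec \<iota> m S = (\<lambda>j\<in>{..<m}. S (\<iota> j))"

definition pull_mat :: "(nat \<Rightarrow> nat) \<Rightarrow> nat \<Rightarrow> nat \<Rightarrow> cmat \<Rightarrow> cmat" where
  "pull_mat \<kappa> n c N = (\<lambda>p\<in>{..<n} \<times> {..<c}. N (\<kappa> (fst p), snd p))"

lemma distr_pull_vec:
  assumes "inj_on \<iota> {..<m'}" "\<iota> \<in> {..<m'} \<rightarrow> {..<m}"
  shows "distr (iid_cvec m) (iid_cvec m') (pull_vec \<iota> m') = iid_cvec m'"
  using distr_PiM_reindex[of "{..<m}" "\<lambda>_. cgauss" \<iota> "{..<m'}"] assms prob_space_cgauss
  unfolding iid_cvec_def pull_vec_def by simp

lemma distr_pull_mat:
  assumes "inj_on \<kappa> {..<n'}" "\<kappa> \<in> {..<n'} \<rightarrow> {..<n}"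
  shows "distr (iid_cmat n c) (iid_cmat n' c) (pull_mat \<kappa> n' c) = iid_cmat n' c"
proof -
  have "inj_on (\<lambda>p. (\<kappa> (fst p), snd p)) ({..<n'} \<times> {..<c})"
    using assms(1) by (auto simp: inj_on_def)
  moreover have "(\<lambda>p. (\<kappa> (fst p), snd p)) \<in> {..<n'} \<times> {..<c} \<rightarrow> {..<n} \<times> {..<c}"
    using assms(2) by auto
  ultimately show ?thesis
    using distr_PiM_reindex[of "{..<n} \<times> {..<c}" "\<lambda>_. cgauss" "\<lambda>p. (\<kappa> (fst p), snd p)" "{..<n'} \<times> {..<c}"] prob_space_cgauss
    unfolding iid_cmat_def pull_mat_def by simp
qed

lemma measurable_pull_vec [measurable]:
  assumes "\<iota> \<in> {..<m'} \<rightarrow> {..<m}"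
  shows "pull_vec \<iota> m' \<in> measurable (PiM {..<m} (\<lambda>_. borel)) (PiM {..<m'} (\<lambda>_. borel))"
  unfolding pull_vec_def using assms by (intro measurable_restrict measurable_component_singleton) auto

lemma measurable_pull_mat [measurable]:
  assumes "\<kappa> \<in> {..<n'} \<rightarrow> {..<n}"
  shows "pull_mat \<kappa> n' c \<in> measurable (PiM ({..<n} \<times> {..<c}) (\<lambda>_. borel)) (PiM ({..<n'} \<times> {..<c}) (\<lambda>_. borel))"
  unfolding pull_mat_def using assms by (intro measurable_restrict measurable_component_singleton) auto

lemma distr_pair_prob:
  assumes f: "f \<in> measurable M S" and g: "g \<in> measurable N T"
    and M: "distr M S f = S" and N: "distr N T g = T" and T: "prob_space T"
  shows "distr (M \<Otimes>\<^sub>M N) (S \<Otimes>\<^sub>M T) (\<lambda>(x, y). (f x, g y)) = S \<Otimes>\<^sub>M T"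
proof -
  interpret T: prob_space T by fact
  have "distr M S f \<Otimes>\<^sub>M distr N T g = distr (M \<Otimes>\<^sub>M N) (S \<Otimes>\<^sub>M T) (\<lambda>(x, y). (f x, g y))"
    using T.sigma_finite_measure_axioms by (intro pair_measure_distr f g) (simp add: N)
  then show ?thesis by (simp add: M N)
qed

text \<open>The channel matrix and the side information gain are passed on unchanged: they stay
  constant over the whole block, so all sub-blocks see the same fading.\<close>

definition pull_joint where
  "pull_joint \<iota> \<kappa> m n Mr = (\<lambda>(S, H, N, G, Z). (pull_vec \<iota> m S, H, pull_mat \<kappa> n Mr N, G, pull_vec \<iota> m Z))"

text \<open>Distinct coordinates of an i.i.d. family are again i.i.d., factor by factor. Only
  injectivity of the two index maps matters; different sub-blocks may overlap, which is used later
  when they share a training sample.\<close>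

lemma
  assumes \<iota>: "inj_on \<iota> {..<m'}" "\<iota> \<in> {..<m'} \<rightarrow> {..<m}"
    and \<kappa>: "inj_on \<kappa> {..<n'}" "\<kappa> \<in> {..<n'} \<rightarrow> {..<n}"
  shows distr_pull_joint: "distr (joint_space Mt Mr m n) (joint_space Mt Mr m' n') (pull_joint \<iota> \<kappa> m' n' Mr)
    = joint_space Mt Mr m' n'"
   and measurable_pull_joint: "pull_joint \<iota> \<kappa> m' n' Mr \<in> measurable (joint_space Mt Mr m n) (joint_space Mt Mr m' n')"
proof -
  note [measurable] = measurable_pull_vec[OF \<iota>(2)] measurable_pull_mat[OF \<kappa>(2)]
  have v: "pull_vec \<iota> m' \<in> measurable (iid_cvec m) (iid_cvec m')" by measurable
  have w: "pull_mat \<kappa> n' Mr \<in> measurable (iid_cmat n Mr) (iid_cmat n' Mr)" by measurable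
  let ?f1 = "\<lambda>(x :: complex, y). (x, pull_vec \<iota> m' y)"
  let ?f2 = "\<lambda>(x, y). (pull_mat \<kappa> n' Mr x, ?f1 y)"
  let ?f3 = "\<lambda>(x :: cmat, y). (x, ?f2 y)"
  have m1: "?f1 \<in> measurable (cgauss \<Otimes>\<^sub>M iid_cvec m) (cgauss \<Otimes>\<^sub>M iid_cvec m')"
    by measurable
  then have m2: "?f2 \<in> measurable (iid_cmat n Mr \<Otimes>\<^sub>M (cgauss \<Otimes>\<^sub>M iid_cvec m)) (iid_cmat n' Mr \<Otimes>\<^sub>M (cgauss \<Otimes>\<^sub>M iid_cvec m'))"
    by measurable
  then have m3: "?f3 \<in> measurable (iid_cmat Mr Mt \<Otimes>\<^sub>M (iid_cmat n Mr \<Otimes>\<^sub>M (cgauss \<Otimes>\<^sub>M iid_cvec m)))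
      (iid_cmat Mr Mt \<Otimes>\<^sub>M (iid_cmat n' Mr \<Otimes>\<^sub>M (cgauss \<Otimes>\<^sub>M iid_cvec m')))"
    by measurable
  have id: "distr M M (\<lambda>x. x) = M" for M :: "'x measure"
    by (rule distr_id)
  note P = prob_space_pair prob_space_iid_cvec prob_space_iid_cmat prob_space_cgauss
  have d1: "distr (cgauss \<Otimes>\<^sub>M iid_cvec m) (cgauss \<Otimes>\<^sub>M iid_cvec m') ?f1 = cgauss \<Otimes>\<^sub>M iid_cvec m'"
    by (rule distr_pair_prob[OF _ v distr_id distr_pull_vec[OF \<iota>]]) (auto intro: P)
  have d2: "distr (iid_cmat n Mr \<Otimes>\<^sub>M (cgauss \<Otimes>\<^sub>M iid_cvec m)) (iid_cmat n' Mr \<Otimes>\<^sub>M (cgauss \<Otimes>\<^sub>M iid_cvec m')) ?f2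
      = iid_cmat n' Mr \<Otimes>\<^sub>M (cgauss \<Otimes>\<^sub>M iid_cvec m')"
    by (rule distr_pair_prob[OF w m1 distr_pull_mat[OF \<kappa>] d1]) (intro P)
  have d3: "distr (iid_cmat Mr Mt \<Otimes>\<^sub>M (iid_cmat n Mr \<Otimes>\<^sub>M (cgauss \<Otimes>\<^sub>M iid_cvec m)))
      (iid_cmat Mr Mt \<Otimes>\<^sub>M (iid_cmat n' Mr \<Otimes>\<^sub>M (cgauss \<Otimes>\<^sub>M iid_cvec m'))) ?f3
      = iid_cmat Mr Mt \<Otimes>\<^sub>M (iid_cmat n' Mr \<Otimes>\<^sub>M (cgauss \<Otimes>\<^sub>M iid_cvec m'))"
    by (rule distr_pair_prob[OF _ m2 distr_id d2]) (auto intro!: P)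
  have eq: "pull_joint \<iota> \<kappa> m' n' Mr = (\<lambda>(x, y). (pull_vec \<iota> m' x, ?f3 y))"
    by (auto simp: pull_joint_def)
  show "distr (joint_space Mt Mr m n) (joint_space Mt Mr m' n') (pull_joint \<iota> \<kappa> m' n' Mr)
    = joint_space Mt Mr m' n'"
    unfolding joint_space_def eq
    by (rule distr_pair_prob[OF v m3 distr_pull_vec[OF \<iota>] d3]) (intro P)
  show "pull_joint \<iota> \<kappa> m' n' Mr \<in> measurable (joint_space Mt Mr m n) (joint_space Mt Mr m' n')"
    unfolding joint_space_def eq using v m3 by measurable
qed

section \<open>Coordinate errors of a code\<close>

definition recon where
  "recon Mt Mr \<rho> \<rho>s m n f g = (\<lambda>(S, H, N, G, Z).
     g (chan_out Mt Mr n \<rho> H (f S) N) (side_out m \<rho>s G S Z) (restrict H ({..<Mr} \<times> {..<Mt})) ((cmod G)\<^sup>2))"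

definition code_measurable where
  "code_measurable Mt Mr m n f g \<longleftrightarrow>
     (\<forall>i<n. \<forall>t<Mt. (\<lambda>S. f S (i,t)) \<in> borel_measurable (iid_cvec m)) \<and>
     (\<forall>j<m. (\<lambda>(y,tt,h,\<gamma>). g y tt h \<gamma> j) \<in> borel_measurable (obs_space Mt Mr m n))"

lemma admissible_code_measurable: "admissible Mt Mr b m n f g \<Longrightarrow> code_measurable Mt Mr m n f g"
  by (auto simp: admissible_def code_measurable_def)

lemma measurable_chan_out [measurable]:
  assumes "\<forall>i<n. \<forall>t<Mt. (\<lambda>S. f S (i,t)) \<in> borel_measurable (iid_cvec m)"
  shows "(\<lambda>(S, H, N). chan_out Mt Mr n \<rho> H (f S) N) \<in> measurable (iid_cvec m \<Otimes>\<^sub>M iid_cmat Mr Mt \<Otimes>\<^sub>M iid_cmat n Mr) (PiM ({..<n} \<times> {..<Mr}) (\<lambda>_. borel))"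
  unfolding chan_out_def case_prod_beta
proof (rule measurable_restrict)
  fix p assume p: "p \<in> {..<n} \<times> {..<Mr}"
  let ?M = "iid_cvec m \<Otimes>\<^sub>M iid_cmat Mr Mt \<Otimes>\<^sub>M iid_cmat n Mr"
  have 1: "(\<lambda>x. f (fst x) (fst p, t)) \<in> borel_measurable ?M" if "t < Mt" for t
    using assms p that by (intro measurable_compose[OF measurable_fst]) auto
  have 2: "(\<lambda>x. fst (snd x) (snd p, t)) \<in> borel_measurable ?M" if "t < Mt" for t
    using p that by (intro measurable_compose[OF measurable_compose[OF measurable_snd measurable_fst] measurable_iid_cmat_component]) auto
  have 3: "(\<lambda>x. snd (snd x) p) \<in> borel_measurable ?M"
    using p by (cases p) (auto intro!: measurable_compose[OF measurable_compose[OF measurable_snd measurable_snd] measurable_iid_cmat_component])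
  show "(\<lambda>x. complex_of_real (sqrt (\<rho> / real Mt)) * (\<Sum>t<Mt. fst (snd x) (snd p, t) * f (fst x) (fst p, t)) + snd (snd x) (fst p, snd p)) \<in> borel_measurable ?M"
    using 1 2 3 by (intro borel_measurable_add borel_measurable_times borel_measurable_const borel_measurable_sum) auto
qed

lemma measurable_side_out [measurable]:
  "(\<lambda>(G, S, Z). side_out m \<rho>s G S Z) \<in> measurable (borel \<Otimes>\<^sub>M PiM {..<m} (\<lambda>_. borel) \<Otimes>\<^sub>M PiM {..<m} (\<lambda>_. borel)) (PiM {..<m} (\<lambda>_. borel))"
  unfolding side_out_def case_prod_beta by measurable

lemma measurable_recon:
  assumes "code_measurable Mt Mr m n f g" "j < m"
  shows "(\<lambda>\<omega>. recon Mt Mr \<rho> \<rho>s m n f g \<omega> j) \<in> borel_measurable (joint_space Mt Mr m n)"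
proof -
  let ?J = "joint_space Mt Mr m n"
  note f = measurable_chan_out[of n Mt f m Mr \<rho>]
  have f: "(\<lambda>(S, H, N). chan_out Mt Mr n \<rho> H (f S) N) \<in> measurable (iid_cvec m \<Otimes>\<^sub>M iid_cmat Mr Mt \<Otimes>\<^sub>M iid_cmat n Mr) (PiM ({..<n} \<times> {..<Mr}) (\<lambda>_. borel))"
    using assms by (intro measurable_chan_out) (auto simp: code_measurable_def)
  have a: "(\<lambda>\<omega>. chan_out Mt Mr n \<rho> (fst (snd \<omega>)) (f (fst \<omega>)) (fst (snd (snd \<omega>)))) \<in> measurable ?J (PiM ({..<n} \<times> {..<Mr}) (\<lambda>_. borel))"
    unfolding joint_space_def
    by (rule measurable_compose[where g="\<lambda>(S, H, N). chan_out Mt Mr n \<rho> H (f S) N" and f="\<lambda>\<omega>. (fst \<omega>, fst (snd \<omega>), fst (snd (snd \<omega>)))", OF _ f, simplified]) measurable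
  have b: "(\<lambda>\<omega>. side_out m \<rho>s (fst (snd (snd (snd \<omega>)))) (fst \<omega>) (snd (snd (snd (snd \<omega>))))) \<in> measurable ?J (PiM {..<m} (\<lambda>_. borel))"
    unfolding joint_space_def
    by (rule measurable_compose[where g="\<lambda>(G, S, Z). side_out m \<rho>s G S Z" and f="\<lambda>\<omega>. (fst (snd (snd (snd \<omega>))), fst \<omega>, snd (snd (snd (snd \<omega>))))", OF _ measurable_side_out, simplified]) measurable
  have c: "(\<lambda>\<omega>. restrict (fst (snd \<omega>)) ({..<Mr} \<times> {..<Mt})) \<in> measurable ?J (PiM ({..<Mr} \<times> {..<Mt}) (\<lambda>_. borel))"
    unfolding joint_space_def by measurable
  have d: "(\<lambda>\<omega>. (cmod (fst (snd (snd (snd \<omega>)))))\<^sup>2) \<in> borel_measurable ?J"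
    unfolding joint_space_def by measurable
  have "(\<lambda>\<omega>. (chan_out Mt Mr n \<rho> (fst (snd \<omega>)) (f (fst \<omega>)) (fst (snd (snd \<omega>))),
      side_out m \<rho>s (fst (snd (snd (snd \<omega>)))) (fst \<omega>) (snd (snd (snd (snd \<omega>)))),
      restrict (fst (snd \<omega>)) ({..<Mr} \<times> {..<Mt}), (cmod (fst (snd (snd (snd \<omega>)))))\<^sup>2)) \<in> measurable ?J (obs_space Mt Mr m n)"
    unfolding obs_space_def using a b c d by (intro measurable_Pair)
  moreover have "(\<lambda>(y,tt,h,\<gamma>). g y tt h \<gamma> j) \<in> borel_measurable (obs_space Mt Mr m n)"
    using assms by (auto simp: code_measurable_def)
  ultimately show ?thesis
    by (auto dest: measurable_compose simp: recon_def case_prod_beta)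
qed

lemma measurable_err:
  assumes "code_measurable Mt Mr m n f g" "j < m"
  shows "(\<lambda>\<omega>. (cmod (fst \<omega> j - recon Mt Mr \<rho> \<rho>s m n f g \<omega> j))\<^sup>2) \<in> borel_measurable (joint_space Mt Mr m n)"
proof -
  have [measurable]: "(\<lambda>\<omega>. fst \<omega> j) \<in> borel_measurable (joint_space Mt Mr m n)"
    unfolding joint_space_def by (intro measurable_compose[OF measurable_fst] measurable_iid_cvec_component assms(2))
  note [measurable] = measurable_recon[OF assms]
  show ?thesis by measurable
qed

text \<open>Multiplied by the block length the distortion is a sum of coordinate errors, the form
  that adds up under concatenation and needs no exception for the empty block.\<close>

lemma exp_dist_alt:
  assumes "code_measurable Mt Mr m n f g"
  shows "ennreal (real m) * exp_dist Mt Mr \<rho> \<rho>s m n f g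
     = (\<Sum>j<m. \<integral>\<^sup>+\<omega>. ennreal ((cmod (fst \<omega> j - recon Mt Mr \<rho> \<rho>s m n f g \<omega> j))\<^sup>2) \<partial>joint_space Mt Mr m n)"
proof (cases "m = 0")
  case False
  let ?e = "\<lambda>\<omega> j. (cmod (fst \<omega> j - recon Mt Mr \<rho> \<rho>s m n f g \<omega> j))\<^sup>2"
  have m: "(\<lambda>\<omega>. ennreal (?e \<omega> j)) \<in> borel_measurable (joint_space Mt Mr m n)" if "j < m" for j
    using measurable_err[OF assms that] by measurable
  have *: "ennreal (distortion m S (g (chan_out Mt Mr n \<rho> H (f S) N) (side_out m \<rho>s G S Z) (restrict H ({..<Mr} \<times> {..<Mt})) ((cmod G)\<^sup>2)))
     = (\<Sum>j<m. ennreal (?e (S, H, N, G, Z) j)) / ennreal (real m)" for S H N G Z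
    using False by (simp add: distortion_def recon_def divide_ennreal sum_nonneg)
  have "exp_dist Mt Mr \<rho> \<rho>s m n f g = (\<integral>\<^sup>+\<omega>. (\<Sum>j<m. ennreal (?e \<omega> j)) / ennreal (real m) \<partial>joint_space Mt Mr m n)"
    unfolding exp_dist_def by (intro nn_integral_cong) (auto simp: *)
  also have "\<dots> = (\<integral>\<^sup>+\<omega>. (\<Sum>j<m. ennreal (?e \<omega> j)) \<partial>joint_space Mt Mr m n) / ennreal (real m)"
    using m by (intro nn_integral_divide borel_measurable_sum) auto
  also have "\<dots> = (\<Sum>j<m. \<integral>\<^sup>+\<omega>. ennreal (?e \<omega> j) \<partial>joint_space Mt Mr m n) / ennreal (real m)"
    using m by (subst nn_integral_sum) auto
  finally show ?thesis using False
    by (simp add: ennreal_times_divide ennreal_mult_divide_eq mult.commute[of "ennreal (real m)"])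
qed simp

text \<open>If the long code acts on a sub-block exactly as the short code does, its error at a
  coordinate of the sub-block is the short error composed with \<open>pull_joint\<close>, and that
  map carries one experiment to the other.\<close>

lemma nn_integral_err_pull:
  assumes \<iota>: "inj_on \<iota> {..<m'}" "\<iota> \<in> {..<m'} \<rightarrow> {..<m}"
    and \<kappa>: "inj_on \<kappa> {..<n'}" "\<kappa> \<in> {..<n'} \<rightarrow> {..<n}"
    and c: "code_measurable Mt Mr m' n' f' g'" and j: "j < m'"
    and f: "\<And>S i t. i < n' \<Longrightarrow> t < Mt \<Longrightarrow> f S (\<kappa> i, t) = f' (pull_vec \<iota> m' S) (i, t)"
    and g: "\<And>y tt h \<gamma>. g y tt h \<gamma> (\<iota> j) = g' (pull_mat \<kappa> n' Mr y) (pull_vec \<iota> m' tt) h \<gamma> j"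
  shows "(\<integral>\<^sup>+\<omega>. ennreal ((cmod (fst \<omega> (\<iota> j) - recon Mt Mr \<rho> \<rho>s m n f g \<omega> (\<iota> j)))\<^sup>2) \<partial>joint_space Mt Mr m n)
    = (\<integral>\<^sup>+\<omega>. ennreal ((cmod (fst \<omega> j - recon Mt Mr \<rho> \<rho>s m' n' f' g' \<omega> j))\<^sup>2) \<partial>joint_space Mt Mr m' n')"
proof -
  let ?e = "\<lambda>\<omega>. ennreal ((cmod (fst \<omega> j - recon Mt Mr \<rho> \<rho>s m' n' f' g' \<omega> j))\<^sup>2)"
  have "(\<integral>\<^sup>+\<omega>. ?e \<omega> \<partial>joint_space Mt Mr m' n') = (\<integral>\<^sup>+\<omega>. ?e \<omega> \<partial>distr (joint_space Mt Mr m n) (joint_space Mt Mr m' n') (pull_joint \<iota> \<kappa> m' n' Mr))"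
    by (simp add: distr_pull_joint[OF \<iota> \<kappa>])
  also have "\<dots> = (\<integral>\<^sup>+\<omega>. ?e (pull_joint \<iota> \<kappa> m' n' Mr \<omega>) \<partial>joint_space Mt Mr m n)"
    using measurable_err[OF c j, of \<rho> \<rho>s]
    by (intro nn_integral_distr measurable_pull_joint \<iota> \<kappa>) (auto intro!: measurable_compose[OF _ measurable_ennreal])
  also have "\<dots> = (\<integral>\<^sup>+\<omega>. ennreal ((cmod (fst \<omega> (\<iota> j) - recon Mt Mr \<rho> \<rho>s m n f g \<omega> (\<iota> j)))\<^sup>2) \<partial>joint_space Mt Mr m n)"
  proof (intro nn_integral_cong, clarify)
    fix S H N G Z
    have 1: "pull_mat \<kappa> n' Mr (chan_out Mt Mr n \<rho> H (f S) N) = chan_out Mt Mr n' \<rho> H (f' (pull_vec \<iota> m' S)) (pull_mat \<kappa> n' Mr N)"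
      using \<kappa>(2) by (auto simp: pull_mat_def chan_out_def fun_eq_iff f intro!: sum.cong)
    have 2: "pull_vec \<iota> m' (side_out m \<rho>s G S Z) = side_out m' \<rho>s G (pull_vec \<iota> m' S) (pull_vec \<iota> m' Z)"
      using \<iota>(2) by (auto simp: pull_vec_def side_out_def fun_eq_iff)
    show "?e (pull_joint \<iota> \<kappa> m' n' Mr (S, H, N, G, Z)) = ennreal ((cmod (fst (S, H, N, G, Z) (\<iota> j) - recon Mt Mr \<rho> \<rho>s m n f g (S, H, N, G, Z) (\<iota> j)))\<^sup>2)"
      using j by (simp add: pull_joint_def recon_def g 1 2) (simp add: pull_vec_def)
  qed
  finally show ?thesis by simp
qed

lemma measurable_code_pull:
  assumes \<iota>: "\<iota> \<in> {..<m'} \<rightarrow> {..<m}" and \<kappa>: "\<kappa> \<in> {..<n'} \<rightarrow> {..<n}" and c: "code_measurable Mt Mr m' n' f' g'"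
  shows "i < n' \<Longrightarrow> t < Mt \<Longrightarrow> (\<lambda>S. f' (pull_vec \<iota> m' S) (i, t)) \<in> borel_measurable (iid_cvec m)"
    and "j < m' \<Longrightarrow> (\<lambda>(y,tt,h,\<gamma>). g' (pull_mat \<kappa> n' Mr y) (pull_vec \<iota> m' tt) h \<gamma> j) \<in> borel_measurable (obs_space Mt Mr m n)"
proof -
  note [measurable] = measurable_pull_vec[OF \<iota>] measurable_pull_mat[OF \<kappa>]
  show "(\<lambda>S. f' (pull_vec \<iota> m' S) (i, t)) \<in> borel_measurable (iid_cvec m)" if "i < n'" "t < Mt"
  proof (rule measurable_compose[where g="\<lambda>S. f' S (i,t)"])
    show "pull_vec \<iota> m' \<in> measurable (iid_cvec m) (iid_cvec m')" by measurable
  qed (use c that in \<open>auto simp: code_measurable_def\<close>)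
  show "(\<lambda>(y,tt,h,\<gamma>). g' (pull_mat \<kappa> n' Mr y) (pull_vec \<iota> m' tt) h \<gamma> j) \<in> borel_measurable (obs_space Mt Mr m n)" if "j < m'"
  proof -
    have "(\<lambda>(y,tt,h,\<gamma>). (pull_mat \<kappa> n' Mr y, pull_vec \<iota> m' tt, h, \<gamma>)) \<in> measurable (obs_space Mt Mr m n) (obs_space Mt Mr m' n')"
      unfolding obs_space_def by measurable
    from measurable_compose[OF this, of "\<lambda>(y,tt,h,\<gamma>). g' y tt h \<gamma> j" borel] c that show ?thesis
      by (auto simp: code_measurable_def case_prod_beta)
  qed
qed

lemma nn_integral_iid_cvec_pull:
  assumes "inj_on \<iota> {..<m'}" "\<iota> \<in> {..<m'} \<rightarrow> {..<m}" "F \<in> borel_measurable (iid_cvec m')"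
  shows "(\<integral>\<^sup>+S. F (pull_vec \<iota> m' S) \<partial>iid_cvec m) = (\<integral>\<^sup>+S. F S \<partial>iid_cvec m')"
proof -
  have [measurable]: "pull_vec \<iota> m' \<in> measurable (iid_cvec m) (iid_cvec m')"
    using measurable_pull_vec[OF assms(2)] by measurable
  have "(\<integral>\<^sup>+S. F S \<partial>iid_cvec m') = (\<integral>\<^sup>+S. F S \<partial>distr (iid_cvec m) (iid_cvec m') (pull_vec \<iota> m'))"
    using distr_pull_vec[OF assms(1,2)] by simp
  also have "\<dots> = (\<integral>\<^sup>+S. F (pull_vec \<iota> m' S) \<partial>iid_cvec m)"
    using assms(3) by (intro nn_integral_distr) auto
  finally show ?thesis by simp
qed

section \<open>Existence of the limit over block lengths\<close>

lemma opt_dist_le_exp_dist: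
  "admissible Mt Mr b m n f g \<Longrightarrow> opt_dist Mt Mr b \<rho> \<rho>s m \<le> exp_dist Mt Mr \<rho> \<rho>s m n f g"
  unfolding opt_dist_def by (rule INF_lower2[of "(n, f, g)"]) auto

text \<open>Sending nothing and estimating 0 is always admissible and leaves the variance of the
  source. The finiteness obtained here is what makes \<open>enn2real\<close> harmless in
  \<open>ED_star\<close>.\<close>

lemma opt_dist_le_1: "0 \<le> b \<Longrightarrow> opt_dist Mt Mr b \<rho> \<rho>s m \<le> 1"
proof -
  assume b: "0 \<le> b"
  define f :: "cvec \<Rightarrow> cmat" where "f = (\<lambda>_ _. 0)"
  define g :: "cmat \<Rightarrow> cvec \<Rightarrow> cmat \<Rightarrow> real \<Rightarrow> cvec" where "g = (\<lambda>_ _ _ _ _. 0)"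
  have adm: "admissible Mt Mr b m 0 f g"
    using b by (auto simp: admissible_def f_def g_def)
  show ?thesis
  proof (cases "m = 0")
    case True
    have "exp_dist Mt Mr \<rho> \<rho>s m 0 f g = 0"
      using True by (simp add: exp_dist_def distortion_def case_prod_beta)
    then show ?thesis using opt_dist_le_exp_dist[OF adm, of \<rho> \<rho>s] by (simp add: order_trans)
  next
    case False
    have one: "(\<integral>\<^sup>+\<omega>. ennreal ((cmod (fst \<omega> j))\<^sup>2) \<partial>joint_space Mt Mr m 0) = 1" if j: "j < m" for j
    proof -
      interpret P: prob_space "iid_cmat Mr Mt \<Otimes>\<^sub>M (iid_cmat 0 Mr \<Otimes>\<^sub>M (cgauss \<Otimes>\<^sub>M iid_cvec m))"
        by (intro prob_space_pair prob_space_iid_cvec prob_space_iid_cmat prob_space_cgauss)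
      have "(\<integral>\<^sup>+\<omega>. ennreal ((cmod (fst \<omega> j))\<^sup>2) \<partial>joint_space Mt Mr m 0) = (\<integral>\<^sup>+S. ennreal ((cmod (S j))\<^sup>2) \<partial>iid_cvec m)"
        unfolding joint_space_def using j
        by (subst P.nn_integral_fst[symmetric]) (simp_all add: P.emeasure_space_1)
      also have "\<dots> = (\<integral>\<^sup>+z. ennreal ((cmod z)\<^sup>2) \<partial>distr (iid_cvec m) cgauss (\<lambda>S. S j))"
        using j by (subst nn_integral_distr) (auto simp: measurable_cong_sets[OF refl sets_cgauss] measurable_cong_sets[OF sets_cgauss refl])
      also have "distr (iid_cvec m) cgauss (\<lambda>S. S j) = cgauss"
        unfolding iid_cvec_def using j by (intro distr_PiM_component[where M="\<lambda>_. cgauss", simplified] prob_space_cgauss) auto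
      also have "(\<integral>\<^sup>+z. ennreal ((cmod z)\<^sup>2) \<partial>cgauss) = 1"
        using nn_integral_cgauss_shift_square[of 0] by simp
      finally show ?thesis .
    qed
    have "ennreal (real m) * exp_dist Mt Mr \<rho> \<rho>s m 0 f g = ennreal (real m)"
      by (subst exp_dist_alt[OF admissible_code_measurable[OF adm]])
         (simp add: recon_def g_def case_prod_beta one ennreal_of_nat_eq_real_of_nat)
    then have "exp_dist Mt Mr \<rho> \<rho>s m 0 f g = ennreal (real m) / ennreal (real m)"
      using False by (metis ennreal_mult_divide_eq ennreal_eq_0_iff ennreal_neq_top mult.commute of_nat_0_less_iff not_le neq0_conv)
    also have "\<dots> = 1" using False by (simp add: divide_ennreal)
    finally show ?thesis using opt_dist_le_exp_dist[OF adm, of \<rho> \<rho>s] by simp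
  qed
qed

lemma sum_lessThan_add:
  fixes f :: "nat \<Rightarrow> 'a::comm_monoid_add"
  shows "(\<Sum>i<m + n. f i) = (\<Sum>i<m. f i) + (\<Sum>i<n. f (m + i))"
  by (induction n) (simp_all add: ac_simps)

text \<open>Running two codes one after the other over the same fading realisation.\<close>
lemma opt_dist_subadditive:
  "ennreal (real (m1 + m2)) * opt_dist Mt Mr b \<rho> \<rho>s (m1 + m2)
    \<le> ennreal (real m1) * opt_dist Mt Mr b \<rho> \<rho>s m1 + ennreal (real m2) * opt_dist Mt Mr b \<rho> \<rho>s m2"
proof -
  have key: "ennreal (real (m1 + m2)) * opt_dist Mt Mr b \<rho> \<rho>s (m1 + m2)
     \<le> ennreal (real m1) * exp_dist Mt Mr \<rho> \<rho>s m1 n1 f1 g1 + ennreal (real m2) * exp_dist Mt Mr \<rho> \<rho>s m2 n2 f2 g2"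
    if a1: "admissible Mt Mr b m1 n1 f1 g1" and a2: "admissible Mt Mr b m2 n2 f2 g2" for n1 f1 g1 n2 f2 g2
  proof -
    define f where "f S = (\<lambda>(i, t). if i < n1 then f1 (pull_vec id m1 S) (i, t) else f2 (pull_vec ((+) m1) m2 S) (i - n1, t))" for S
    define g where "g y tt h \<gamma> j = (if j < m1 then g1 (pull_mat id n1 Mr y) (pull_vec id m1 tt) h \<gamma> j
        else g2 (pull_mat ((+) n1) n2 Mr y) (pull_vec ((+) m1) m2 tt) h \<gamma> (j - m1))" for y tt h \<gamma> j
    note c1 = admissible_code_measurable[OF a1] and c2 = admissible_code_measurable[OF a2]
    have i1: "inj_on id {..<m1}" "id \<in> {..<m1} \<rightarrow> {..<m1 + m2}" "inj_on id {..<n1}" "id \<in> {..<n1} \<rightarrow> {..<n1 + n2}"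
      by auto
    have i2: "inj_on ((+) m1) {..<m2}" "(+) m1 \<in> {..<m2} \<rightarrow> {..<m1 + m2}" "inj_on ((+) n1) {..<n2}" "(+) n1 \<in> {..<n2} \<rightarrow> {..<n1 + n2}"
      by auto
    have cm: "code_measurable Mt Mr (m1 + m2) (n1 + n2) f g"
      unfolding code_measurable_def
    proof (intro conjI allI impI)
      fix i t assume "i < n1 + n2" "t < Mt"
      then show "(\<lambda>S. f S (i, t)) \<in> borel_measurable (iid_cvec (m1 + m2))"
        using measurable_code_pull(1)[OF i1(2,4) c1, of i t] measurable_code_pull(1)[OF i2(2,4) c2, of "i - n1" t]
        by (cases "i < n1") (auto simp: f_def)
    next
      fix j assume "j < m1 + m2"
      then show "(\<lambda>(y,tt,h,\<gamma>). g y tt h \<gamma> j) \<in> borel_measurable (obs_space Mt Mr (m1 + m2) (n1 + n2))"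
        using measurable_code_pull(2)[OF i1(2,4) c1, of j] measurable_code_pull(2)[OF i2(2,4) c2, of "j - m1"]
        by (cases "j < m1") (auto simp: g_def)
    qed
    let ?P = "\<lambda>n f m. (\<integral>\<^sup>+ S. ennreal (\<Sum>i<n. \<Sum>t<Mt. (cmod (f S (i,t)))\<^sup>2) \<partial>iid_cvec m)"
    have m1: "(\<lambda>S. ennreal (\<Sum>i<n1. \<Sum>t<Mt. (cmod (f1 S (i,t)))\<^sup>2)) \<in> borel_measurable (iid_cvec m1)"
      using c1 unfolding code_measurable_def
      by (intro measurable_compose[OF _ measurable_ennreal] borel_measurable_sum borel_measurable_power measurable_compose[OF _ borel_measurable_norm]) auto
    have m2: "(\<lambda>S. ennreal (\<Sum>i<n2. \<Sum>t<Mt. (cmod (f2 S (i,t)))\<^sup>2)) \<in> borel_measurable (iid_cvec m2)"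
      using c2 unfolding code_measurable_def
      by (intro measurable_compose[OF _ measurable_ennreal] borel_measurable_sum borel_measurable_power measurable_compose[OF _ borel_measurable_norm]) auto
    have m1': "(\<lambda>S. ennreal (\<Sum>i<n1. \<Sum>t<Mt. (cmod (f1 (pull_vec id m1 S) (i,t)))\<^sup>2)) \<in> borel_measurable (iid_cvec (m1 + m2))"
      using measurable_code_pull(1)[OF i1(2,4) c1]
      by (intro measurable_compose[OF _ measurable_ennreal] borel_measurable_sum borel_measurable_power measurable_compose[OF _ borel_measurable_norm]) auto
    have m2': "(\<lambda>S. ennreal (\<Sum>i<n2. \<Sum>t<Mt. (cmod (f2 (pull_vec ((+) m1) m2 S) (i,t)))\<^sup>2)) \<in> borel_measurable (iid_cvec (m1 + m2))"
      using measurable_code_pull(1)[OF i2(2,4) c2]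
      by (intro measurable_compose[OF _ measurable_ennreal] borel_measurable_sum borel_measurable_power measurable_compose[OF _ borel_measurable_norm]) auto
    have "?P (n1 + n2) f (m1 + m2) = (\<integral>\<^sup>+ S. ennreal (\<Sum>i<n1. \<Sum>t<Mt. (cmod (f1 (pull_vec id m1 S) (i,t)))\<^sup>2)
        + ennreal (\<Sum>i<n2. \<Sum>t<Mt. (cmod (f2 (pull_vec ((+) m1) m2 S) (i,t)))\<^sup>2) \<partial>iid_cvec (m1 + m2))"
      by (intro nn_integral_cong) (simp add: sum_lessThan_add f_def sum_nonneg flip: ennreal_plus)
    also have "\<dots> = ?P n1 f1 m1 + ?P n2 f2 m2"
      by (subst nn_integral_add[OF m1' m2'])
        (simp only: nn_integral_iid_cvec_pull[OF i1(1,2) m1] nn_integral_iid_cvec_pull[OF i2(1,2) m2])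
    also have "\<dots> \<le> ennreal (real n1 * real Mt) + ennreal (real n2 * real Mt)"
      using a1 a2 by (intro add_mono) (auto simp: admissible_def)
    also have "\<dots> = ennreal (real (n1 + n2) * real Mt)"
      by (simp add: algebra_simps flip: ennreal_plus)
    finally have adm: "admissible Mt Mr b (m1 + m2) (n1 + n2) f g"
      using cm a1 a2 unfolding admissible_def code_measurable_def by (auto simp: algebra_simps)
    let ?e = "\<lambda>m n f g j. (\<integral>\<^sup>+\<omega>. ennreal ((cmod (fst \<omega> j - recon Mt Mr \<rho> \<rho>s m n f g \<omega> j))\<^sup>2) \<partial>joint_space Mt Mr m n)"
    have "ennreal (real (m1 + m2)) * opt_dist Mt Mr b \<rho> \<rho>s (m1 + m2) \<le> ennreal (real (m1 + m2)) * exp_dist Mt Mr \<rho> \<rho>s (m1 + m2) (n1 + n2) f g"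
      by (intro mult_left_mono opt_dist_le_exp_dist adm) auto
    also have "\<dots> = (\<Sum>j<m1. ?e (m1 + m2) (n1 + n2) f g (id j)) + (\<Sum>j<m2. ?e (m1 + m2) (n1 + n2) f g (m1 + j))"
      by (subst exp_dist_alt[OF cm]) (simp add: sum_lessThan_add)
    also have "\<dots> = (\<Sum>j<m1. ?e m1 n1 f1 g1 j) + (\<Sum>j<m2. ?e m2 n2 f2 g2 j)"
      by (intro arg_cong2[where f="(+)"] sum.cong refl
           nn_integral_err_pull[OF i1(1,2,3,4) c1] nn_integral_err_pull[OF i2(1,2,3,4) c2])
         (auto simp: f_def g_def)
    finally show ?thesis
      by (simp only: exp_dist_alt[OF c1] exp_dist_alt[OF c2])
  qed
  show ?thesis
  proof (rule ennreal_le_epsilon)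
    fix e :: real assume e: "0 < e"
    \<comment> \<open>The infimum need not be attained. The slack
      \<open>e / (2 * (real m + 1))\<close>, multiplied by the block length, stays below
      \<open>e / 2\<close>, and the added 1 avoids division by zero.\<close>
    have ex: "\<exists>n f g. admissible Mt Mr b m n f g \<and> ennreal (real m) * exp_dist Mt Mr \<rho> \<rho>s m n f g \<le> ennreal (real m) * opt_dist Mt Mr b \<rho> \<rho>s m + ennreal (e / 2)"
      if fin: "opt_dist Mt Mr b \<rho> \<rho>s m < \<infinity>" for m
    proof -
      define d where "d = ennreal (e / (2 * (real m + 1)))"
      have "0 < d" using e unfolding d_def by (simp add: divide_pos_pos)
      then have "opt_dist Mt Mr b \<rho> \<rho>s m < opt_dist Mt Mr b \<rho> \<rho>s m + d"
        using fin ennreal_add_left_cancel_less[of "opt_dist Mt Mr b \<rho> \<rho>s m" 0 d] by (simp add: less_top)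
      then obtain n f g where nfg: "admissible Mt Mr b m n f g" "exp_dist Mt Mr \<rho> \<rho>s m n f g < opt_dist Mt Mr b \<rho> \<rho>s m + d"
        unfolding opt_dist_def[of _ _ _ _ _ m] INF_less_iff by auto
      have "ennreal (real m) * exp_dist Mt Mr \<rho> \<rho>s m n f g \<le> ennreal (real m) * (opt_dist Mt Mr b \<rho> \<rho>s m + d)"
        using nfg by (intro mult_left_mono) auto
      also have "\<dots> = ennreal (real m) * opt_dist Mt Mr b \<rho> \<rho>s m + ennreal (real m) * d"
        by (simp add: distrib_left)
      also have "ennreal (real m) * d \<le> ennreal (e / 2)"
        unfolding d_def using e by (auto simp: field_simps simp flip: ennreal_mult intro!: ennreal_leI)
      finally show ?thesis using nfg by (auto simp: add_left_mono)
    qed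
    show "ennreal (real (m1 + m2)) * opt_dist Mt Mr b \<rho> \<rho>s (m1 + m2)
      \<le> ennreal (real m1) * opt_dist Mt Mr b \<rho> \<rho>s m1 + ennreal (real m2) * opt_dist Mt Mr b \<rho> \<rho>s m2 + ennreal e"
    proof (cases "opt_dist Mt Mr b \<rho> \<rho>s m1 < \<infinity> \<and> opt_dist Mt Mr b \<rho> \<rho>s m2 < \<infinity>")
      case True
      from ex[of m1] True obtain n1 f1 g1 where 1: "admissible Mt Mr b m1 n1 f1 g1"
        "ennreal (real m1) * exp_dist Mt Mr \<rho> \<rho>s m1 n1 f1 g1 \<le> ennreal (real m1) * opt_dist Mt Mr b \<rho> \<rho>s m1 + ennreal (e / 2)" by auto
      from ex[of m2] True obtain n2 f2 g2 where 2: "admissible Mt Mr b m2 n2 f2 g2"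
        "ennreal (real m2) * exp_dist Mt Mr \<rho> \<rho>s m2 n2 f2 g2 \<le> ennreal (real m2) * opt_dist Mt Mr b \<rho> \<rho>s m2 + ennreal (e / 2)" by auto
      have "ennreal (e/2) + ennreal (e/2) = ennreal e" using ennreal_plus[of "e/2" "e/2"] e by simp
      then have "ennreal (real m1) * opt_dist Mt Mr b \<rho> \<rho>s m1 + ennreal (real m2) * opt_dist Mt Mr b \<rho> \<rho>s m2 + ennreal e
         = (ennreal (real m1) * opt_dist Mt Mr b \<rho> \<rho>s m1 + ennreal (e / 2)) + (ennreal (real m2) * opt_dist Mt Mr b \<rho> \<rho>s m2 + ennreal (e / 2))"
        by (simp only: ac_simps flip: \<open>ennreal (e / 2) + ennreal (e / 2) = ennreal e\<close>)
      then show ?thesis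
        using order_trans[OF key[OF 1(1) 2(1)] add_mono[OF 1(2) 2(2)]] by (simp only:)
    next
      case False
      \<comment> \<open>An infimum is infinite when no code is admissible, as for negative
        \<open>b\<close>. The right side is then infinite too, except when the factor in front is 0;
        in that case both sides reduce to the other block.\<close>
      then have "m1 = 0 \<or> m2 = 0 \<or> ennreal (real m1) * opt_dist Mt Mr b \<rho> \<rho>s m1 + ennreal (real m2) * opt_dist Mt Mr b \<rho> \<rho>s m2 = \<infinity>"
        by (auto simp: ennreal_mult_top less_top[symmetric])
      then show ?thesis by (elim disjE) auto
    qed
  qed
qed

text \<open>Fekete's lemma. Dividing \<open>n\<close> by a nearly optimal \<open>k\<close> bounds
  \<open>a n\<close> by \<open>n div k\<close> copies of \<open>a k\<close> and a remainder among
  finitely many values, whose share of the quotient vanishes.\<close>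

lemma subadditive_quotient_limit:
  fixes a :: "nat \<Rightarrow> real"
  assumes sub: "\<And>m n. a (m + n) \<le> a m + a n" and nn: "\<And>n. 0 \<le> a n"
  shows "(\<lambda>n. a n / real n) \<longlonglongrightarrow> (INF n\<in>{1..}. a n / real n)"
proof (rule tendstoI)
  let ?L = "INF n\<in>{1..}. a n / real n"
  have bdd: "bdd_below ((\<lambda>n. a n / real n) ` {1..})"
    by (rule bdd_belowI2[of _ 0]) (auto simp: nn)
  fix e :: real assume e: "0 < e"
  have "?L < ?L + e / 2" using e by simp
  then obtain k where k: "1 \<le> k" "a k / real k < ?L + e / 2"
    by (subst (asm) cINF_less_iff[OF _ bdd]) auto
  have mult: "a (q * k) \<le> real q * a k" if "1 \<le> q" for q
    using that
  proof (induction q rule: nat_induct_at_least)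
    case (Suc q)
    have "a (Suc q * k) \<le> a k + a (q * k)" using sub[of k "q * k"] by simp
    then show ?case using Suc by (simp add: algebra_simps)
  qed simp
  define B where "B = (\<Sum>r<k. a r)"
  have B: "a r \<le> B" if "r < k" for r
    unfolding B_def using that by (intro member_le_sum nn) auto
  have up: "a n / real n \<le> a k / real k + B / real n" if n: "k \<le> n" for n
  proof -
    have q: "1 \<le> n div k" using n k by (simp add: Suc_leI div_greater_zero_iff)
    have "a n \<le> a (n div k * k) + a (n mod k)" using sub[of "n div k * k" "n mod k"] by simp
    also have "\<dots> \<le> real (n div k) * a k + B" using k by (intro add_mono mult[OF q] B) auto
    also have "real (n div k) * a k \<le> (real n / real k) * a k"
    proof (intro mult_right_mono nn)
      have "real (n div k) * real k \<le> real n"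
        by (metis div_times_less_eq_dividend of_nat_le_iff of_nat_mult)
      then show "real (n div k) \<le> real n / real k" using k by (simp add: field_simps)
    qed
    finally show ?thesis using n k by (simp add: field_simps)
  qed
  have "(\<lambda>n. B / real n) \<longlonglongrightarrow> 0" by (rule lim_const_over_n)
  then have "\<forall>\<^sub>F n in sequentially. dist (B / real n) 0 < e / 2"
    using e by (intro tendstoD) auto
  then show "\<forall>\<^sub>F n in sequentially. dist (a n / real n) ?L < e"
    using eventually_ge_at_top[of k]
  proof eventually_elim
    case (elim n)
    have "?L \<le> a n / real n" using k elim by (intro cINF_lower bdd) auto
    moreover have "B / real n < e / 2" using elim(1) by (simp only: dist_real_def)
    then have "a n / real n < ?L + e" using up[OF elim(2)] k(2) by linarith
    ultimately show ?case by (simp add: dist_real_def)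
  qed
qed

text \<open>The limit is an infimum because the block length times the optimum is subadditive. Hence
  one good block length bounds \<open>ED_star\<close> from above, while a lower bound has to hold
  for every block length.\<close>

lemma
  assumes b: "0 \<le> b"
  shows convergent_opt_dist: "convergent (\<lambda>m. enn2real (opt_dist Mt Mr b \<rho> \<rho>s m))"
    and ED_star_eq_INF: "ED_star Mt Mr b \<rho> \<rho>s = (INF m\<in>{1..}. enn2real (opt_dist Mt Mr b \<rho> \<rho>s m))"
proof -
  define a where "a m = real m * enn2real (opt_dist Mt Mr b \<rho> \<rho>s m)" for m
  have fin: "opt_dist Mt Mr b \<rho> \<rho>s m = ennreal (enn2real (opt_dist Mt Mr b \<rho> \<rho>s m))" for m
    using opt_dist_le_1[OF b, of Mt Mr \<rho> \<rho>s m] by (simp add: order_le_less_trans)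
  have "ennreal (a (m + n)) \<le> ennreal (a m + a n)" for m n
    using opt_dist_subadditive[of m n Mt Mr b \<rho> \<rho>s]
    unfolding a_def by (subst (asm) (1 2 3) fin) (simp flip: ennreal_mult ennreal_plus)
  then have sub: "a (m + n) \<le> a m + a n" for m n
    by (subst (asm) ennreal_le_iff) (auto simp: a_def)
  have "(\<lambda>n. a n / real n) \<longlonglongrightarrow> (INF n\<in>{1..}. a n / real n)"
    by (intro subadditive_quotient_limit sub) (simp add: a_def)
  moreover have "\<forall>\<^sub>F n in sequentially. a n / real n = enn2real (opt_dist Mt Mr b \<rho> \<rho>s n)"
    using eventually_ge_at_top[of 1] by eventually_elim (simp add: a_def)
  moreover have "(INF n\<in>{1..}. a n / real n) = (INF m\<in>{1..}. enn2real (opt_dist Mt Mr b \<rho> \<rho>s m))"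
    by (intro INF_cong) (auto simp: a_def)
  ultimately have lim: "(\<lambda>m. enn2real (opt_dist Mt Mr b \<rho> \<rho>s m)) \<longlonglongrightarrow> (INF m\<in>{1..}. enn2real (opt_dist Mt Mr b \<rho> \<rho>s m))"
    by (simp only: tendsto_cong)
  then show "convergent (\<lambda>m. enn2real (opt_dist Mt Mr b \<rho> \<rho>s m))" by (rule convergentI)
  show "ED_star Mt Mr b \<rho> \<rho>s = (INF m\<in>{1..}. enn2real (opt_dist Mt Mr b \<rho> \<rho>s m))"
    unfolding ED_star_def using lim by (rule limI)
qed

section \<open>The converse for codes\<close>

declare measurable_iid_cvec_component [measurable del] measurable_iid_cmat_component [measurable del]

text \<open>Ladder of side information qualities. A distortion profile \<open>d\<close> that satisfies the rate
  inequality along every increasing ladder of fading values cannot have a small average: on each of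
  the annuli \<open>4\<^sup>k\<^sup>-\<^sup>K/4 \<le> |G|\<^sup>2 < 4\<^sup>k\<^sup>-\<^sup>K\<close> some value is at most the average over the annulus.\<close>
lemma ladder_average_ge:
  fixes d :: "complex \<Rightarrow> ennreal"
  assumes [measurable]: "d \<in> borel_measurable borel"
    and \<rho>s: "0 < \<rho>s"
    and ladder: "\<And>K G v. (\<And>k. k < K \<Longrightarrow> cmod (G k) \<le> cmod (G (Suc k))) \<Longrightarrow>
       (\<And>k. k \<le> K \<Longrightarrow> 0 \<le> v k) \<Longrightarrow> (\<And>k. k \<le> K \<Longrightarrow> d (G k) \<le> ennreal (v k)) \<Longrightarrow> 0 < v K \<Longrightarrow> v K \<le> 1 \<Longrightarrow>
       ln (1 / v K) \<le> R + ln (1 + \<rho>s * (cmod (G 0))\<^sup>2) + (\<Sum>k<K. ln (1 + \<rho>s * (cmod (G (Suc k)))\<^sup>2 * v k))"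
  shows "ennreal (1 / 2000 * min (1 / \<rho>s) (min 1 (exp (- R)))) \<le> (\<integral>\<^sup>+G. d G \<partial>cgauss)"
proof (rule ccontr)
  \<comment> \<open>The constant is fixed by the final contradiction. The top rung has value
    \<open>200 * V\<close>, so the left side of the ladder inequality is at least
    \<open>R + ln 10\<close>. On the right the bottom rung costs at most 1 and the remaining rungs
    at most \<open>800 * (\<rho>s * V)\<close>, that is 2/5, while \<open>ln 10\<close> exceeds
    7/5.\<close>
  define V where "V = 1 / 2000 * min (1 / \<rho>s) (min 1 (exp (- R)))"
  have V: "0 < V" "V \<le> 1 / 2000" "\<rho>s * V \<le> 1 / 2000" "V \<le> exp (- R) / 2000"
  proof -
    have "V \<le> 1 / 2000 * (1 / \<rho>s)" "V \<le> 1 / 2000 * 1" "V \<le> 1 / 2000 * exp (- R)"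
      unfolding V_def by (intro mult_left_mono; simp)+
    then show "V \<le> 1 / 2000" "\<rho>s * V \<le> 1 / 2000" "V \<le> exp (- R) / 2000"
      using \<rho>s by (auto simp: field_simps)
    show "0 < V" using \<rho>s by (simp add: V_def)
  qed
  assume "\<not> ?thesis"
  then have lt: "(\<integral>\<^sup>+G. d G \<partial>cgauss) < ennreal V" by (simp add: V_def)
  \<comment> \<open>The ladder must reach down to fading values of order \<open>1 / \<rho>s\<close>:
    there the side information is worth at most one nat, and no further rung is needed
    below.\<close>
  obtain K where K: "\<rho>s \<le> 4 ^ K"
    using real_arch_pow[of 4 \<rho>s] by (auto intro: less_imp_le)
  define a :: "nat \<Rightarrow> real" where "a k = (1 / 4) ^ (K - k)" for k
  have a: "0 < a k" "a k \<le> 1" for k by (auto simp: a_def power_le_one)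
  have a_Suc: "a (Suc k) = 4 * a k" if "k < K" for k
    using that by (simp add: a_def Suc_diff_Suc[symmetric])
  define A where "A k = {z. a k / 4 \<le> (cmod z)\<^sup>2 \<and> (cmod z)\<^sup>2 < a k}" for k
  have [measurable]: "A k \<in> sets borel" for k unfolding A_def by measurable
  define D where "D k = (\<integral>\<^sup>+G. d G * indicator (A k) G \<partial>cgauss)" for k
  have disj: "k \<le> K \<Longrightarrow> k' \<le> K \<Longrightarrow> k < k' \<Longrightarrow> A k \<inter> A k' = {}" for k k'
  proof -
    assume k: "k \<le> K" "k' \<le> K" "k < k'"
    have "a (Suc k) \<le> a k'" using k unfolding a_def by (intro power_decreasing) auto
    then have "a k \<le> a k' / 4" using a_Suc[of k] k by simp
    then show ?thesis by (auto simp: A_def)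
  qed
  have D_sum: "(\<Sum>k\<le>K. D k) < ennreal V"
  proof -
    have "(\<Sum>k\<le>K. D k) = (\<integral>\<^sup>+G. (\<Sum>k\<le>K. d G * indicator (A k) G) \<partial>cgauss)"
      unfolding D_def by (subst nn_integral_sum) auto
    also have "\<dots> \<le> (\<integral>\<^sup>+G. d G \<partial>cgauss)"
    proof (intro nn_integral_mono)
      fix G
      have "(\<Sum>k\<le>K. indicator (A k) G) \<le> (1::ennreal)"
      proof (cases "\<exists>k\<le>K. G \<in> A k")
        case True
        then obtain k where k: "k \<le> K" "G \<in> A k" by auto
        have "(\<Sum>k\<le>K. indicator (A k) G) = (\<Sum>k'\<in>{k}. indicator (A k') G :: ennreal)"
          using k disj by (intro sum.mono_neutral_right) (auto simp: indicator_def, metis disjoint_iff linorder_neqE_nat)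
        then show ?thesis using k by simp
      next
        case False
        then have "(\<Sum>k\<le>K. indicator (A k) G) = (0::ennreal)" by (intro sum.neutral) (auto simp: indicator_def)
        then show ?thesis by simp
      qed
      then have "d G * (\<Sum>k\<le>K. indicator (A k) G) \<le> d G * 1" by (intro mult_left_mono) auto
      then show "(\<Sum>k\<le>K. d G * indicator (A k) G) \<le> d G" by (simp add: sum_distrib_left)
    qed
    finally show ?thesis using lt by simp
  qed
  have D_fin: "D k = ennreal (enn2real (D k))" if "k \<le> K" for k
  proof -
    have "D k \<le> (\<Sum>k\<le>K. D k)" using that by (intro member_le_sum) auto
    then have "D k < ennreal V" using D_sum by (rule le_less_trans)
    then have "D k < \<infinity>" using ennreal_less_top less_trans by (metis infinity_ennreal_def)
    then show ?thesis by simp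
  qed
  \<comment> \<open>Just above the mean of \<open>d\<close> over the annulus, whose probability is
    at least \<open>a k / 100\<close>. The extra \<open>V / (real K + 1)\<close> makes the
    comparison strict even if \<open>D k\<close> is 0, and its sum over all rungs is only
    \<open>V\<close>.\<close>
  define w where "w k = (enn2real (D k) + V / (real K + 1)) * 100 / a k" for k
  have w0: "0 \<le> w k" for k unfolding w_def using V a[of k] by simp
  have "\<exists>G. G \<in> A k \<and> d G \<le> ennreal (w k)" if k: "k \<le> K" for k
  proof (rule ccontr)
    assume "\<not> ?thesis"
    then have *: "ennreal (w k) \<le> d G" if "G \<in> A k" for G using that by (meson le_cases)
    have "ennreal (w k) * ennreal (a k / 100) \<le> ennreal (w k) * emeasure cgauss (A k)"
      unfolding A_def by (intro mult_left_mono cgauss_annulus_ge a) auto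
    also have "\<dots> = (\<integral>\<^sup>+G. ennreal (w k) * indicator (A k) G \<partial>cgauss)"
      by (simp add: nn_integral_cmult_indicator)
    also have "\<dots> \<le> D k"
      unfolding D_def by (intro nn_integral_mono) (auto simp: indicator_def *)
    finally have "ennreal (w k * (a k / 100)) \<le> ennreal (enn2real (D k))"
      using D_fin[OF k] w0 a[of k] by (simp flip: ennreal_mult)
    then have "w k * (a k / 100) \<le> enn2real (D k)" by (subst (asm) ennreal_le_iff) auto
    moreover have "w k * (a k / 100) = enn2real (D k) + V / (real K + 1)"
      using a[of k] by (simp add: w_def)
    moreover have "0 < V / (real K + 1)" using V by simp
    ultimately show False by linarith
  qed
  then obtain G where G: "\<And>k. k \<le> K \<Longrightarrow> G k \<in> A k" "\<And>k. k \<le> K \<Longrightarrow> d (G k) \<le> ennreal (w k)" by metis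
  \<comment> \<open>At the top \<open>a K = 1\<close> and both summands of \<open>w K\<close> are at
    most \<open>V\<close>, so \<open>w K\<close> may be rounded up to the explicit value
    \<open>200 * V\<close>.\<close>
  define v where "v k = (if k = K then 200 * V else w k)" for k
  have sum_D: "(\<Sum>k\<le>K. enn2real (D k)) < V"
  proof -
    have "ennreal (\<Sum>k\<le>K. enn2real (D k)) = (\<Sum>k\<le>K. D k)"
      using D_fin by (subst sum_ennreal[symmetric]) (auto intro!: sum.cong)
    then have "ennreal (\<Sum>k\<le>K. enn2real (D k)) < ennreal V" using D_sum by (simp only:)
    then show ?thesis by (subst (asm) ennreal_less_iff) (auto intro: sum_nonneg)
  qed
  have wK: "w K \<le> 200 * V"
  proof -
    have "enn2real (D K) \<le> (\<Sum>k\<le>K. enn2real (D k))" by (intro member_le_sum) auto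
    moreover have "V / (real K + 1) \<le> V" using V by (simp add: field_simps)
    ultimately have "enn2real (D K) + V / (real K + 1) \<le> 2 * V" using sum_D by linarith
    then have "(enn2real (D K) + V / (real K + 1)) * 100 \<le> 2 * V * 100" by (rule mult_right_mono) simp
    also have "(enn2real (D K) + V / (real K + 1)) * 100 = w K" by (simp only: w_def a_def) simp
    finally show ?thesis by simp
  qed
  have "ln (1 / v K) \<le> R + ln (1 + \<rho>s * (cmod (G 0))\<^sup>2) + (\<Sum>k<K. ln (1 + \<rho>s * (cmod (G (Suc k)))\<^sup>2 * v k))"
  proof (rule ladder)
    fix k assume k: "k < K"
    have "(cmod (G k))\<^sup>2 \<le> (cmod (G (Suc k)))\<^sup>2"
    proof -
      have "(cmod (G k))\<^sup>2 < a k" using G(1)[of k] k by (auto simp: A_def)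
      also have "a k = a (Suc k) / 4" using a_Suc[of k] k by simp
      also have "\<dots> \<le> (cmod (G (Suc k)))\<^sup>2" using G(1)[of "Suc k"] k by (auto simp: A_def)
      finally show ?thesis by (rule less_imp_le)
    qed
    then show "cmod (G k) \<le> cmod (G (Suc k))" by (rule power2_le_imp_le) simp
  next
    fix k assume k: "k \<le> K"
    show "0 \<le> v k" using w0 V by (simp add: v_def)
    show "d (G k) \<le> ennreal (v k)"
      using G(2)[OF k] wK by (auto simp: v_def intro: order_trans ennreal_leI)
  qed (use V in \<open>auto simp: v_def\<close>)
  moreover have "ln (1 + \<rho>s * (cmod (G 0))\<^sup>2) \<le> 1"
  proof -
    have "\<rho>s * (cmod (G 0))\<^sup>2 \<le> 4 ^ K * (1 / 4) ^ K"
      using G(1)[of 0] K \<rho>s by (intro mult_mono) (auto simp: A_def a_def)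
    then have "\<rho>s * (cmod (G 0))\<^sup>2 \<le> 1" by (simp add: power_mult_distrib[symmetric])
    moreover have "0 \<le> \<rho>s * (cmod (G 0))\<^sup>2" using \<rho>s by simp
    ultimately show ?thesis using ln_add_one_self_le_self[of "\<rho>s * (cmod (G 0))\<^sup>2"] by linarith
  qed
  \<comment> \<open>By \<open>ln (1 + x) \<le> x\<close> the rung costs \<rho>s times the next
    fading value times \<open>v k\<close>. The fading is below \<open>4 * a k\<close>, which cancels
    the \<open>1 / a k\<close> in \<open>w k\<close>; what is left is the contribution of one
    annulus to the average, so the sum is bounded independently of the number of rungs.\<close>
  moreover have "(\<Sum>k<K. ln (1 + \<rho>s * (cmod (G (Suc k)))\<^sup>2 * v k)) \<le> 2 / 5"
  proof -
    have "(\<Sum>k<K. ln (1 + \<rho>s * (cmod (G (Suc k)))\<^sup>2 * v k)) \<le> (\<Sum>k<K. \<rho>s * 400 * (enn2real (D k) + V / (real K + 1)))"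
    proof (rule sum_mono)
      fix k assume "k \<in> {..<K}"
      then have k: "k < K" by simp
      have "ln (1 + \<rho>s * (cmod (G (Suc k)))\<^sup>2 * v k) \<le> \<rho>s * (cmod (G (Suc k)))\<^sup>2 * v k"
        using \<rho>s w0 k by (intro ln_add_one_self_le_self) (auto simp: v_def)
      also have "\<dots> \<le> \<rho>s * (4 * a k) * v k"
        using \<rho>s w0 k G(1)[of "Suc k"] a_Suc[OF k] by (intro mult_right_mono mult_left_mono) (auto simp: v_def A_def)
      also have "\<dots> = \<rho>s * 400 * (enn2real (D k) + V / (real K + 1))"
        using k a[of k] by (simp add: v_def w_def)
      finally show "ln (1 + \<rho>s * (cmod (G (Suc k)))\<^sup>2 * v k) \<le> \<rho>s * 400 * (enn2real (D k) + V / (real K + 1))" .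
    qed
    also have "\<dots> \<le> (\<Sum>k\<le>K. \<rho>s * 400 * (enn2real (D k) + V / (real K + 1)))"
      using \<rho>s V by (intro sum_mono2) auto
    also have "\<dots> = \<rho>s * 400 * ((\<Sum>k\<le>K. enn2real (D k)) + V)"
    proof -
      have "(\<Sum>k\<le>K. V / (real K + 1)) = (real K + 1) * (V / (real K + 1))" by (simp add: add.commute)
      also have "\<dots> = V" by (rule nonzero_mult_div_cancel_left[THEN trans[rotated]]) (auto simp: add_nonneg_eq_0_iff)
      finally show ?thesis by (simp only: sum_distrib_left[symmetric] sum.distrib)
    qed
    also have "\<dots> \<le> \<rho>s * 400 * (2 * V)" using sum_D \<rho>s by (intro mult_left_mono) auto
    also have "\<dots> = 800 * (\<rho>s * V)" by simp
    also have "\<dots> \<le> 800 * (1 / 2000)" using V by (intro mult_left_mono) auto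
    also have "\<dots> = 2 / 5" by simp
    finally show ?thesis .
  qed
  moreover have "R + ln 10 \<le> ln (1 / v K)"
  proof -
    have "R + ln 10 = ln (10 * exp R)" by (simp add: ln_mult)
    also have "\<dots> \<le> ln (1 / v K)"
    proof (subst ln_le_cancel_iff)
      have "V * exp R \<le> exp (- R) / 2000 * exp R" using V by (intro mult_right_mono) auto
      also have "\<dots> = 1 / 2000" by (simp flip: exp_add)
      finally show "10 * exp R \<le> 1 / v K" using V(1) by (simp add: v_def field_simps)
    qed (use V in \<open>auto simp: v_def\<close>)
    finally show ?thesis .
  qed
  moreover have "7 / 5 < ln (10::real)"
  proof -
    have "exp (7/5) \<le> exp (1 + 1 :: real)" by simp
    also have "\<dots> = exp 1 * exp 1" by (rule exp_add)
    also have "\<dots> \<le> 3 * 3" by (intro mult_mono exp_le) auto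
    finally have "exp (7/5 :: real) < 10" by simp
    then have "ln (exp (7/5)) < ln (10::real)" by (subst ln_less_cancel_iff) auto
    then show ?thesis by simp
  qed
  ultimately show False by linarith
qed

section \<open>A Gaussian chain as reference law along the ladder\<close>

lemma sets_PiM_lscale [measurable_cong]: "sets (PiM I (\<lambda>_. lscale)) = sets (PiM I (\<lambda>_. borel))"
  by (intro sets_PiM_cong) auto

lemma sets_PiM_cgauss [measurable_cong]: "sets (PiM I (\<lambda>_. cgauss)) = sets (PiM I (\<lambda>_. borel))"
  by (intro sets_PiM_cong) auto

text \<open>Coordinate \<open>i\<close> is fresh noise for \<phi>, so it can be integrated first
  with \<phi> frozen; it adds its variance 1.\<close>

lemma nn_integral_PiM_cgauss_square:
  assumes I: "finite I" "i \<in> I" and [measurable]: "\<phi> \<in> borel_measurable (PiM I (\<lambda>_. borel))"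
    and indep: "\<And>x z. \<phi> (x(i := z)) = \<phi> x"
  shows "(\<integral>\<^sup>+x. ennreal ((cmod (\<phi> x + x i))\<^sup>2) \<partial>PiM I (\<lambda>_. cgauss)) = (\<integral>\<^sup>+x. ennreal ((cmod (\<phi> x))\<^sup>2) \<partial>PiM I (\<lambda>_. cgauss)) + 1"
proof -
  interpret P: prob_space "PiM I (\<lambda>_. cgauss)" by (intro prob_space_PiM prob_space_cgauss)
  have [measurable]: "(\<lambda>x. x i) \<in> borel_measurable (PiM I (\<lambda>_. borel))" using I by measurable
  define J where "J = I - {i}"
  have IJ: "I = insert i J" "i \<notin> J" "finite J" using I by (auto simp: J_def)
  have "(\<integral>\<^sup>+x. ennreal ((cmod (\<phi> x + x i))\<^sup>2) \<partial>PiM I (\<lambda>_. cgauss))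
     = (\<integral>\<^sup>+x. (\<integral>\<^sup>+z. ennreal ((cmod (\<phi> (x(i := z)) + (x(i := z)) i))\<^sup>2) \<partial>cgauss) \<partial>PiM J (\<lambda>_. cgauss))"
    unfolding IJ(1) by (subst PG.product_nn_integral_insert[OF IJ(3,2)]) (simp_all flip: IJ(1))
  also have "\<dots> = (\<integral>\<^sup>+x. (\<integral>\<^sup>+z. ennreal ((cmod (\<phi> (x(i := z))))\<^sup>2 + 1) \<partial>cgauss) \<partial>PiM J (\<lambda>_. cgauss))"
    by (simp add: indep nn_integral_cgauss_shift_square cgauss.emeasure_space_1[simplified])
  also have "\<dots> = (\<integral>\<^sup>+x. ennreal ((cmod (\<phi> x))\<^sup>2 + 1) \<partial>PiM I (\<lambda>_. cgauss))"
    unfolding IJ(1) by (subst PG.product_nn_integral_insert[OF IJ(3,2)]) (simp_all flip: IJ(1))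
  also have "\<dots> = (\<integral>\<^sup>+x. ennreal ((cmod (\<phi> x))\<^sup>2) \<partial>PiM I (\<lambda>_. cgauss)) + 1"
    by (simp add: nn_integral_add P.emeasure_space_1)
  finally show ?thesis .
qed

text \<open>The normalising constant of an autoregressive Gaussian. Each centre depends on earlier
  rows only, so the last row integrates to \<open>W K ^ m\<close> whatever its centre is, and
  induction removes the rows one by one.\<close>

lemma nn_integral_sequential_gaussian:
  fixes \<mu> :: "cmat \<Rightarrow> nat \<times> nat \<Rightarrow> complex"
  assumes W: "\<And>k. 0 < W k"
    and dep: "\<And>k j t t'. (\<And>k' j. k' < k \<Longrightarrow> j < m \<Longrightarrow> t (k', j) = t' (k', j)) \<Longrightarrow> \<mu> t (k, j) = \<mu> t' (k, j)"
    and meas: "\<And>k j K. k < K \<Longrightarrow> j < m \<Longrightarrow> (\<lambda>t. \<mu> t (k, j)) \<in> borel_measurable (PiM ({..<K} \<times> {..<m}) (\<lambda>_. borel))"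
  shows "(\<integral>\<^sup>+t. ennreal (exp (- (\<Sum>p\<in>{..<K} \<times> {..<m}. (cmod (t p - \<mu> t p))\<^sup>2 / W (fst p)))) \<partial>PiM ({..<K} \<times> {..<m}) (\<lambda>_. lscale))
     = ennreal (\<Prod>k<K. W k ^ m)"
proof (induction K)
  case 0
  show ?case by (simp add: PiM_empty nn_integral_count_space_finite)
next
  case (Suc K)
  let ?I = "{..<K} \<times> {..<m}" and ?J = "{K} \<times> {..<m}"
  have U: "{..<Suc K} \<times> {..<m} = ?I \<union> ?J" by auto
  have D: "?I \<inter> ?J = {}" "finite ?I" "finite ?J" by auto
  let ?f = "\<lambda>t. ennreal (exp (- (\<Sum>p\<in>?I \<union> ?J. (cmod (t p - \<mu> t p))\<^sup>2 / W (fst p))))"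
  have "(\<lambda>t. t p - \<mu> t p) \<in> borel_measurable (PiM (?I \<union> ?J) (\<lambda>_. borel))" if "p \<in> ?I \<union> ?J" for p
    using that meas[of "fst p" "Suc K" "snd p"] unfolding U by (intro borel_measurable_diff measurable_component_singleton) auto
  then have fm: "?f \<in> borel_measurable (PiM (?I \<union> ?J) (\<lambda>_. lscale))"
    unfolding measurable_cong_sets[OF sets_PiM_lscale refl]
    by (intro measurable_compose[OF _ measurable_ennreal] measurable_compose[OF _ borel_measurable_exp] borel_measurable_uminus
        borel_measurable_sum borel_measurable_divide borel_measurable_power measurable_compose[OF _ borel_measurable_norm] borel_measurable_const)
  have "(\<integral>\<^sup>+t. ?f t \<partial>PiM (?I \<union> ?J) (\<lambda>_. lscale))
      = (\<integral>\<^sup>+x. (\<integral>\<^sup>+y. ?f (merge ?I ?J (x, y)) \<partial>PiM ?J (\<lambda>_. lscale)) \<partial>PiM ?I (\<lambda>_. lscale))"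
    by (rule PL.product_nn_integral_fold[OF D fm])
  also have "\<dots> = (\<integral>\<^sup>+x. ennreal (exp (- (\<Sum>p\<in>?I. (cmod (x p - \<mu> x p))\<^sup>2 / W (fst p)))) * ennreal (W K ^ m) \<partial>PiM ?I (\<lambda>_. lscale))"
  proof (intro nn_integral_cong)
    fix x
    have eq: "?f (merge ?I ?J (x, y)) = ennreal (exp (- (\<Sum>p\<in>?I. (cmod (x p - \<mu> x p))\<^sup>2 / W (fst p))))
        * ennreal (exp (- (\<Sum>p\<in>?J. (cmod (y p - \<mu> x p))\<^sup>2 / W K)))" for y
    proof -
      have 1: "\<mu> (merge ?I ?J (x, y)) p = \<mu> x p" if "p \<in> ?I \<union> ?J" for p
        using dep[of "fst p" "merge ?I ?J (x, y)" x "snd p"] that by (auto simp: merge_def)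
      have 2: "(\<Sum>p\<in>?I. (cmod (merge ?I ?J (x, y) p - \<mu> (merge ?I ?J (x, y)) p))\<^sup>2 / W (fst p)) = (\<Sum>p\<in>?I. (cmod (x p - \<mu> x p))\<^sup>2 / W (fst p))"
        by (intro sum.cong) (auto simp: 1, auto simp: merge_def)
      have 3: "(\<Sum>p\<in>?J. (cmod (merge ?I ?J (x, y) p - \<mu> (merge ?I ?J (x, y)) p))\<^sup>2 / W (fst p)) = (\<Sum>p\<in>?J. (cmod (y p - \<mu> x p))\<^sup>2 / W K)"
        by (intro sum.cong) (auto simp: 1, auto simp: merge_def)
      show ?thesis
        by (subst sum.union_disjoint[OF D(2,3,1)]) (simp only: 2 3 minus_add_distrib exp_add ennreal_mult exp_ge_zero)
    qed
    have m: "(\<lambda>y. ennreal (exp (- (\<Sum>p\<in>?J. (cmod (y p - \<mu> x p))\<^sup>2 / W K)))) \<in> borel_measurable (PiM ?J (\<lambda>_. lscale))"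
      by measurable
    show "(\<integral>\<^sup>+y. ?f (merge ?I ?J (x, y)) \<partial>PiM ?J (\<lambda>_. lscale))
       = ennreal (exp (- (\<Sum>p\<in>?I. (cmod (x p - \<mu> x p))\<^sup>2 / W (fst p)))) * ennreal (W K ^ m)"
      unfolding eq using nn_integral_PiM_lscale_gaussian[of ?J "\<lambda>_. W K" "\<mu> x"] W
      by (subst nn_integral_cmult[OF m]) (simp add: card_cartesian_product)
  qed
  also have "\<dots> = ennreal (\<Prod>k<K. W k ^ m) * ennreal (W K ^ m)"
  proof (subst nn_integral_multc)
    have "(\<lambda>t. t p - \<mu> t p) \<in> borel_measurable (PiM ?I (\<lambda>_. borel))" if "p \<in> ?I" for p
      using that meas[of "fst p" "K" "snd p"] by (intro borel_measurable_diff measurable_component_singleton) auto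
    then show "(\<lambda>x. ennreal (exp (- (\<Sum>p\<in>?I. (cmod (x p - \<mu> x p))\<^sup>2 / W (fst p))))) \<in> borel_measurable (PiM ?I (\<lambda>_. lscale))"
      unfolding measurable_cong_sets[OF sets_PiM_lscale refl]
      by (intro measurable_compose[OF _ measurable_ennreal] measurable_compose[OF _ borel_measurable_exp] borel_measurable_uminus
        borel_measurable_sum borel_measurable_divide borel_measurable_power measurable_compose[OF _ borel_measurable_norm] borel_measurable_const)
  qed (simp only: Suc.IH)
  also have "\<dots> = ennreal (\<Prod>k<Suc K. W k ^ m)"
    using W by (subst ennreal_mult[symmetric]) (auto intro!: prod_nonneg zero_le_power less_imp_le[OF W])
  finally show ?case unfolding U .
qed

definition row :: "nat \<Rightarrow> nat \<Rightarrow> cmat \<Rightarrow> cvec" where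
  "row m k t = (\<lambda>j\<in>{..<m}. t (k, j))"

lemma measurable_row: "k < K \<Longrightarrow> row m k \<in> measurable (PiM ({..<K} \<times> {..<m}) (\<lambda>_. borel)) (PiM {..<m} (\<lambda>_. borel))"
  unfolding row_def by (intro measurable_restrict measurable_component_singleton) auto

lemma distr_row:
  assumes "k < K"
  shows "distr (iid_cmat K m) (iid_cvec m) (row m k) = iid_cvec m"
  using distr_PiM_reindex[of "{..<K} \<times> {..<m}" "\<lambda>_. cgauss" "\<lambda>j. (k, j)" "{..<m}"] assms prob_space_cgauss
  unfolding iid_cvec_def iid_cmat_def row_def by (auto simp: inj_on_def)

lemma nn_integral_row:
  assumes "k < K" "F \<in> borel_measurable (PiM {..<m} (\<lambda>_. borel))"
  shows "(\<integral>\<^sup>+Z. F (row m k Z) \<partial>iid_cmat K m) = (\<integral>\<^sup>+Z. F Z \<partial>iid_cvec m)"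
proof -
  have [measurable]: "row m k \<in> measurable (iid_cmat K m) (iid_cvec m)"
    using measurable_row[OF assms(1), of m] by measurable
  have "(\<integral>\<^sup>+Z. F Z \<partial>iid_cvec m) = (\<integral>\<^sup>+Z. F Z \<partial>distr (iid_cmat K m) (iid_cvec m) (row m k))"
    by (simp add: distr_row[OF assms(1)])
  also have "\<dots> = (\<integral>\<^sup>+Z. F (row m k Z) \<partial>iid_cmat K m)"
    using assms(2) by (intro nn_integral_distr) (auto simp: measurable_cong_sets[OF sets_iid_cvec refl])
  finally show ?thesis by simp
qed

text \<open>The rate inequality behind the converse. It is the nonnegativity of the relative entropy of the
  true law of source, channel output and \<open>K + 1\<close> conditionally independent side informations with
  respect to an explicit Gaussian chain: \<open>QY\<close> for the channel output, then each side information
  centred at the estimate formed at the previous quality level, and finally the source centred at the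
  last estimate.\<close>
lemma gibbs_ladder:
  fixes gh :: "nat \<Rightarrow> cmat \<Rightarrow> cvec \<Rightarrow> cvec" and a :: "cvec \<Rightarrow> cmat" and QY :: "cmat \<Rightarrow> real"
  assumes a: "\<And>p. p \<in> {..<n} \<times> {..<Mr} \<Longrightarrow> (\<lambda>S. a S p) \<in> borel_measurable (PiM {..<m} (\<lambda>_. borel))"
    and gh: "\<And>k j. k \<le> K \<Longrightarrow> j < m \<Longrightarrow> (\<lambda>(y, t). gh k y t j) \<in> borel_measurable (PiM ({..<n} \<times> {..<Mr}) (\<lambda>_. borel) \<Otimes>\<^sub>M PiM {..<m} (\<lambda>_. borel))"
    and QY[measurable]: "QY \<in> borel_measurable (PiM ({..<n} \<times> {..<Mr}) (\<lambda>_. borel))" and QY0: "\<And>y. 0 \<le> QY y"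
    and QYi: "(\<integral>\<^sup>+y. ennreal (exp (- QY y)) \<partial>PiM ({..<n} \<times> {..<Mr}) (\<lambda>_. lscale)) \<le> ennreal (exp LY)" and LY: "0 \<le> LY"
    and QYe: "(\<integral>\<^sup>+S. \<integral>\<^sup>+N. ennreal (QY (\<lambda>p\<in>{..<n} \<times> {..<Mr}. a S p + N p)) \<partial>iid_cmat n Mr \<partial>iid_cvec m) \<le> ennreal (real (n * Mr))"
    and v: "\<And>k. k \<le> K \<Longrightarrow> 0 \<le> v k" "0 < v K" "v K \<le> 1"
    and e: "\<And>k. k \<le> K \<Longrightarrow> (\<Sum>j<m. \<integral>\<^sup>+S. \<integral>\<^sup>+N. \<integral>\<^sup>+Z. ennreal ((cmod (S j - gh k (\<lambda>p\<in>{..<n} \<times> {..<Mr}. a S p + N p) (\<lambda>j\<in>{..<m}. c k * S j + Z j) j))\<^sup>2)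
        \<partial>iid_cvec m \<partial>iid_cmat n Mr \<partial>iid_cvec m) \<le> ennreal (real m * v k)"
  shows "real m * ln (1 / v K) \<le> LY + real m * (ln (1 + (cmod (c 0))\<^sup>2) + (\<Sum>k<K. ln (1 + (cmod (c (Suc k)))\<^sup>2 * v k)))"
proof -
  let ?IY = "{..<n} \<times> {..<Mr}" and ?IT = "{..<Suc K} \<times> {..<m}" and ?IS = "{..<m}"
  let ?BS = "PiM ?IS (\<lambda>_. borel :: complex measure)" and ?BY = "PiM ?IY (\<lambda>_. borel :: complex measure)" and ?BT = "PiM ?IT (\<lambda>_. borel :: complex measure)"
  let ?GS = "PiM ?IS (\<lambda>_. cgauss)" and ?GY = "PiM ?IY (\<lambda>_. cgauss)" and ?GT = "PiM ?IT (\<lambda>_. cgauss)"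
  let ?LS = "PiM ?IS (\<lambda>_. lscale)" and ?LY = "PiM ?IY (\<lambda>_. lscale)" and ?LT = "PiM ?IT (\<lambda>_. lscale)"
  \<comment> \<open>The mean square of what a side information still contains after its prediction
    is subtracted: \<open>c (Suc k)\<close> times an estimation error of mean square at most
    \<open>v k\<close>, plus unit noise. The inner \<open>if\<close> only keeps \<open>W\<close>
    positive at all indices.\<close>
  define W where "W k = (case k of 0 \<Rightarrow> 1 + (cmod (c 0))\<^sup>2 | Suc k \<Rightarrow> 1 + (cmod (c (Suc k)))\<^sup>2 * (if k \<le> K then v k else 0))" for k
  \<comment> \<open>The prediction of row \<open>Suc k\<close> uses the estimate formed from row
    \<open>k\<close> alone, not from all earlier rows. This makes the distortion at quality
    \<open>k\<close>, rather than that of a joint estimator, appear in the inequality.\<close>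
  define \<mu> where "\<mu> y t p = (case fst p of 0 \<Rightarrow> 0 | Suc k \<Rightarrow> c (Suc k) * gh k y (row m k t) (snd p))" for y and t :: cmat and p :: "nat \<times> nat"
  have W1: "1 \<le> W k" for k using v(1) by (auto simp: W_def split: nat.splits)
  then have W0: "0 < W k" for k by (smt (verit))
  define QT where "QT y t = (\<Sum>p\<in>?IT. (cmod (t p - \<mu> y t p))\<^sup>2 / W (fst p))" for y t
  define QS where "QS s y t = (\<Sum>j\<in>?IS. (cmod (s j - gh K y (row m K t) j))\<^sup>2 / v K)" for s y t
  define Q where "Q s y t = QY y + QT y t + QS s y t" for s y t
  define Yf where "Yf S N = (\<lambda>p\<in>?IY. a S p + N p)" for S N
  define Tf where "Tf S Z = (\<lambda>p\<in>?IT. c (fst p) * S (snd p) + Z p)" for S :: cvec and Z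
  \<comment> \<open>\<open>exp (- P)\<close> is the density of the true law with respect to the flat
    measure, \<open>exp (- Q)\<close> the density of the chain before normalisation, so
    \<open>P - Q\<close> is the logarithm of their ratio.\<close>
  define P where "P S N Z = (\<Sum>j\<in>?IS. (cmod (S j))\<^sup>2) + (\<Sum>p\<in>?IY. (cmod (N p))\<^sup>2) + (\<Sum>p\<in>?IT. (cmod (Z p))\<^sup>2)" for S N Z :: "_ \<Rightarrow> complex"
  interpret GS: prob_space ?GS by (intro prob_space_PiM prob_space_cgauss)
  interpret GY: prob_space ?GY by (intro prob_space_PiM prob_space_cgauss)
  interpret GT: prob_space ?GT by (intro prob_space_PiM prob_space_cgauss)
  interpret LS: sigma_finite_measure ?LS by (intro PL.sigma_finite) auto
  interpret LY: sigma_finite_measure ?LY by (intro PL.sigma_finite) auto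
  interpret LT: sigma_finite_measure ?LT by (intro PL.sigma_finite) auto
  have row_meas[measurable]: "row m k \<in> measurable ?BT ?BS" if "k \<le> K" for k
    using that by (intro measurable_row) auto
  have gh_comp: "(\<lambda>x. gh k (f x) (g x) j) \<in> borel_measurable M"
    if "f \<in> measurable M ?BY" "g \<in> measurable M ?BS" "k \<le> K" "j < m" for k j f g and M :: "'x measure"
    using measurable_compose[OF measurable_Pair[OF that(1,2)] gh[OF that(3,4)]] by simp
  have \<mu>_meas: "(\<lambda>x. \<mu> (f x) (g x) p) \<in> borel_measurable M"
    if f: "f \<in> measurable M ?BY" and g: "g \<in> measurable M ?BT" and p: "p \<in> ?IT" for f g p and M :: "'x measure"
  proof (cases "fst p")
    case (Suc k)
    then show ?thesis using p gh_comp[OF f measurable_compose[OF g row_meas], of k k "snd p"]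
      by (auto simp: \<mu>_def)
  qed (simp add: \<mu>_def)
  have comp[measurable]: "(\<lambda>x. g x p) \<in> borel_measurable M" if "g \<in> measurable M (PiM I (\<lambda>_. borel))" "p \<in> I" for g p I and M :: "'x measure"
    using that by (intro measurable_compose[OF that(1) measurable_component_singleton])
  have QT_meas: "(\<lambda>x. QT (f x) (g x)) \<in> borel_measurable M"
    if f: "f \<in> measurable M ?BY" and g: "g \<in> measurable M ?BT" for f g and M :: "'x measure"
    unfolding QT_def using \<mu>_meas[OF f g] comp[OF g]
    by (intro borel_measurable_sum borel_measurable_divide borel_measurable_power measurable_compose[OF _ borel_measurable_norm] borel_measurable_diff borel_measurable_const)
  have QS_meas: "(\<lambda>x. QS (h x) (f x) (g x)) \<in> borel_measurable M"
    if h: "h \<in> measurable M ?BS" and f: "f \<in> measurable M ?BY" and g: "g \<in> measurable M ?BT" for f g h and M :: "'x measure"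
    unfolding QS_def using gh_comp[OF f measurable_compose[OF g row_meas], of K K] comp[OF h]
    by (intro borel_measurable_sum borel_measurable_divide borel_measurable_power measurable_compose[OF _ borel_measurable_norm] borel_measurable_diff borel_measurable_const) auto
  have Q_meas: "(\<lambda>x. Q (h x) (f x) (g x)) \<in> borel_measurable M"
    if h: "h \<in> measurable M ?BS" and f: "f \<in> measurable M ?BY" and g: "g \<in> measurable M ?BT" for f g h and M :: "'x measure"
    unfolding Q_def using QT_meas[OF f g] QS_meas[OF h f g] measurable_compose[OF f QY]
    by (intro borel_measurable_add)
  have Yf_meas: "(\<lambda>x. Yf (h x) (f x)) \<in> measurable M ?BY"
    if h: "h \<in> measurable M ?BS" and f: "f \<in> measurable M ?BY" for f h and M :: "'x measure"
    unfolding Yf_def using measurable_compose[OF h a] comp[OF f]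
    by (intro measurable_restrict borel_measurable_add)
  have Tf_meas: "(\<lambda>x. Tf (h x) (g x)) \<in> measurable M ?BT"
    if h: "h \<in> measurable M ?BS" and g: "g \<in> measurable M ?BT" for g h and M :: "'x measure"
    unfolding Tf_def using comp[OF h] comp[OF g]
    by (intro measurable_restrict borel_measurable_add borel_measurable_times borel_measurable_const) auto
  have P_meas: "(\<lambda>x. P (h x) (f x) (g x)) \<in> borel_measurable M"
    if h: "h \<in> measurable M ?BS" and f: "f \<in> measurable M ?BY" and g: "g \<in> measurable M ?BT" for f g h and M :: "'x measure"
    unfolding P_def using comp[OF h] comp[OF f] comp[OF g]
    by (intro borel_measurable_sum borel_measurable_add borel_measurable_power measurable_compose[OF _ borel_measurable_norm])
  have sets: "sets ?GS = sets ?BS" "sets ?GY = sets ?BY" "sets ?GT = sets ?BT" "sets ?LS = sets ?BS" "sets ?LY = sets ?BY" "sets ?LT = sets ?BT"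
    by (simp_all add: sets_PiM_cgauss sets_PiM_lscale)
  have idm: "(\<lambda>x. x) \<in> measurable M B" if "sets M = sets B" for M B :: "'x measure"
    using that by (simp add: measurable_ident_sets)
  have fstm: "fst \<in> measurable (L \<Otimes>\<^sub>M M) B" if "sets L = sets B" for L B :: "'x measure" and M :: "'y measure"
    using measurable_compose[OF measurable_fst idm[OF that]] .
  have sndm: "snd \<in> measurable (M \<Otimes>\<^sub>M L) B" if "sets L = sets B" for L B :: "'x measure" and M :: "'y measure"
    using measurable_compose[OF measurable_snd idm[OF that]] .
  have expQ_meas: "(\<lambda>x. ennreal (exp (- Q (h x) (f x) (g x)))) \<in> borel_measurable M"
    if h: "h \<in> measurable M ?BS" and f: "f \<in> measurable M ?BY" and g: "g \<in> measurable M ?BT" for f g h and M :: "'x measure"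
    using Q_meas[OF that] by (intro measurable_compose[OF _ measurable_ennreal] measurable_compose[OF _ borel_measurable_exp] borel_measurable_uminus)

  \<comment> \<open>Change of variables from the noises to the observations.\<close>
  have Eexp: "(\<integral>\<^sup>+S. \<integral>\<^sup>+N. \<integral>\<^sup>+Z. ennreal (exp (P S N Z - Q S (Yf S N) (Tf S Z))) \<partial>?GT \<partial>?GY \<partial>?GS)
     \<le> ennreal (exp LY * (\<Prod>k<Suc K. W k ^ m) * v K ^ m)"
  proof -
    have in1: "(\<integral>\<^sup>+Z. ennreal (exp (P S N Z - Q S (Yf S N) (Tf S Z))) \<partial>?GT)
       = ennreal (exp ((\<Sum>j\<in>?IS. (cmod (S j))\<^sup>2) + (\<Sum>p\<in>?IY. (cmod (N p))\<^sup>2))) * (\<integral>\<^sup>+t. ennreal (exp (- Q S (Yf S N) t)) \<partial>?LT)"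
      if S: "S \<in> space ?BS" and N: "N \<in> space ?BY" for S N
    proof -
      have Y: "Yf S N \<in> space ?BY" by (auto simp: Yf_def space_PiM)
      have m1: "(\<lambda>t. ennreal (exp (- Q S (Yf S N) t))) \<in> borel_measurable ?LT"
        using S Y by (intro measurable_compose[OF _ measurable_ennreal] measurable_compose[OF _ borel_measurable_exp] borel_measurable_uminus Q_meas) (auto intro!: idm simp: sets)
      have m2: "(\<lambda>Z. ennreal (exp (- Q S (Yf S N) (Tf S Z))) * ennreal (exp (\<Sum>p\<in>?IT. (cmod (Z p))\<^sup>2))) \<in> borel_measurable ?GT"
        using S Y by (intro borel_measurable_times_ennreal measurable_compose[OF _ measurable_ennreal] measurable_compose[OF _ borel_measurable_exp] borel_measurable_uminus Q_meas Tf_meas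
           borel_measurable_sum borel_measurable_power measurable_compose[OF _ borel_measurable_norm] comp[OF idm[of ?GT ?BT]]) (auto intro!: idm simp: sets)
      have "(\<integral>\<^sup>+Z. ennreal (exp (P S N Z - Q S (Yf S N) (Tf S Z))) \<partial>?GT)
        = (\<integral>\<^sup>+Z. ennreal (exp ((\<Sum>j\<in>?IS. (cmod (S j))\<^sup>2) + (\<Sum>p\<in>?IY. (cmod (N p))\<^sup>2))) *
            (ennreal (exp (- Q S (Yf S N) (Tf S Z))) * ennreal (exp (\<Sum>p\<in>?IT. (cmod (Z p))\<^sup>2))) \<partial>?GT)"
        by (intro nn_integral_cong) (simp add: P_def algebra_simps flip: ennreal_mult exp_add)
      also have "\<dots> = ennreal (exp ((\<Sum>j\<in>?IS. (cmod (S j))\<^sup>2) + (\<Sum>p\<in>?IY. (cmod (N p))\<^sup>2))) *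
            (\<integral>\<^sup>+Z. ennreal (exp (- Q S (Yf S N) (Tf S Z))) * ennreal (exp (\<Sum>p\<in>?IT. (cmod (Z p))\<^sup>2)) \<partial>?GT)"
        by (rule nn_integral_cmult[OF m2])
      also have "(\<integral>\<^sup>+Z. ennreal (exp (- Q S (Yf S N) (Tf S Z))) * ennreal (exp (\<Sum>p\<in>?IT. (cmod (Z p))\<^sup>2)) \<partial>?GT)
          = (\<integral>\<^sup>+t. ennreal (exp (- Q S (Yf S N) t)) \<partial>?LT)"
        unfolding Tf_def by (rule nn_integral_PiM_cgauss_change_of_measure[OF _ m1]) auto
      finally show ?thesis .
    qed
    define F where "F S y = (\<integral>\<^sup>+t. ennreal (exp (- Q S y t)) \<partial>?LT)" for S y
    have F_meas: "(\<lambda>x. F (h x) (f x)) \<in> borel_measurable M"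
      if h: "h \<in> measurable M ?BS" and f: "f \<in> measurable M ?BY" for f h and M :: "'x measure"
      unfolding F_def
      unfolding case_prod_beta'
      by (rule LT.borel_measurable_nn_integral, unfold case_prod_beta')
         (intro expQ_meas measurable_compose[OF measurable_fst h] measurable_compose[OF measurable_fst f] sndm sets)
    have in2: "(\<integral>\<^sup>+N. \<integral>\<^sup>+Z. ennreal (exp (P S N Z - Q S (Yf S N) (Tf S Z))) \<partial>?GT \<partial>?GY)
       = ennreal (exp (\<Sum>j\<in>?IS. (cmod (S j))\<^sup>2)) * (\<integral>\<^sup>+y. F S y \<partial>?LY)" if S: "S \<in> space ?BS" for S
    proof -
      have m1: "F S \<in> borel_measurable ?LY"
        using S F_meas[of "\<lambda>_. S" ?LY "\<lambda>x. x"] by (auto intro!: idm simp: sets)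
      have m2: "(\<lambda>N. F S (Yf S N) * ennreal (exp (\<Sum>p\<in>?IY. (cmod (N p))\<^sup>2))) \<in> borel_measurable ?GY"
        using S by (intro borel_measurable_times_ennreal measurable_compose[OF _ measurable_ennreal] measurable_compose[OF _ borel_measurable_exp] F_meas Yf_meas
           borel_measurable_sum borel_measurable_power measurable_compose[OF _ borel_measurable_norm] comp[OF idm[of ?GY ?BY]]) (auto intro!: idm simp: sets)
      have "(\<integral>\<^sup>+N. \<integral>\<^sup>+Z. ennreal (exp (P S N Z - Q S (Yf S N) (Tf S Z))) \<partial>?GT \<partial>?GY)
        = (\<integral>\<^sup>+N. ennreal (exp (\<Sum>j\<in>?IS. (cmod (S j))\<^sup>2)) * (F S (Yf S N) * ennreal (exp (\<Sum>p\<in>?IY. (cmod (N p))\<^sup>2))) \<partial>?GY)"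
        using S by (intro nn_integral_cong)
          (auto simp: in1 F_def exp_add ennreal_mult ac_simps space_PiM)
      also have "\<dots> = ennreal (exp (\<Sum>j\<in>?IS. (cmod (S j))\<^sup>2)) * (\<integral>\<^sup>+N. F S (Yf S N) * ennreal (exp (\<Sum>p\<in>?IY. (cmod (N p))\<^sup>2)) \<partial>?GY)"
        by (rule nn_integral_cmult[OF m2])
      also have "(\<integral>\<^sup>+N. F S (Yf S N) * ennreal (exp (\<Sum>p\<in>?IY. (cmod (N p))\<^sup>2)) \<partial>?GY) = (\<integral>\<^sup>+y. F S y \<partial>?LY)"
        unfolding Yf_def by (rule nn_integral_PiM_cgauss_change_of_measure[OF _ m1]) auto
      finally show ?thesis .
    qed
    have m3: "(\<lambda>S. \<integral>\<^sup>+y. F S y \<partial>?LY) \<in> borel_measurable ?LS"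
      by (rule LY.borel_measurable_nn_integral, unfold case_prod_beta') (intro F_meas fstm sndm sets)
    have "(\<integral>\<^sup>+S. \<integral>\<^sup>+N. \<integral>\<^sup>+Z. ennreal (exp (P S N Z - Q S (Yf S N) (Tf S Z))) \<partial>?GT \<partial>?GY \<partial>?GS)
       = (\<integral>\<^sup>+S. (\<integral>\<^sup>+y. F (\<lambda>j\<in>?IS. 0 + S j) y \<partial>?LY) * ennreal (exp (\<Sum>j\<in>?IS. (cmod (S j))\<^sup>2)) \<partial>?GS)"
    proof (intro nn_integral_cong)
      fix S assume S: "S \<in> space ?GS"
      then have "(\<lambda>j\<in>?IS. 0 + S j) = S" by (auto simp: space_PiM PiE_def extensional_def)
      then show "(\<integral>\<^sup>+N. \<integral>\<^sup>+Z. ennreal (exp (P S N Z - Q S (Yf S N) (Tf S Z))) \<partial>?GT \<partial>?GY)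
        = (\<integral>\<^sup>+y. F (\<lambda>j\<in>?IS. 0 + S j) y \<partial>?LY) * ennreal (exp (\<Sum>j\<in>?IS. (cmod (S j))\<^sup>2))"
        using in2[of S] S by (simp add: space_PiM mult.commute)
    qed
    also have "\<dots> = (\<integral>\<^sup>+S. \<integral>\<^sup>+y. F S y \<partial>?LY \<partial>?LS)"
      by (rule nn_integral_PiM_cgauss_change_of_measure[OF _ m3]) auto
    \<comment> \<open>The flat integrals are now taken in the order opposite to the causal one:
      given output and side informations the source is Gaussian around the last estimate, then the
      side informations form an autoregressive chain, and the output comes last.\<close>
    also have "\<dots> = (\<integral>\<^sup>+y. \<integral>\<^sup>+S. F S y \<partial>?LS \<partial>?LY)"
      by (rule pair_sigma_finite.Fubini'[OF pair_sigma_finite.intro[OF LS.sigma_finite_measure_axioms LY.sigma_finite_measure_axioms], symmetric],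
          unfold case_prod_beta') (intro F_meas fstm sndm sets)
    also have "\<dots> \<le> (\<integral>\<^sup>+y. ennreal ((\<Prod>k<Suc K. W k ^ m) * v K ^ m) * ennreal (exp (- QY y)) \<partial>?LY)"
    proof (intro nn_integral_mono)
      fix y assume "y \<in> space ?LY"
      then have y: "y \<in> space ?BY" by (simp add: space_PiM)
      have "(\<integral>\<^sup>+S. F S y \<partial>?LS) = (\<integral>\<^sup>+t. \<integral>\<^sup>+S. ennreal (exp (- Q S y t)) \<partial>?LS \<partial>?LT)"
        unfolding F_def
        by (rule pair_sigma_finite.Fubini'[OF pair_sigma_finite.intro[OF LS.sigma_finite_measure_axioms LT.sigma_finite_measure_axioms], symmetric],
          unfold case_prod_beta') (intro expQ_meas fstm sndm sets measurable_const y)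
      also have "\<dots> = (\<integral>\<^sup>+t. ennreal (v K ^ m * exp (- QY y)) * ennreal (exp (- QT y t)) \<partial>?LT)"
      proof (intro nn_integral_cong)
        fix t assume t: "t \<in> space ?LT"
        have "(\<integral>\<^sup>+S. ennreal (exp (- Q S y t)) \<partial>?LS) = (\<integral>\<^sup>+S. ennreal (exp (- QY y) * exp (- QT y t)) * ennreal (exp (- QS S y t)) \<partial>?LS)"
          by (intro nn_integral_cong) (simp add: Q_def flip: ennreal_mult exp_add)
        also have "\<dots> = ennreal (exp (- QY y) * exp (- QT y t)) * (\<integral>\<^sup>+S. ennreal (exp (- QS S y t)) \<partial>?LS)"
          using y t by (intro nn_integral_cmult measurable_compose[OF _ measurable_ennreal] measurable_compose[OF _ borel_measurable_exp] borel_measurable_uminus QS_meas) (auto intro!: idm simp: sets space_PiM)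
        also have "(\<integral>\<^sup>+S. ennreal (exp (- QS S y t)) \<partial>?LS) = ennreal (v K ^ m)"
          unfolding QS_def using v nn_integral_PiM_lscale_gaussian[of ?IS "\<lambda>_. v K" "gh K y (row m K t)"] by simp
        finally show "(\<integral>\<^sup>+S. ennreal (exp (- Q S y t)) \<partial>?LS) = ennreal (v K ^ m * exp (- QY y)) * ennreal (exp (- QT y t))"
          using v by (simp add: ac_simps flip: ennreal_mult)
      qed
      also have "\<dots> = ennreal (v K ^ m * exp (- QY y)) * (\<integral>\<^sup>+t. ennreal (exp (- QT y t)) \<partial>?LT)"
        using y by (intro nn_integral_cmult measurable_compose[OF _ measurable_ennreal] measurable_compose[OF _ borel_measurable_exp] borel_measurable_uminus QT_meas) (auto intro!: idm simp: sets)
      also have "(\<integral>\<^sup>+t. ennreal (exp (- QT y t)) \<partial>?LT) = ennreal (\<Prod>k<Suc K. W k ^ m)"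
      proof -
        \<comment> \<open>The lemma on chains speaks of all numbers of rows at once, so the centres
          are cut to 0 outside the rows where the estimates are known to be measurable.\<close>
        define \<mu>' where "\<mu>' t p = (if fst p \<le> K \<and> snd p < m then \<mu> y t p else 0)" for t p
        have "(\<integral>\<^sup>+t. ennreal (exp (- QT y t)) \<partial>?LT) = (\<integral>\<^sup>+t. ennreal (exp (- (\<Sum>p\<in>?IT. (cmod (t p - \<mu>' t p))\<^sup>2 / W (fst p)))) \<partial>?LT)"
          unfolding QT_def by (intro nn_integral_cong arg_cong[where f=ennreal] arg_cong[where f=exp] arg_cong[where f=uminus] sum.cong) (auto simp: \<mu>'_def)
        also have "\<dots> = ennreal (\<Prod>k<Suc K. W k ^ m)"
        proof (rule nn_integral_sequential_gaussian[OF W0])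
          fix k j :: nat and t t' :: cmat
          assume eq: "\<And>k' j. k' < k \<Longrightarrow> j < m \<Longrightarrow> t (k', j) = t' (k', j)"
          then have "row m k' t = row m k' t'" if "k' < k" for k'
            using that by (auto simp: row_def)
          then show "\<mu>' t (k, j) = \<mu>' t' (k, j)" by (auto simp: \<mu>'_def \<mu>_def split: nat.splits)
        next
          fix k j K' :: nat assume kj: "k < K'" "j < m"
          show "(\<lambda>t. \<mu>' t (k, j)) \<in> borel_measurable (PiM ({..<K'} \<times> {..<m}) (\<lambda>_. borel))"
          proof (cases "k = 0 \<or> K < k")
            case True
            then show ?thesis using kj by (auto simp: \<mu>'_def \<mu>_def)
          next
            case False
            then obtain k0 where k0: "k = Suc k0" "k \<le> K" by (cases k) auto
            show ?thesis
              using k0 kj y gh_comp[of "\<lambda>_. y" "PiM ({..<K'} \<times> {..<m}) (\<lambda>_. borel)" "row m k0" k0 j] measurable_row[of k0 K' m]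
              by (auto simp: \<mu>'_def \<mu>_def)
          qed
        qed
        finally show ?thesis .
      qed
      also have "ennreal (v K ^ m * exp (- QY y)) * ennreal (\<Prod>k<Suc K. W k ^ m) = ennreal ((\<Prod>k<Suc K. W k ^ m) * v K ^ m) * ennreal (exp (- QY y))"
        using v W0 by (simp add: ac_simps prod_nonneg less_imp_le del: prod.lessThan_Suc flip: ennreal_mult)
      finally show "(\<integral>\<^sup>+S. F S y \<partial>?LS) \<le> ennreal ((\<Prod>k<Suc K. W k ^ m) * v K ^ m) * ennreal (exp (- QY y))" by simp
    qed
    also have "\<dots> = ennreal ((\<Prod>k<Suc K. W k ^ m) * v K ^ m) * (\<integral>\<^sup>+y. ennreal (exp (- QY y)) \<partial>?LY)"
      by (intro nn_integral_cmult measurable_compose[OF _ measurable_ennreal] measurable_compose[OF _ borel_measurable_exp] borel_measurable_uminus)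
         (auto simp: measurable_cong_sets[OF sets(5) refl])
    also have "\<dots> \<le> ennreal ((\<Prod>k<Suc K. W k ^ m) * v K ^ m) * ennreal (exp LY)"
      by (intro mult_left_mono QYi) auto
    also have "\<dots> = ennreal (exp LY * (\<Prod>k<Suc K. W k ^ m) * v K ^ m)"
      using v W0 by (simp add: ac_simps prod_nonneg less_imp_le del: prod.lessThan_Suc flip: ennreal_mult)
    finally show ?thesis .
  qed
  define \<Omega> where "\<Omega> = ?GS \<Otimes>\<^sub>M (?GY \<Otimes>\<^sub>M ?GT)"
  interpret GYT: prob_space "?GY \<Otimes>\<^sub>M ?GT" by (intro prob_space_pair GY.prob_space_axioms GT.prob_space_axioms)
  interpret \<Omega>: prob_space \<Omega> unfolding \<Omega>_def by (intro prob_space_pair GS.prob_space_axioms GYT.prob_space_axioms)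
  let ?s = "\<lambda>\<omega>. fst \<omega>" and ?n = "\<lambda>\<omega>. fst (snd \<omega>)" and ?z = "\<lambda>\<omega>. snd (snd \<omega>)"
  let ?y = "\<lambda>\<omega>. Yf (?s \<omega>) (?n \<omega>)" and ?t = "\<lambda>\<omega>. Tf (?s \<omega>) (?z \<omega>)"
  have sM: "?s \<in> measurable \<Omega> ?BS" unfolding \<Omega>_def by (intro fstm sets)
  have nM: "?n \<in> measurable \<Omega> ?BY" unfolding \<Omega>_def by (intro measurable_compose[OF measurable_snd] fstm sets)
  have zM: "?z \<in> measurable \<Omega> ?BT" unfolding \<Omega>_def by (intro measurable_compose[OF measurable_snd] sndm sets)
  note yM = Yf_meas[OF sM nM] and tM = Tf_meas[OF sM zM]
  have iter: "(\<integral>\<^sup>+\<omega>. f \<omega> \<partial>\<Omega>) = (\<integral>\<^sup>+S. \<integral>\<^sup>+N. \<integral>\<^sup>+Z. f (S, N, Z) \<partial>?GT \<partial>?GY \<partial>?GS)"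
    if f: "f \<in> borel_measurable \<Omega>" for f
  proof -
    have "(\<integral>\<^sup>+\<omega>. f \<omega> \<partial>\<Omega>) = (\<integral>\<^sup>+S. \<integral>\<^sup>+x. f (S, x) \<partial>(?GY \<Otimes>\<^sub>M ?GT) \<partial>?GS)"
      using f unfolding \<Omega>_def by (rule GYT.nn_integral_fst[symmetric])
    also have "\<dots> = (\<integral>\<^sup>+S. \<integral>\<^sup>+N. \<integral>\<^sup>+Z. f (S, N, Z) \<partial>?GT \<partial>?GY \<partial>?GS)"
      using f unfolding \<Omega>_def
      by (intro nn_integral_cong GT.nn_integral_fst[symmetric] measurable_compose_Pair1) auto
    finally show ?thesis .
  qed
  have cardI: "(\<integral>\<^sup>+x. ennreal (\<Sum>i\<in>I. (cmod (x i))\<^sup>2) \<partial>PiM I (\<lambda>_. cgauss)) = ennreal (real (card I))" if I: "finite I" for I :: "'x set"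
  proof -
    interpret PI: prob_space "PiM I (\<lambda>_. cgauss)" by (intro prob_space_PiM prob_space_cgauss)
    have 1: "(\<integral>\<^sup>+x. ennreal ((cmod (x i))\<^sup>2) \<partial>PiM I (\<lambda>_. cgauss)) = 1" if "i \<in> I" for i
      using nn_integral_PiM_cgauss_square[OF I that, of "\<lambda>_. 0"] by simp
    have m: "(\<lambda>x. ennreal ((cmod (x i))\<^sup>2)) \<in> borel_measurable (PiM I (\<lambda>_. cgauss))" if "i \<in> I" for i
      using comp[OF idm[OF sets_PiM_cgauss] that]
      by (intro measurable_compose[OF _ measurable_ennreal] borel_measurable_power measurable_compose[OF _ borel_measurable_norm])
    have "(\<integral>\<^sup>+x. ennreal (\<Sum>i\<in>I. (cmod (x i))\<^sup>2) \<partial>PiM I (\<lambda>_. cgauss)) = (\<integral>\<^sup>+x. (\<Sum>i\<in>I. ennreal ((cmod (x i))\<^sup>2)) \<partial>PiM I (\<lambda>_. cgauss))"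
      by (intro nn_integral_cong) simp
    also have "\<dots> = ennreal (real (card I))"
      by (subst nn_integral_sum) (auto simp: m 1 ennreal_of_nat_eq_real_of_nat)
    finally show ?thesis .
  qed
  \<comment> \<open>The mean of \<open>P\<close> is the number of complex coordinates, and the means
    of \<open>QY\<close>, \<open>QT\<close> and \<open>QS\<close> are bounded by their shares of the
    same number. The dimensions cancel and only the logarithms of the normalising constants
    survive.\<close>
  have EP: "(\<integral>\<^sup>+\<omega>. ennreal (P (?s \<omega>) (?n \<omega>) (?z \<omega>)) \<partial>\<Omega>) = ennreal (real m + real (n * Mr) + real (Suc K * m))"
  proof -
    have mm: "(\<lambda>x. ennreal (\<Sum>i\<in>I. (cmod (x i))\<^sup>2)) \<in> borel_measurable (PiM I (\<lambda>_. cgauss))" for I :: "'x set"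
      using comp[OF idm[OF sets_PiM_cgauss]]
      by (intro measurable_compose[OF _ measurable_ennreal] borel_measurable_sum borel_measurable_power measurable_compose[OF _ borel_measurable_norm])
    have add: "(\<integral>\<^sup>+x. ennreal (r + (\<Sum>i\<in>I. (cmod (x i))\<^sup>2)) \<partial>PiM I (\<lambda>_. cgauss)) = ennreal (r + real (card I))"
      if "finite I" "0 \<le> r" for I :: "'x set" and r
    proof -
      interpret PI: prob_space "PiM I (\<lambda>_. cgauss)" by (intro prob_space_PiM prob_space_cgauss)
      have "(\<integral>\<^sup>+x. ennreal (r + (\<Sum>i\<in>I. (cmod (x i))\<^sup>2)) \<partial>PiM I (\<lambda>_. cgauss)) = (\<integral>\<^sup>+x. ennreal r + ennreal (\<Sum>i\<in>I. (cmod (x i))\<^sup>2) \<partial>PiM I (\<lambda>_. cgauss))"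
        using that by (intro nn_integral_cong) (simp add: sum_nonneg)
      also have "\<dots> = ennreal r + ennreal (real (card I))"
        by (subst nn_integral_add[OF _ mm]) (simp_all add: cardI[OF that(1)] PI.emeasure_space_1)
      finally show ?thesis using that by simp
    qed
    have "(\<integral>\<^sup>+\<omega>. ennreal (P (?s \<omega>) (?n \<omega>) (?z \<omega>)) \<partial>\<Omega>) = (\<integral>\<^sup>+S. \<integral>\<^sup>+N. \<integral>\<^sup>+Z. ennreal (P S N Z) \<partial>?GT \<partial>?GY \<partial>?GS)"
      unfolding iter[OF measurable_compose[OF P_meas[OF sM nM zM] measurable_ennreal]] by (simp only: fst_conv snd_conv)
    also have "\<dots> = (\<integral>\<^sup>+S. \<integral>\<^sup>+N. ennreal (real (Suc K * m) + (\<Sum>j\<in>?IS. (cmod (S j))\<^sup>2) + (\<Sum>p\<in>?IY. (cmod (N p))\<^sup>2)) \<partial>?GY \<partial>?GS)"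
    proof (intro nn_integral_cong)
      fix S N
      show "(\<integral>\<^sup>+Z. ennreal (P S N Z) \<partial>?GT) = ennreal (real (Suc K * m) + (\<Sum>j\<in>?IS. (cmod (S j))\<^sup>2) + (\<Sum>p\<in>?IY. (cmod (N p))\<^sup>2))"
        unfolding P_def
        by (subst add, simp, simp add: sum_nonneg, rule arg_cong[where f=ennreal], simp add: card_cartesian_product algebra_simps)
    qed
    also have "\<dots> = (\<integral>\<^sup>+S. ennreal (real (Suc K * m) + real (n * Mr) + (\<Sum>j\<in>?IS. (cmod (S j))\<^sup>2)) \<partial>?GS)"
    proof (intro nn_integral_cong)
      fix S
      show "(\<integral>\<^sup>+N. ennreal (real (Suc K * m) + (\<Sum>j\<in>?IS. (cmod (S j))\<^sup>2) + (\<Sum>p\<in>?IY. (cmod (N p))\<^sup>2)) \<partial>?GY)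
        = ennreal (real (Suc K * m) + real (n * Mr) + (\<Sum>j\<in>?IS. (cmod (S j))\<^sup>2))"
        by (subst add, simp, simp add: sum_nonneg, rule arg_cong[where f=ennreal], simp add: card_cartesian_product algebra_simps)
    qed
    also have "\<dots> = ennreal (real m + real (n * Mr) + real (Suc K * m))"
      by (subst add, simp, simp, rule arg_cong[where f=ennreal], simp add: algebra_simps)
    finally show ?thesis .
  qed
  define er where "er k j \<omega> = (cmod (?s \<omega> j - gh k (?y \<omega>) (row m k (?t \<omega>)) j))\<^sup>2" for k j \<omega>
  have er_meas: "er k j \<in> borel_measurable \<Omega>" if "k \<le> K" "j < m" for k j
    unfolding er_def using comp[OF sM] gh_comp[OF yM measurable_compose[OF tM row_meas] that] that
    by (intro borel_measurable_power measurable_compose[OF _ borel_measurable_norm] borel_measurable_diff) auto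
  have row_Tf: "row m k (Tf S Z) = (\<lambda>j\<in>?IS. c k * S j + row m k Z j)" if "k \<le> K" for k S Z
    using that by (auto simp: row_def Tf_def fun_eq_iff)
  have Eer: "(\<Sum>j<m. \<integral>\<^sup>+\<omega>. ennreal (er k j \<omega>) \<partial>\<Omega>) \<le> ennreal (real m * v k)" if k: "k \<le> K" for k
  proof -
    have eq: "(\<integral>\<^sup>+\<omega>. ennreal (er k j \<omega>) \<partial>\<Omega>) = (\<integral>\<^sup>+S. \<integral>\<^sup>+N. \<integral>\<^sup>+Z. ennreal ((cmod (S j - gh k (\<lambda>p\<in>?IY. a S p + N p) (\<lambda>j\<in>?IS. c k * S j + Z j) j))\<^sup>2)
        \<partial>iid_cvec m \<partial>iid_cmat n Mr \<partial>iid_cvec m)" if j: "j < m" for j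
    proof -
      have "(\<integral>\<^sup>+\<omega>. ennreal (er k j \<omega>) \<partial>\<Omega>) = (\<integral>\<^sup>+S. \<integral>\<^sup>+N. \<integral>\<^sup>+Z. ennreal ((cmod (S j - gh k (Yf S N) (\<lambda>j\<in>?IS. c k * S j + row m k Z j) j))\<^sup>2) \<partial>?GT \<partial>?GY \<partial>?GS)"
        unfolding iter[OF measurable_compose[OF er_meas[OF k j] measurable_ennreal]]
        by (simp only: er_def fst_conv snd_conv row_Tf[OF k])
      also have "\<dots> = (\<integral>\<^sup>+S. \<integral>\<^sup>+N. \<integral>\<^sup>+Z. ennreal ((cmod (S j - gh k (Yf S N) (\<lambda>j\<in>?IS. c k * S j + Z j) j))\<^sup>2) \<partial>iid_cvec m \<partial>?GY \<partial>?GS)"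
      proof (intro nn_integral_cong)
        fix S N assume S: "S \<in> space ?GS" and N: "N \<in> space ?GY"
        have Y: "Yf S N \<in> space ?BY" by (auto simp: Yf_def space_PiM)
        have Rm: "(\<lambda>Z. \<lambda>j\<in>?IS. c k * S j + Z j) \<in> measurable ?BS ?BS"
          using comp[OF idm[of ?BS ?BS]] by (intro measurable_restrict borel_measurable_add) auto
        have "(\<lambda>Z. ennreal ((cmod (S j - gh k (Yf S N) (\<lambda>j\<in>?IS. c k * S j + Z j) j))\<^sup>2)) \<in> borel_measurable ?BS"
          using gh_comp[OF measurable_const[OF Y] Rm k j]
          by (intro measurable_compose[OF _ measurable_ennreal] borel_measurable_power measurable_compose[OF _ borel_measurable_norm] borel_measurable_diff) auto
        from nn_integral_row[OF _ this, of k "Suc K"] k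
        show "(\<integral>\<^sup>+Z. ennreal ((cmod (S j - gh k (Yf S N) (\<lambda>j\<in>?IS. c k * S j + row m k Z j) j))\<^sup>2) \<partial>?GT)
          = (\<integral>\<^sup>+Z. ennreal ((cmod (S j - gh k (Yf S N) (\<lambda>j\<in>?IS. c k * S j + Z j) j))\<^sup>2) \<partial>iid_cvec m)"
          by (simp add: iid_cmat_def)
      qed
      finally show ?thesis by (simp add: Yf_def iid_cmat_def iid_cvec_def)
    qed
    show ?thesis by (rule ord_eq_le_trans[OF sum.cong[OF refl eq] e[OF k]]) simp
  qed
  have EQS: "(\<integral>\<^sup>+\<omega>. ennreal (QS (?s \<omega>) (?y \<omega>) (?t \<omega>)) \<partial>\<Omega>) \<le> ennreal (real m)"
  proof -
    have "(\<integral>\<^sup>+\<omega>. ennreal (QS (?s \<omega>) (?y \<omega>) (?t \<omega>)) \<partial>\<Omega>) = (\<integral>\<^sup>+\<omega>. ennreal (1 / v K) * (\<Sum>j<m. ennreal (er K j \<omega>)) \<partial>\<Omega>)"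
      using v by (intro nn_integral_cong) (simp add: QS_def er_def sum_nonneg sum_divide_distrib flip: ennreal_mult)
    also have "\<dots> = ennreal (1 / v K) * (\<Sum>j<m. \<integral>\<^sup>+\<omega>. ennreal (er K j \<omega>) \<partial>\<Omega>)"
      using measurable_compose[OF er_meas[of K] measurable_ennreal]
      by (subst nn_integral_cmult, intro borel_measurable_sum, simp, subst nn_integral_sum) auto
    also have "\<dots> \<le> ennreal (1 / v K) * ennreal (real m * v K)"
      by (intro mult_left_mono Eer) auto
    also have "\<dots> = ennreal (real m)" using v by (simp flip: ennreal_mult)
    finally show ?thesis .
  qed
  have EQT: "(\<integral>\<^sup>+\<omega>. ennreal (QT (?y \<omega>) (?t \<omega>)) \<partial>\<Omega>) \<le> ennreal (real (Suc K * m))"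
  proof -
    have p_meas: "(\<lambda>\<omega>. ennreal ((cmod (?t \<omega> p - \<mu> (?y \<omega>) (?t \<omega>) p))\<^sup>2)) \<in> borel_measurable \<Omega>" if "p \<in> ?IT" for p
      using comp[OF tM that] \<mu>_meas[OF yM tM that]
      by (intro measurable_compose[OF _ measurable_ennreal] borel_measurable_power measurable_compose[OF _ borel_measurable_norm] borel_measurable_diff) auto
    have 0: "(\<integral>\<^sup>+\<omega>. ennreal ((cmod (?t \<omega> (0, j) - \<mu> (?y \<omega>) (?t \<omega>) (0, j)))\<^sup>2) \<partial>\<Omega>) = ennreal (W 0)" if j: "j < m" for j
    proof -
      have p: "(0, j) \<in> ?IT" using j by auto
      have "(\<integral>\<^sup>+\<omega>. ennreal ((cmod (?t \<omega> (0, j) - \<mu> (?y \<omega>) (?t \<omega>) (0, j)))\<^sup>2) \<partial>\<Omega>)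
        = (\<integral>\<^sup>+S. \<integral>\<^sup>+N. \<integral>\<^sup>+Z. ennreal ((cmod (c 0 * S j + Z (0, j)))\<^sup>2) \<partial>?GT \<partial>?GY \<partial>?GS)"
        by (subst iter[OF p_meas[OF p]]) (use j in \<open>auto simp: \<mu>_def Tf_def\<close>)
      also have "\<dots> = (\<integral>\<^sup>+S. ennreal ((cmod (c 0))\<^sup>2) * ennreal ((cmod (S j))\<^sup>2) + 1 \<partial>?GS)"
        by (intro nn_integral_cong, subst nn_integral_PiM_cgauss_square[OF _ p])
           (auto simp: GT.emeasure_space_1 GY.emeasure_space_1 norm_mult power_mult_distrib ennreal_mult)
      also have "\<dots> = ennreal ((cmod (c 0))\<^sup>2) * (\<integral>\<^sup>+S. ennreal ((cmod (S j))\<^sup>2) \<partial>?GS) + 1"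
      proof -
        have "(\<lambda>S. ennreal ((cmod (S j))\<^sup>2)) \<in> borel_measurable ?GS"
          using j by (intro measurable_compose[OF _ measurable_ennreal] borel_measurable_power measurable_compose[OF _ borel_measurable_norm] comp[OF idm[OF sets(1)]]) auto
        then show ?thesis by (simp add: nn_integral_add nn_integral_cmult GS.emeasure_space_1)
      qed
      also have "(\<integral>\<^sup>+S. ennreal ((cmod (S j))\<^sup>2) \<partial>?GS) = 1"
        using nn_integral_PiM_cgauss_square[of ?IS j "\<lambda>_. 0"] j by (simp add: GS.emeasure_space_1)
      finally show ?thesis by (simp add: W_def add.commute)
    qed
    \<comment> \<open>The innovation of row \<open>Suc k\<close> is \<open>c (Suc k)\<close> times
      the error of the estimate from row \<open>k\<close>, plus the noise of row
      \<open>Suc k\<close>. That estimate involves another row of noise, hence the two mean squares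
      add.\<close>
    have S: "(\<integral>\<^sup>+\<omega>. ennreal ((cmod (?t \<omega> (Suc k, j) - \<mu> (?y \<omega>) (?t \<omega>) (Suc k, j)))\<^sup>2) \<partial>\<Omega>)
       = ennreal ((cmod (c (Suc k)))\<^sup>2) * (\<integral>\<^sup>+\<omega>. ennreal (er k j \<omega>) \<partial>\<Omega>) + 1" if k: "k < K" and j: "j < m" for k j
    proof -
      have p: "(Suc k, j) \<in> ?IT" using j k by auto
      have kK: "k \<le> K" using k by simp
      define \<phi> where "\<phi> S N Z = c (Suc k) * (S j - gh k (Yf S N) (row m k (Tf S Z)) j)" for S N Z
      have \<phi>_meas: "(\<lambda>\<omega>. \<phi> (?s \<omega>) (?n \<omega>) (?z \<omega>)) \<in> borel_measurable \<Omega>"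
        unfolding \<phi>_def using comp[OF sM] gh_comp[OF yM measurable_compose[OF tM row_meas] kK j] j kK
        by (intro borel_measurable_times borel_measurable_diff) auto
      have "(\<integral>\<^sup>+\<omega>. ennreal ((cmod (?t \<omega> (Suc k, j) - \<mu> (?y \<omega>) (?t \<omega>) (Suc k, j)))\<^sup>2) \<partial>\<Omega>)
        = (\<integral>\<^sup>+S. \<integral>\<^sup>+N. \<integral>\<^sup>+Z. ennreal ((cmod (\<phi> S N Z + Z (Suc k, j)))\<^sup>2) \<partial>?GT \<partial>?GY \<partial>?GS)"
        by (subst iter[OF p_meas[OF p]]) (use j k in \<open>auto simp: \<mu>_def \<phi>_def Tf_def algebra_simps\<close>)
      also have "\<dots> = (\<integral>\<^sup>+S. \<integral>\<^sup>+N. \<integral>\<^sup>+Z. ennreal ((cmod (\<phi> S N Z))\<^sup>2) + 1 \<partial>?GT \<partial>?GY \<partial>?GS)"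
      proof (rule nn_integral_cong, rule nn_integral_cong)
        fix S N assume S: "S \<in> space ?GS" and N: "N \<in> space ?GY"
        have S': "S \<in> space ?BS" using S by (simp add: space_PiM)
        have Y: "Yf S N \<in> space ?BY" by (auto simp: Yf_def space_PiM)
        have \<phi>m: "\<phi> S N \<in> borel_measurable ?BT"
          unfolding \<phi>_def using gh_comp[OF measurable_const[OF Y] measurable_compose[OF Tf_meas[OF measurable_const[OF S'] idm] row_meas] kK j] kK
          by (intro borel_measurable_times borel_measurable_diff borel_measurable_const) auto
        have inv: "\<phi> S N (Z((Suc k, j) := z)) = \<phi> S N Z" for Z z
        proof -
          have "row m k (Tf S (Z((Suc k, j) := z))) = row m k (Tf S Z)"
            by (auto simp: row_def Tf_def fun_eq_iff)
          then show ?thesis by (simp add: \<phi>_def)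
        qed
        have "(\<lambda>Z. ennreal ((cmod (\<phi> S N Z))\<^sup>2)) \<in> borel_measurable ?GT"
          unfolding measurable_cong_sets[OF sets(3) refl] using \<phi>m
          by (intro measurable_compose[OF _ measurable_ennreal] borel_measurable_power measurable_compose[OF _ borel_measurable_norm])
        then show "(\<integral>\<^sup>+Z. ennreal ((cmod (\<phi> S N Z + Z (Suc k, j)))\<^sup>2) \<partial>?GT) = (\<integral>\<^sup>+Z. ennreal ((cmod (\<phi> S N Z))\<^sup>2) + 1 \<partial>?GT)"
          by (subst nn_integral_PiM_cgauss_square[OF _ p \<phi>m inv]) (auto simp: nn_integral_add GT.emeasure_space_1)
      qed
      also have "\<dots> = (\<integral>\<^sup>+\<omega>. ennreal ((cmod (\<phi> (?s \<omega>) (?n \<omega>) (?z \<omega>)))\<^sup>2) + 1 \<partial>\<Omega>)"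
        using \<phi>_meas by (subst iter) (auto intro!: measurable_compose[OF _ measurable_ennreal] borel_measurable_add borel_measurable_power measurable_compose[OF _ borel_measurable_norm])
      also have "\<dots> = (\<integral>\<^sup>+\<omega>. ennreal ((cmod (c (Suc k)))\<^sup>2) * ennreal (er k j \<omega>) + 1 \<partial>\<Omega>)"
        by (intro nn_integral_cong) (simp add: \<phi>_def er_def norm_mult power_mult_distrib ennreal_mult)
      also have "\<dots> = ennreal ((cmod (c (Suc k)))\<^sup>2) * (\<integral>\<^sup>+\<omega>. ennreal (er k j \<omega>) \<partial>\<Omega>) + 1"
        using er_meas[OF kK j] by (simp add: nn_integral_add nn_integral_cmult \<Omega>.emeasure_space_1)
      finally show ?thesis .
    qed
    have rowsum: "(\<Sum>j<m. \<integral>\<^sup>+\<omega>. ennreal ((cmod (?t \<omega> (k, j) - \<mu> (?y \<omega>) (?t \<omega>) (k, j)))\<^sup>2) \<partial>\<Omega>) \<le> ennreal (real m * W k)" if k: "k < Suc K" for k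
    proof (cases k)
      case 0
      then show ?thesis using 0 \<open>\<And>j. j < m \<Longrightarrow> _ = ennreal (W 0)\<close> W0[of 0]
        by (simp add: ennreal_of_nat_eq_real_of_nat flip: ennreal_mult)
    next
      case (Suc k')
      then have k': "k' < K" using k by simp
      have "(\<Sum>j<m. \<integral>\<^sup>+\<omega>. ennreal ((cmod (?t \<omega> (k, j) - \<mu> (?y \<omega>) (?t \<omega>) (k, j)))\<^sup>2) \<partial>\<Omega>)
        = ennreal ((cmod (c (Suc k')))\<^sup>2) * (\<Sum>j<m. \<integral>\<^sup>+\<omega>. ennreal (er k' j \<omega>) \<partial>\<Omega>) + ennreal (real m)"
        using k' unfolding Suc by (simp add: S sum.distrib sum_distrib_left ennreal_of_nat_eq_real_of_nat)
      also have "\<dots> \<le> ennreal ((cmod (c (Suc k')))\<^sup>2) * ennreal (real m * v k') + ennreal (real m)"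
        using k' by (intro add_mono mult_left_mono Eer) auto
      also have "\<dots> = ennreal (real m * W k)"
        using k' v(1)[of k'] by (simp add: W_def Suc algebra_simps flip: ennreal_mult ennreal_plus)
      finally show ?thesis .
    qed
    have "(\<integral>\<^sup>+\<omega>. ennreal (QT (?y \<omega>) (?t \<omega>)) \<partial>\<Omega>)
      = (\<integral>\<^sup>+\<omega>. (\<Sum>p\<in>?IT. ennreal (1 / W (fst p)) * ennreal ((cmod (?t \<omega> p - \<mu> (?y \<omega>) (?t \<omega>) p))\<^sup>2)) \<partial>\<Omega>)"
      using W0 by (intro nn_integral_cong) (simp add: QT_def less_imp_le flip: ennreal_mult)
    also have "\<dots> = (\<Sum>p\<in>?IT. ennreal (1 / W (fst p)) * (\<integral>\<^sup>+\<omega>. ennreal ((cmod (?t \<omega> p - \<mu> (?y \<omega>) (?t \<omega>) p))\<^sup>2) \<partial>\<Omega>))"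
      by (subst nn_integral_sum, intro borel_measurable_times_ennreal measurable_const p_meas, simp, assumption,
          intro sum.cong refl nn_integral_cmult p_meas)
    also have "\<dots> = (\<Sum>k<Suc K. ennreal (1 / W k) * (\<Sum>j<m. \<integral>\<^sup>+\<omega>. ennreal ((cmod (?t \<omega> (k, j) - \<mu> (?y \<omega>) (?t \<omega>) (k, j)))\<^sup>2) \<partial>\<Omega>))"
      by (subst sum.cartesian_product[symmetric, of "\<lambda>k j. ennreal (1 / W k) * (\<integral>\<^sup>+\<omega>. ennreal ((cmod (?t \<omega> (k, j) - \<mu> (?y \<omega>) (?t \<omega>) (k, j)))\<^sup>2) \<partial>\<Omega>)", unfolded case_prod_beta prod.collapse])
         (simp add: sum_distrib_left)
    also have "\<dots> \<le> (\<Sum>k<Suc K. ennreal (1 / W k) * ennreal (real m * W k))"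
      using rowsum by (intro sum_mono mult_left_mono) auto
    also have "\<dots> = (\<Sum>k<Suc K. ennreal (real m))"
      using W0 by (intro sum.cong) (auto simp: less_imp_le less_imp_neq[THEN not_sym] simp flip: ennreal_mult)
    also have "\<dots> = ennreal (real (Suc K * m))"
      by (subst sum_ennreal) (simp_all only: of_nat_0_le_iff sum_constant card_lessThan of_nat_mult)
    finally show ?thesis .
  qed
  have EQY: "(\<integral>\<^sup>+\<omega>. ennreal (QY (?y \<omega>)) \<partial>\<Omega>) \<le> ennreal (real (n * Mr))"
    using QYe measurable_compose[OF yM QY]
    by (subst iter) (auto simp: GT.emeasure_space_1 Yf_def iid_cvec_def iid_cmat_def)
  define L1 where "L1 = LY + real m * (\<Sum>k<Suc K. ln (W k))"
  define L2 where "L2 = real m * ln (1 / v K)"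
  have L1: "0 \<le> L1" unfolding L1_def using LY W1 by (intro add_nonneg_nonneg mult_nonneg_nonneg sum_nonneg) auto
  have L2: "0 \<le> L2" unfolding L2_def using v by (intro mult_nonneg_nonneg) auto
  have Qnn: "0 \<le> QS s y t" "0 \<le> QT y t" for s y t
    using v W0[THEN less_imp_le] by (auto simp: QS_def QT_def intro!: sum_nonneg divide_nonneg_nonneg)
  have expL: "exp (L1 - L2) = exp LY * (\<Prod>k<Suc K. W k ^ m) * v K ^ m"
  proof -
    have "exp L1 = exp LY * (\<Prod>k<Suc K. W k ^ m)"
      using W0 by (simp add: L1_def exp_add sum_distrib_left exp_sum exp_of_nat_mult del: sum.lessThan_Suc prod.lessThan_Suc)
    moreover have "exp (- L2) = v K ^ m"
      using v by (simp add: L2_def ln_div exp_of_nat_mult)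
    ultimately show ?thesis by (simp add: exp_diff exp_minus divide_inverse)
  qed
  let ?X = "\<lambda>\<omega>. P (?s \<omega>) (?n \<omega>) (?z \<omega>)" and ?Q = "\<lambda>\<omega>. Q (?s \<omega>) (?y \<omega>) (?t \<omega>)"
  have X_meas: "?X \<in> borel_measurable \<Omega>" by (rule P_meas[OF sM nM zM])
  have Q_meas': "?Q \<in> borel_measurable \<Omega>" by (rule Q_meas[OF sM yM tM])
  have exp_meas: "(\<lambda>\<omega>. ennreal (exp (?X \<omega> - ?Q \<omega>))) \<in> borel_measurable \<Omega>"
    using X_meas Q_meas' by (intro measurable_compose[OF _ measurable_ennreal] measurable_compose[OF _ borel_measurable_exp] borel_measurable_diff)
  have X0: "0 \<le> ?X \<omega>" for \<omega> by (auto simp: P_def intro!: add_nonneg_nonneg sum_nonneg)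
  have Eexp': "(\<integral>\<^sup>+\<omega>. ennreal (exp (?X \<omega> - ?Q \<omega>)) \<partial>\<Omega>) \<le> ennreal (exp (L1 - L2))"
    using Eexp by (subst iter[OF exp_meas]) (simp add: expL)
  \<comment> \<open>Gibbs' inequality without integrating a logarithm:
    \<open>1 + x \<le> exp x\<close> with \<open>x = L2 - L1 + P - Q\<close>, where the exponential
    has mean at most 1. Each term is put on the side where it is nonnegative, so that nonnegative
    integrals suffice and no integrability has to be shown.\<close>
  have "ennreal (1 + L2 + (real m + real (n * Mr) + real (Suc K * m))) = (\<integral>\<^sup>+\<omega>. ennreal (1 + L2) + ennreal (?X \<omega>) \<partial>\<Omega>)"
    using X_meas L2 by (subst nn_integral_add) (auto simp: EP \<Omega>.emeasure_space_1)
  also have "\<dots> \<le> (\<integral>\<^sup>+\<omega>. ennreal (exp (L2 - L1)) * ennreal (exp (?X \<omega> - ?Q \<omega>)) + ennreal L1 + (ennreal (QY (?y \<omega>)) + ennreal (QT (?y \<omega>) (?t \<omega>)) + ennreal (QS (?s \<omega>) (?y \<omega>) (?t \<omega>))) \<partial>\<Omega>)"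
  proof (intro nn_integral_mono)
    fix \<omega>
    have "1 + (L2 - L1 + (?X \<omega> - ?Q \<omega>)) \<le> exp (L2 - L1 + (?X \<omega> - ?Q \<omega>))" by (rule exp_ge_add_one_self)
    then have "1 + L2 + ?X \<omega> \<le> exp (L2 - L1) * exp (?X \<omega> - ?Q \<omega>) + L1 + (QY (?y \<omega>) + QT (?y \<omega>) (?t \<omega>) + QS (?s \<omega>) (?y \<omega>) (?t \<omega>))"
      by (simp add: exp_add Q_def)
    then show "ennreal (1 + L2) + ennreal (?X \<omega>) \<le> ennreal (exp (L2 - L1)) * ennreal (exp (?X \<omega> - ?Q \<omega>)) + ennreal L1 + (ennreal (QY (?y \<omega>)) + ennreal (QT (?y \<omega>) (?t \<omega>)) + ennreal (QS (?s \<omega>) (?y \<omega>) (?t \<omega>)))"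
      using L1 L2 X0[of \<omega>] Qnn QY0 by (simp flip: ennreal_mult ennreal_plus)
  qed
  also have "\<dots> = ennreal (exp (L2 - L1)) * (\<integral>\<^sup>+\<omega>. ennreal (exp (?X \<omega> - ?Q \<omega>)) \<partial>\<Omega>) + ennreal L1
     + ((\<integral>\<^sup>+\<omega>. ennreal (QY (?y \<omega>)) \<partial>\<Omega>) + (\<integral>\<^sup>+\<omega>. ennreal (QT (?y \<omega>) (?t \<omega>)) \<partial>\<Omega>) + (\<integral>\<^sup>+\<omega>. ennreal (QS (?s \<omega>) (?y \<omega>) (?t \<omega>)) \<partial>\<Omega>))"
  proof -
    have add: "(\<integral>\<^sup>+\<omega>. ennreal r * a \<omega> + ennreal L1 + (b \<omega> + c \<omega> + d \<omega>) \<partial>\<Omega>) = ennreal r * (\<integral>\<^sup>+\<omega>. a \<omega> \<partial>\<Omega>) + ennreal L1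
        + ((\<integral>\<^sup>+\<omega>. b \<omega> \<partial>\<Omega>) + (\<integral>\<^sup>+\<omega>. c \<omega> \<partial>\<Omega>) + (\<integral>\<^sup>+\<omega>. d \<omega> \<partial>\<Omega>))"
      if "a \<in> borel_measurable \<Omega>" "b \<in> borel_measurable \<Omega>" "c \<in> borel_measurable \<Omega>" "d \<in> borel_measurable \<Omega>" for a b c d r
      using that by (simp add: nn_integral_add nn_integral_cmult \<Omega>.emeasure_space_1)
    show ?thesis
      by (rule add[OF exp_meas measurable_compose[OF measurable_compose[OF yM QY] measurable_ennreal]
           measurable_compose[OF QT_meas[OF yM tM] measurable_ennreal] measurable_compose[OF QS_meas[OF sM yM tM] measurable_ennreal]])
  qed
  also have "\<dots> \<le> ennreal (exp (L2 - L1)) * ennreal (exp (L1 - L2)) + ennreal L1 + (ennreal (real (n * Mr)) + ennreal (real (Suc K * m)) + ennreal (real m))"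
    by (intro add_mono mult_left_mono Eexp' EQY EQT EQS order_refl) auto
  also have "\<dots> = ennreal (1 + L1 + (real (n * Mr) + real (Suc K * m) + real m))"
  proof -
    have "ennreal (exp (L2 - L1)) * ennreal (exp (L1 - L2)) = 1" by (simp flip: ennreal_mult exp_add)
    moreover have "1 + ennreal x + (ennreal a + ennreal b + ennreal c) = ennreal (1 + x + (a + b + c))"
      if "0 \<le> x" "0 \<le> a" "0 \<le> b" "0 \<le> c" for x a b c :: real
      using that by simp
    ultimately show ?thesis using L1 by (simp only: of_nat_0_le_iff)
  qed
  finally have "1 + L2 + (real m + real (n * Mr) + real (Suc K * m)) \<le> 1 + L1 + (real (n * Mr) + real (Suc K * m) + real m)"
    using L1 by (subst (asm) ennreal_le_iff) auto
  then have "L2 \<le> L1" by simp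
  moreover have "(\<Sum>k<Suc K. ln (W k)) = ln (1 + (cmod (c 0))\<^sup>2) + (\<Sum>k<K. ln (1 + (cmod (c (Suc k)))\<^sup>2 * v k))"
    unfolding sum.lessThan_Suc_shift by (auto simp: W_def intro!: sum.cong)
  ultimately show ?thesis by (simp add: L1_def L2_def)
qed

section \<open>Output law of a rank-one channel\<close>

text \<open>With several receive antennas there is one transmit antenna, and the strongest receive
  antenna is taken as reference to make all ratios at most 1 in modulus. If its gain is 0 all gains
  are 0, which agrees with division by zero giving 0.\<close>

lemma rank_one_rows:
  fixes H :: cmat
  assumes "1 \<le> Mt" "1 \<le> Mr" "min Mt Mr = 1"
  shows "\<exists>r0 \<beta>. r0 < Mr \<and> (\<forall>r<Mr. cmod (\<beta> r) \<le> 1) \<and> (\<forall>r<Mr. \<forall>t<Mt. H (r, t) = \<beta> r * H (r0, t))"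
proof (cases "Mr = 1")
  case True
  then show ?thesis by (intro exI[of _ 0] exI[of _ "\<lambda>_. 1"]) auto
next
  case False
  then have Mt: "Mt = 1" using assms by (auto simp: min_def split: if_splits)
  let ?A = "(\<lambda>r. cmod (H (r, 0))) ` {..<Mr}"
  have "Max ?A \<in> ?A" using assms by (intro Max_in) (auto simp: lessThan_empty_iff)
  then obtain r0 where r0: "r0 < Mr" "Max ?A = cmod (H (r0, 0))" by auto
  have le: "cmod (H (r, 0)) \<le> cmod (H (r0, 0))" if "r < Mr" for r
    unfolding r0(2)[symmetric] using that by (intro Max_ge) auto
  show ?thesis
  proof (intro exI conjI allI impI)
    fix r t assume r: "r < Mr"
    show "cmod (H (r, 0) / H (r0, 0)) \<le> 1"
      using le[OF r] by (cases "H (r0, 0) = 0") (auto simp: norm_divide)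
    assume "t < Mt"
    then show "H (r, t) = H (r, 0) / H (r0, 0) * H (r0, t)" using Mt le[OF r] by auto
  qed (rule r0)
qed

text \<open>Antenna \<open>r0\<close> is described by a centred Gaussian, the others by Gaussians around its rescaled output.\<close>
definition out_quad :: "nat \<Rightarrow> nat \<Rightarrow> nat \<Rightarrow> (nat \<Rightarrow> complex) \<Rightarrow> real \<Rightarrow> cmat \<Rightarrow> real" where
  "out_quad n Mr r0 \<beta> w y = (\<Sum>p\<in>{..<n} \<times> {r0}. (cmod (y p))\<^sup>2 / w)
     + (\<Sum>p\<in>{..<n} \<times> ({..<Mr} - {r0}). (cmod (y p - \<beta> (snd p) * y (fst p, r0)))\<^sup>2 / 2)"

lemma out_quad_nonneg: "0 \<le> w \<Longrightarrow> 0 \<le> out_quad n Mr r0 \<beta> w y"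
  unfolding out_quad_def by (intro add_nonneg_nonneg sum_nonneg divide_nonneg_nonneg) auto

lemma measurable_out_quad:
  assumes "r0 < Mr"
  shows "out_quad n Mr r0 \<beta> w \<in> borel_measurable (PiM ({..<n} \<times> {..<Mr}) (\<lambda>_. borel))"
proof -
  have c: "(\<lambda>y. y p) \<in> borel_measurable (PiM ({..<n} \<times> {..<Mr}) (\<lambda>_. borel :: complex measure))" if "p \<in> {..<n} \<times> {..<Mr}" for p
    by (rule measurable_component_singleton[OF that])
  show ?thesis
    unfolding out_quad_def using assms
    by (intro borel_measurable_add borel_measurable_sum borel_measurable_divide borel_measurable_power
        measurable_compose[OF _ borel_measurable_norm] borel_measurable_diff borel_measurable_times borel_measurable_const c) auto
qed

lemma nn_integral_out_quad:
  assumes r0: "r0 < Mr" and w: "0 < w"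
  shows "(\<integral>\<^sup>+y. ennreal (exp (- out_quad n Mr r0 \<beta> w y)) \<partial>PiM ({..<n} \<times> {..<Mr}) (\<lambda>_. lscale)) = ennreal (w ^ n * 2 ^ (n * (Mr - 1)))"
proof -
  let ?I = "{..<n} \<times> {r0}" and ?J = "{..<n} \<times> ({..<Mr} - {r0})"
  have U: "{..<n} \<times> {..<Mr} = ?I \<union> ?J" using r0 by auto
  have D: "?I \<inter> ?J = {}" "finite ?I" "finite ?J" by auto
  let ?f = "\<lambda>y. ennreal (exp (- out_quad n Mr r0 \<beta> w y))"
  have fm: "?f \<in> borel_measurable (PiM (?I \<union> ?J) (\<lambda>_. lscale))"
    unfolding measurable_cong_sets[OF sets_PiM_lscale refl] U[symmetric]
    by (intro measurable_compose[OF _ measurable_ennreal] measurable_compose[OF _ borel_measurable_exp] borel_measurable_uminus measurable_out_quad r0)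
  have "(\<integral>\<^sup>+y. ?f y \<partial>PiM (?I \<union> ?J) (\<lambda>_. lscale)) = (\<integral>\<^sup>+x. (\<integral>\<^sup>+y. ?f (merge ?I ?J (x, y)) \<partial>PiM ?J (\<lambda>_. lscale)) \<partial>PiM ?I (\<lambda>_. lscale))"
    by (rule PL.product_nn_integral_fold[OF D fm])
  also have "\<dots> = (\<integral>\<^sup>+x. ennreal (2 ^ (n * (Mr - 1))) * ennreal (exp (- (\<Sum>p\<in>?I. (cmod (x p - 0))\<^sup>2 / w))) \<partial>PiM ?I (\<lambda>_. lscale))"
  proof (rule nn_integral_cong)
    fix x
    have eq: "?f (merge ?I ?J (x, y)) = ennreal (exp (- (\<Sum>p\<in>?I. (cmod (x p - 0))\<^sup>2 / w))) * ennreal (exp (- (\<Sum>p\<in>?J. (cmod (y p - \<beta> (snd p) * x (fst p, r0)))\<^sup>2 / 2)))" for y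
    proof -
      have 1: "(\<Sum>p\<in>?I. (cmod (merge ?I ?J (x, y) p))\<^sup>2 / w) = (\<Sum>p\<in>?I. (cmod (x p - 0))\<^sup>2 / w)"
        by (intro sum.cong) (auto simp: merge_def)
      have 2: "(\<Sum>p\<in>?J. (cmod (merge ?I ?J (x, y) p - \<beta> (snd p) * merge ?I ?J (x, y) (fst p, r0)))\<^sup>2 / 2) = (\<Sum>p\<in>?J. (cmod (y p - \<beta> (snd p) * x (fst p, r0)))\<^sup>2 / 2)"
        by (intro sum.cong) (auto simp: merge_def)
      show ?thesis unfolding out_quad_def 1 2 by (simp only: minus_add_distrib exp_add ennreal_mult exp_ge_zero)
    qed
    have m: "(\<lambda>y. ennreal (exp (- (\<Sum>p\<in>?J. (cmod (y p - \<beta> (snd p) * x (fst p, r0)))\<^sup>2 / 2)))) \<in> borel_measurable (PiM ?J (\<lambda>_. lscale))"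
      unfolding measurable_cong_sets[OF sets_PiM_lscale refl]
      by (intro measurable_compose[OF _ measurable_ennreal] measurable_compose[OF _ borel_measurable_exp] borel_measurable_uminus
          borel_measurable_sum borel_measurable_divide borel_measurable_power
        measurable_compose[OF _ borel_measurable_norm] borel_measurable_diff borel_measurable_const measurable_component_singleton)
    have card: "card ?J = n * (Mr - 1)" using r0 by (simp add: card_cartesian_product)
    show "(\<integral>\<^sup>+y. ?f (merge ?I ?J (x, y)) \<partial>PiM ?J (\<lambda>_. lscale)) = ennreal (2 ^ (n * (Mr - 1))) * ennreal (exp (- (\<Sum>p\<in>?I. (cmod (x p - 0))\<^sup>2 / w)))"
      unfolding eq nn_integral_cmult[OF m] nn_integral_PiM_lscale_gaussian[of ?J "\<lambda>_. 2" "\<lambda>p. \<beta> (snd p) * x (fst p, r0)", OF D(3) zero_less_numeral]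
      by (simp add: card mult.commute)
  qed
  also have "\<dots> = ennreal (2 ^ (n * (Mr - 1))) * ennreal (w ^ n)"
  proof -
    have m: "(\<lambda>x. ennreal (exp (- (\<Sum>p\<in>?I. (cmod (x p - 0))\<^sup>2 / w)))) \<in> borel_measurable (PiM ?I (\<lambda>_. lscale))"
      unfolding measurable_cong_sets[OF sets_PiM_lscale refl]
      by (intro measurable_compose[OF _ measurable_ennreal] measurable_compose[OF _ borel_measurable_exp] borel_measurable_uminus
          borel_measurable_sum borel_measurable_divide borel_measurable_power
        measurable_compose[OF _ borel_measurable_norm] borel_measurable_diff borel_measurable_const measurable_component_singleton)
    show ?thesis
      unfolding nn_integral_cmult[OF m] using nn_integral_PiM_lscale_gaussian[of ?I "\<lambda>_. w" "\<lambda>_. 0"] w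
      by (simp add: card_cartesian_product)
  qed
  finally show ?thesis using w unfolding U by (simp add: mult.commute flip: ennreal_mult)
qed

lemma norm_square_sum_le:
  fixes a x :: "nat \<Rightarrow> complex"
  shows "(cmod (\<Sum>t<k. a t * x t))\<^sup>2 \<le> (\<Sum>t<k. (cmod (a t))\<^sup>2) * (\<Sum>t<k. (cmod (x t))\<^sup>2)"
proof -
  have "cmod (\<Sum>t<k. a t * x t) \<le> (\<Sum>t<k. cmod (a t) * cmod (x t))"
    using norm_sum[of "\<lambda>t. a t * x t" "{..<k}"] by (simp add: norm_mult)
  then have "(cmod (\<Sum>t<k. a t * x t))\<^sup>2 \<le> (\<Sum>t<k. cmod (a t) * cmod (x t))\<^sup>2"
    by (intro power_mono) auto
  also have "\<dots> \<le> (\<Sum>t<k. (cmod (a t))\<^sup>2) * (\<Sum>t<k. (cmod (x t))\<^sup>2)"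
    by (rule Cauchy_Schwarz_ineq_sum)
  finally show ?thesis .
qed

lemma sum_ennreal_cmult:
  assumes "0 \<le> c" "\<And>p. p \<in> A \<Longrightarrow> 0 \<le> x p"
  shows "(\<Sum>p\<in>A. ennreal c * ennreal (x p)) = ennreal (\<Sum>p\<in>A. c * x p)"
proof -
  have "(\<Sum>p\<in>A. ennreal c * ennreal (x p)) = (\<Sum>p\<in>A. ennreal (c * x p))"
    using assms by (intro sum.cong refl ennreal_mult[symmetric])
  also have "\<dots> = ennreal (\<Sum>p\<in>A. c * x p)"
    using assms by (intro sum_ennreal) auto
  finally show ?thesis .
qed

lemma nn_integral_cgauss_component_square:
  assumes "finite I" "p \<in> I"
  shows "(\<integral>\<^sup>+x. ennreal ((cmod (a + x p))\<^sup>2) \<partial>PiM I (\<lambda>_. cgauss)) = ennreal ((cmod a)\<^sup>2 + 1)"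
proof -
  interpret P: prob_space "PiM I (\<lambda>_. cgauss)" by (intro prob_space_PiM prob_space_cgauss)
  show ?thesis
    by (subst nn_integral_PiM_cgauss_square[OF assms, of "\<lambda>_. a"]) (simp_all add: P.emeasure_space_1)
qed

text \<open>Subtracting the rescaled reference output cancels the signal at the other antennas and
  leaves noise of variance at most 2, the width used in \<open>out_quad\<close>. At the reference
  antenna Cauchy-Schwarz and the power constraint bound the mean power per use by \<open>w\<close>;
  the factor \<open>Mt\<close> of the constraint cancels the one in the SNR. So every coordinate
  contributes at most 1.\<close>

lemma nn_integral_out_quad_output:
  assumes r0: "r0 < Mr" and rank: "\<And>r t. r < Mr \<Longrightarrow> t < Mt \<Longrightarrow> H (r, t) = \<beta> r * H (r0, t)"
    and \<beta>: "\<And>r. r < Mr \<Longrightarrow> cmod (\<beta> r) \<le> 1"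
    and f: "\<And>i t. i < n \<Longrightarrow> t < Mt \<Longrightarrow> (\<lambda>S. f S (i,t)) \<in> borel_measurable (iid_cvec m)"
    and pow: "(\<integral>\<^sup>+ S. ennreal (\<Sum>i<n. \<Sum>t<Mt. (cmod (f S (i,t)))\<^sup>2) \<partial>iid_cvec m) \<le> ennreal (real n * real Mt)"
    and \<rho>: "0 < \<rho>" and Mt: "1 \<le> Mt" and w: "w = 1 + \<rho> * (\<Sum>t<Mt. (cmod (H (r0, t)))\<^sup>2)"
  shows "(\<integral>\<^sup>+S. \<integral>\<^sup>+N. ennreal (out_quad n Mr r0 \<beta> w (chan_out Mt Mr n \<rho> H (f S) N)) \<partial>iid_cmat n Mr \<partial>iid_cvec m) \<le> ennreal (real (n * Mr))"
proof -
  define h where "h = (\<Sum>t<Mt. (cmod (H (r0, t)))\<^sup>2)"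
  have h0: "0 \<le> h" by (auto simp: h_def intro: sum_nonneg)
  have w1: "1 \<le> w" using \<rho> h0 by (simp add: w h_def)
  define a where "a S p = complex_of_real (sqrt (\<rho> / real Mt)) * (\<Sum>t<Mt. H (snd p, t) * f S (fst p, t))" for S p
  have Y: "chan_out Mt Mr n \<rho> H (f S) N p = a S p + N p" if "p \<in> {..<n} \<times> {..<Mr}" for S N p
    using that by (auto simp: chan_out_def a_def)
  have ab: "a S (i, r) = \<beta> r * a S (i, r0)" if "r < Mr" for S i r
    using that by (simp add: a_def rank sum_distrib_left mult_ac)
  let ?I = "{..<n} \<times> {r0}" and ?J = "{..<n} \<times> ({..<Mr} - {r0})"
  have f': "(\<lambda>S. f S p) \<in> borel_measurable (iid_cvec m)" if "p \<in> {..<n} \<times> {..<Mt}" for p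
    using f[of "fst p" "snd p"] that by auto
  have am: "(\<lambda>S. (cmod (f S (i, t)))\<^sup>2) \<in> borel_measurable (iid_cvec m)" if "i < n" "t < Mt" for i t
    using that by (intro borel_measurable_power measurable_compose[OF _ borel_measurable_norm] f)
  interpret PN: prob_space "iid_cmat n Mr" by (rule prob_space_iid_cmat)
  interpret PS: prob_space "iid_cvec m" by (rule prob_space_iid_cvec)
  have cN: "(\<lambda>N. N p) \<in> borel_measurable (iid_cmat n Mr)" if "p \<in> {..<n} \<times> {..<Mr}" for p
    using measurable_iid_cmat_component[of "fst p" n "snd p" Mr] that by auto
  have inner: "(\<integral>\<^sup>+N. ennreal (out_quad n Mr r0 \<beta> w (chan_out Mt Mr n \<rho> H (f S) N)) \<partial>iid_cmat n Mr)
     \<le> ennreal (1 / w * (real n + \<rho> * h / real Mt * (\<Sum>i<n. \<Sum>t<Mt. (cmod (f S (i,t)))\<^sup>2)) + real (n * (Mr - 1)))" for S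
  proof -
    have "(\<integral>\<^sup>+N. ennreal (out_quad n Mr r0 \<beta> w (chan_out Mt Mr n \<rho> H (f S) N)) \<partial>iid_cmat n Mr)
      = (\<integral>\<^sup>+N. (\<Sum>p\<in>?I. ennreal (1 / w) * ennreal ((cmod (a S p + N p))\<^sup>2)) + (\<Sum>p\<in>?J. ennreal (1 / 2) * ennreal ((cmod (- \<beta> (snd p) * N (fst p, r0) + N p))\<^sup>2)) \<partial>iid_cmat n Mr)"
    proof (rule nn_integral_cong)
      fix N
      have 1: "(\<Sum>p\<in>?I. (cmod (chan_out Mt Mr n \<rho> H (f S) N p))\<^sup>2 / w) = (\<Sum>p\<in>?I. 1 / w * (cmod (a S p + N p))\<^sup>2)"
        using r0 by (intro sum.cong refl, subst Y) auto
      have 2: "(\<Sum>p\<in>?J. (cmod (chan_out Mt Mr n \<rho> H (f S) N p - \<beta> (snd p) * chan_out Mt Mr n \<rho> H (f S) N (fst p, r0)))\<^sup>2 / 2)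
         = (\<Sum>p\<in>?J. 1 / 2 * (cmod (- \<beta> (snd p) * N (fst p, r0) + N p))\<^sup>2)"
      proof (rule sum.cong[OF refl])
        fix p assume p: "p \<in> ?J"
        then have "chan_out Mt Mr n \<rho> H (f S) N p = \<beta> (snd p) * a S (fst p, r0) + N p"
          using ab[of "snd p" S "fst p"] by (subst Y) auto
        moreover have "chan_out Mt Mr n \<rho> H (f S) N (fst p, r0) = a S (fst p, r0) + N (fst p, r0)"
          using p r0 by (subst Y) auto
        ultimately show "(cmod (chan_out Mt Mr n \<rho> H (f S) N p - \<beta> (snd p) * chan_out Mt Mr n \<rho> H (f S) N (fst p, r0)))\<^sup>2 / 2 = 1 / 2 * (cmod (- \<beta> (snd p) * N (fst p, r0) + N p))\<^sup>2"
          by (simp add: algebra_simps)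
      qed
      show "ennreal (out_quad n Mr r0 \<beta> w (chan_out Mt Mr n \<rho> H (f S) N)) = (\<Sum>p\<in>?I. ennreal (1 / w) * ennreal ((cmod (a S p + N p))\<^sup>2)) + (\<Sum>p\<in>?J. ennreal (1 / 2) * ennreal ((cmod (- \<beta> (snd p) * N (fst p, r0) + N p))\<^sup>2))"
        unfolding out_quad_def 1 2 using w1
        by (subst (1 2) sum_ennreal_cmult) (auto intro!: sum_nonneg ennreal_plus)
    qed
    also have "\<dots> = (\<Sum>p\<in>?I. ennreal (1 / w) * (\<integral>\<^sup>+N. ennreal ((cmod (a S p + N p))\<^sup>2) \<partial>iid_cmat n Mr)) + (\<Sum>p\<in>?J. ennreal (1 / 2) * (\<integral>\<^sup>+N. ennreal ((cmod (- \<beta> (snd p) * N (fst p, r0) + N p))\<^sup>2) \<partial>iid_cmat n Mr))"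
    proof -
      have m1: "(\<lambda>N. ennreal ((cmod (a S p + N p))\<^sup>2)) \<in> borel_measurable (iid_cmat n Mr)" if "p \<in> ?I" for p
        using that r0 by (intro measurable_compose[OF _ measurable_ennreal] borel_measurable_power measurable_compose[OF _ borel_measurable_norm] borel_measurable_add borel_measurable_const cN) auto
      have m2: "(\<lambda>N. ennreal ((cmod (- \<beta> (snd p) * N (fst p, r0) + N p))\<^sup>2)) \<in> borel_measurable (iid_cmat n Mr)" if "p \<in> ?J" for p
        using that r0 by (intro measurable_compose[OF _ measurable_ennreal] borel_measurable_power measurable_compose[OF _ borel_measurable_norm] borel_measurable_add borel_measurable_times borel_measurable_const cN) auto
      show ?thesis
        by (subst nn_integral_add, intro borel_measurable_sum borel_measurable_times_ennreal measurable_const m1, simp, assumption,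
            intro borel_measurable_sum borel_measurable_times_ennreal measurable_const m2, simp, assumption,
            subst (1 2) nn_integral_sum, intro borel_measurable_times_ennreal measurable_const m2, simp, assumption,
            intro borel_measurable_times_ennreal measurable_const m1, simp, assumption,
            intro arg_cong2[where f="(+)"] sum.cong refl nn_integral_cmult m1 m2)
    qed
    also have "\<dots> \<le> (\<Sum>p\<in>?I. ennreal (1 / w) * ennreal ((cmod (a S p))\<^sup>2 + 1)) + (\<Sum>p\<in>?J. ennreal (1 / 2) * ennreal 2)"
    proof (intro add_mono sum_mono mult_left_mono)
      fix p assume p: "p \<in> ?I"
      then show "(\<integral>\<^sup>+N. ennreal ((cmod (a S p + N p))\<^sup>2) \<partial>iid_cmat n Mr) \<le> ennreal ((cmod (a S p))\<^sup>2 + 1)"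
        unfolding iid_cmat_def using r0 by (subst nn_integral_cgauss_component_square) auto
    next
      fix p assume p: "p \<in> ?J"
      have "(\<integral>\<^sup>+N. ennreal ((cmod (- \<beta> (snd p) * N (fst p, r0) + N p))\<^sup>2) \<partial>iid_cmat n Mr)
        = (\<integral>\<^sup>+N. ennreal ((cmod (- \<beta> (snd p) * N (fst p, r0)))\<^sup>2) \<partial>iid_cmat n Mr) + 1"
        unfolding iid_cmat_def
        by (rule nn_integral_PiM_cgauss_square)
           (use p r0 in \<open>auto intro!: borel_measurable_times borel_measurable_uminus measurable_component_singleton\<close>)
      also have "\<dots> \<le> (\<integral>\<^sup>+N. ennreal ((cmod (0 + N (fst p, r0)))\<^sup>2) \<partial>iid_cmat n Mr) + 1"
        using \<beta>[of "snd p"] p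
        by (intro add_mono nn_integral_mono ennreal_leI power_mono) (auto simp: norm_mult intro: mult_left_le_one_le)
      also have "\<dots> = ennreal ((cmod 0)\<^sup>2 + 1) + 1"
        unfolding iid_cmat_def using p r0 by (subst nn_integral_cgauss_component_square) auto
      also have "\<dots> = ennreal 2" by (simp flip: ennreal_plus ennreal_1)
      finally show "(\<integral>\<^sup>+N. ennreal ((cmod (- \<beta> (snd p) * N (fst p, r0) + N p))\<^sup>2) \<partial>iid_cmat n Mr) \<le> ennreal 2" .
    qed auto
    also have "\<dots> = ennreal (1 / w * (\<Sum>p\<in>?I. (cmod (a S p))\<^sup>2 + 1) + real (n * (Mr - 1)))"
    proof -
      have "(\<Sum>p\<in>?J. ennreal (1 / 2) * ennreal 2) = ennreal (real (n * (Mr - 1)))"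
        using r0 by (subst sum_ennreal_cmult) (auto simp: card_cartesian_product)
      moreover have "(\<Sum>p\<in>?I. ennreal (1 / w) * ennreal ((cmod (a S p))\<^sup>2 + 1)) = ennreal (1 / w * (\<Sum>p\<in>?I. (cmod (a S p))\<^sup>2 + 1))"
        using w1 by (subst sum_ennreal_cmult) (auto simp: sum_distrib_left)
      ultimately show ?thesis using w1 by (simp add: ennreal_plus[symmetric] sum_nonneg del: ennreal_plus)
    qed
    also have "\<dots> \<le> ennreal (1 / w * (real n + \<rho> * h / real Mt * (\<Sum>i<n. \<Sum>t<Mt. (cmod (f S (i,t)))\<^sup>2)) + real (n * (Mr - 1)))"
    proof -
      have "(cmod (a S (i, r0)))\<^sup>2 \<le> \<rho> * h / real Mt * (\<Sum>t<Mt. (cmod (f S (i,t)))\<^sup>2)" for i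
      proof -
        have "(cmod (a S (i, r0)))\<^sup>2 = \<rho> / real Mt * (cmod (\<Sum>t<Mt. H (r0, t) * f S (i, t)))\<^sup>2"
          using \<rho> by (simp add: a_def norm_mult power_mult_distrib)
        also have "\<dots> \<le> \<rho> / real Mt * (h * (\<Sum>t<Mt. (cmod (f S (i,t)))\<^sup>2))"
          unfolding h_def using \<rho> by (intro mult_left_mono norm_square_sum_le) auto
        finally show ?thesis by simp
      qed
      then have "(\<Sum>i<n. (cmod (a S (i, r0)))\<^sup>2) \<le> (\<Sum>i<n. \<rho> * h / real Mt * (\<Sum>t<Mt. (cmod (f S (i,t)))\<^sup>2))"
        by (intro sum_mono)
      moreover have "(\<Sum>p\<in>?I. (cmod (a S p))\<^sup>2 + 1) = (\<Sum>i<n. (cmod (a S (i, r0)))\<^sup>2) + real n"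
        by (simp add: sum.cartesian_product[symmetric] sum.distrib) (simp add: sum.cartesian_product')
      ultimately show ?thesis using w1
        by (intro ennreal_leI add_mono mult_left_mono) (auto simp: sum_distrib_left)
    qed
    finally show ?thesis .
  qed
  have "(\<integral>\<^sup>+S. \<integral>\<^sup>+N. ennreal (out_quad n Mr r0 \<beta> w (chan_out Mt Mr n \<rho> H (f S) N)) \<partial>iid_cmat n Mr \<partial>iid_cvec m)
    \<le> (\<integral>\<^sup>+S. ennreal (real n / w + real (n * (Mr - 1))) + ennreal (\<rho> * h / real Mt / w) * ennreal (\<Sum>i<n. \<Sum>t<Mt. (cmod (f S (i,t)))\<^sup>2) \<partial>iid_cvec m)"
    using w1 \<rho> h0 by (intro nn_integral_mono order_trans[OF inner]) (simp add: sum_nonneg algebra_simps flip: ennreal_mult ennreal_plus)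
  also have "\<dots> = ennreal (real n / w + real (n * (Mr - 1))) + ennreal (\<rho> * h / real Mt / w) * (\<integral>\<^sup>+S. ennreal (\<Sum>i<n. \<Sum>t<Mt. (cmod (f S (i,t)))\<^sup>2) \<partial>iid_cvec m)"
  proof -
    have "(\<lambda>S. ennreal (\<Sum>i<n. \<Sum>t<Mt. (cmod (f S (i,t)))\<^sup>2)) \<in> borel_measurable (iid_cvec m)"
      by (intro measurable_compose[OF _ measurable_ennreal] borel_measurable_sum am) auto
    then show ?thesis by (simp add: nn_integral_add nn_integral_cmult PS.emeasure_space_1)
  qed
  also have "\<dots> \<le> ennreal (real n / w + real (n * (Mr - 1))) + ennreal (\<rho> * h / real Mt / w) * ennreal (real n * real Mt)"
    by (intro add_mono mult_left_mono pow) auto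
  also have "\<dots> = ennreal (real n / w + real (n * (Mr - 1)) + \<rho> * h * real n / w)"
    using w1 \<rho> h0 Mt by (simp flip: ennreal_mult ennreal_plus)
  also have "real n / w + real (n * (Mr - 1)) + \<rho> * h * real n / w = real (n * Mr)"
  proof -
    have "real n / w + \<rho> * h * real n / w = real n * (1 + \<rho> * h) / w" by (simp add: add_divide_distrib[symmetric] algebra_simps)
    also have "\<dots> = real n" using w1 by (simp add: w h_def)
    finally have "real n / w + real (n * (Mr - 1)) + \<rho> * h * real n / w = real n + real (n * (Mr - 1))" by linarith
    also have "\<dots> = real (n * Mr)" using r0 by (cases Mr) (auto simp: algebra_simps)
    finally show ?thesis .
  qed
  finally show ?thesis .
qed

section \<open>Averaging the converse over fading and channel\<close>

text \<open>Moves the channel and the side information gain outermost, since the rate inequality is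
  applied for each fixed value of both.\<close>

lemma nn_integral_reorder5:
  assumes "prob_space A" "prob_space B" "prob_space C" "prob_space D" "prob_space E"
    and [measurable]: "f \<in> borel_measurable (A \<Otimes>\<^sub>M (B \<Otimes>\<^sub>M (C \<Otimes>\<^sub>M (D \<Otimes>\<^sub>M E))))"
  shows "(\<integral>\<^sup>+\<omega>. f \<omega> \<partial>(A \<Otimes>\<^sub>M (B \<Otimes>\<^sub>M (C \<Otimes>\<^sub>M (D \<Otimes>\<^sub>M E)))))
    = (\<integral>\<^sup>+H. \<integral>\<^sup>+G. \<integral>\<^sup>+S. \<integral>\<^sup>+N. \<integral>\<^sup>+Z. f (S, H, N, G, Z) \<partial>E \<partial>C \<partial>A \<partial>D \<partial>B)"
proof -
  interpret A: prob_space A by fact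
  interpret B: prob_space B by fact
  interpret C: prob_space C by fact
  interpret D: prob_space D by fact
  interpret E: prob_space E by fact
  interpret DE: prob_space "D \<Otimes>\<^sub>M E" by (intro prob_space_pair assms)
  interpret CDE: prob_space "C \<Otimes>\<^sub>M (D \<Otimes>\<^sub>M E)" by (intro prob_space_pair assms)
  interpret BCDE: prob_space "B \<Otimes>\<^sub>M (C \<Otimes>\<^sub>M (D \<Otimes>\<^sub>M E))" by (intro prob_space_pair assms)
  interpret AB: pair_sigma_finite A B ..
  interpret CD: pair_sigma_finite C D ..
  interpret AD: pair_sigma_finite A D ..
  have "(\<integral>\<^sup>+\<omega>. f \<omega> \<partial>(A \<Otimes>\<^sub>M (B \<Otimes>\<^sub>M (C \<Otimes>\<^sub>M (D \<Otimes>\<^sub>M E))))) = (\<integral>\<^sup>+S. \<integral>\<^sup>+H. \<integral>\<^sup>+N. \<integral>\<^sup>+G. \<integral>\<^sup>+Z. f (S, H, N, G, Z) \<partial>E \<partial>D \<partial>C \<partial>B \<partial>A)"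
    by (simp add: BCDE.nn_integral_fst[symmetric] CDE.nn_integral_fst[symmetric] DE.nn_integral_fst[symmetric] E.nn_integral_fst[symmetric] cong: nn_integral_cong)
  also have "\<dots> = (\<integral>\<^sup>+H. \<integral>\<^sup>+S. \<integral>\<^sup>+N. \<integral>\<^sup>+G. \<integral>\<^sup>+Z. f (S, H, N, G, Z) \<partial>E \<partial>D \<partial>C \<partial>A \<partial>B)"
    by (rule AB.Fubini'[symmetric]) measurable
  also have "\<dots> = (\<integral>\<^sup>+H. \<integral>\<^sup>+S. \<integral>\<^sup>+G. \<integral>\<^sup>+N. \<integral>\<^sup>+Z. f (S, H, N, G, Z) \<partial>E \<partial>C \<partial>D \<partial>A \<partial>B)"
    by (rule nn_integral_cong, rule nn_integral_cong, rule CD.Fubini'[symmetric]) measurable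
  also have "\<dots> = (\<integral>\<^sup>+H. \<integral>\<^sup>+G. \<integral>\<^sup>+S. \<integral>\<^sup>+N. \<integral>\<^sup>+Z. f (S, H, N, G, Z) \<partial>E \<partial>C \<partial>A \<partial>D \<partial>B)"
    by (rule nn_integral_cong, rule AD.Fubini'[symmetric]) measurable
  finally show ?thesis .
qed

definition frob :: "nat \<Rightarrow> nat \<Rightarrow> cmat \<Rightarrow> real" where
  "frob Mt Mr H = (\<Sum>p\<in>{..<Mr} \<times> {..<Mt}. (cmod (H p))\<^sup>2)"

lemma frob_nonneg: "0 \<le> frob Mt Mr H"
  unfolding frob_def by (intro sum_nonneg) auto

text \<open>Bound on the information per source sample in nats. The term
  \<open>real Mr * ln 2\<close> pays for describing the other antennas with variance 2, rounded up
  from \<open>Mr - 1\<close> to \<open>Mr\<close> antennas.\<close>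

definition rate_of :: "nat \<Rightarrow> nat \<Rightarrow> real \<Rightarrow> real \<Rightarrow> cmat \<Rightarrow> real" where
  "rate_of Mt Mr b \<rho> H = b * (ln (1 + \<rho> * frob Mt Mr H) + real Mr * ln 2)"

text \<open>For a fixed channel the conditional distortion, as a function of the side information
  gain, is a profile that obeys the ladder inequality: \<open>gibbs_ladder\<close> supplies the
  hypothesis of \<open>ladder_average_ge\<close>.\<close>

lemma exp_dist_ge_channel_average:
  assumes adm: "admissible Mt Mr b m n f g" and m: "1 \<le> m"
    and M: "1 \<le> Mt" "1 \<le> Mr" "min Mt Mr = 1" and \<rho>: "0 < \<rho>" and \<rho>s: "0 < \<rho>s"
  shows "(\<integral>\<^sup>+H. ennreal (1 / 2000 * min (1 / \<rho>s) (min 1 (exp (- rate_of Mt Mr b \<rho> H)))) \<partial>iid_cmat Mr Mt) \<le> exp_dist Mt Mr \<rho> \<rho>s m n f g"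
proof -
  note c = admissible_code_measurable[OF adm]
  let ?J = "joint_space Mt Mr m n"
  define F where "F \<omega> = (\<Sum>j<m. ennreal ((cmod (fst \<omega> j - recon Mt Mr \<rho> \<rho>s m n f g \<omega> j))\<^sup>2)) / ennreal (real m)" for \<omega>
  have em: "(\<lambda>\<omega>. ennreal ((cmod (fst \<omega> j - recon Mt Mr \<rho> \<rho>s m n f g \<omega> j))\<^sup>2)) \<in> borel_measurable ?J" if "j < m" for j
    using measurable_err[OF c that] by (intro measurable_compose[OF _ measurable_ennreal])
  have F[measurable]: "F \<in> borel_measurable ?J"
    unfolding F_def by (intro borel_measurable_divide_ennreal borel_measurable_sum em borel_measurable_const) auto
  have "exp_dist Mt Mr \<rho> \<rho>s m n f g = (\<integral>\<^sup>+\<omega>. F \<omega> \<partial>?J)"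
    unfolding exp_dist_def F_def using m
    by (intro nn_integral_cong) (auto simp: distortion_def recon_def divide_ennreal sum_nonneg)
  also have "\<dots> = (\<integral>\<^sup>+H. \<integral>\<^sup>+G. \<integral>\<^sup>+S. \<integral>\<^sup>+N. \<integral>\<^sup>+Z. F (S, H, N, G, Z) \<partial>iid_cvec m \<partial>iid_cmat n Mr \<partial>iid_cvec m \<partial>cgauss \<partial>iid_cmat Mr Mt)"
    unfolding joint_space_def
    by (rule nn_integral_reorder5) (use F in \<open>auto simp: joint_space_def intro: prob_space_iid_cvec prob_space_iid_cmat prob_space_cgauss\<close>)
  also have "(\<integral>\<^sup>+H. ennreal (1 / 2000 * min (1 / \<rho>s) (min 1 (exp (- rate_of Mt Mr b \<rho> H)))) \<partial>iid_cmat Mr Mt) \<le> \<dots>"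
  proof (rule nn_integral_mono)
    fix H assume H: "H \<in> space (iid_cmat Mr Mt)"
    define d where "d G = (\<integral>\<^sup>+S. \<integral>\<^sup>+N. \<integral>\<^sup>+Z. F (S, H, N, G, Z) \<partial>iid_cvec m \<partial>iid_cmat n Mr \<partial>iid_cvec m)" for G
    interpret PS: prob_space "iid_cvec m" by (rule prob_space_iid_cvec)
    interpret PN: prob_space "iid_cmat n Mr" by (rule prob_space_iid_cmat)
    have F'[measurable]: "F \<in> borel_measurable (iid_cvec m \<Otimes>\<^sub>M (iid_cmat Mr Mt \<Otimes>\<^sub>M (iid_cmat n Mr \<Otimes>\<^sub>M (cgauss \<Otimes>\<^sub>M iid_cvec m))))"
      using F by (simp add: joint_space_def)
    have d: "d \<in> borel_measurable cgauss" unfolding d_def using H by measurable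
    obtain r0 \<beta> where r0: "r0 < Mr" and \<beta>: "\<And>r. r < Mr \<Longrightarrow> cmod (\<beta> r) \<le> 1"
      and rank: "\<And>r t. r < Mr \<Longrightarrow> t < Mt \<Longrightarrow> H (r, t) = \<beta> r * H (r0, t)"
      using rank_one_rows[OF M, of H] by blast
    define h where "h = (\<Sum>t<Mt. (cmod (H (r0, t)))\<^sup>2)"
    define w where "w = 1 + \<rho> * h"
    have h0: "0 \<le> h" unfolding h_def by (intro sum_nonneg) auto
    have w1: "1 \<le> w" using h0 \<rho> by (simp add: w_def)
    have h_frob: "h \<le> frob Mt Mr H"
    proof -
      have "h = (\<Sum>p\<in>{r0} \<times> {..<Mt}. (cmod (H p))\<^sup>2)"
        unfolding h_def by (simp add: sum.cartesian_product[symmetric] sum.cartesian_product')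
      also have "\<dots> \<le> frob Mt Mr H" unfolding frob_def using r0 by (intro sum_mono2) auto
      finally show ?thesis .
    qed
    have "ennreal (1 / 2000 * min (1 / \<rho>s) (min 1 (exp (- rate_of Mt Mr b \<rho> H)))) \<le> (\<integral>\<^sup>+G. d G \<partial>cgauss)"
    proof (rule ladder_average_ge[OF _ \<rho>s])
      show "d \<in> borel_measurable borel" using d by (simp add: measurable_cong_sets[OF sets_cgauss refl])
      fix K :: nat and G :: "nat \<Rightarrow> complex" and v :: "nat \<Rightarrow> real"
      assume v: "\<And>k. k \<le> K \<Longrightarrow> 0 \<le> v k" "\<And>k. k \<le> K \<Longrightarrow> d (G k) \<le> ennreal (v k)" "0 < v K" "v K \<le> 1"
      \<comment> \<open>With the channel and the gain of rung \<open>k\<close> fixed, the decoder is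
        a function of channel output and side information only. The complex gain itself enters
        through \<open>cc\<close>, as the rate inequality allows arbitrary complex
        coefficients.\<close>
      define gh where "gh k y t = g y t (restrict H ({..<Mr} \<times> {..<Mt})) ((cmod (G k))\<^sup>2)" for k y t
      define cc where "cc k = complex_of_real (sqrt \<rho>s) * G k" for k
      define a where "a S = (\<lambda>(i,r). complex_of_real (sqrt (\<rho> / real Mt)) * (\<Sum>t<Mt. H (r,t) * f S (i,t)))" for S
      have ch: "(\<lambda>p\<in>{..<n} \<times> {..<Mr}. a S p + N p) = chan_out Mt Mr n \<rho> H (f S) N" for S N
        by (auto simp: chan_out_def a_def fun_eq_iff)
      have so: "(\<lambda>j\<in>{..<m}. cc k * S j + Z j) = side_out m \<rho>s (G k) S Z" for k S Z
        by (auto simp: side_out_def cc_def)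
      have fm: "(\<lambda>S. f S (i, t)) \<in> borel_measurable (PiM {..<m} (\<lambda>_. borel))" if "i < n" "t < Mt" for i t
        using c that by (simp add: code_measurable_def measurable_cong_sets[OF sets_iid_cvec refl])
      have LYe: "exp (real n * (ln w + real (Mr - 1) * ln 2)) = w ^ n * 2 ^ (n * (Mr - 1))"
        using w1 by (simp add: exp_add distrib_left exp_of_nat_mult power_mult[symmetric] flip: mult.assoc of_nat_mult)
      have "real m * ln (1 / v K) \<le> real n * (ln w + real (Mr - 1) * ln 2) + real m * (ln (1 + (cmod (cc 0))\<^sup>2) + (\<Sum>k<K. ln (1 + (cmod (cc (Suc k)))\<^sup>2 * v k)))"
      proof (rule gibbs_ladder[where a=a and gh=gh and QY="out_quad n Mr r0 \<beta> w" and n=n and Mr=Mr])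
        show "(\<lambda>S. a S p) \<in> borel_measurable (PiM {..<m} (\<lambda>_. borel))" if "p \<in> {..<n} \<times> {..<Mr}" for p
          using that fm by (cases p) (auto simp: a_def intro!: borel_measurable_times borel_measurable_sum)
        show "(\<lambda>(y, t). gh k y t j) \<in> borel_measurable (PiM ({..<n} \<times> {..<Mr}) (\<lambda>_. borel) \<Otimes>\<^sub>M PiM {..<m} (\<lambda>_. borel))" if "j < m" for k j
        proof -
          have "(\<lambda>x. (fst x, snd x, restrict H ({..<Mr} \<times> {..<Mt}), (cmod (G k))\<^sup>2)) \<in> measurable (PiM ({..<n} \<times> {..<Mr}) (\<lambda>_. borel) \<Otimes>\<^sub>M PiM {..<m} (\<lambda>_. borel)) (obs_space Mt Mr m n)"
            unfolding obs_space_def by (intro measurable_Pair measurable_fst measurable_snd measurable_const) (auto simp: space_PiM)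
          moreover have "(\<lambda>(y,tt,h,\<gamma>). g y tt h \<gamma> j) \<in> borel_measurable (obs_space Mt Mr m n)"
            using c that by (auto simp: code_measurable_def)
          ultimately show ?thesis by (auto dest: measurable_compose simp: gh_def case_prod_beta')
        qed
        show "out_quad n Mr r0 \<beta> w \<in> borel_measurable (PiM ({..<n} \<times> {..<Mr}) (\<lambda>_. borel))" by (rule measurable_out_quad[OF r0])
        show "0 \<le> out_quad n Mr r0 \<beta> w y" for y using w1 by (intro out_quad_nonneg) auto
        show "(\<integral>\<^sup>+y. ennreal (exp (- out_quad n Mr r0 \<beta> w y)) \<partial>PiM ({..<n} \<times> {..<Mr}) (\<lambda>_. lscale)) \<le> ennreal (exp (real n * (ln w + real (Mr - 1) * ln 2)))"
          using w1 by (subst nn_integral_out_quad[OF r0]) (auto simp only: LYe)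
        show "0 \<le> real n * (ln w + real (Mr - 1) * ln 2)" using w1 by (intro mult_nonneg_nonneg add_nonneg_nonneg) auto
        show "(\<integral>\<^sup>+S. \<integral>\<^sup>+N. ennreal (out_quad n Mr r0 \<beta> w (\<lambda>p\<in>{..<n} \<times> {..<Mr}. a S p + N p)) \<partial>iid_cmat n Mr \<partial>iid_cvec m) \<le> ennreal (real (n * Mr))"
          unfolding ch
        proof (rule nn_integral_out_quad_output[where Mt=Mt and H=H and m=m and f=f and \<rho>=\<rho> and \<beta>=\<beta> and ?r0.0=r0])
          show "r0 < Mr" "0 < \<rho>" "1 \<le> Mt" by (fact r0 \<rho> M(1))+
          show "H (r, t) = \<beta> r * H (r0, t)" if "r < Mr" "t < Mt" for r t using that by (rule rank)
          show "cmod (\<beta> r) \<le> 1" if "r < Mr" for r using that by (rule \<beta>)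
          show "(\<lambda>S. f S (i, t)) \<in> borel_measurable (iid_cvec m)" if "i < n" "t < Mt" for i t
            using c that by (simp add: code_measurable_def)
          show "(\<integral>\<^sup>+ S. ennreal (\<Sum>i<n. \<Sum>t<Mt. (cmod (f S (i,t)))\<^sup>2) \<partial>iid_cvec m) \<le> ennreal (real n * real Mt)"
            using adm by (simp add: admissible_def)
        qed (auto simp: w_def h_def)
        fix k assume k: "k \<le> K"
        define er where "er j = (\<lambda>x. ennreal ((cmod (fst (fst x) j - recon Mt Mr \<rho> \<rho>s m n f g (fst (fst x), H, snd (fst x), G k, snd x) j))\<^sup>2))" for j
        have erm: "er j \<in> borel_measurable ((iid_cvec m \<Otimes>\<^sub>M iid_cmat n Mr) \<Otimes>\<^sub>M iid_cvec m)" if "j < m" for j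
        proof -
          have "(\<lambda>x. (fst (fst x), H, snd (fst x), G k, snd x)) \<in> measurable ((iid_cvec m \<Otimes>\<^sub>M iid_cmat n Mr) \<Otimes>\<^sub>M iid_cvec m) ?J"
            unfolding joint_space_def using H by measurable
          from measurable_compose[OF this em[OF that]] show ?thesis by (simp add: er_def)
        qed
        let ?E = "\<lambda>f. \<integral>\<^sup>+S. \<integral>\<^sup>+N. \<integral>\<^sup>+Z. f ((S, N), Z) \<partial>iid_cvec m \<partial>iid_cmat n Mr \<partial>iid_cvec m"
        have E: "?E f = (\<integral>\<^sup>+x. f x \<partial>((iid_cvec m \<Otimes>\<^sub>M iid_cmat n Mr) \<Otimes>\<^sub>M iid_cvec m))"
          if [measurable]: "f \<in> borel_measurable ((iid_cvec m \<Otimes>\<^sub>M iid_cmat n Mr) \<Otimes>\<^sub>M iid_cvec m)" for f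
          by (simp add: PS.nn_integral_fst[symmetric] PN.nn_integral_fst[symmetric] case_prod_beta')
        have "ennreal (real m) * d (G k) = (\<Sum>j<m. ?E (er j))"
        proof -
          have sm: "(\<lambda>x. (\<Sum>j<m. er j x)) \<in> borel_measurable ((iid_cvec m \<Otimes>\<^sub>M iid_cmat n Mr) \<Otimes>\<^sub>M iid_cvec m)"
            using erm by (intro borel_measurable_sum) auto
          have "d (G k) = ?E (\<lambda>x. (\<Sum>j<m. er j x) / ennreal (real m))"
            by (simp add: d_def F_def er_def)
          also have "\<dots> = (\<integral>\<^sup>+x. (\<Sum>j<m. er j x) / ennreal (real m) \<partial>((iid_cvec m \<Otimes>\<^sub>M iid_cmat n Mr) \<Otimes>\<^sub>M iid_cvec m))"
            using sm by (intro E borel_measurable_divide_ennreal borel_measurable_const)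
          also have "\<dots> = (\<Sum>j<m. ?E (er j)) / ennreal (real m)"
            using erm by (subst nn_integral_divide[OF sm], simp, subst nn_integral_sum) (auto simp: E)
          finally have "d (G k) = (\<Sum>j<m. ?E (er j)) / ennreal (real m)" .
          then show ?thesis using m
            by (simp add: ennreal_times_divide ennreal_mult_divide_eq mult.commute[of "ennreal (real m)"])
        qed
        moreover have "(\<Sum>j<m. ?E (er j)) = (\<Sum>j<m. \<integral>\<^sup>+S. \<integral>\<^sup>+N. \<integral>\<^sup>+Z. ennreal ((cmod (S j - gh k (\<lambda>p\<in>{..<n} \<times> {..<Mr}. a S p + N p) (\<lambda>j\<in>{..<m}. cc k * S j + Z j) j))\<^sup>2)
          \<partial>iid_cvec m \<partial>iid_cmat n Mr \<partial>iid_cvec m)"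
          unfolding ch so by (simp add: er_def recon_def gh_def)
        moreover have "ennreal (real m) * d (G k) \<le> ennreal (real m * v k)"
          using v(1,2)[OF k] by (auto simp: ennreal_mult intro!: mult_left_mono)
        ultimately show "(\<Sum>j<m. \<integral>\<^sup>+S. \<integral>\<^sup>+N. \<integral>\<^sup>+Z. ennreal ((cmod (S j - gh k (\<lambda>p\<in>{..<n} \<times> {..<Mr}. a S p + N p) (\<lambda>j\<in>{..<m}. cc k * S j + Z j) j))\<^sup>2)
          \<partial>iid_cvec m \<partial>iid_cmat n Mr \<partial>iid_cvec m) \<le> ennreal (real m * v k)" by simp
      qed (use v in auto)
      \<comment> \<open>The bandwidth ratio enters here only, through
        \<open>real n \<le> real m * b\<close>; afterwards the bound no longer mentions the
        code.\<close>
      moreover have "real n * (ln w + real (Mr - 1) * ln 2) \<le> real m * rate_of Mt Mr b \<rho> H"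
      proof -
        have "real n * (ln w + real (Mr - 1) * ln 2) \<le> (real m * b) * (ln (1 + \<rho> * frob Mt Mr H) + real Mr * ln 2)"
        proof (intro mult_mono add_mono)
          show "real n \<le> real m * b" using adm by (simp add: admissible_def)
          then show "0 \<le> real m * b" by linarith
          show "ln w \<le> ln (1 + \<rho> * frob Mt Mr H)"
            using w1 h_frob \<rho> by (intro ln_mono) (auto simp: w_def intro!: mult_left_mono)
        qed (use w1 in auto)
        then show ?thesis by (simp add: rate_of_def mult.assoc)
      qed
      ultimately have "real m * ln (1 / v K) \<le> real m * (rate_of Mt Mr b \<rho> H + (ln (1 + (cmod (cc 0))\<^sup>2) + (\<Sum>k<K. ln (1 + (cmod (cc (Suc k)))\<^sup>2 * v k))))"
        by (simp add: distrib_left)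
      then have "ln (1 / v K) \<le> rate_of Mt Mr b \<rho> H + (ln (1 + (cmod (cc 0))\<^sup>2) + (\<Sum>k<K. ln (1 + (cmod (cc (Suc k)))\<^sup>2 * v k)))"
        using m by (subst (asm) mult_le_cancel_left_pos) auto
      moreover have "(cmod (cc k))\<^sup>2 = \<rho>s * (cmod (G k))\<^sup>2" for k
        using \<rho>s by (simp add: cc_def norm_mult power_mult_distrib)
      ultimately show "ln (1 / v K) \<le> rate_of Mt Mr b \<rho> H + ln (1 + \<rho>s * (cmod (G 0))\<^sup>2) + (\<Sum>k<K. ln (1 + \<rho>s * (cmod (G (Suc k)))\<^sup>2 * v k))"
        by simp
    qed
    then show "ennreal (1 / 2000 * min (1 / \<rho>s) (min 1 (exp (- rate_of Mt Mr b \<rho> H))))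
      \<le> (\<integral>\<^sup>+G. \<integral>\<^sup>+S. \<integral>\<^sup>+N. \<integral>\<^sup>+Z. F (S, H, N, G, Z) \<partial>iid_cvec m \<partial>iid_cmat n Mr \<partial>iid_cvec m \<partial>cgauss)"
      by (simp add: d_def)
  qed
  finally show ?thesis .
qed

text \<open>A deep fade: independently, each of the \<open>Mr * Mt\<close> entries has squared
  modulus below \<open>a\<close> with probability at least \<open>a / 100\<close>, and on this event
  the squared norm is at most \<open>Mr * Mt * a\<close>. The exponent is the diversity of the
  channel.\<close>

lemma channel_average_ge:
  assumes a: "0 < a" "a \<le> 1" and \<phi>: "\<And>H. frob Mt Mr H \<le> real (Mr * Mt) * a \<Longrightarrow> \<phi>0 \<le> \<phi> H" and \<phi>0: "0 \<le> \<phi>0"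
  shows "ennreal (\<phi>0 * (a / 100) ^ (Mr * Mt)) \<le> (\<integral>\<^sup>+H. ennreal (\<phi> H) \<partial>iid_cmat Mr Mt)"
proof -
  let ?I = "{..<Mr} \<times> {..<Mt}"
  let ?B = "{z. a / 4 \<le> (cmod z)\<^sup>2 \<and> (cmod z)\<^sup>2 < a}"
  let ?A = "Pi\<^sub>E ?I (\<lambda>_. ?B)"
  have B: "?B \<in> sets borel" by measurable
  have A: "?A \<in> sets (iid_cmat Mr Mt)"
    unfolding iid_cmat_def using B by (intro sets_PiM_I_finite) auto
  have "ennreal (\<phi>0 * (a / 100) ^ (Mr * Mt)) = ennreal \<phi>0 * (\<Prod>p\<in>?I. ennreal (a / 100))"
    using a \<phi>0 by (simp add: card_cartesian_product ennreal_mult ennreal_power[symmetric])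
  also have "\<dots> \<le> ennreal \<phi>0 * (\<Prod>p\<in>?I. emeasure cgauss ?B)"
    by (intro mult_left_mono prod_mono_ennreal cgauss_annulus_ge a) auto
  also have "(\<Prod>p\<in>?I. emeasure cgauss ?B) = emeasure (iid_cmat Mr Mt) ?A"
    unfolding iid_cmat_def using B by (subst PG.emeasure_PiM) auto
  also have "ennreal \<phi>0 * emeasure (iid_cmat Mr Mt) ?A = (\<integral>\<^sup>+H. ennreal \<phi>0 * indicator ?A H \<partial>iid_cmat Mr Mt)"
    using A by (simp add: nn_integral_cmult_indicator)
  also have "\<dots> \<le> (\<integral>\<^sup>+H. ennreal (\<phi> H) \<partial>iid_cmat Mr Mt)"
  proof (rule nn_integral_mono)
    fix H
    show "ennreal \<phi>0 * indicator ?A H \<le> ennreal (\<phi> H)"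
    proof (cases "H \<in> ?A")
      case True
      have "frob Mt Mr H \<le> (\<Sum>p\<in>?I. a)" unfolding frob_def using True by (intro sum_mono) (auto simp: PiE_iff less_imp_le)
      then have "\<phi>0 \<le> \<phi> H" by (intro \<phi>) simp
      then show ?thesis using True by (simp add: ennreal_leI)
    qed auto
  qed
  finally show ?thesis .
qed

text \<open>The value of the ladder bound on the deep-fade event of level \<open>a\<close>, times
  the lower bound for the probability of that event. The level stays free and becomes
  \<open>\<rho> powr (- \<alpha>)\<close> later.\<close>

definition converse_bound :: "nat \<Rightarrow> nat \<Rightarrow> real \<Rightarrow> real \<Rightarrow> real \<Rightarrow> real \<Rightarrow> real" where
  "converse_bound Mt Mr b \<rho> \<rho>s a = 1 / 2000 * min (1 / \<rho>s) (min 1 (exp (- (b * (ln (1 + \<rho> * (real (Mr * Mt) * a)) + real Mr * ln 2))))) * (a / 100) ^ (Mr * Mt)"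

lemma channel_average_ge_converse_bound:
  assumes a: "0 < a" "a \<le> 1" and "0 \<le> b" "0 < \<rho>" "0 < \<rho>s"
  shows "ennreal (converse_bound Mt Mr b \<rho> \<rho>s a) \<le> (\<integral>\<^sup>+H. ennreal (1 / 2000 * min (1 / \<rho>s) (min 1 (exp (- rate_of Mt Mr b \<rho> H)))) \<partial>iid_cmat Mr Mt)"
  unfolding converse_bound_def
proof (rule channel_average_ge[OF a])
  fix H assume H: "frob Mt Mr H \<le> real (Mr * Mt) * a"
  have "ln (1 + \<rho> * frob Mt Mr H) \<le> ln (1 + \<rho> * (real (Mr * Mt) * a))"
    using assms H frob_nonneg[of Mt Mr H] by (intro ln_mono) (auto intro: add_pos_nonneg mult_nonneg_nonneg mult_left_mono)
  then have "rate_of Mt Mr b \<rho> H \<le> b * (ln (1 + \<rho> * (real (Mr * Mt) * a)) + real Mr * ln 2)"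
    unfolding rate_of_def using assms by (intro mult_left_mono) auto
  then show "1 / 2000 * min (1 / \<rho>s) (min 1 (exp (- (b * (ln (1 + \<rho> * (real (Mr * Mt) * a)) + real Mr * ln 2))))) \<le> 1 / 2000 * min (1 / \<rho>s) (min 1 (exp (- rate_of Mt Mr b \<rho> H)))"
    by (intro mult_left_mono min.mono order_refl) auto
qed (use assms in auto)

lemma ED_star_ge_converse_bound:
  assumes M: "1 \<le> Mt" "1 \<le> Mr" "min Mt Mr = 1" and "0 \<le> b" "0 < \<rho>" "0 < \<rho>s" "0 < a" "a \<le> 1"
  shows "converse_bound Mt Mr b \<rho> \<rho>s a \<le> ED_star Mt Mr b \<rho> \<rho>s"
  unfolding ED_star_eq_INF[OF assms(4)]
proof (rule cINF_greatest)
  fix m :: nat assume "m \<in> {1..}"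
  then have m: "1 \<le> m" by simp
  have "ennreal (converse_bound Mt Mr b \<rho> \<rho>s a) \<le> opt_dist Mt Mr b \<rho> \<rho>s m"
    unfolding opt_dist_def
  proof (rule INF_greatest, clarify)
    fix n f g assume adm: "admissible Mt Mr b m n f g"
    show "ennreal (converse_bound Mt Mr b \<rho> \<rho>s a) \<le> exp_dist Mt Mr \<rho> \<rho>s m n f g"
      by (rule order_trans[OF channel_average_ge_converse_bound[OF assms(7,8,4,5,6)] exp_dist_ge_channel_average[OF adm m M assms(5,6)]])
  qed
  moreover have "opt_dist Mt Mr b \<rho> \<rho>s m < \<infinity>"
    using opt_dist_le_1[OF assms(4), of Mt Mr \<rho> \<rho>s m] by (rule le_less_trans) simp
  moreover have "0 \<le> converse_bound Mt Mr b \<rho> \<rho>s a" using assms by (auto simp: converse_bound_def intro!: mult_nonneg_nonneg)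
  ultimately show "converse_bound Mt Mr b \<rho> \<rho>s a \<le> enn2real (opt_dist Mt Mr b \<rho> \<rho>s m)"
    by (metis enn2real_ennreal enn2real_mono infinity_ennreal_def)
qed auto

section \<open>The converse for BS-LD\<close>

text \<open>The matrix determinant lemma. Two block triangular matrices with identity diagonal
  blocks are multiplied in both orders: one product exposes the outer product, the other the scalar
  product, and the determinants agree.\<close>

lemma det_one_plus_outer_product:
  fixes u v :: "nat \<Rightarrow> complex"
  shows "Determinant.det (Matrix.mat n n (\<lambda>(i,j). (if i = j then 1 else 0) + u i * v j)) = 1 + (\<Sum>i<n. v i * u i)"
proof -
  let ?U = "Matrix.mat n 1 (\<lambda>(i,j). u i)" and ?V = "Matrix.mat 1 n (\<lambda>(i,j). v j)"
  let ?A = "four_block_mat (1\<^sub>m 1) (- ?V) ?U (1\<^sub>m n)" and ?B = "four_block_mat (1\<^sub>m 1) ?V (0\<^sub>m n 1) (1\<^sub>m n)"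
  have dims: "?U \<in> carrier_mat n 1" "?V \<in> carrier_mat 1 n" by auto
  have A: "?A \<in> carrier_mat (1 + n) (1 + n)" and B: "?B \<in> carrier_mat (1 + n) (1 + n)" by auto
  have UV: "?U * ?V + 1\<^sub>m n = Matrix.mat n n (\<lambda>(i,j). (if i = j then 1 else 0) + u i * v j)"
    by (rule eq_matI) (auto simp: scalar_prod_def)
  have VU: "1\<^sub>m 1 + ?V * ?U = Matrix.mat 1 1 (\<lambda>_. 1 + (\<Sum>i<n. v i * u i))"
    by (rule eq_matI) (auto simp: scalar_prod_def atLeast0LessThan)
  have AB: "?A * ?B = four_block_mat (1\<^sub>m 1) (0\<^sub>m 1 n) ?U (?U * ?V + 1\<^sub>m n)"
  proof -
    have "?A * ?B = four_block_mat (1\<^sub>m 1 * 1\<^sub>m 1 + (- ?V) * 0\<^sub>m n 1) (1\<^sub>m 1 * ?V + (- ?V) * 1\<^sub>m n) (?U * 1\<^sub>m 1 + 1\<^sub>m n * 0\<^sub>m n 1) (?U * ?V + 1\<^sub>m n * 1\<^sub>m n)"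
      by (rule mult_four_block_mat) auto
    moreover have "1\<^sub>m 1 * 1\<^sub>m 1 + (- ?V) * 0\<^sub>m n 1 = (1\<^sub>m 1 :: complex mat)" by (rule eq_matI) auto
    moreover have "1\<^sub>m 1 * ?V + (- ?V) * 1\<^sub>m n = 0\<^sub>m 1 n" using dims by (auto intro!: eq_matI)
    moreover have "?U * 1\<^sub>m 1 + 1\<^sub>m n * 0\<^sub>m n 1 = ?U" using dims by (auto intro!: eq_matI)
    ultimately show ?thesis by simp
  qed
  have BA: "?B * ?A = four_block_mat (1\<^sub>m 1 + ?V * ?U) (0\<^sub>m 1 n) ?U (1\<^sub>m n)"
  proof -
    have "?B * ?A = four_block_mat (1\<^sub>m 1 * 1\<^sub>m 1 + ?V * ?U) (1\<^sub>m 1 * (- ?V) + ?V * 1\<^sub>m n) (0\<^sub>m n 1 * 1\<^sub>m 1 + 1\<^sub>m n * ?U) (0\<^sub>m n 1 * (- ?V) + 1\<^sub>m n * 1\<^sub>m n)"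
      by (rule mult_four_block_mat) auto
    moreover have "1\<^sub>m 1 * (- ?V) + ?V * 1\<^sub>m n = 0\<^sub>m 1 n" using dims by (auto intro!: eq_matI)
    moreover have "0\<^sub>m n 1 * 1\<^sub>m 1 + 1\<^sub>m n * ?U = ?U" using dims by (auto intro!: eq_matI)
    moreover have "1\<^sub>m 1 * 1\<^sub>m 1 = (1\<^sub>m 1 :: complex mat)" by simp
    moreover have "0\<^sub>m n 1 * (- ?V) + 1\<^sub>m n * 1\<^sub>m n = (1\<^sub>m n :: complex mat)" using dims by (auto intro!: eq_matI)
    ultimately show ?thesis by (simp only:)
  qed
  have "Determinant.det (?U * ?V + 1\<^sub>m n) = Determinant.det (?A * ?B)"
    unfolding AB by (subst det_four_block_mat_upper_right_zero[of _ 1 _ n]) auto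
  also have "\<dots> = Determinant.det (?B * ?A)"
    using Determinant.det_mult[OF A B] Determinant.det_mult[OF B A] by simp
  also have "\<dots> = Determinant.det (1\<^sub>m 1 + ?V * ?U)"
    unfolding BA by (subst det_four_block_mat_upper_right_zero[of _ 1 _ n]) auto
  also have "\<dots> = 1 + (\<Sum>i<n. v i * u i)"
    unfolding VU by (subst det_single) auto
  finally show ?thesis unfolding UV .
qed

text \<open>All rows are multiples of one row, so the Gram matrix is an outer product and its
  determinant depends on the channel through the trace only.\<close>

lemma gram_det_eq:
  assumes M: "1 \<le> Mt" "1 \<le> Mr" "min Mt Mr = 1"
  shows "gram_det Mt Mr H x = 1 + x * frob Mt Mr H"
proof -
  obtain r0 \<beta> where rank: "\<And>r t. r < Mr \<Longrightarrow> t < Mt \<Longrightarrow> H (r, t) = \<beta> r * H (r0, t)"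
    using rank_one_rows[OF M, of H] by blast
  define h where "h = (\<Sum>t<Mt. H (r0, t) * cnj (H (r0, t)))"
  have "Matrix.mat Mr Mr (\<lambda>(i,j). (if i = j then 1 else 0) + complex_of_real (x / real (min Mt Mr)) * (\<Sum>t<Mt. H (i,t) * cnj (H (j,t))))
     = Matrix.mat Mr Mr (\<lambda>(i,j). (if i = j then 1 else 0) + (complex_of_real x * \<beta> i * h) * cnj (\<beta> j))"
    by (rule eq_matI) (auto simp: M(3) rank h_def sum_distrib_left sum_distrib_right mult_ac)
  then have "gram_det Mt Mr H x = Re (1 + (\<Sum>i<Mr. cnj (\<beta> i) * (complex_of_real x * \<beta> i * h)))"
    unfolding gram_det_def by (simp only: det_one_plus_outer_product)
  also have "(\<Sum>i<Mr. cnj (\<beta> i) * (complex_of_real x * \<beta> i * h)) = complex_of_real (x * frob Mt Mr H)"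
  proof -
    have "(\<Sum>i<Mr. cnj (\<beta> i) * (complex_of_real x * \<beta> i * h)) = (\<Sum>i<Mr. \<Sum>t<Mt. complex_of_real x * complex_of_real ((cmod (H (i, t)))\<^sup>2))"
    proof (rule sum.cong[OF refl])
      fix i assume i: "i \<in> {..<Mr}"
      have "complex_of_real ((cmod (H (i, t)))\<^sup>2) = cnj (\<beta> i) * \<beta> i * (H (r0, t) * cnj (H (r0, t)))" if "t < Mt" for t
        using i that by (simp only: complex_norm_square rank lessThan_iff complex_cnj_mult) (simp add: mult_ac)
      then show "cnj (\<beta> i) * (complex_of_real x * \<beta> i * h) = (\<Sum>t<Mt. complex_of_real x * complex_of_real ((cmod (H (i, t)))\<^sup>2))"
        by (simp add: h_def sum_distrib_left mult_ac)
    qed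
    also have "\<dots> = complex_of_real (x * frob Mt Mr H)"
      by (simp add: frob_def sum.cartesian_product' sum_distrib_left)
    finally show ?thesis .
  qed
  finally show ?thesis by simp
qed

section \<open>Layers decoded by BS-LD and their ladder inequality\<close>

lemma bsld_layers_props:
  "bsld_layers Mt Mr b \<rho> \<rho>s L r \<xi> H \<gamma> \<le> L"
  "k \<in> {1..bsld_layers Mt Mr b \<rho> \<rho>s L r \<xi> H \<gamma>} \<Longrightarrow> \<not> bsld_outage Mt Mr b \<rho> \<rho>s r \<xi> H \<gamma> k"
  "l \<le> L \<Longrightarrow> (\<And>k. k \<in> {1..l} \<Longrightarrow> \<not> bsld_outage Mt Mr b \<rho> \<rho>s r \<xi> H \<gamma> k) \<Longrightarrow> l \<le> bsld_layers Mt Mr b \<rho> \<rho>s L r \<xi> H \<gamma>"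
proof -
  let ?A = "{l. l \<le> L \<and> (\<forall>k\<in>{1..l}. \<not> bsld_outage Mt Mr b \<rho> \<rho>s r \<xi> H \<gamma> k)}"
  have A: "finite ?A" "?A \<noteq> {}" by (auto intro: exI[of _ 0])
  have "Max ?A \<in> ?A" by (rule Max_in[OF A])
  then have "Max ?A \<le> L \<and> (\<forall>k\<in>{1..Max ?A}. \<not> bsld_outage Mt Mr b \<rho> \<rho>s r \<xi> H \<gamma> k)"
    by (rule CollectD)
  note * = conjunct1[OF this] conjunct2[OF this]
  show "bsld_layers Mt Mr b \<rho> \<rho>s L r \<xi> H \<gamma> \<le> L"
    unfolding bsld_layers_def by (rule *)
  show "k \<in> {1..bsld_layers Mt Mr b \<rho> \<rho>s L r \<xi> H \<gamma>} \<Longrightarrow> \<not> bsld_outage Mt Mr b \<rho> \<rho>s r \<xi> H \<gamma> k"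
    unfolding bsld_layers_def by (rule bspec[OF *(2)])
  show "l \<le> bsld_layers Mt Mr b \<rho> \<rho>s L r \<xi> H \<gamma>" if "l \<le> L" "\<And>k. k \<in> {1..l} \<Longrightarrow> \<not> bsld_outage Mt Mr b \<rho> \<rho>s r \<xi> H \<gamma> k"
    unfolding bsld_layers_def using that by (intro Max_ge A) auto
qed

context
  fixes Mt Mr L :: nat and b \<rho> \<rho>s :: real and r \<xi> :: "nat \<Rightarrow> real"
  assumes M: "1 \<le> Mt" "1 \<le> Mr" "min Mt Mr = 1" and b: "0 < b" and \<rho>: "1 < \<rho>" and \<rho>s: "0 < \<rho>s"
    and params: "bsld_params L r \<xi>"
begin

definition aux :: "nat \<Rightarrow> real" where "aux l = 2 powr (b * cum_rate \<rho> r l)"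

lemma aux_0: "aux 0 = 1" by (simp add: aux_def cum_rate_def)

lemma aux_mono: "l \<le> l' \<Longrightarrow> l' \<le> L \<Longrightarrow> aux l \<le> aux l'"
proof -
  assume l: "l \<le> l'" "l' \<le> L"
  have "cum_rate \<rho> r l \<le> cum_rate \<rho> r l'"
    unfolding cum_rate_def using l params \<rho>
    by (intro sum_mono2) (auto simp: bsld_params_def)
  then show ?thesis unfolding aux_def using b by (intro powr_mono) auto
qed

lemma aux_ge_1: "l \<le> L \<Longrightarrow> 1 \<le> aux l"
  using aux_mono[of 0 l] by (simp add: aux_0)

text \<open>The determinant ratio for layers 1 to \<open>l\<close> taken together, as \<xi> starts
  at 1. The quotient of consecutive values is the ratio in the outage condition, which makes the
  conditions telescope.\<close>

definition gap :: "cmat \<Rightarrow> nat \<Rightarrow> real" where "gap H l = (1 + \<rho> * frob Mt Mr H) / (1 + \<rho> powr \<xi> l * frob Mt Mr H)"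

lemma gram_pos: "0 < 1 + \<rho> powr x * frob Mt Mr H"
  using frob_nonneg[of Mt Mr H] by (intro add_pos_nonneg mult_nonneg_nonneg) auto

lemma gap_le: "gap H l \<le> 1 + \<rho> * frob Mt Mr H"
  unfolding gap_def using frob_nonneg[of Mt Mr H] \<rho>
  by (subst pos_divide_le_eq[OF gram_pos]) (auto intro!: mult_right_le_one_le[THEN order_trans] simp: algebra_simps mult_nonneg_nonneg)

lemma gap_pos: "0 < gap H l"
  unfolding gap_def using frob_nonneg[of Mt Mr H] \<rho> gram_pos[of "\<xi> l" H]
  by (intro divide_pos_pos) (auto intro: add_pos_nonneg)

lemma outage_iff:
  assumes "Suc l \<le> L"
  shows "bsld_outage Mt Mr b \<rho> \<rho>s r \<xi> H \<gamma> (Suc l) \<longleftrightarrow> b * ln (gap H (Suc l) / gap H l) \<le> ln ((aux (Suc l) + \<gamma> * \<rho>s) / (aux l + \<gamma> * \<rho>s))"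
proof -
  have "gram_det Mt Mr H (\<rho> powr \<xi> l) / gram_det Mt Mr H (\<rho> powr \<xi> (Suc l)) = gap H (Suc l) / gap H l"
    using gram_pos[of "\<xi> l" H] gram_pos[of "\<xi> (Suc l)" H] frob_nonneg[of Mt Mr H] \<rho>
    by (simp add: gram_det_eq[OF M] gap_def divide_simps) (smt (verit) mult_nonneg_nonneg)
  then show ?thesis
    unfolding bsld_outage_def aux_def by (simp add: log_def divide_le_cancel)
qed

abbreviation lay where "lay H \<gamma> \<equiv> bsld_layers Mt Mr b \<rho> \<rho>s L r \<xi> H \<gamma>"

text \<open>Sum of the conditions of the decoded layers between \<open>n\<close> and
  \<open>n'\<close>: both the rate side and the channel side are differences of logarithms.\<close>

lemma lay_step:
  assumes "n \<le> n'" "n' \<le> lay H \<gamma>" "0 \<le> \<gamma>"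
  shows "ln ((aux n' + \<gamma> * \<rho>s) / (aux n + \<gamma> * \<rho>s)) \<le> b * ln (gap H n' / gap H n)"
  using assms(1,2)
proof (induction n' rule: dec_induct)
  case base
  have "0 < aux n + \<gamma> * \<rho>s" using assms(3) \<rho>s by (auto simp: aux_def intro: add_pos_nonneg)
  then show ?case using gap_pos[of H n] by simp
next
  case (step k)
  have kL: "Suc k \<le> L" using step bsld_layers_props(1)[of Mt Mr b \<rho> \<rho>s L r \<xi> H \<gamma>] by simp
  have pos: "0 < aux l + \<gamma> * \<rho>s" for l using assms(3) \<rho>s by (auto simp: aux_def intro: add_pos_nonneg)
  have "ln ((aux (Suc k) + \<gamma> * \<rho>s) / (aux k + \<gamma> * \<rho>s)) \<le> b * ln (gap H (Suc k) / gap H k)"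
    using bsld_layers_props(2)[of "Suc k" Mt Mr b \<rho> \<rho>s L r \<xi> H \<gamma>] step outage_iff[OF kL, of H \<gamma>] by auto
  moreover have "ln ((aux k + \<gamma> * \<rho>s) / (aux n + \<gamma> * \<rho>s)) \<le> b * ln (gap H k / gap H n)"
    using step by simp
  moreover have "ln ((aux i + \<gamma> * \<rho>s) / (aux j + \<gamma> * \<rho>s)) = ln (aux i + \<gamma> * \<rho>s) - ln (aux j + \<gamma> * \<rho>s)" for i j
    using pos[of i] pos[of j] by (rule ln_divide_pos)
  moreover have "ln (gap H i / gap H j) = ln (gap H i) - ln (gap H j)" for i j
    by (intro ln_divide_pos gap_pos)
  ultimately show ?case by (simp only: right_diff_distrib)
qed

text \<open>Adding the same amount to numerator and denominator of a ratio that is at least 1 brings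
  it closer to 1, so better side information lowers the rate required of every layer.\<close>

lemma lay_mono:
  assumes "0 \<le> \<gamma>" "\<gamma> \<le> \<gamma>'"
  shows "lay H \<gamma> \<le> lay H \<gamma>'"
proof (rule bsld_layers_props(3))
  show "lay H \<gamma> \<le> L" by (rule bsld_layers_props(1))
  fix k assume k: "k \<in> {1..lay H \<gamma>}"
  then obtain l where l: "k = Suc l" by (cases k) auto
  have kL: "Suc l \<le> L" using k l bsld_layers_props(1)[of Mt Mr b \<rho> \<rho>s L r \<xi> H \<gamma>] by simp
  have no: "ln ((aux (Suc l) + \<gamma> * \<rho>s) / (aux l + \<gamma> * \<rho>s)) < b * ln (gap H (Suc l) / gap H l)"
    using bsld_layers_props(2)[OF k] outage_iff[OF kL, of H \<gamma>] l by auto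
  have pos: "0 < aux l" "0 < aux (Suc l)" by (auto simp: aux_def)
  have "(aux (Suc l) + \<gamma>' * \<rho>s) / (aux l + \<gamma>' * \<rho>s) \<le> (aux (Suc l) + \<gamma> * \<rho>s) / (aux l + \<gamma> * \<rho>s)"
  proof -
    have "0 \<le> (aux (Suc l) - aux l) * ((\<gamma>' - \<gamma>) * \<rho>s)"
      using aux_mono[of l "Suc l"] kL assms \<rho>s by (intro mult_nonneg_nonneg) auto
    moreover have "0 < aux l + \<gamma>' * \<rho>s" "0 < aux l + \<gamma> * \<rho>s"
      using pos assms \<rho>s by (auto intro!: add_pos_nonneg)
    ultimately show ?thesis by (simp add: frac_le_eq divide_le_0_iff) (simp add: algebra_simps)
  qed
  moreover have "0 < (aux (Suc l) + \<gamma>' * \<rho>s) / (aux l + \<gamma>' * \<rho>s)"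
    using pos assms \<rho>s by (intro divide_pos_pos add_pos_nonneg) auto
  ultimately have "ln ((aux (Suc l) + \<gamma>' * \<rho>s) / (aux l + \<gamma>' * \<rho>s)) \<le> ln ((aux (Suc l) + \<gamma> * \<rho>s) / (aux l + \<gamma> * \<rho>s))"
    by (intro ln_mono) auto
  then show "\<not> bsld_outage Mt Mr b \<rho> \<rho>s r \<xi> H \<gamma>' k"
    using no outage_iff[OF kL, of H \<gamma>'] l by auto
qed

definition Dl :: "cmat \<Rightarrow> real \<Rightarrow> real" where
  "Dl H \<gamma> = D_d \<rho>s (b * cum_rate \<rho> r (lay H \<gamma>)) \<gamma>"

lemma Dl_alt: "Dl H \<gamma> = 1 / (\<gamma> * \<rho>s + aux (lay H \<gamma>))"
  by (simp add: Dl_def D_d_def aux_def mult.commute)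

lemma Dl_pos: "0 \<le> \<gamma> \<Longrightarrow> 0 < Dl H \<gamma>"
  unfolding Dl_alt using \<rho>s by (intro divide_pos_pos add_nonneg_pos) (auto simp: aux_def)

text \<open>One rung up, the logarithm of \<open>1 / Dl\<close> grows for two reasons. Additional
  layers are decoded, paid for by the channel through a quotient of \<open>gap\<close> that
  telescopes over the rungs; and the side information improves with the layers held fixed, which
  gives one summand of the ladder sum.\<close>

lemma bsld_ladder:
  assumes g: "\<And>k. k < K \<Longrightarrow> \<gamma> k \<le> \<gamma> (Suc k)" "0 \<le> \<gamma> 0"
  shows "ln (1 / Dl H (\<gamma> K)) \<le> b * ln (gap H (lay H (\<gamma> K))) + ln (1 + \<rho>s * \<gamma> 0) + (\<Sum>k<K. ln (1 + \<rho>s * \<gamma> (Suc k) * Dl H (\<gamma> k)))"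
  using g(1)
proof (induction K)
  case 0
  have pos: "0 < 1 + \<gamma> 0 * \<rho>s" "0 < aux (lay H (\<gamma> 0)) + \<gamma> 0 * \<rho>s" using g \<rho>s by (auto simp: aux_def intro!: add_pos_nonneg)
  have gap0: "gap H 0 = 1"
    using params gram_pos[of 1 H] \<rho> by (simp add: gap_def bsld_params_def)
  have "ln ((aux (lay H (\<gamma> 0)) + \<gamma> 0 * \<rho>s) / (aux 0 + \<gamma> 0 * \<rho>s)) \<le> b * ln (gap H (lay H (\<gamma> 0)) / gap H 0)"
    using g by (intro lay_step) auto
  then show ?case using pos by (simp add: gap0 aux_0 Dl_alt ln_div add.commute mult.commute)
next
  case (Suc K)
  have nn: "0 \<le> \<gamma> k" if "k \<le> Suc K" for k
    using that by (induction k) (auto intro: g(2) order_trans[OF _ Suc.prems])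
  have IH: "ln (1 / Dl H (\<gamma> K)) \<le> b * ln (gap H (lay H (\<gamma> K))) + ln (1 + \<rho>s * \<gamma> 0) + (\<Sum>k<K. ln (1 + \<rho>s * \<gamma> (Suc k) * Dl H (\<gamma> k)))"
    using Suc by auto
  define x x' A A' where "x = \<gamma> K * \<rho>s" and "x' = \<gamma> (Suc K) * \<rho>s" and "A = aux (lay H (\<gamma> K))" and "A' = aux (lay H (\<gamma> (Suc K)))"
  have pos: "0 \<le> x" "x \<le> x'" "0 < A" "0 < A'" using nn \<rho>s Suc.prems[of K] by (auto simp: x_def x'_def A_def A'_def aux_def)
  have 1: "ln ((A' + x') / (A + x')) \<le> b * ln (gap H (lay H (\<gamma> (Suc K))) / gap H (lay H (\<gamma> K)))"
    unfolding A_def A'_def x'_def using nn Suc.prems by (intro lay_step lay_mono) auto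
  \<comment> \<open>With the layers fixed, \<open>1 / (A + x)\<close> is the old distortion, and the
    quotient exceeds 1 by \<open>(x' - x) / (A + x)\<close>, at most the new side information
    strength times that distortion.\<close>
  have 2: "ln ((A + x') / (A + x)) \<le> ln (1 + x' * (1 / (x + A)))"
  proof (rule ln_mono)
    show "(A + x') / (A + x) \<le> 1 + x' * (1 / (x + A))" using pos by (simp add: field_simps)
    show "0 < (A + x') / (A + x)" using pos by (intro divide_pos_pos) auto
  qed
  have "ln (1 / Dl H (\<gamma> (Suc K))) = ln ((A' + x') / (A + x')) + ln ((A + x') / (A + x)) + ln (1 / Dl H (\<gamma> K))"
    using pos by (simp add: Dl_alt ln_div flip: x_def x'_def A_def A'_def) (simp add: add.commute)
  also have "\<dots> \<le> b * ln (gap H (lay H (\<gamma> (Suc K))) / gap H (lay H (\<gamma> K))) + ln (1 + x' * (1 / (x + A))) + (b * ln (gap H (lay H (\<gamma> K))) + ln (1 + \<rho>s * \<gamma> 0) + (\<Sum>k<K. ln (1 + \<rho>s * \<gamma> (Suc k) * Dl H (\<gamma> k))))"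
    by (intro add_mono 1 2 IH)
  also have "x' * (1 / (x + A)) = \<rho>s * \<gamma> (Suc K) * Dl H (\<gamma> K)"
    by (simp add: Dl_alt x'_def x_def A_def mult_ac)
  finally show ?case by (simp add: ln_divide_pos[OF gap_pos gap_pos] algebra_simps)
qed

lemma measurable_frob [measurable]: "frob Mt Mr \<in> borel_measurable (iid_cmat Mr Mt)"
  unfolding frob_def
  by (intro borel_measurable_sum borel_measurable_power measurable_compose[OF _ borel_measurable_norm])
     (use measurable_iid_cmat_component[of _ Mr _ Mt] in auto)

lemma measurable_Dl:
  "(\<lambda>\<omega>. ennreal (Dl (fst \<omega>) ((cmod (snd \<omega>))\<^sup>2))) \<in> borel_measurable (iid_cmat Mr Mt \<Otimes>\<^sub>M cgauss)"
proof -
  let ?M = "iid_cmat Mr Mt \<Otimes>\<^sub>M cgauss"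
  let ?out = "\<lambda>k \<omega>. bsld_outage Mt Mr b \<rho> \<rho>s r \<xi> (fst \<omega>) ((cmod (snd \<omega>))\<^sup>2) k"
  have F: "(\<lambda>\<omega>. frob Mt Mr (fst \<omega>)) \<in> borel_measurable ?M"
    by (rule measurable_compose[OF measurable_fst measurable_frob])
  have G: "(\<lambda>\<omega>. (cmod (snd \<omega>))\<^sup>2) \<in> borel_measurable ?M"
    by (intro borel_measurable_power measurable_compose[OF _ borel_measurable_norm])
       (simp add: measurable_cong_sets[OF refl sets_cgauss[symmetric]])
  have [measurable]: "(\<lambda>\<omega>. ?out k \<omega>) \<in> measurable ?M (count_space UNIV)" for k
    unfolding bsld_outage_def gram_det_eq[OF M]
    by (subst Measurable.pred_def, intro borel_measurable_le borel_measurable_times borel_measurable_const borel_measurable_log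
        borel_measurable_divide borel_measurable_add F G)
  have "(\<lambda>\<omega>. lay (fst \<omega>) ((cmod (snd \<omega>))\<^sup>2)) \<in> measurable ?M (count_space UNIV)"
  proof (rule measurable_count_space_eq_countable[THEN iffD2])
    show "countable (UNIV :: nat set)" by simp
    show "(\<lambda>\<omega>. lay (fst \<omega>) ((cmod (snd \<omega>))\<^sup>2)) \<in> space ?M \<rightarrow> UNIV \<and> (\<forall>l\<in>UNIV. (\<lambda>\<omega>. lay (fst \<omega>) ((cmod (snd \<omega>))\<^sup>2)) -` {l} \<inter> space ?M \<in> sets ?M)"
    proof (intro conjI ballI)
      fix l
      have iff: "lay H \<gamma> = l \<longleftrightarrow> l \<le> L \<and> (\<forall>k\<in>{1..l}. \<not> bsld_outage Mt Mr b \<rho> \<rho>s r \<xi> H \<gamma> k) \<and> (l < L \<longrightarrow> bsld_outage Mt Mr b \<rho> \<rho>s r \<xi> H \<gamma> (Suc l))" for H \<gamma>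
      proof
        assume *: "lay H \<gamma> = l"
        show "l \<le> L \<and> (\<forall>k\<in>{1..l}. \<not> bsld_outage Mt Mr b \<rho> \<rho>s r \<xi> H \<gamma> k) \<and> (l < L \<longrightarrow> bsld_outage Mt Mr b \<rho> \<rho>s r \<xi> H \<gamma> (Suc l))"
        proof (intro conjI ballI impI)
          show "l \<le> L" using bsld_layers_props(1) * by metis
          show no: "\<not> bsld_outage Mt Mr b \<rho> \<rho>s r \<xi> H \<gamma> k" if "k \<in> {1..l}" for k
            using bsld_layers_props(2) that * by metis
          assume "l < L"
          show "bsld_outage Mt Mr b \<rho> \<rho>s r \<xi> H \<gamma> (Suc l)"
          proof (rule ccontr)
            assume "\<not> ?thesis"
            then have "Suc l \<le> lay H \<gamma>" using no \<open>l < L\<close> by (intro bsld_layers_props(3)) (auto simp: le_Suc_eq)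
            then show False using * by simp
          qed
        qed
      next
        assume *: "l \<le> L \<and> (\<forall>k\<in>{1..l}. \<not> bsld_outage Mt Mr b \<rho> \<rho>s r \<xi> H \<gamma> k) \<and> (l < L \<longrightarrow> bsld_outage Mt Mr b \<rho> \<rho>s r \<xi> H \<gamma> (Suc l))"
        then have "l \<le> lay H \<gamma>" by (intro bsld_layers_props(3)) auto
        moreover have "\<not> l < lay H \<gamma>"
        proof
          assume lt: "l < lay H \<gamma>"
          then have "\<not> bsld_outage Mt Mr b \<rho> \<rho>s r \<xi> H \<gamma> (Suc l)" by (intro bsld_layers_props(2)[of _ Mt Mr b \<rho> \<rho>s L r \<xi> H \<gamma>]) auto
          moreover have "l < L" using lt bsld_layers_props(1)[of Mt Mr b \<rho> \<rho>s L r \<xi> H \<gamma>] by simp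
          ultimately show False using * by blast
        qed
        ultimately show "lay H \<gamma> = l" by simp
      qed
      have "{\<omega> \<in> space ?M. l \<le> L \<and> (\<forall>k\<in>{1..l}. \<not> ?out k \<omega>) \<and> (l < L \<longrightarrow> ?out (Suc l) \<omega>)} \<in> sets ?M"
        by measurable
      moreover have "{\<omega> \<in> space ?M. l \<le> L \<and> (\<forall>k\<in>{1..l}. \<not> ?out k \<omega>) \<and> (l < L \<longrightarrow> ?out (Suc l) \<omega>)} = (\<lambda>\<omega>. lay (fst \<omega>) ((cmod (snd \<omega>))\<^sup>2)) -` {l} \<inter> space ?M"
        by (subst vimage_def, simp only: singleton_iff iff, blast)
      ultimately show "(\<lambda>\<omega>. lay (fst \<omega>) ((cmod (snd \<omega>))\<^sup>2)) -` {l} \<inter> space ?M \<in> sets ?M" by (simp only:)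
    qed auto
  qed
  then show ?thesis unfolding Dl_alt
    by (rule measurable_compose_countable[where f="\<lambda>l \<omega>. ennreal (1 / ((cmod (snd \<omega>))\<^sup>2 * \<rho>s + aux l))", rotated])
       (intro measurable_compose[OF _ measurable_ennreal] borel_measurable_divide borel_measurable_add borel_measurable_times borel_measurable_const G)
qed

lemma bsld_exp_dist_eq:
  "bsld_exp_dist Mt Mr b \<rho> \<rho>s L r \<xi> = enn2real (\<integral>\<^sup>+\<omega>. ennreal (Dl (fst \<omega>) ((cmod (snd \<omega>))\<^sup>2)) \<partial>(iid_cmat Mr Mt \<Otimes>\<^sub>M cgauss))"
  unfolding bsld_exp_dist_def Dl_def by (simp add: case_prod_beta')

lemma Dl_le_1: "0 \<le> \<gamma> \<Longrightarrow> Dl H \<gamma> \<le> 1"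
proof -
  assume "0 \<le> \<gamma>"
  then have "0 \<le> \<gamma> * \<rho>s" using \<rho>s by simp
  then have "1 \<le> \<gamma> * \<rho>s + aux (lay H \<gamma>)"
    using aux_ge_1[OF bsld_layers_props(1)[of Mt Mr b \<rho> \<rho>s L r \<xi> H \<gamma>]] by linarith
  then show ?thesis unfolding Dl_alt by (simp add: divide_le_eq)
qed

lemma bsld_exp_dist_fin: "(\<integral>\<^sup>+\<omega>. ennreal (Dl (fst \<omega>) ((cmod (snd \<omega>))\<^sup>2)) \<partial>(iid_cmat Mr Mt \<Otimes>\<^sub>M cgauss)) \<le> 1"
proof -
  interpret P: prob_space "iid_cmat Mr Mt \<Otimes>\<^sub>M cgauss" by (intro prob_space_pair prob_space_iid_cmat prob_space_cgauss)
  have "(\<integral>\<^sup>+\<omega>. ennreal (Dl (fst \<omega>) ((cmod (snd \<omega>))\<^sup>2)) \<partial>(iid_cmat Mr Mt \<Otimes>\<^sub>M cgauss)) \<le> (\<integral>\<^sup>+\<omega>. 1 \<partial>(iid_cmat Mr Mt \<Otimes>\<^sub>M cgauss))"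
    by (intro nn_integral_mono) (auto simp: Dl_le_1)
  then show ?thesis by (simp add: P.emeasure_space_1)
qed

text \<open>The same averaging lemma as for codes applies, since the total channel gain of all
  layers is at most \<open>1 + \<rho> * frob\<close>. The two converses therefore share one bound,
  with \<open>rate_of\<close> a little too generous for BS-LD.\<close>

lemma bsld_exp_dist_ge_converse_bound:
  assumes a: "0 < a" "a \<le> 1"
  shows "converse_bound Mt Mr b \<rho> \<rho>s a \<le> bsld_exp_dist Mt Mr b \<rho> \<rho>s L r \<xi>"
proof -
  have "ennreal (converse_bound Mt Mr b \<rho> \<rho>s a) \<le> (\<integral>\<^sup>+H. ennreal (1 / 2000 * min (1 / \<rho>s) (min 1 (exp (- rate_of Mt Mr b \<rho> H)))) \<partial>iid_cmat Mr Mt)"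
    using b \<rho> \<rho>s by (intro channel_average_ge_converse_bound a) auto
  also have "\<dots> \<le> (\<integral>\<^sup>+H. \<integral>\<^sup>+G. ennreal (Dl H ((cmod G)\<^sup>2)) \<partial>cgauss \<partial>iid_cmat Mr Mt)"
  proof (rule nn_integral_mono)
    fix H assume H: "H \<in> space (iid_cmat Mr Mt)"
    show "ennreal (1 / 2000 * min (1 / \<rho>s) (min 1 (exp (- rate_of Mt Mr b \<rho> H)))) \<le> (\<integral>\<^sup>+G. ennreal (Dl H ((cmod G)\<^sup>2)) \<partial>cgauss)"
    proof (rule ladder_average_ge[OF _ \<rho>s])
      show "(\<lambda>G. ennreal (Dl H ((cmod G)\<^sup>2))) \<in> borel_measurable borel"
        using measurable_compose_Pair1[OF H measurable_Dl] by (simp add: measurable_cong_sets[OF sets_cgauss refl])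
      fix K :: nat and G :: "nat \<Rightarrow> complex" and v :: "nat \<Rightarrow> real"
      assume G: "\<And>k. k < K \<Longrightarrow> cmod (G k) \<le> cmod (G (Suc k))"
        and v: "\<And>k. k \<le> K \<Longrightarrow> 0 \<le> v k" "\<And>k. k \<le> K \<Longrightarrow> ennreal (Dl H ((cmod (G k))\<^sup>2)) \<le> ennreal (v k)" "0 < v K"
      have dv: "Dl H ((cmod (G k))\<^sup>2) \<le> v k" if "k \<le> K" for k using v(1,2)[OF that] by simp
      have "ln (1 / v K) \<le> ln (1 / Dl H ((cmod (G K))\<^sup>2))"
        using v(3) dv[of K] Dl_pos[of "(cmod (G K))\<^sup>2" H] by (intro ln_mono) (auto simp: frac_le)
      also have "\<dots> \<le> b * ln (gap H (lay H ((cmod (G K))\<^sup>2))) + ln (1 + \<rho>s * (cmod (G 0))\<^sup>2) + (\<Sum>k<K. ln (1 + \<rho>s * (cmod (G (Suc k)))\<^sup>2 * Dl H ((cmod (G k))\<^sup>2)))"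
        using G by (intro bsld_ladder[where \<gamma>="\<lambda>k. (cmod (G k))\<^sup>2"] power_mono) auto
      also have "\<dots> \<le> rate_of Mt Mr b \<rho> H + ln (1 + \<rho>s * (cmod (G 0))\<^sup>2) + (\<Sum>k<K. ln (1 + \<rho>s * (cmod (G (Suc k)))\<^sup>2 * v k))"
      proof (intro add_mono sum_mono order_refl)
        have "ln (gap H (lay H ((cmod (G K))\<^sup>2))) \<le> ln (1 + \<rho> * frob Mt Mr H)"
          using gap_pos gap_le frob_nonneg[of Mt Mr H] \<rho> by (intro ln_mono) (auto intro: add_pos_nonneg)
        moreover have "0 \<le> real Mr * ln 2" by simp
        ultimately show "b * ln (gap H (lay H ((cmod (G K))\<^sup>2))) \<le> rate_of Mt Mr b \<rho> H"
          unfolding rate_of_def using b by (intro mult_left_mono) linarith+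
        fix k assume "k \<in> {..<K}"
        then have "Dl H ((cmod (G k))\<^sup>2) \<le> v k" using dv by simp
        then show "ln (1 + \<rho>s * (cmod (G (Suc k)))\<^sup>2 * Dl H ((cmod (G k))\<^sup>2)) \<le> ln (1 + \<rho>s * (cmod (G (Suc k)))\<^sup>2 * v k)"
          using \<rho>s Dl_pos[of "(cmod (G k))\<^sup>2" H]
          by (intro ln_mono add_left_mono mult_left_mono) (auto intro!: add_pos_nonneg mult_nonneg_nonneg)
      qed
      finally show "ln (1 / v K) \<le> rate_of Mt Mr b \<rho> H + ln (1 + \<rho>s * (cmod (G 0))\<^sup>2) + (\<Sum>k<K. ln (1 + \<rho>s * (cmod (G (Suc k)))\<^sup>2 * v k))" .
    qed
  qed
  also have "\<dots> = (\<integral>\<^sup>+\<omega>. ennreal (Dl (fst \<omega>) ((cmod (snd \<omega>))\<^sup>2)) \<partial>(iid_cmat Mr Mt \<Otimes>\<^sub>M cgauss))"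
    using cgauss.nn_integral_fst[OF measurable_Dl] by simp
  finally have le: "ennreal (converse_bound Mt Mr b \<rho> \<rho>s a) \<le> (\<integral>\<^sup>+\<omega>. ennreal (Dl (fst \<omega>) ((cmod (snd \<omega>))\<^sup>2)) \<partial>(iid_cmat Mr Mt \<Otimes>\<^sub>M cgauss))" .
  have "0 \<le> converse_bound Mt Mr b \<rho> \<rho>s a" using a \<rho>s by (auto simp: converse_bound_def intro!: mult_nonneg_nonneg)
  then show ?thesis
    unfolding bsld_exp_dist_eq using enn2real_mono[OF le] le_less_trans[OF bsld_exp_dist_fin] by simp
qed

end

section \<open>Achievability by BS-LD\<close>

lemma AE_cgauss_nonzero: "AE z in cgauss. z \<noteq> 0"
  unfolding cgauss_def by (subst AE_density) (auto intro: AE_mp[OF AE_lborel_singleton[of 0]])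

text \<open>The squared norm dominates every squared entry. Splitting its negative power evenly into
  \<open>Mr * Mt\<close> factors and bounding each by a different entry gives a product of
  independent variables, each needing a negative moment of order below 2.\<close>

lemma frob_negative_moment:
  assumes s: "0 \<le> s" "s < real (Mr * Mt)"
  shows "\<exists>C>0. (\<integral>\<^sup>+H. ennreal (frob Mt Mr H powr (- s)) \<partial>iid_cmat Mr Mt) \<le> ennreal C"
proof -
  let ?I = "{..<Mr} \<times> {..<Mt}"
  define M where "M = real (Mr * Mt)"
  have M: "0 < M" using s by (simp add: M_def)
  have Mpos: "0 < Mr" "0 < Mt" using s by (auto intro!: Nat.gr0I)
  obtain C where C: "0 < C" "\<And>a. (\<integral>\<^sup>+z. ennreal (cmod (a + z) powr (- (2 * s / M))) \<partial>cgauss) \<le> ennreal C"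
    using cgauss_shift_negative_moment[of "2 * s / M"] s M by (auto simp: M_def field_simps)
  \<comment> \<open>Where an entry is 0 the product on the right collapses to 0 by the convention
    for \<open>powr\<close>, so the comparison is made off a null set.\<close>
  have "AE H in iid_cmat Mr Mt. \<forall>p\<in>?I. H p \<noteq> 0"
    unfolding iid_cmat_def
    by (intro AE_finite_allI AE_PiM_component prob_space_cgauss AE_cgauss_nonzero) auto
  then have "(\<integral>\<^sup>+H. ennreal (frob Mt Mr H powr (- s)) \<partial>iid_cmat Mr Mt) \<le> (\<integral>\<^sup>+H. (\<Prod>p\<in>?I. ennreal (cmod (H p) powr (- (2 * s / M)))) \<partial>iid_cmat Mr Mt)"
  proof (intro nn_integral_mono_AE, elim AE_mp, intro AE_I2 impI)
    fix H :: cmat assume nz: "\<forall>p\<in>?I. H p \<noteq> 0"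
    have F: "0 < frob Mt Mr H"
      unfolding frob_def using nz Mpos by (intro sum_pos) (auto simp: lessThan_empty_iff)
    have "frob Mt Mr H powr (- s) = (\<Prod>p\<in>?I. frob Mt Mr H powr (- (s / M)))"
      using F Mpos by (simp add: powr_powr card_cartesian_product M_def flip: powr_realpow)
    also have "\<dots> \<le> (\<Prod>p\<in>?I. cmod (H p) powr (- (2 * s / M)))"
    proof (intro prod_mono conjI)
      fix p assume p: "p \<in> ?I"
      have "(cmod (H p))\<^sup>2 \<le> frob Mt Mr H" unfolding frob_def using p by (intro member_le_sum) auto
      then have "frob Mt Mr H powr (- (s / M)) \<le> ((cmod (H p))\<^sup>2) powr (- (s / M))"
        using nz p s M by (intro powr_mono2') auto
      also have "\<dots> = cmod (H p) powr (- (2 * s / M))"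
        using nz p powr_powr[of "cmod (H p)" 2 "- (s/M)"] by (simp add: powr_numeral)
      finally show "frob Mt Mr H powr (- (s / M)) \<le> cmod (H p) powr (- (2 * s / M))" .
    qed auto
    finally have "ennreal (frob Mt Mr H powr (- s)) \<le> ennreal (\<Prod>p\<in>?I. cmod (H p) powr (- (2 * s / M)))"
      by (rule ennreal_leI)
    then show "ennreal (frob Mt Mr H powr (- s)) \<le> (\<Prod>p\<in>?I. ennreal (cmod (H p) powr (- (2 * s / M))))"
      by (simp add: prod_ennreal)
  qed
  also have "\<dots> = (\<Prod>p\<in>?I. \<integral>\<^sup>+z. ennreal (cmod z powr (- (2 * s / M))) \<partial>cgauss)"
    unfolding iid_cmat_def by (rule PG.product_nn_integral_prod) auto
  also have "\<dots> \<le> (\<Prod>p\<in>?I. ennreal C)"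
    using C(2)[of 0] by (intro prod_mono_ennreal) auto
  also have "\<dots> = ennreal (C ^ (Mr * Mt))"
    using C(1) by (simp add: card_cartesian_product ennreal_power)
  finally show ?thesis using C(1) by (intro exI[of _ "C ^ (Mr * Mt)"]) auto
qed

text \<open>The maximum is attained at \<theta> = 0 if b \<le> \<nu>, at 1 if \<nu> < b \<le> M, and
  at \<open>M / b\<close> otherwise; the minimum at \<alpha> = 0 or at \<open>1 - \<nu> / b\<close>,
  where the two terms of the inner maximum balance. Attainment is all that is needed: achievability
  takes \<theta>, the converse takes \<alpha>.\<close>

lemma Delta_formula_eq_theta:
  assumes b: "0 < b" and \<nu>: "0 \<le> \<nu>" and M: "1 \<le> Mt" "1 \<le> Mr" "min Mt Mr = 1"
  shows "\<exists>\<theta>. 0 \<le> \<theta> \<and> \<theta> \<le> 1 \<and> b * \<theta> \<le> real (Mr * Mt) \<and> Delta_formula Mt Mr b \<nu> = b * \<theta> + \<nu> * (1 - \<theta>)"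
    and "\<exists>\<alpha>. 0 \<le> \<alpha> \<and> \<alpha> \<le> 1 \<and> real (Mr * Mt) * \<alpha> + max \<nu> (b * (1 - \<alpha>)) = Delta_formula Mt Mr b \<nu>"
proof -
  define Ms where "Ms = real (Mr * Mt)"
  have Ms: "real (max Mt Mr) = Ms" "1 \<le> Ms"
    using M by (auto simp: Ms_def min_def max_def split: if_splits)
  have D: "Delta_formula Mt Mr b \<nu> = (if b \<le> max Ms \<nu> then max \<nu> b else Ms + \<nu> * (1 - Ms / b))"
    unfolding Delta_formula_def Ms(1) by simp
  show "\<exists>\<theta>. 0 \<le> \<theta> \<and> \<theta> \<le> 1 \<and> b * \<theta> \<le> real (Mr * Mt) \<and> Delta_formula Mt Mr b \<nu> = b * \<theta> + \<nu> * (1 - \<theta>)"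
  proof (cases "b \<le> max Ms \<nu>")
    case True
    show ?thesis
    proof (cases "b \<le> \<nu>")
      case le: True
      then show ?thesis using True Ms D by (intro exI[of _ 0]) auto
    next
      case False
      then show ?thesis using True Ms D b \<nu> by (intro exI[of _ 1]) (auto simp: Ms_def[symmetric] max_def simp del: of_nat_mult split: if_splits)
    qed
  next
    case False
    then show ?thesis using Ms D b \<nu> unfolding Ms_def[symmetric] by (intro exI[of _ "Ms / b"]) (auto simp: field_simps)
  qed
  show "\<exists>\<alpha>. 0 \<le> \<alpha> \<and> \<alpha> \<le> 1 \<and> real (Mr * Mt) * \<alpha> + max \<nu> (b * (1 - \<alpha>)) = Delta_formula Mt Mr b \<nu>"
  proof (cases "b \<le> max Ms \<nu>")
    case True
    then show ?thesis using D by (intro exI[of _ 0]) auto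
  next
    case False
    have "b * (1 - (1 - \<nu> / b)) = \<nu>" using b by (simp add: field_simps)
    then show ?thesis using False D b \<nu> unfolding Ms_def[symmetric]
      by (intro exI[of _ "1 - \<nu> / b"]) (auto simp: algebra_simps)
  qed
qed

text \<open>Rates slightly below the power gaps: a layer is decoded as soon as the interference left
  by the later layers is above the noise level.\<close>
lemma bsld_distortion_le:
  assumes M: "1 \<le> Mt" "1 \<le> Mr" "min Mt Mr = 1" and b: "0 < b" and \<delta>: "0 < \<delta>" "\<delta> < 1" and L: "1 \<le> L"
    and \<rho>: "2 powr (real L / \<delta>) < \<rho>" and \<rho>s: "0 < \<rho>s"
    and r: "r = (\<lambda>_. (1 - \<delta>) / real L)" and \<xi>: "\<xi> = (\<lambda>l. 1 - real l / real L)" and \<gamma>: "0 < \<gamma>" and F: "0 < frob Mt Mr H"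
    and \<tau>: "0 \<le> \<tau>" "0 \<le> \<theta>" "\<tau> + \<theta> \<le> 1"
  shows "Dl Mt Mr L b \<rho> \<rho>s r \<xi> H \<gamma>
    \<le> (\<gamma> * \<rho>s) powr (- \<tau>) * (\<rho> powr (1 - 1 / real L) * min 1 (frob Mt Mr H)) powr (- (b * (1 - \<delta>) * \<theta>))"
proof -
  have "1 < 2 powr (real L / \<delta>)" using L \<delta> by simp
  then have \<rho>1: "1 < \<rho>" using \<rho> by simp
  have params: "bsld_params L r \<xi>"
    unfolding bsld_params_def r \<xi> using L \<delta> by (auto simp: field_simps)
  note ctx = M b \<rho>1 \<rho>s params
  let ?F = "frob Mt Mr H" and ?N = "bsld_layers Mt Mr b \<rho> \<rho>s L r \<xi> H \<gamma>"
  define b' where "b' = b * (1 - \<delta>)"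
  have b': "0 < b'" using b \<delta> by (simp add: b'_def)
  \<comment> \<open>The threshold on \<rho> is chosen for this: the rate slack \<delta> per layer,
    \<open>\<delta> * ln \<rho> / real L\<close>, exceeds the \<open>ln 2\<close> lost below to
    residual interference.\<close>
  have logr: "real L < \<delta> * log 2 \<rho>"
  proof -
    have "real L / \<delta> < log 2 \<rho>" using \<rho> \<rho>1 by (simp add: less_log_iff)
    then show ?thesis using \<delta> by (simp add: field_simps)
  qed
  have aux: "aux b \<rho> r l = \<rho> powr (b' * real l / real L)" for l
  proof -
    have "b * cum_rate \<rho> r l = (b' * real l / real L) * log 2 \<rho>"
      by (simp add: cum_rate_def r b'_def)
    then have "aux b \<rho> r l = (2 powr log 2 \<rho>) powr (b' * real l / real L)"
      by (simp add: aux_def[OF ctx] powr_powr mult.commute)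
    then show ?thesis using \<rho>1 by simp
  qed
  have dec: "\<not> bsld_outage Mt Mr b \<rho> \<rho>s r \<xi> H \<gamma> (Suc l)" if l: "Suc l \<le> L" "1 \<le> \<rho> powr \<xi> (Suc l) * ?F" for l
  proof -
    define u where "u = \<rho> powr \<xi> (Suc l) * ?F"
    have u: "1 \<le> u" using l by (simp add: u_def)
    have xi: "\<xi> l = \<xi> (Suc l) + 1 / real L" using L by (simp add: \<xi> field_simps)
    have g: "gap Mt Mr \<rho> \<xi> H (Suc l) / gap Mt Mr \<rho> \<xi> H l = (1 + \<rho> powr (1 / real L) * u) / (1 + u)"
    proof -
      have "1 + \<rho> * ?F \<noteq> 0" using mult_pos_pos[of \<rho> ?F] F \<rho>1 by linarith
      then have "gap Mt Mr \<rho> \<xi> H (Suc l) / gap Mt Mr \<rho> \<xi> H l = (1 + \<rho> powr \<xi> l * ?F) / (1 + u)"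
        by (simp add: gap_def[OF ctx] u_def)
      also have "\<rho> powr \<xi> l * ?F = \<rho> powr (1 / real L) * u" by (simp add: u_def xi powr_add mult_ac)
      finally show ?thesis .
    qed
    \<comment> \<open>With \<open>u \<ge> 1\<close> noise at most doubles the residual interference,
      so the layer keeps its full power ratio up to the factor 2.\<close>
    have "\<rho> powr (1 / real L) / 2 \<le> (1 + \<rho> powr (1 / real L) * u) / (1 + u)"
    proof -
      have "\<rho> powr (1 / real L) * (1 + u) \<le> 2 * (1 + \<rho> powr (1 / real L) * u)"
      proof -
        have "\<rho> powr (1 / real L) * 1 \<le> \<rho> powr (1 / real L) * u" using u by (intro mult_left_mono) auto
        then show ?thesis by (simp add: algebra_simps)
      qed
      then show ?thesis using u by (simp add: field_simps)
    qed
    then have "ln (\<rho> powr (1 / real L) / 2) \<le> ln (gap Mt Mr \<rho> \<xi> H (Suc l) / gap Mt Mr \<rho> \<xi> H l)"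
      unfolding g using \<rho>1 u by (intro ln_mono) (auto intro!: divide_pos_pos add_pos_nonneg)
    moreover have "ln (\<rho> powr (1 / real L) / 2) = ln \<rho> / real L - ln 2"
      using \<rho>1 by (simp add: ln_divide_pos ln_powr)
    moreover have "(1 - \<delta>) * ln \<rho> / real L < ln \<rho> / real L - ln 2"
    proof -
      have "real L * ln 2 < \<delta> * ln \<rho>" using logr by (simp add: log_def field_simps)
      then show ?thesis using L by (simp add: field_simps)
    qed
    ultimately have 1: "b * ((1 - \<delta>) * ln \<rho> / real L) < b * ln (gap Mt Mr \<rho> \<xi> H (Suc l) / gap Mt Mr \<rho> \<xi> H l)"
      using b by (intro mult_strict_left_mono) auto
    have A: "0 < aux b \<rho> r l" "aux b \<rho> r l \<le> aux b \<rho> r (Suc l)"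
      using aux_mono[OF ctx, of l "Suc l"] l by (auto simp: aux_def[OF ctx])
    \<comment> \<open>The help of the side information in decoding a layer is simply dropped; it
      counts only in the final distortion.\<close>
    have "(aux b \<rho> r (Suc l) + \<gamma> * \<rho>s) / (aux b \<rho> r l + \<gamma> * \<rho>s) \<le> aux b \<rho> r (Suc l) / aux b \<rho> r l"
    proof -
      have "aux b \<rho> r l * (\<gamma> * \<rho>s) \<le> aux b \<rho> r (Suc l) * (\<gamma> * \<rho>s)" using A \<gamma> \<rho>s by (intro mult_right_mono) auto
      moreover have "0 < aux b \<rho> r l + \<gamma> * \<rho>s" using A \<gamma> \<rho>s by (simp add: add_pos_pos)
      ultimately show ?thesis using A by (simp add: divide_simps) (simp add: algebra_simps)
    qed
    then have "ln ((aux b \<rho> r (Suc l) + \<gamma> * \<rho>s) / (aux b \<rho> r l + \<gamma> * \<rho>s)) \<le> ln (aux b \<rho> r (Suc l) / aux b \<rho> r l)"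
      using A \<gamma> \<rho>s by (intro ln_mono) (auto intro!: divide_pos_pos add_pos_pos)
    also have "\<dots> = b * ((1 - \<delta>) * ln \<rho> / real L)"
      using \<rho>1 by (simp add: aux ln_divide_pos ln_powr b'_def add_divide_distrib diff_divide_distrib algebra_simps)
    finally show ?thesis unfolding outage_iff[OF ctx l(1)] using 1 by simp
  qed
  have DN: "Dl Mt Mr L b \<rho> \<rho>s r \<xi> H \<gamma> \<le> \<rho> powr (- (b' * real n / real L))" if n: "n \<le> L" "n = 0 \<or> 1 \<le> \<rho> powr \<xi> n * ?F" for n
  proof -
    have "n \<le> ?N"
    proof (rule bsld_layers_props(3)[OF n(1)])
      fix k assume k: "k \<in> {1..n}"
      then obtain l where l: "k = Suc l" by (cases k) auto
      have "\<rho> powr \<xi> n * ?F \<le> \<rho> powr \<xi> k * ?F"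
        using k F \<rho>1 L by (intro mult_right_mono powr_mono) (auto simp: \<xi> divide_right_mono)
      then show "\<not> bsld_outage Mt Mr b \<rho> \<rho>s r \<xi> H \<gamma> k"
        using k n dec[of l] l by auto
    qed
    then have "aux b \<rho> r n \<le> aux b \<rho> r ?N"
      by (intro aux_mono[OF ctx] bsld_layers_props(1))
    also have "\<dots> \<le> \<gamma> * \<rho>s + aux b \<rho> r ?N" using \<gamma> \<rho>s by simp
    finally have "1 / (\<gamma> * \<rho>s + aux b \<rho> r ?N) \<le> 1 / aux b \<rho> r n"
      using \<gamma> \<rho>s by (intro divide_left_mono) (auto simp: aux_def[OF ctx] intro!: mult_pos_pos add_pos_pos)
    then show ?thesis unfolding Dl_alt[OF ctx] by (simp add: aux powr_minus_divide)
  qed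
  let ?D = "Dl Mt Mr L b \<rho> \<rho>s r \<xi> H \<gamma>" and ?X = "\<rho> powr (1 - 1 / real L) * min 1 ?F"
  have X: "0 < ?X" using F \<rho>1 by simp
  have D0: "0 < ?D" using \<gamma> by (intro Dl_pos[OF ctx]) auto
  have D1: "?D \<le> 1" using \<gamma> by (intro Dl_le_1[OF ctx]) auto
  have D2: "?D \<le> 1 / (\<gamma> * \<rho>s)"
    unfolding Dl_alt[OF ctx] using \<gamma> \<rho>s by (intro divide_left_mono) (auto simp: aux_def[OF ctx] intro!: mult_pos_pos add_pos_pos)
  have D3: "?D \<le> ?X powr (- b')"
  proof (cases "1 \<le> ?F")
    case True
    have "?D \<le> \<rho> powr (- (b' * real L / real L))"
      using True L \<rho>1 by (intro DN) (auto simp: \<xi>)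
    also have "\<dots> = \<rho> powr (- b')" using L by simp
    also have "\<dots> = (\<rho> powr 1) powr (- b')" using \<rho>1 by simp
    also have "\<dots> \<le> (\<rho> powr (1 - 1 / real L)) powr (- b')"
      using b' \<rho>1 powr_mono[of "1 - 1 / real L" 1 \<rho>] by (intro powr_mono2') auto
    finally show ?thesis using True by simp
  next
    case False
    \<comment> \<open>Let \<open>n\<close> be the last layer whose residual interference is above
      the noise. Maximality says that the power left after layer \<open>n + 1\<close> is below the
      noise, so \<open>n\<close> layers nearly exhaust the channel; rounding to whole layers costs
      the exponent \<open>1 / real L\<close>.\<close>
    define A where "A = {n. n \<le> L \<and> (n = 0 \<or> 1 \<le> \<rho> powr \<xi> n * ?F)}"
    have A: "finite A" "0 \<in> A" by (auto simp: A_def)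
    define n where "n = Max A"
    have nA: "n \<in> A" unfolding n_def using A by (intro Max_in) auto
    have nL: "n < L"
    proof -
      have "L \<notin> A" using False L \<rho>1 by (auto simp: A_def \<xi>)
      then show ?thesis using nA by (auto simp: A_def le_less)
    qed
    have "Suc n \<notin> A" using Max_ge[OF A(1), of "Suc n"] by (auto simp: n_def)
    then have lt: "\<rho> powr \<xi> (Suc n) * ?F < 1" using nL by (auto simp: A_def)
    have "?X = \<rho> powr (1 - 1 / real L) * ?F" using False by simp
    also have "\<dots> = \<rho> powr (real n / real L) * (\<rho> powr \<xi> (Suc n) * ?F)"
    proof -
      have "real n / real L + \<xi> (Suc n) = 1 - 1 / real L" by (simp add: \<xi> add_divide_distrib)
      then show ?thesis by (simp flip: mult.assoc powr_add)
    qed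
    also have "\<dots> \<le> \<rho> powr (real n / real L) * 1" using lt by (intro mult_left_mono) auto
    finally have "?X \<le> \<rho> powr (real n / real L)" by simp
    then have "(\<rho> powr (real n / real L)) powr (- b') \<le> ?X powr (- b')"
      using X b' by (intro powr_mono2') auto
    moreover have "?D \<le> \<rho> powr (- (b' * real n / real L))" using nA by (intro DN) (auto simp: A_def)
    ultimately show ?thesis by (simp add: powr_powr mult.commute)
  qed
  \<comment> \<open>Three bounds are interpolated: 1, the side information alone, and the channel
    alone. The weights need not add up to 1, which later permits \<tau> < 1 even when \<theta> =
    0.\<close>
  have "?D = ?D powr (1 - \<tau> - \<theta>) * ?D powr \<tau> * ?D powr \<theta>"
    using D0 by (simp flip: powr_add)
  also have "\<dots> \<le> 1 * (1 / (\<gamma> * \<rho>s)) powr \<tau> * (?X powr (- b')) powr \<theta>"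
  proof (intro mult_mono)
    show "?D powr (1 - \<tau> - \<theta>) \<le> 1" using D0 D1 \<tau> powr_mono2[of "1 - \<tau> - \<theta>" ?D 1] by simp
    show "?D powr \<tau> \<le> (1 / (\<gamma> * \<rho>s)) powr \<tau>" using D0 D2 \<tau> by (intro powr_mono2) auto
    show "?D powr \<theta> \<le> (?X powr (- b')) powr \<theta>" using D0 D3 \<tau> by (intro powr_mono2) auto
  qed auto
  also have "\<dots> = (\<gamma> * \<rho>s) powr (- \<tau>) * ?X powr (- (b * (1 - \<delta>) * \<theta>))"
    using \<gamma> \<rho>s by (simp add: powr_powr b'_def powr_minus_divide powr_divide)
  finally show ?thesis .
qed

text \<open>The pointwise bound is a product of a function of the fading and a function of the
  channel. Their means are finite by \<tau> < 1 and by the bound below \<open>Mr * Mt\<close>; they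
  do not depend on \<rho> or \<rho>s, so \<open>C\<close> is uniform.\<close>

lemma bsld_exp_dist_le:
  assumes M: "1 \<le> Mt" "1 \<le> Mr" "min Mt Mr = 1" and b: "0 < b" and \<delta>: "0 < \<delta>" "\<delta> < 1" and L: "1 \<le> L"
    and r: "r = (\<lambda>_. (1 - \<delta>) / real L)" and \<xi>: "\<xi> = (\<lambda>l. 1 - real l / real L)"
    and \<tau>: "0 \<le> \<tau>" "\<tau> < 1" "0 \<le> \<theta>" "\<tau> + \<theta> \<le> 1" "b * (1 - \<delta>) * \<theta> < real (Mr * Mt)"
  shows "\<exists>C>0. \<forall>\<rho> \<rho>s. 2 powr (real L / \<delta>) < \<rho> \<longrightarrow> 0 < \<rho>s \<longrightarrow>
    bsld_exp_dist Mt Mr b \<rho> \<rho>s L r \<xi> \<le> C * \<rho>s powr (- \<tau>) * \<rho> powr (- ((1 - 1 / real L) * (b * (1 - \<delta>) * \<theta>)))"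
proof -
  define s where "s = b * (1 - \<delta>) * \<theta>"
  have s: "0 \<le> s" "s < real (Mr * Mt)" using b \<delta> \<tau> by (auto simp: s_def)
  obtain C1 where C1: "0 < C1" "(\<integral>\<^sup>+H. ennreal (frob Mt Mr H powr (- s)) \<partial>iid_cmat Mr Mt) \<le> ennreal C1"
    using frob_negative_moment[OF s] by auto
  obtain C2 where C2: "0 < C2" "\<And>a. (\<integral>\<^sup>+z. ennreal (cmod (a + z) powr (- (2 * \<tau>))) \<partial>cgauss) \<le> ennreal C2"
    using cgauss_shift_negative_moment[of "2 * \<tau>"] \<tau> by auto
  show ?thesis
  proof (intro exI[of _ "C2 * (1 + C1)"] conjI allI impI)
    show "0 < C2 * (1 + C1)" using C1 C2 by simp
    fix \<rho> \<rho>s :: real assume \<rho>: "2 powr (real L / \<delta>) < \<rho>" and \<rho>s: "0 < \<rho>s"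
    have "1 < 2 powr (real L / \<delta>)" using L \<delta> by simp
    then have \<rho>1: "1 < \<rho>" using \<rho> by simp
    have params: "bsld_params L r \<xi>"
      unfolding bsld_params_def r \<xi> using L \<delta> by (auto simp: field_simps)
    note ctx = M b \<rho>1 \<rho>s params
    let ?D = "Dl Mt Mr L b \<rho> \<rho>s r \<xi>" and ?F = "frob Mt Mr"
    interpret PH: prob_space "iid_cmat Mr Mt" by (rule prob_space_iid_cmat)
    define k where "k = \<rho>s powr (- \<tau>) * \<rho> powr (- ((1 - 1 / real L) * s))"
    have k: "0 < k" using \<rho>s \<rho>1 by (simp add: k_def)
    have AEF: "AE H in iid_cmat Mr Mt. 0 < ?F H"
    proof -
      have "AE H in iid_cmat Mr Mt. H (0, 0) \<noteq> 0"
        unfolding iid_cmat_def using M by (intro AE_PiM_component prob_space_cgauss AE_cgauss_nonzero) auto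
      then show ?thesis
      proof eventually_elim
        case (elim H)
        have "0 < (cmod (H (0, 0)))\<^sup>2" using elim by simp
        also have "\<dots> \<le> ?F H" unfolding frob_def using M by (intro member_le_sum) auto
        finally show ?case .
      qed
    qed
    have "(\<integral>\<^sup>+\<omega>. ennreal (?D (fst \<omega>) ((cmod (snd \<omega>))\<^sup>2)) \<partial>(iid_cmat Mr Mt \<Otimes>\<^sub>M cgauss))
      = (\<integral>\<^sup>+H. \<integral>\<^sup>+G. ennreal (?D H ((cmod G)\<^sup>2)) \<partial>cgauss \<partial>iid_cmat Mr Mt)"
      using cgauss.nn_integral_fst[OF measurable_Dl[OF ctx]] by simp
    also have "\<dots> \<le> (\<integral>\<^sup>+H. ennreal (k * (1 + ?F H powr (- s))) * ennreal C2 \<partial>iid_cmat Mr Mt)"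
    proof (rule nn_integral_mono_AE, use AEF in eventually_elim)
      case (elim H)
      have "(\<integral>\<^sup>+G. ennreal (?D H ((cmod G)\<^sup>2)) \<partial>cgauss) \<le> (\<integral>\<^sup>+G. ennreal (k * (1 + ?F H powr (- s))) * ennreal (cmod (0 + G) powr (- (2 * \<tau>))) \<partial>cgauss)"
      proof (rule nn_integral_mono_AE, use AE_cgauss_nonzero in eventually_elim)
        case (elim G)
        have "?D H ((cmod G)\<^sup>2) \<le> ((cmod G)\<^sup>2 * \<rho>s) powr (- \<tau>) * (\<rho> powr (1 - 1 / real L) * min 1 (?F H)) powr (- s)"
          unfolding s_def using elim \<open>0 < ?F H\<close> \<tau>
          by (intro bsld_distortion_le[OF M b \<delta> L \<rho> \<rho>s r \<xi>]) auto
        also have "\<dots> = cmod G powr (- (2 * \<tau>)) * k * min 1 (?F H) powr (- s)"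
          using elim \<rho>s \<rho>1 \<open>0 < ?F H\<close> powr_powr[of "cmod G" 2 "- \<tau>"]
          by (simp add: powr_mult k_def powr_powr powr_numeral mult_ac)
        also have "\<dots> \<le> cmod G powr (- (2 * \<tau>)) * k * (1 + ?F H powr (- s))"
        proof (intro mult_left_mono)
          show "min 1 (?F H) powr (- s) \<le> 1 + ?F H powr (- s)"
            by (cases "1 \<le> ?F H") auto
        qed (use k in auto)
        finally have "ennreal (?D H ((cmod G)\<^sup>2)) \<le> ennreal (k * (1 + ?F H powr (- s)) * cmod (0 + G) powr (- (2 * \<tau>)))"
          by (intro ennreal_leI) (simp add: mult_ac)
        then show ?case using k by (simp add: ennreal_mult add_nonneg_nonneg)
      qed
      also have "\<dots> = ennreal (k * (1 + ?F H powr (- s))) * (\<integral>\<^sup>+G. ennreal (cmod (0 + G) powr (- (2 * \<tau>))) \<partial>cgauss)"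
        by (rule nn_integral_cmult) simp
      also have "\<dots> \<le> ennreal (k * (1 + ?F H powr (- s))) * ennreal C2"
        by (intro mult_left_mono C2) auto
      finally show ?case .
    qed
    also have "\<dots> = (\<integral>\<^sup>+H. ennreal (k * C2) + ennreal (k * C2) * ennreal (?F H powr (- s)) \<partial>iid_cmat Mr Mt)"
      using k C2(1) by (intro nn_integral_cong) (simp add: algebra_simps flip: ennreal_mult ennreal_plus)
    also have "\<dots> = ennreal (k * C2) + ennreal (k * C2) * (\<integral>\<^sup>+H. ennreal (?F H powr (- s)) \<partial>iid_cmat Mr Mt)"
      using measurable_frob[OF ctx] by (subst nn_integral_add) (auto simp: nn_integral_cmult PH.emeasure_space_1)
    also have "\<dots> \<le> ennreal (k * C2) + ennreal (k * C2) * ennreal C1"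
      by (intro add_left_mono mult_left_mono C1) auto
    also have "\<dots> = ennreal (C2 * (1 + C1) * k)"
      using k C1(1) C2(1) by (simp add: algebra_simps flip: ennreal_mult ennreal_plus)
    finally have le: "(\<integral>\<^sup>+\<omega>. ennreal (?D (fst \<omega>) ((cmod (snd \<omega>))\<^sup>2)) \<partial>(iid_cmat Mr Mt \<Otimes>\<^sub>M cgauss)) \<le> ennreal (C2 * (1 + C1) * k)" .
    have "bsld_exp_dist Mt Mr b \<rho> \<rho>s L r \<xi> \<le> C2 * (1 + C1) * k"
      unfolding bsld_exp_dist_eq[OF ctx] using enn2real_mono[OF le] k C1(1) C2(1) by simp
    then show "bsld_exp_dist Mt Mr b \<rho> \<rho>s L r \<xi> \<le> C2 * (1 + C1) * \<rho>s powr (- \<tau>) * \<rho> powr (- ((1 - 1 / real L) * (b * (1 - \<delta>) * \<theta>)))"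
      by (simp add: k_def s_def mult.assoc)
  qed
qed

section \<open>An interleaved digit code\<close>

definition dval :: "real \<Rightarrow> nat \<Rightarrow> (nat \<Rightarrow> int) \<Rightarrow> real" where
  "dval \<beta> n x = (\<Sum>l<n. real_of_int (x l) / \<beta> ^ Suc l)"

lemma geometric_tail:
  fixes \<beta> :: real
  assumes "1 < \<beta>" "m \<le> n"
  shows "(\<Sum>l\<in>{m..<n}. (\<beta> - 1) / \<beta> ^ Suc l) \<le> 1 / \<beta> ^ m"
proof -
  have "(\<Sum>l\<in>{m..<n}. (\<beta> - 1) / \<beta> ^ Suc l) = 1 / \<beta> ^ m - 1 / \<beta> ^ n"
    using assms(2)
  proof (induction n rule: dec_induct)
    case (step n)
    have "(\<beta> - 1) / \<beta> ^ Suc n = 1 / \<beta> ^ n - 1 / \<beta> ^ Suc n"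
      using assms(1) by (simp add: field_simps)
    then show ?case using step by simp
  qed simp
  then show ?thesis using assms by simp
qed

lemma dval_diff_le:
  assumes B: "2 \<le> B" and x: "\<And>l. x l \<in> {0..<B}" and y: "\<And>l. y l \<in> {0..<B}" and eq: "\<And>l. l < l1 \<Longrightarrow> x l = y l"
  shows "\<bar>dval (real_of_int B) n x - dval (real_of_int B) n y\<bar> \<le> 1 / real_of_int B ^ l1"
proof -
  have B1: "1 < real_of_int B" using B by simp
  have "dval (real_of_int B) n x - dval (real_of_int B) n y = (\<Sum>l<n. real_of_int (x l - y l) / real_of_int B ^ Suc l)"
    by (simp add: dval_def sum_subtractf[symmetric] diff_divide_distrib)
  also have "\<dots> = (\<Sum>l\<in>{l1..<n}. real_of_int (x l - y l) / real_of_int B ^ Suc l)"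
    using eq by (intro sum.mono_neutral_right) (auto simp: not_le)
  also have "\<bar>\<dots>\<bar> \<le> (\<Sum>l\<in>{l1..<n}. (real_of_int B - 1) / real_of_int B ^ Suc l)"
  proof (intro order_trans[OF sum_abs] sum_mono)
    fix l
    have "\<bar>x l - y l\<bar> \<le> B - 1" using x[of l] y[of l] by auto
    then have "\<bar>real_of_int (x l - y l)\<bar> \<le> real_of_int B - 1" by linarith
    then show "\<bar>real_of_int (x l - y l) / real_of_int B ^ Suc l\<bar> \<le> (real_of_int B - 1) / real_of_int B ^ Suc l"
      using B1 by (simp add: abs_divide divide_right_mono del: of_int_diff)
  qed
  also have "\<dots> \<le> 1 / real_of_int B ^ l1"
  proof (cases "l1 \<le> n")
    case True then show ?thesis by (rule geometric_tail[OF B1])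
  qed (use B1 in simp)
  finally show ?thesis .
qed

text \<open>In base \<open>2 B\<close> the digit expansions with digits below \<open>B\<close> form a Cantor set, so that the first
  differing digit dominates the tail.\<close>
lemma dval_diff_ge:
  assumes B: "2 \<le> B" and x: "\<And>l. x l \<in> {0..<B}" and y: "\<And>l. y l \<in> {0..<B}"
    and eq: "\<And>l. l < l0 \<Longrightarrow> x l = y l" and ne: "x l0 \<noteq> y l0" and n: "l0 < n"
  shows "1 / (2 * (2 * real_of_int B) ^ Suc l0) \<le> \<bar>dval (2 * real_of_int B) n x - dval (2 * real_of_int B) n y\<bar>"
proof -
  define \<beta> where "\<beta> = 2 * real_of_int B"
  have \<beta>: "4 \<le> \<beta>" using B by (simp add: \<beta>_def)
  define d where "d l = real_of_int (x l - y l) / \<beta> ^ Suc l" for l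
  have "dval \<beta> n x - dval \<beta> n y = (\<Sum>l<n. d l)"
    by (simp add: dval_def d_def sum_subtractf[symmetric] diff_divide_distrib)
  also have "\<dots> = (\<Sum>l\<in>{l0..<n}. d l)"
    using eq by (intro sum.mono_neutral_right) (auto simp: not_le d_def)
  also have "\<dots> = d l0 + (\<Sum>l\<in>{Suc l0..<n}. d l)"
    using n by (simp add: sum.atLeast_Suc_lessThan)
  finally have e: "dval \<beta> n x - dval \<beta> n y = d l0 + (\<Sum>l\<in>{Suc l0..<n}. d l)" .
  have "1 / \<beta> ^ Suc l0 \<le> \<bar>d l0\<bar>"
  proof -
    have "1 \<le> \<bar>x l0 - y l0\<bar>" using ne by auto
    then have "1 \<le> \<bar>real_of_int (x l0 - y l0)\<bar>" by linarith
    then show ?thesis using \<beta> by (simp add: d_def abs_divide divide_right_mono del: of_int_diff)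
  qed
  moreover have "\<bar>\<Sum>l\<in>{Suc l0..<n}. d l\<bar> \<le> 1 / 2 * (1 / \<beta> ^ Suc l0)"
  proof -
    have "\<bar>\<Sum>l\<in>{Suc l0..<n}. d l\<bar> \<le> (\<Sum>l\<in>{Suc l0..<n}. 1 / 2 * ((\<beta> - 1) / \<beta> ^ Suc l))"
    proof (intro order_trans[OF sum_abs] sum_mono)
      fix l
      have "\<bar>x l - y l\<bar> \<le> B - 1" using x[of l] y[of l] by auto
      then have "\<bar>real_of_int (x l - y l)\<bar> \<le> real_of_int B - 1" by linarith
      also have "\<dots> \<le> 1 / 2 * (\<beta> - 1)" by (simp add: \<beta>_def)
      finally have "\<bar>real_of_int (x l - y l)\<bar> / \<beta> ^ Suc l \<le> 1 / 2 * (\<beta> - 1) / \<beta> ^ Suc l"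
        using \<beta> by (intro divide_right_mono) auto
      then show "\<bar>d l\<bar> \<le> 1 / 2 * ((\<beta> - 1) / \<beta> ^ Suc l)"
        using \<beta> by (simp add: d_def abs_divide del: of_int_diff)
    qed
    also have "\<dots> \<le> 1 / 2 * (1 / \<beta> ^ Suc l0)"
      unfolding sum_distrib_left[symmetric] using \<beta> n by (intro mult_left_mono geometric_tail) auto
    finally show ?thesis .
  qed
  ultimately have "1 / 2 * (1 / \<beta> ^ Suc l0) \<le> \<bar>dval \<beta> n x - dval \<beta> n y\<bar>"
    unfolding e by linarith
  then show ?thesis by (simp add: \<beta>_def)
qed

text \<open>A word interleaves digit strings: digit \<open>l\<close> of string \<open>c\<close> among \<open>Q\<close> strings sits at position \<open>l * Q + c\<close>.\<close>
definition words :: "int \<Rightarrow> nat \<Rightarrow> (nat \<Rightarrow> int) set" where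
  "words B E = {w. (\<forall>e<E. w e \<in> {0..<B}) \<and> (\<forall>e\<ge>E. w e = 0)}"

text \<open>The number of summands is \<open>E\<close> for every \<open>Q\<close>, more than any
  single strand needs. Positions beyond the word carry the digit 0, so the same word can be read
  with different numbers of strands and in different bases.\<close>

definition strand :: "real \<Rightarrow> nat \<Rightarrow> nat \<Rightarrow> (nat \<Rightarrow> int) \<Rightarrow> nat \<Rightarrow> real" where
  "strand \<beta> E Q w c = dval \<beta> E (\<lambda>l. w (l * Q + c))"

lemma finite_words: "finite (words B E)"
proof -
  have "words B E \<subseteq> {w. \<forall>e. (e \<in> {..<E} \<longrightarrow> w e \<in> {0..<B}) \<and> (e \<notin> {..<E} \<longrightarrow> w e = 0)}"
    by (auto simp: words_def)
  moreover have "finite {w. \<forall>e. (e \<in> {..<E} \<longrightarrow> w e \<in> {0..<B}) \<and> (e \<notin> {..<E} \<longrightarrow> w e = 0)}"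
    by (rule finite_set_of_finite_funs) auto
  ultimately show ?thesis by (rule finite_subset)
qed

lemma words_digit: "w \<in> words B E \<Longrightarrow> 2 \<le> B \<Longrightarrow> w e \<in> {0..<B}"
  unfolding words_def by (cases "e < E") auto

lemma strand_bound:
  assumes "w \<in> words B E" "2 \<le> B"
  shows "0 \<le> strand (2 * real_of_int B) E Q w c" "strand (2 * real_of_int B) E Q w c \<le> 1"
proof -
  show "0 \<le> strand (2 * real_of_int B) E Q w c"
    unfolding strand_def dval_def using words_digit[OF assms] assms(2)
    by (intro sum_nonneg divide_nonneg_nonneg) auto
  have "strand (2 * real_of_int B) E Q w c \<le> (\<Sum>l\<in>{0..<E}. (2 * real_of_int B - 1) / (2 * real_of_int B) ^ Suc l)"
    unfolding strand_def dval_def atLeast0LessThan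
  proof (intro sum_mono divide_right_mono)
    fix l
    have "w (l * Q + c) \<le> 2 * B - 1" using words_digit[OF assms, of "l * Q + c"] assms(2) by auto
    then show "real_of_int (w (l * Q + c)) \<le> 2 * real_of_int B - 1" by linarith
  qed (use assms in auto)
  also have "\<dots> \<le> 1 / (2 * real_of_int B) ^ 0" using assms(2) by (intro geometric_tail) auto
  finally show "strand (2 * real_of_int B) E Q w c \<le> 1" by simp
qed

text \<open>The inverse of the map from channel coordinates to source coordinates is Hoelder continuous.\<close>
lemma strand_holder:
  fixes B :: int
  assumes B: "2 \<le> B" and P: "1 \<le> P" and Q: "1 \<le> Q" and \<kappa>: "0 \<le> \<kappa>" "\<kappa> * ln (2 * real_of_int B) * real Q \<le> real P * ln (real_of_int B)"
    and w: "w \<in> words B E" "w' \<in> words B E" and c: "c < Q"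
    and t: "\<And>c'. c' < P \<Longrightarrow> \<bar>strand (2 * real_of_int B) E P w c' - strand (2 * real_of_int B) E P w' c'\<bar> \<le> t"
  shows "\<bar>strand (real_of_int B) E Q w c - strand (real_of_int B) E Q w' c\<bar> \<le> real_of_int B * (4 * real_of_int B * t) powr \<kappa>"
proof (cases "w = w'")
  case True
  then show ?thesis using B by simp
next
  case False
  \<comment> \<open>At the first differing position \<open>e\<close> some channel strand differs at
    digit \<open>e div P\<close>, hence by about \<open>(2B)\<close> to the power
    \<open>- e/P\<close>, whereas every source strand agrees on its first \<open>e div Q\<close>
    digits and differs by at most about \<open>B\<close> to the power \<open>- e/Q\<close>. The
    condition on \<kappa> says exactly that the second quantity is at most the \<kappa>-th power of
    the first.\<close>
  define e where "e = (LEAST e. w e \<noteq> w' e)"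
  have ex: "\<exists>e. w e \<noteq> w' e" using False by auto
  have ne: "w e \<noteq> w' e" unfolding e_def by (rule LeastI_ex[OF ex])
  have eq: "w l = w' l" if "l < e" for l using not_less_Least[of l "\<lambda>e. w e \<noteq> w' e"] that by (auto simp: e_def)
  have eE: "e < E" using ne w by (auto simp: words_def not_le[symmetric])
  let ?B = "real_of_int B"
  have B2: "2 \<le> ?B" using B by simp
  have dP: "e div P * P + e mod P = e" by simp
  have "1 / (2 * (2 * ?B) ^ Suc (e div P)) \<le> \<bar>strand (2 * ?B) E P w (e mod P) - strand (2 * ?B) E P w' (e mod P)\<bar>"
    unfolding strand_def
  proof (rule dval_diff_ge[OF B])
    show "w (l * P + e mod P) = w' (l * P + e mod P)" if "l < e div P" for l
    proof (rule eq)
      have "l * P < e div P * P" using that P by simp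
      then show "l * P + e mod P < e" using dP by linarith
    qed
    show "w (e div P * P + e mod P) \<noteq> w' (e div P * P + e mod P)" using ne by simp
    show "e div P < E" using eE by (meson div_le_dividend le_less_trans)
  qed (use words_digit[OF w(1) B] words_digit[OF w(2) B] in auto)
  also have "\<dots> \<le> t" using P by (intro t) simp
  finally have "1 / (2 * (2 * ?B) ^ Suc (e div P)) \<le> t" .
  then have t1: "1 / (2 * ?B) ^ (e div P) \<le> 4 * ?B * t" using B2 by (simp add: field_simps)
  have "\<bar>strand ?B E Q w c - strand ?B E Q w' c\<bar> \<le> 1 / ?B ^ (e div Q)"
    unfolding strand_def
  proof (rule dval_diff_le[OF B])
    show "w (l * Q + c) = w' (l * Q + c)" if "l < e div Q" for l
    proof (rule eq)
      have "Suc l * Q \<le> e div Q * Q" using that by (intro mult_le_mono1) simp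
      also have "\<dots> \<le> e" by simp
      finally show "l * Q + c < e" using c by simp
    qed
  qed (use words_digit[OF w(1) B] words_digit[OF w(2) B] in auto)
  also have "\<dots> = ?B powr (- real (e div Q))"
    using B2 by (simp add: powr_minus_divide powr_realpow)
  \<comment> \<open>Rounding \<open>e / Q\<close> down to whole digits loses at most one digit; this
    is the leading factor \<open>B\<close> of the claim.\<close>
  also have "\<dots> \<le> ?B powr (1 - real e / real Q)"
  proof (intro powr_mono)
    have "real e / real Q \<le> real (e div Q) + 1"
    proof -
      have "e \<le> Q + e div Q * Q" using dividend_less_div_times[of Q e] Q by simp
      then have "real e \<le> real (Q + e div Q * Q)" by (simp only: of_nat_le_iff)
      then show ?thesis using Q by (simp add: field_simps)
    qed
    then show "- real (e div Q) \<le> 1 - real e / real Q" by simp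
  qed (use B2 in auto)
  also have "\<dots> = ?B * exp (- (real e / real Q * ln ?B))"
    using B2 by (simp add: powr_def exp_diff exp_minus left_diff_distrib divide_inverse)
  also have "\<dots> \<le> ?B * exp (- (real (e div P) * \<kappa> * ln (2 * ?B)))"
  proof -
    have "real (e div P) * \<kappa> * ln (2 * ?B) \<le> real e / real P * (\<kappa> * ln (2 * ?B))"
    proof -
      have "real (e div P) * real P \<le> real e" by (metis div_times_less_eq_dividend of_nat_le_iff of_nat_mult)
      then have "real (e div P) \<le> real e / real P" using P by (simp add: field_simps)
      moreover have "0 \<le> \<kappa> * ln (2 * ?B)" using \<kappa> B2 by (intro mult_nonneg_nonneg) auto
      ultimately show ?thesis by (metis mult.assoc mult_right_mono)
    qed
    also have "\<dots> \<le> real e / real P * (real P * ln ?B / real Q)"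
      using \<kappa> P Q by (intro mult_left_mono) (auto simp: field_simps)
    also have "\<dots> = real e / real Q * ln ?B" using P by simp
    finally show ?thesis using B2 by simp
  qed
  also have "exp (- (real (e div P) * \<kappa> * ln (2 * ?B))) = (1 / (2 * ?B) ^ (e div P)) powr \<kappa>"
  proof -
    have "ln (1 / X ^ n) = - (real n * ln X)" if "0 < X" for X :: real and n
      using that by (simp add: ln_divide_pos ln_realpow)
    from this[of "2 * ?B" "e div P"] show ?thesis using B2 by (simp add: powr_def mult_ac)
  qed
  also have "?B * (1 / (2 * ?B) ^ (e div P)) powr \<kappa> \<le> ?B * (4 * ?B * t) powr \<kappa>"
    using t1 B2 \<kappa> by (intro mult_left_mono powr_mono2) auto
  finally show ?thesis .
qed

text \<open>The difference \<open>\<lfloor>u B^(l+1)\<rfloor> - B \<lfloor>u B^l\<rfloor>\<close> is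
  digit \<open>l\<close> of the base \<open>B\<close> expansion; coordinates are interleaved in the
  positions read back by \<open>strand\<close>.\<close>

definition quant :: "int \<Rightarrow> nat \<Rightarrow> nat \<Rightarrow> (nat \<Rightarrow> real) \<Rightarrow> nat \<Rightarrow> int" where
  "quant B L Q u = (\<lambda>e. if e < L * Q then \<lfloor>u (e mod Q) * real_of_int B ^ Suc (e div Q)\<rfloor> - B * \<lfloor>u (e mod Q) * real_of_int B ^ (e div Q)\<rfloor> else 0)"

lemma quant_words:
  assumes "2 \<le> B"
  shows "quant B L Q u \<in> words B (L * Q)"
proof -
  have "\<lfloor>x * real_of_int B\<rfloor> - B * \<lfloor>x\<rfloor> \<in> {0..<B}" for x :: real
  proof -
    have 1: "real_of_int \<lfloor>x\<rfloor> \<le> x" "x < real_of_int \<lfloor>x\<rfloor> + 1" by linarith+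
    have "real_of_int (B * \<lfloor>x\<rfloor>) \<le> x * real_of_int B" using 1 assms by (simp add: mult.commute mult_left_mono)
    then have "B * \<lfloor>x\<rfloor> \<le> \<lfloor>x * real_of_int B\<rfloor>" by (simp only: le_floor_iff)
    moreover have "x * real_of_int B < real_of_int (B * \<lfloor>x\<rfloor> + B)"
    proof -
      have "x * real_of_int B < (real_of_int \<lfloor>x\<rfloor> + 1) * real_of_int B" using 1 assms by (intro mult_strict_right_mono) auto
      then show ?thesis by (simp add: algebra_simps)
    qed
    then have "\<lfloor>x * real_of_int B\<rfloor> < B * \<lfloor>x\<rfloor> + B" by (simp only: floor_less_iff)
    ultimately show ?thesis by simp
  qed
  from this[of "u (e mod Q) * real_of_int B ^ (e div Q)" for e] show ?thesis
    unfolding words_def quant_def by (auto simp: mult.assoc mult.commute[of "_ ^ _"])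
qed

text \<open>The digits telescope to \<open>\<lfloor>u B^L\<rfloor> / B^L\<close>, so the error is a
  fractional part divided by \<open>B^L\<close>. The bound \<open>u c < 1\<close> makes the integer
  part at the start of the telescope vanish.\<close>

lemma strand_quant:
  assumes B: "2 \<le> B" and c: "c < Q" and u: "0 \<le> u c" "u c < 1"
  shows "\<bar>u c - strand (real_of_int B) (L * Q) Q (quant B L Q u) c\<bar> \<le> 1 / real_of_int B ^ L"
proof -
  let ?B = "real_of_int B"
  have B0: "0 < ?B" using B by simp
  have q: "quant B L Q u (l * Q + c) = (if l < L then \<lfloor>u c * ?B ^ Suc l\<rfloor> - B * \<lfloor>u c * ?B ^ l\<rfloor> else 0)" for l
  proof -
    have "l * Q + c < L * Q \<longleftrightarrow> l < L"
    proof
      assume "l * Q + c < L * Q"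
      then have "l * Q < L * Q" by linarith
      then show "l < L" by simp
    next
      assume "l < L"
      then have "Suc l * Q \<le> L * Q" by (intro mult_le_mono1) simp
      then show "l * Q + c < L * Q" using c by simp
    qed
    moreover have "(l * Q + c) mod Q = c" "(l * Q + c) div Q = l" using c by auto
    ultimately show ?thesis by (simp add: quant_def)
  qed
  have LQ: "L \<le> L * Q" using c by (cases Q) auto
  have "strand ?B (L * Q) Q (quant B L Q u) c = (\<Sum>l<L * Q. real_of_int (if l < L then \<lfloor>u c * ?B ^ Suc l\<rfloor> - B * \<lfloor>u c * ?B ^ l\<rfloor> else 0) / ?B ^ Suc l)"
    unfolding strand_def dval_def q by simp
  also have "\<dots> = (\<Sum>l<L. real_of_int \<lfloor>u c * ?B ^ Suc l\<rfloor> / ?B ^ Suc l - real_of_int \<lfloor>u c * ?B ^ l\<rfloor> / ?B ^ l)"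
    using LQ B0 by (intro sum.mono_neutral_cong_right) (auto simp: field_simps)
  also have "\<dots> = real_of_int \<lfloor>u c * ?B ^ L\<rfloor> / ?B ^ L - real_of_int \<lfloor>u c * ?B ^ 0\<rfloor> / ?B ^ 0"
    by (rule sum_lessThan_telescope)
  also have "\<dots> = real_of_int \<lfloor>u c * ?B ^ L\<rfloor> / ?B ^ L"
  proof -
    have "\<lfloor>u c\<rfloor> = 0" using u by (simp add: floor_eq_iff)
    then show ?thesis by simp
  qed
  finally have s: "strand ?B (L * Q) Q (quant B L Q u) c = real_of_int \<lfloor>u c * ?B ^ L\<rfloor> / ?B ^ L" .
  have "u c - real_of_int \<lfloor>u c * ?B ^ L\<rfloor> / ?B ^ L = (u c * ?B ^ L - real_of_int \<lfloor>u c * ?B ^ L\<rfloor>) / ?B ^ L"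
    using B0 by (simp add: diff_divide_distrib)
  moreover have "0 \<le> u c * ?B ^ L - real_of_int \<lfloor>u c * ?B ^ L\<rfloor>" "u c * ?B ^ L - real_of_int \<lfloor>u c * ?B ^ L\<rfloor> \<le> 1"
    by linarith+
  ultimately show ?thesis unfolding s using B0 by (simp add: abs_divide divide_right_mono)
qed

text \<open>Doubling the base changes its logarithm by the constant \<open>ln 2\<close>, which is
  negligible for large \<open>B\<close>: the ratio of \<open>ln B\<close> to \<open>ln (2 B)\<close>
  tends to 1.\<close>

lemma ex_base:
  assumes "0 \<le> \<kappa>" "\<kappa> < p"
  shows "\<exists>B::int. 2 \<le> B \<and> \<kappa> * ln (2 * real_of_int B) \<le> p * ln (real_of_int B)"
proof -
  define x where "x = exp (\<kappa> * ln 2 / (p - \<kappa>))"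
  define B where "B = max 2 \<lceil>x\<rceil>"
  have B: "2 \<le> B" "x \<le> real_of_int B" unfolding B_def by linarith+
  have "\<kappa> * ln 2 / (p - \<kappa>) = ln x" by (simp add: x_def)
  also have "\<dots> \<le> ln (real_of_int B)" using B by (intro ln_mono) (auto simp: x_def)
  finally have "\<kappa> * ln 2 \<le> (p - \<kappa>) * ln (real_of_int B)" using assms by (simp add: field_simps)
  moreover have "ln (2 * real_of_int B) = ln 2 + ln (real_of_int B)" using B by (simp add: ln_mult)
  ultimately show ?thesis using B by (intro exI[of _ B]) (simp add: algebra_simps)
qed

section \<open>Stability of polynomial interpolation\<close>

text \<open>Induction by splitting off a linear factor at one of the points. The quotient has lower
  degree and is small at the remaining points, because distinct integers are at least 1 apart and
  the division therefore never enlarges the values.\<close>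

lemma poly_coeff_bound:
  "\<exists>C>0. \<forall>(p::complex poly) A \<epsilon>. degree p \<le> k \<longrightarrow> A \<subseteq> {..<N} \<longrightarrow> Suc k \<le> card A \<longrightarrow>
     (\<forall>i\<in>A. cmod (poly p (of_nat i)) \<le> \<epsilon>) \<longrightarrow> (\<forall>j. cmod (coeff p j) \<le> C * \<epsilon>)"
proof (induction k)
  case 0
  show ?case
  proof (intro exI[of _ 1] conjI allI impI)
    fix p :: "complex poly" and A \<epsilon> j
    assume p: "degree p \<le> 0" and A: "A \<subseteq> {..<N}" "Suc 0 \<le> card A" "\<forall>i\<in>A. cmod (poly p (of_nat i)) \<le> \<epsilon>"
    obtain i where i: "i \<in> A" using A by (metis card.empty ex_in_conv not_one_le_zero One_nat_def)
    obtain a where a: "p = [:a:]" using p by (metis degree_eq_zeroE le_zero_eq)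
    have "cmod a \<le> \<epsilon>" using A i a by auto
    moreover have "0 \<le> \<epsilon>" using calculation norm_ge_zero order_trans by blast
    ultimately show "cmod (coeff p j) \<le> 1 * \<epsilon>" using a by (cases j) auto
  qed simp
next
  case (Suc k)
  then obtain C where C: "0 < C" "\<And>(p::complex poly) A \<epsilon> j. degree p \<le> k \<Longrightarrow> A \<subseteq> {..<N} \<Longrightarrow> Suc k \<le> card A \<Longrightarrow>
     (\<And>i. i \<in> A \<Longrightarrow> cmod (poly p (of_nat i)) \<le> \<epsilon>) \<Longrightarrow> cmod (coeff p j) \<le> C * \<epsilon>" by metis
  \<comment> \<open>A coefficient of \<open>p\<close> is one of the quotient minus \<open>i0\<close>
    times the next one, with \<open>i0\<close> below \<open>N\<close>; the quotient has values up to
    \<open>2 * \<epsilon>\<close>. The final 1 accounts for the value of \<open>p\<close> at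
    \<open>i0\<close> in the constant coefficient.\<close>
  define C' where "C' = (1 + real N) * (C * 2) + 1"
  show ?case
  proof (intro exI[of _ C'] conjI allI impI)
    show "0 < C'" using C by (simp add: C'_def add_nonneg_pos)
    fix p :: "complex poly" and A \<epsilon> j
    assume p: "degree p \<le> Suc k" and A: "A \<subseteq> {..<N}" "Suc (Suc k) \<le> card A" and small: "\<forall>i\<in>A. cmod (poly p (of_nat i)) \<le> \<epsilon>"
    have finA: "finite A" using A finite_subset by blast
    obtain i0 where i0: "i0 \<in> A" using A by (metis card.empty ex_in_conv not_less_eq_eq zero_le)
    define r where "r = synthetic_div p (of_nat i0)"
    have rdeg: "degree r \<le> k" using p by (simp add: r_def degree_synthetic_div)
    have rc: "p + Polynomial.smult (of_nat i0) r = pCons (poly p (of_nat i0)) r"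
      unfolding r_def by (rule synthetic_div_correct)
    have \<epsilon>: "0 \<le> \<epsilon>" using small i0 norm_ge_zero order_trans by blast
    have rsmall: "cmod (poly r (of_nat i)) \<le> 2 * \<epsilon>" if i: "i \<in> A - {i0}" for i
    proof -
      have "poly p (of_nat i) + of_nat i0 * poly r (of_nat i) = poly p (of_nat i0) + of_nat i * poly r (of_nat i)"
        using arg_cong[OF rc, of "\<lambda>p. poly p (of_nat i)"] by simp
      then have "(of_nat i - of_nat i0) * poly r (of_nat i) = poly p (of_nat i) - poly p (of_nat i0)"
        by (simp add: algebra_simps)
      then have "cmod (of_nat i - of_nat i0) * cmod (poly r (of_nat i)) = cmod (poly p (of_nat i) - poly p (of_nat i0))"
        by (metis norm_mult)
      also have "\<dots> \<le> \<epsilon> + \<epsilon>" using small i i0 by (intro order_trans[OF norm_triangle_ineq4] add_mono) auto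
      finally have 1: "cmod (of_nat i - of_nat i0) * cmod (poly r (of_nat i)) \<le> 2 * \<epsilon>" by simp
      have "1 \<le> cmod (of_nat i - of_nat i0)"
      proof -
        have "(of_nat i - of_nat i0 :: complex) = of_int (int i - int i0)" by simp
        then have "cmod (of_nat i - of_nat i0) = \<bar>real_of_int (int i - int i0)\<bar>" by (metis norm_of_int)
        moreover have "1 \<le> \<bar>int i - int i0\<bar>" using i by auto
        ultimately show ?thesis by linarith
      qed
      then have "1 * cmod (poly r (of_nat i)) \<le> cmod (of_nat i - of_nat i0) * cmod (poly r (of_nat i))"
        by (intro mult_right_mono) auto
      then show ?thesis using 1 by simp
    qed
    have rb: "cmod (coeff r j) \<le> C * (2 * \<epsilon>)" for j
      by (rule C(2)[OF rdeg, of "A - {i0}"]) (use A i0 finA rsmall in auto)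
    have i0N: "real i0 \<le> real N" using i0 A by auto
    have prod: "cmod (of_nat i0 * coeff r j) \<le> real N * (C * (2 * \<epsilon>))" for j
      unfolding norm_mult using rb i0N by (intro mult_mono) auto
    show "cmod (coeff p j) \<le> C' * \<epsilon>"
    proof (cases j)
      case 0
      have "coeff p 0 + of_nat i0 * coeff r 0 = poly p (of_nat i0)"
        using arg_cong[OF rc, of "\<lambda>p. coeff p 0"] by simp
      then have "coeff p 0 = poly p (of_nat i0) - of_nat i0 * coeff r 0" by (simp add: algebra_simps)
      then have "cmod (coeff p 0) \<le> \<epsilon> + real N * (C * (2 * \<epsilon>))"
        using small i0 prod by (auto intro!: order_trans[OF norm_triangle_ineq4] add_mono)
      also have "\<dots> \<le> C' * \<epsilon>" using C(1) \<epsilon> by (simp add: C'_def algebra_simps)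
      finally show ?thesis using 0 by simp
    next
      case (Suc j')
      have "coeff p (Suc j') + of_nat i0 * coeff r (Suc j') = coeff r j'"
        using arg_cong[OF rc, of "\<lambda>p. coeff p (Suc j')"] by simp
      then have "coeff p (Suc j') = coeff r j' - of_nat i0 * coeff r (Suc j')" by (simp add: algebra_simps)
      then have "cmod (coeff p (Suc j')) \<le> C * (2 * \<epsilon>) + real N * (C * (2 * \<epsilon>))"
        using prod rb by (auto intro!: order_trans[OF norm_triangle_ineq4] add_mono)
      also have "\<dots> \<le> C' * \<epsilon>" using C(1) \<epsilon> by (simp add: C'_def algebra_simps)
      finally show ?thesis using Suc by simp
    qed
  qed
qed

definition peval :: "nat \<Rightarrow> (nat \<Rightarrow> complex) \<Rightarrow> nat \<Rightarrow> complex" where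
  "peval k a i = (\<Sum>j<k. a j * of_nat i ^ j)"

lemma peval_coeff_bound:
  "\<exists>C>0. \<forall>a A \<epsilon>. A \<subseteq> {..<N} \<longrightarrow> k \<le> card A \<longrightarrow> (\<forall>i\<in>A. cmod (peval k a i) \<le> \<epsilon>) \<longrightarrow> (\<forall>j<k. cmod (a j) \<le> C * \<epsilon>)"
proof (cases k)
  case 0
  then show ?thesis by (intro exI[of _ 1]) auto
next
  case (Suc k')
  obtain C where C: "0 < C" "\<And>(p::complex poly) A \<epsilon> j. degree p \<le> k' \<Longrightarrow> A \<subseteq> {..<N} \<Longrightarrow> Suc k' \<le> card A \<Longrightarrow>
     (\<And>i. i \<in> A \<Longrightarrow> cmod (poly p (of_nat i)) \<le> \<epsilon>) \<Longrightarrow> cmod (coeff p j) \<le> C * \<epsilon>"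
    using poly_coeff_bound[of k' N] by metis
  show ?thesis
  proof (intro exI[of _ C] conjI allI impI)
    fix a :: "nat \<Rightarrow> complex" and A \<epsilon> j assume A: "A \<subseteq> {..<N}" "k \<le> card A" "\<forall>i\<in>A. cmod (peval k a i) \<le> \<epsilon>" and j: "j < k"
    define p where "p = (\<Sum>j<k. Polynomial.monom (a j) j)"
    have "poly p z = (\<Sum>j<k. a j * z ^ j)" for z by (simp add: p_def poly_sum poly_monom)
    then have e: "poly p (of_nat i) = peval k a i" for i by (simp add: peval_def)
    have c: "coeff p j = (if j < k then a j else 0)" for j by (simp add: p_def coeff_sum if_distrib cong: if_cong)
    have "degree p \<le> k'" unfolding p_def using Suc by (intro degree_sum_le) (auto intro: order_trans[OF degree_monom_le])
    then have "cmod (coeff p j) \<le> C * \<epsilon>" using A Suc by (intro C(2)) (auto simp: e)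
    then show "cmod (a j) \<le> C * \<epsilon>" using j by (simp add: c)
  qed (rule C)
qed

text \<open>Each factor is small at fewer points than its number of coefficients, so some evaluation point
  is good for both.\<close>
lemma peval_product_bound:
  assumes "1 \<le> M" "1 \<le> k"
  shows "\<exists>c>0. \<forall>h a. \<exists>i<M + k - 1. \<forall>t<M. \<forall>j<k. c * cmod (h t) * cmod (a j) \<le> cmod (peval M h i * peval k a i)"
proof -
  define N where "N = M + k - 1"
  obtain C1 where C1: "0 < C1" "\<And>a A \<epsilon> j. A \<subseteq> {..<N} \<Longrightarrow> M \<le> card A \<Longrightarrow> (\<And>i. i \<in> A \<Longrightarrow> cmod (peval M a i) \<le> \<epsilon>) \<Longrightarrow> j < M \<Longrightarrow> cmod (a j) \<le> C1 * \<epsilon>"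
    using peval_coeff_bound[of N M] by metis
  obtain C2 where C2: "0 < C2" "\<And>a A \<epsilon> j. A \<subseteq> {..<N} \<Longrightarrow> k \<le> card A \<Longrightarrow> (\<And>i. i \<in> A \<Longrightarrow> cmod (peval k a i) \<le> \<epsilon>) \<Longrightarrow> j < k \<Longrightarrow> cmod (a j) \<le> C2 * \<epsilon>"
    using peval_coeff_bound[of N k] by metis
  \<comment> \<open>A point is bad if the value there is small compared with some coefficient. With
    \<open>m\<close> bad points the coefficient bound, applied at the level
    \<open>\<mu> / (2 * C)\<close>, would bound the largest coefficient \<mu> by half of itself, so
    \<mu> would be 0; but a bad point requires a coefficient of positive modulus.\<close>
  have key: "card {i\<in>{..<N}. \<not> (\<forall>t<m. cmod (h t) \<le> 2 * C * cmod (peval m h i))} < m"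
    if C: "0 < C" "\<And>a A \<epsilon> j. A \<subseteq> {..<N} \<Longrightarrow> m \<le> card A \<Longrightarrow> (\<And>i. i \<in> A \<Longrightarrow> cmod (peval m a i) \<le> \<epsilon>) \<Longrightarrow> j < m \<Longrightarrow> cmod (a j) \<le> C * \<epsilon>" and m: "1 \<le> m" for C m h
  proof (rule ccontr)
    let ?A = "{i\<in>{..<N}. \<not> (\<forall>t<m. cmod (h t) \<le> 2 * C * cmod (peval m h i))}"
    assume "\<not> ?thesis"
    then have card: "m \<le> card ?A" by simp
    define \<mu> where "\<mu> = Max ((\<lambda>t. cmod (h t)) ` {..<m})"
    have le: "cmod (h t) \<le> \<mu>" if "t < m" for t unfolding \<mu>_def using that by (intro Max_ge) auto
    have "\<mu> \<in> (\<lambda>t. cmod (h t)) ` {..<m}" unfolding \<mu>_def using m by (intro Max_in) (auto simp: lessThan_empty_iff)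
    then obtain t0 where t0: "t0 < m" "\<mu> = cmod (h t0)" by auto
    have "cmod (peval m h i) \<le> \<mu> / (2 * C)" if i: "i \<in> ?A" for i
    proof -
      obtain t where "t < m" "2 * C * cmod (peval m h i) < cmod (h t)" using i by (auto simp: not_le)
      then have "2 * C * cmod (peval m h i) \<le> \<mu>" using le[of t] by linarith
      then show ?thesis using C(1) by (simp add: field_simps)
    qed
    then have "cmod (h t0) \<le> C * (\<mu> / (2 * C))" using card t0 by (intro C(2)[of ?A]) auto
    then have "\<mu> \<le> \<mu> / 2" using C(1) t0 by simp
    then have "\<mu> \<le> 0" by simp
    have "?A \<noteq> {}"
    proof
      assume "?A = {}"
      then have "card ?A = 0" by (simp only: card.empty)
      then show False using card m by linarith
    qed
    then obtain i where i: "i \<in> ?A" by blast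
    then obtain t where t: "t < m" "2 * C * cmod (peval m h i) < cmod (h t)" by (auto simp: not_le)
    have "0 \<le> 2 * C * cmod (peval m h i)" using C(1) by simp
    then show False using t le[of t] \<open>\<mu> \<le> 0\<close> by linarith
  qed
  show ?thesis
  proof (intro exI[of _ "1 / (2 * C1 * (2 * C2))"] conjI allI)
    show "0 < 1 / (2 * C1 * (2 * C2))" using C1 C2 by simp
    fix h a
    let ?A = "{i\<in>{..<N}. \<not> (\<forall>t<M. cmod (h t) \<le> 2 * C1 * cmod (peval M h i))}"
    let ?B = "{i\<in>{..<N}. \<not> (\<forall>t<k. cmod (a t) \<le> 2 * C2 * cmod (peval k a i))}"
    have "card (?A \<union> ?B) \<le> card ?A + card ?B" by (rule card_Un_le)
    also have "\<dots> < N"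
    proof -
      have "card ?A < M"
      proof (rule key[where C=C1 and m=M and h=h])
        show "cmod (x j) \<le> C1 * \<epsilon>" if "A \<subseteq> {..<N}" "M \<le> card A" "\<And>i. i \<in> A \<Longrightarrow> cmod (peval M x i) \<le> \<epsilon>" "j < M" for x A \<epsilon> j
          using that by (rule C1(2))
      qed (fact C1(1) assms)+
      moreover have "card ?B < k"
      proof (rule key[where C=C2 and m=k and h=a])
        show "cmod (x j) \<le> C2 * \<epsilon>" if "A \<subseteq> {..<N}" "k \<le> card A" "\<And>i. i \<in> A \<Longrightarrow> cmod (peval k x i) \<le> \<epsilon>" "j < k" for x A \<epsilon> j
          using that by (rule C2(2))
      qed (fact C2(1) assms)+
      ultimately show ?thesis by (simp add: N_def)
    qed
    finally have "card (?A \<union> ?B) < card {..<N}" by simp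
    have "\<not> {..<N} \<subseteq> ?A \<union> ?B"
    proof
      assume "{..<N} \<subseteq> ?A \<union> ?B"
      then have "card {..<N} \<le> card (?A \<union> ?B)" by (intro card_mono) auto
      then show False using \<open>card (?A \<union> ?B) < card {..<N}\<close> by linarith
    qed
    then obtain i where i: "i < N" "i \<notin> ?A" "i \<notin> ?B" by auto
    have "1 / (2 * C1 * (2 * C2)) * cmod (h t) * cmod (a j) \<le> cmod (peval M h i * peval k a i)" if tj: "t < M" "j < k" for t j
    proof -
      have "cmod (h t) * cmod (a j) \<le> (2 * C1 * cmod (peval M h i)) * (2 * C2 * cmod (peval k a i))"
        using i tj C1 C2 by (intro mult_mono) auto
      then show ?thesis using C1 C2 by (simp add: norm_mult field_simps)
    qed
    then show "\<exists>i<M + k - 1. \<forall>t<M. \<forall>j<k. 1 / (2 * C1 * (2 * C2)) * cmod (h t) * cmod (a j) \<le> cmod (peval M h i * peval k a i)"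
      using i by (auto simp: N_def)
  qed
qed

section \<open>The block code\<close>

text \<open>After multiplication by \<open>cmod c\<close> the path from \<open>c\<close> to
  \<open>cmod c * sgn w\<close> is broken at \<open>w\<close>; both pieces are at most
  \<open>cmod (c - w)\<close>. This also covers \<open>w = 0\<close>, where \<open>sgn\<close> is
  0.\<close>

lemma sgn_diff_le:
  fixes c w :: complex
  assumes "c \<noteq> 0"
  shows "cmod (sgn c - sgn w) \<le> 2 * cmod (c - w) / cmod c"
proof -
  have "cmod c * cmod (sgn c - sgn w) = cmod (c - cmod c * sgn w)"
  proof -
    have "complex_of_real (cmod c) * sgn c = c" using assms by (simp add: sgn_eq)
    then have "complex_of_real (cmod c) * (sgn c - sgn w) = c - cmod c * sgn w" by (simp only: right_diff_distrib)
    then show ?thesis by (metis norm_mult norm_of_real abs_norm_cancel)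
  qed
  also have "\<dots> \<le> cmod (c - w) + cmod (w - cmod c * sgn w)"
    using norm_triangle_ineq[of "c - w" "w - cmod c * sgn w"] by simp
  also have "cmod (w - cmod c * sgn w) \<le> cmod (c - w)"
  proof (cases "w = 0")
    case False
    have "w - cmod c * sgn w = (cmod w - cmod c) * sgn w"
    proof -
      have "complex_of_real (cmod w) * sgn w = w" using False by (simp add: sgn_eq)
      then show ?thesis by (simp only: left_diff_distrib of_real_diff)
    qed
    then have "cmod (w - cmod c * sgn w) = \<bar>cmod w - cmod c\<bar>"
      using False by (metis norm_mult norm_of_real norm_sgn mult.right_neutral of_real_diff)
    then show ?thesis using norm_triangle_ineq3[of w c] by (simp add: norm_minus_commute)
  qed simp
  finally show ?thesis using assms by (simp add: field_simps)
qed

lemma sgn_scale_pos: "0 < r \<Longrightarrow> sgn (complex_of_real r * z) = sgn z"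
  by (simp add: sgn_mult sgn_of_real)

text \<open>Phase error of the side information channel estimated from a single training sample.\<close>
lemma phase_error:
  fixes c h S0 N0 Z0 :: complex and A \<mu> :: real
  assumes c: "c \<noteq> 0" and h: "h \<noteq> 0" and A: "0 < A" and \<mu>: "0 \<le> \<mu>" "\<mu> \<le> 1"
    and V: "V = S0 + N0 / (A * h)" "V \<noteq> 0"
  shows "(cmod (sgn c - sgn ((c * S0 + Z0) * cnj (A * h * S0 + N0) * h)))\<^sup>2
    \<le> 16 * (cmod (N0 / (A * h)) powr (2 * \<mu>) + cmod Z0 powr (2 * \<mu>) * cmod c powr (- (2 * \<mu>))) * cmod V powr (- (2 * \<mu>))"
proof -
  define N' where "N' = N0 / (A * h)"
  have V': "A * h * S0 + N0 = A * h * V" using h A by (simp add: V(1) field_simps)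
  \<comment> \<open>\<open>V\<close> is the training sample as seen after dividing out the channel.
    Up to a positive factor the statistic is the received side information times the conjugate of
    \<open>V\<close>; without noise it would be \<open>c\<close> times
    \<open>(cmod V)\<^sup>2\<close> and have the phase of \<open>c\<close>.\<close>
  have "(c * S0 + Z0) * cnj (A * h * S0 + N0) * h = complex_of_real (A * (cmod h)\<^sup>2) * ((c * S0 + Z0) * cnj V)"
    unfolding V' by (simp add: complex_norm_square mult_ac del: of_real_power)
  then have s1: "sgn ((c * S0 + Z0) * cnj (A * h * S0 + N0) * h) = sgn ((c * S0 + Z0) * cnj V)"
  proof -
    have "0 < A * (cmod h)\<^sup>2" using A h by simp
    from sgn_scale_pos[OF this] show ?thesis by (simp only: \<open>(c * S0 + Z0) * cnj (A * h * S0 + N0) * h = _\<close>)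
  qed
  have "0 < (cmod V)\<^sup>2" using V(2) by simp
  from sgn_scale_pos[OF this, of c] have s2: "sgn c = sgn (c * complex_of_real ((cmod V)\<^sup>2))"
    by (simp only: mult.commute[of c])
  define x where "x = (cmod c * cmod N' + cmod Z0) / (cmod c * cmod V)"
  have x0: "0 \<le> x" by (simp add: x_def)
  have "cmod (sgn c - sgn ((c * S0 + Z0) * cnj V)) \<le> 2 * cmod (c * complex_of_real ((cmod V)\<^sup>2) - (c * S0 + Z0) * cnj V) / cmod (c * complex_of_real ((cmod V)\<^sup>2))"
    unfolding s2 using c V(2) by (intro sgn_diff_le) simp
  also have "c * complex_of_real ((cmod V)\<^sup>2) - (c * S0 + Z0) * cnj V = (c * N' - Z0) * cnj V"
  proof -
    have "V - S0 = N'" by (simp add: V(1) N'_def)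
    moreover have "c * (V * cnj V) - (c * S0 + Z0) * cnj V = (c * (V - S0) - Z0) * cnj V" by (simp add: algebra_simps)
    ultimately show ?thesis unfolding complex_norm_square by simp
  qed
  also have "2 * cmod ((c * N' - Z0) * cnj V) / cmod (c * complex_of_real ((cmod V)\<^sup>2)) = 2 * (cmod (c * N' - Z0) / (cmod c * cmod V))"
    using V(2) by (simp add: norm_mult power2_eq_square)
  also have "\<dots> \<le> 2 * x"
    unfolding x_def using norm_triangle_ineq4[of "c * N'" Z0]
    by (intro mult_left_mono divide_right_mono) (auto simp: norm_mult)
  finally have e1: "cmod (sgn c - sgn ((c * S0 + Z0) * cnj V)) \<le> 2 * x" .
  have e2: "cmod (sgn c - sgn ((c * S0 + Z0) * cnj V)) \<le> 2"
    by (rule order_trans[OF norm_triangle_ineq4]) (auto simp: norm_sgn)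
  \<comment> \<open>The error is at most \<open>2 * x\<close> and at most 2. For \<mu> \<le> 1 both
    bounds lie below twice \<open>x powr \<mu>\<close>, which grows slowly enough for the moments
    used later.\<close>
  have e3: "(cmod (sgn c - sgn ((c * S0 + Z0) * cnj V)))\<^sup>2 \<le> 4 * x powr (2 * \<mu>)"
  proof (cases "x \<le> 1")
    case True
    have "(cmod (sgn c - sgn ((c * S0 + Z0) * cnj V)))\<^sup>2 \<le> (2 * x)\<^sup>2" using e1 by (intro power_mono) auto
    also have "\<dots> = 4 * x powr 2" using x0 by (cases "x = 0") (auto simp: power_mult_distrib powr_numeral)
    also have "\<dots> \<le> 4 * x powr (2 * \<mu>)" using powr_mono'[of "2 * \<mu>" 2 x] True x0 \<mu> by linarith
    finally show ?thesis .
  next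
    case False
    have "(cmod (sgn c - sgn ((c * S0 + Z0) * cnj V)))\<^sup>2 \<le> 2\<^sup>2" using e2 by (intro power_mono) auto
    also have "\<dots> \<le> 4 * x powr (2 * \<mu>)" using False \<mu> ge_one_powr_ge_zero[of x "2 * \<mu>"] by simp
    finally show ?thesis .
  qed
  have e4: "x powr (2 * \<mu>) \<le> 4 * (cmod N' powr (2 * \<mu>) + cmod Z0 powr (2 * \<mu>) * cmod c powr (- (2 * \<mu>))) * cmod V powr (- (2 * \<mu>))"
  proof -
    \<comment> \<open>Replacing the sum by twice the maximum splits its power without any case
      distinction on the exponent.\<close>
    define m where "m = max (cmod c * cmod N') (cmod Z0)"
    have m0: "0 \<le> m" by (simp add: m_def le_max_iff_disj)
    have "x powr (2 * \<mu>) \<le> (2 * m / (cmod c * cmod V)) powr (2 * \<mu>)"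
      unfolding x_def using \<mu> by (intro powr_mono2 divide_right_mono) (auto simp: m_def)
    also have "\<dots> = 2 powr (2 * \<mu>) * m powr (2 * \<mu>) * (cmod c powr (- (2 * \<mu>)) * cmod V powr (- (2 * \<mu>)))"
      using m0 by (simp add: powr_divide powr_mult powr_minus_divide)
    also have "\<dots> \<le> 4 * ((cmod c * cmod N') powr (2 * \<mu>) + cmod Z0 powr (2 * \<mu>)) * (cmod c powr (- (2 * \<mu>)) * cmod V powr (- (2 * \<mu>)))"
    proof (intro mult_right_mono mult_mono)
      have "2 powr (2 * \<mu>) \<le> 2 powr (2::real)" using \<mu> by (intro powr_mono) auto
      then show "2 powr (2 * \<mu>) \<le> 4" by simp
      show "m powr (2 * \<mu>) \<le> (cmod c * cmod N') powr (2 * \<mu>) + cmod Z0 powr (2 * \<mu>)"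
        unfolding m_def max_def by auto
    qed auto
    also have "(cmod c * cmod N') powr (2 * \<mu>) = cmod c powr (2 * \<mu>) * cmod N' powr (2 * \<mu>)"
      by (simp add: powr_mult)
    also have "4 * (cmod c powr (2 * \<mu>) * cmod N' powr (2 * \<mu>) + cmod Z0 powr (2 * \<mu>)) * (cmod c powr (- (2 * \<mu>)) * cmod V powr (- (2 * \<mu>)))
       = 4 * (cmod N' powr (2 * \<mu>) * (cmod c powr (2 * \<mu>) * cmod c powr (- (2 * \<mu>))) + cmod Z0 powr (2 * \<mu>) * cmod c powr (- (2 * \<mu>))) * cmod V powr (- (2 * \<mu>))"
      by (simp add: algebra_simps)
    also have "cmod c powr (2 * \<mu>) * cmod c powr (- (2 * \<mu>)) = 1" using c by (simp flip: powr_add)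
    finally show ?thesis by simp
  qed
  show ?thesis unfolding s1 N'_def[symmetric] using e3 e4 by linarith
qed

section \<open>From source samples to channel inputs\<close>

text \<open>Dividing by 4 and not by 2 keeps the values at most 1/2, hence strictly below 1 as the
  digit expansion requires.\<close>

definition clip :: "real \<Rightarrow> real \<Rightarrow> real" where
  "clip R x = (max (-1) (min 1 (x / R)) + 1) / 4"

lemma clip_range: "0 \<le> clip R x" "clip R x < 1"
  by (auto simp: clip_def max_def min_def)

text \<open>\<open>R (4 u - 1)\<close> inverts \<open>clip R\<close> on \<open>[-R, R]\<close>.\<close>
lemma clip_error:
  assumes R: "0 < R" and g: "0 \<le> g" and xy: "\<bar>x\<bar> \<le> y"
  shows "(x - R * (4 * v - 1))\<^sup>2 \<le> 2 * (y powr (2 + g) * R powr (- g)) + 32 * R\<^sup>2 * (clip R x - v)\<^sup>2"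
proof -
  define d where "d = x - R * (4 * clip R x - 1)"
  \<comment> \<open>The clipping error vanishes up to \<open>R\<close> and is at most
    \<open>\<bar>x\<bar>\<close> beyond it, where a factor \<open>(\<bar>x\<bar> / R) powr g\<close>
    can be inserted because it is at least 1. A moment of order \<open>2 + g\<close> thus makes the
    mean error of order \<open>R powr (- g)\<close>.\<close>
  have d: "d\<^sup>2 \<le> y powr (2 + g) * R powr (- g)"
  proof (cases "\<bar>x\<bar> \<le> R")
    case True
    then have "d = 0" using R by (auto simp: d_def clip_def max_def min_def field_simps abs_le_iff)
    then show ?thesis by simp
  next
    case False
    have "\<bar>d\<bar> \<le> \<bar>x\<bar>" using False R by (auto simp: d_def clip_def max_def min_def field_simps abs_if split: if_splits)
    then have "d\<^sup>2 \<le> x\<^sup>2" by (simp add: abs_le_square_iff)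
    also have "\<dots> = \<bar>x\<bar> powr 2" using False R by (simp add: powr_numeral)
    also have "\<dots> \<le> \<bar>x\<bar> powr 2 * (\<bar>x\<bar> / R) powr g"
    proof -
      have "1 \<le> (\<bar>x\<bar> / R) powr g" using False R g by (intro ge_one_powr_ge_zero) auto
      from mult_left_mono[OF this, of "\<bar>x\<bar> powr 2"] show ?thesis by simp
    qed
    also have "\<dots> = \<bar>x\<bar> powr (2 + g) * R powr (- g)"
      using False R by (simp add: powr_add powr_divide powr_minus_divide)
    also have "\<dots> \<le> y powr (2 + g) * R powr (- g)"
      using xy g by (intro mult_right_mono powr_mono2) auto
    finally show ?thesis .
  qed
  have "x - R * (4 * v - 1) = d + 4 * R * (clip R x - v)" by (simp add: d_def algebra_simps)
  then have "(x - R * (4 * v - 1))\<^sup>2 = (d + 4 * R * (clip R x - v))\<^sup>2" by simp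
  also have "\<dots> \<le> 2 * d\<^sup>2 + 2 * (4 * R * (clip R x - v))\<^sup>2"
    using sum_squares_bound[of d "4 * R * (clip R x - v)"] by (simp add: power2_sum)
  also have "\<dots> = 2 * d\<^sup>2 + 32 * R\<^sup>2 * (clip R x - v)\<^sup>2" by (simp add: power_mult_distrib)
  finally show ?thesis using d by linarith
qed

text \<open>Source coordinates \<open>2 c\<close> and \<open>2 c + 1\<close> are the real and imaginary parts of data sample \<open>1 + c\<close>;
  sample \<open>0\<close> is the training sample.\<close>
definition src_coord :: "real \<Rightarrow> cvec \<Rightarrow> nat \<Rightarrow> real" where
  "src_coord R S c = clip R (if even c then Re (S (Suc (c div 2))) else Im (S (Suc (c div 2))))"

definition src_word :: "int \<Rightarrow> nat \<Rightarrow> nat \<Rightarrow> real \<Rightarrow> cvec \<Rightarrow> nat \<Rightarrow> int" where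
  "src_word B L q R S = quant B L (2 * q) (src_coord R S)"

text \<open>The same word is read twice: with \<open>2 * k\<close> strands in base
  \<open>2 B\<close> as channel symbols, and with \<open>2 * q\<close> strands in base
  \<open>B\<close> as source values in \<open>word_src\<close>. The ratio of \<open>k\<close> to
  \<open>q\<close> is the bandwidth expansion of the block.\<close>

definition word_sym :: "int \<Rightarrow> nat \<Rightarrow> nat \<Rightarrow> (nat \<Rightarrow> int) \<Rightarrow> nat \<Rightarrow> complex" where
  "word_sym B E k w j = Complex (strand (2 * real_of_int B) E (2 * k) w (2 * j)) (strand (2 * real_of_int B) E (2 * k) w (2 * j + 1))"

definition word_src :: "int \<Rightarrow> nat \<Rightarrow> nat \<Rightarrow> real \<Rightarrow> (nat \<Rightarrow> int) \<Rightarrow> nat \<Rightarrow> complex" where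
  "word_src B E q R w c = Complex (R * (4 * strand (real_of_int B) E (2 * q) w (2 * c) - 1)) (R * (4 * strand (real_of_int B) E (2 * q) w (2 * c + 1) - 1))"

lemma cmod_word_sym_le:
  assumes "w \<in> words B E" "2 \<le> B"
  shows "cmod (word_sym B E k w j) \<le> 2"
proof -
  have "cmod (word_sym B E k w j) \<le> \<bar>Re (word_sym B E k w j)\<bar> + \<bar>Im (word_sym B E k w j)\<bar>" by (rule cmod_le)
  also have "\<dots> \<le> 2"
    using strand_bound[OF assms, of "2 * k" "2 * j"] strand_bound[OF assms, of "2 * k" "2 * j + 1"] by (simp add: word_sym_def)
  finally show ?thesis .
qed

text \<open>Three sources of error: clipping at \<open>R\<close>, truncation to \<open>L\<close>
  digits, and decoding to a wrong word. The last is small if the wrong word has nearby channel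
  symbols, by \<open>strand_holder\<close>.\<close>

lemma word_src_error:
  fixes B :: int
  assumes B: "2 \<le> B" and k: "1 \<le> k" and q: "1 \<le> q" and \<kappa>: "0 \<le> \<kappa>" "\<kappa> * ln (2 * real_of_int B) * real (2 * q) \<le> real (2 * k) * ln (real_of_int B)"
    and R: "0 < R" and g: "0 \<le> g" and w: "w \<in> words B (L * (2 * q))" and c: "c < q"
    and t: "0 \<le> t" "\<And>j. j < k \<Longrightarrow> cmod (word_sym B (L * (2 * q)) k (src_word B L q R S) j - word_sym B (L * (2 * q)) k w j) \<le> t"
  shows "(cmod (S (Suc c) - word_src B (L * (2 * q)) q R w c))\<^sup>2
     \<le> 4 * (cmod (S (Suc c)) powr (2 + g) * R powr (- g)) + 128 * R\<^sup>2 * (1 / real_of_int B ^ L)\<^sup>2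
       + 128 * R\<^sup>2 * (real_of_int B * (4 * real_of_int B) powr \<kappa>)\<^sup>2 * t powr (2 * \<kappa>)"
proof -
  let ?B = "real_of_int B" and ?E = "L * (2 * q)"
  define w0 where "w0 = src_word B L q R S"
  have w0: "w0 \<in> words B ?E" unfolding w0_def src_word_def by (rule quant_words[OF B])
  define C where "C = ?B * (4 * ?B) powr \<kappa>"
  have coord: "(clip R x - strand ?B ?E (2 * q) w c')\<^sup>2 \<le> 2 * (1 / ?B ^ L)\<^sup>2 + 2 * C\<^sup>2 * t powr (2 * \<kappa>)"
    if c': "c' < 2 * q" and x: "clip R x = src_coord R S c'" for c' x
  proof -
    have "\<bar>src_coord R S c' - strand ?B ?E (2 * q) w0 c'\<bar> \<le> 1 / ?B ^ L"
      unfolding w0_def src_word_def by (intro strand_quant B c') (auto simp: src_coord_def clip_range)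
    then have 1: "\<bar>clip R x - strand ?B ?E (2 * q) w0 c'\<bar> \<le> 1 / ?B ^ L" by (simp add: x)
    have 2: "\<bar>strand ?B ?E (2 * q) w0 c' - strand ?B ?E (2 * q) w c'\<bar> \<le> ?B * (4 * ?B * t) powr \<kappa>"
    proof (rule strand_holder[where P="2 * k"])
      fix p assume p: "p < 2 * k"
      have p2: "p div 2 < k" using p by linarith
      have "\<bar>Re (word_sym B ?E k w0 (p div 2) - word_sym B ?E k w (p div 2))\<bar> \<le> t"
        "\<bar>Im (word_sym B ?E k w0 (p div 2) - word_sym B ?E k w (p div 2))\<bar> \<le> t"
        unfolding w0_def by (rule order_trans[OF abs_Re_le_cmod t(2)[OF p2]], rule order_trans[OF abs_Im_le_cmod t(2)[OF p2]])
      then show "\<bar>strand (2 * ?B) ?E (2 * k) w0 p - strand (2 * ?B) ?E (2 * k) w p\<bar> \<le> t"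
        by (cases "even p") (auto simp: word_sym_def)
    qed (use B k q \<kappa> w w0 c' in auto)
    have "?B * (4 * ?B * t) powr \<kappa> = C * t powr \<kappa>" using B t(1) by (simp add: C_def powr_mult)
    then have 3: "\<bar>clip R x - strand ?B ?E (2 * q) w c'\<bar> \<le> 1 / ?B ^ L + C * t powr \<kappa>" using 1 2 by linarith
    have C0: "0 \<le> C" using B by (simp add: C_def)
    have "(clip R x - strand ?B ?E (2 * q) w c')\<^sup>2 \<le> (1 / ?B ^ L + C * t powr \<kappa>)\<^sup>2"
      using 3 by (metis abs_ge_zero power2_abs power_mono)
    also have "\<dots> \<le> 2 * (1 / ?B ^ L)\<^sup>2 + 2 * (C * t powr \<kappa>)\<^sup>2"
      using sum_squares_bound[of "1 / ?B ^ L" "C * t powr \<kappa>"] by (simp add: power2_sum)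
    also have "(C * t powr \<kappa>)\<^sup>2 = C\<^sup>2 * t powr (2 * \<kappa>)"
      by (simp add: power_mult_distrib powr_powr[symmetric] power2_eq_square powr_add[symmetric])
    finally show ?thesis by simp
  qed
  let ?z = "S (Suc c)"
  define X where "X = 2 * (1 / ?B ^ L)\<^sup>2 + 2 * C\<^sup>2 * t powr (2 * \<kappa>)"
  have c1: "(clip R (Re ?z) - strand ?B ?E (2 * q) w (2 * c))\<^sup>2 \<le> X"
    unfolding X_def using c by (intro coord) (auto simp: src_coord_def)
  have c2: "(clip R (Im ?z) - strand ?B ?E (2 * q) w (2 * c + 1))\<^sup>2 \<le> X"
    unfolding X_def using c by (intro coord) (auto simp: src_coord_def)
  have "(cmod (?z - word_src B ?E q R w c))\<^sup>2 = (Re ?z - R * (4 * strand ?B ?E (2 * q) w (2 * c) - 1))\<^sup>2 + (Im ?z - R * (4 * strand ?B ?E (2 * q) w (2 * c + 1) - 1))\<^sup>2"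
    by (simp add: cmod_power2 word_src_def)
  also have "\<dots> \<le> (2 * (cmod ?z powr (2 + g) * R powr (- g)) + 32 * R\<^sup>2 * X) + (2 * (cmod ?z powr (2 + g) * R powr (- g)) + 32 * R\<^sup>2 * X)"
    by (rule add_mono; rule order_trans[OF clip_error[OF R g abs_Re_le_cmod]] order_trans[OF clip_error[OF R g abs_Im_le_cmod]];
        intro add_left_mono mult_left_mono c1 c2; simp)
  also have "\<dots> = 4 * (cmod ?z powr (2 + g) * R powr (- g)) + 128 * R\<^sup>2 * (1 / ?B ^ L)\<^sup>2 + 128 * R\<^sup>2 * C\<^sup>2 * t powr (2 * \<kappa>)"
    by (simp add: X_def algebra_simps)
  finally show ?thesis by (simp add: C_def)
qed

text \<open>Keeps every transmitted symbol below 1/2 in modulus: a word symbol has modulus at most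
  2, there are \<open>k\<close> of them, and the powers of the evaluation point are at most
  \<open>(Mt + k) ^ k\<close> and \<open>(Mt + k) ^ Mt\<close>.\<close>

definition sym_scale :: "nat \<Rightarrow> nat \<Rightarrow> real" where
  "sym_scale Mt k = 1 / (4 * real k * real (Mt + k) ^ (Mt + k))"

text \<open>The noiseless output is a product of two polynomial values at the same point, one with
  the channel gains as coefficients and one with the data symbols. Neither factor can be small at
  many points, so no channel direction hides the data.\<close>

definition chan_sig :: "nat \<Rightarrow> nat \<Rightarrow> real \<Rightarrow> cmat \<Rightarrow> (nat \<Rightarrow> complex) \<Rightarrow> nat \<times> nat \<Rightarrow> complex" where
  "chan_sig Mt k \<rho> H a p = complex_of_real (sqrt (\<rho> / real Mt) * sym_scale Mt k) * (peval Mt (\<lambda>t. H (snd p, t)) (fst p) * peval k a (fst p))"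

text \<open>A space-time code of Vandermonde type, with full diversity although the transmitter does
  not know the channel: use \<open>i\<close> evaluates at \<open>i - 1\<close>, and antenna
  \<open>t\<close> weights by the \<open>t\<close>-th power. It spends \<open>Mt + k - 1\<close>
  uses on \<open>k\<close> symbols; use 0 is training.\<close>

definition blk_tx :: "nat \<Rightarrow> nat \<Rightarrow> int \<Rightarrow> nat \<Rightarrow> nat \<Rightarrow> real \<Rightarrow> real \<Rightarrow> cvec \<Rightarrow> cmat" where
  "blk_tx Mt k B L q R P S = (\<lambda>(i, t). if i = 0 then (if t = 0 then complex_of_real (sqrt P) * S 0 else 0)
     else complex_of_real (sym_scale Mt k) * of_nat (i - 1) ^ t * peval k (word_sym B (L * (2 * q)) k (src_word B L q R S)) (i - 1))"

lemma cmod_blk_tx_le: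
  assumes B: "2 \<le> B" and k: "1 \<le> k" and i: "1 \<le> i" "i < Mt + k" and t: "t < Mt"
  shows "(cmod (blk_tx Mt k B L q R P S (i, t)))\<^sup>2 \<le> 1 / 4"
proof -
  let ?w = "src_word B L q R S" and ?N = "real (Mt + k)"
  have w: "?w \<in> words B (L * (2 * q))" unfolding src_word_def by (rule quant_words[OF B])
  have N1: "1 \<le> ?N" using k by simp
  have i1: "real (i - 1) \<le> ?N" using i by simp
  have sc0: "0 \<le> sym_scale Mt k" by (simp add: sym_scale_def)
  have pw: "real (i - 1) ^ j \<le> ?N ^ k" if "j < k" for j
  proof -
    have "real (i - 1) ^ j \<le> ?N ^ j" using i1 by (intro power_mono) auto
    also have "\<dots> \<le> ?N ^ k" using N1 that by (intro power_increasing) auto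
    finally show ?thesis .
  qed
  have "cmod (peval k (word_sym B (L * (2 * q)) k ?w) (i - 1)) \<le> (\<Sum>j<k. 2 * ?N ^ k)"
    unfolding peval_def
  proof (intro order_trans[OF norm_sum] sum_mono)
    fix j assume "j \<in> {..<k}"
    then show "cmod (word_sym B (L * (2 * q)) k ?w j * of_nat (i - 1) ^ j) \<le> 2 * ?N ^ k"
      unfolding norm_mult norm_power norm_of_nat
      using cmod_word_sym_le[OF w B] pw by (intro mult_mono) auto
  qed
  then have a: "cmod (peval k (word_sym B (L * (2 * q)) k ?w) (i - 1)) \<le> 2 * real k * ?N ^ k" by simp
  have b: "real (i - 1) ^ t \<le> ?N ^ Mt"
  proof -
    have "real (i - 1) ^ t \<le> ?N ^ t" using i1 by (intro power_mono) auto
    also have "\<dots> \<le> ?N ^ Mt" using N1 t by (intro power_increasing) auto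
    finally show ?thesis .
  qed
  have "cmod (blk_tx Mt k B L q R P S (i, t)) = sym_scale Mt k * real (i - 1) ^ t * cmod (peval k (word_sym B (L * (2 * q)) k ?w) (i - 1))"
    using i sc0 by (cases i) (simp_all add: blk_tx_def norm_mult norm_power)
  also have "\<dots> \<le> sym_scale Mt k * ?N ^ Mt * (2 * real k * ?N ^ k)"
    using a b by (intro mult_mono mult_nonneg_nonneg) (auto simp: sym_scale_def)
  also have "\<dots> = 1 / 2" using k N1 by (simp add: sym_scale_def power_add)
  finally have "(cmod (blk_tx Mt k B L q R P S (i, t)))\<^sup>2 \<le> (1/2)\<^sup>2" by (intro power_mono) auto
  then show ?thesis by (simp add: power_divide)
qed

section \<open>Minimum distance decoding\<close>

text \<open>A fixed numbering of the code words lets the decoder choose a least index, which settles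
  ties and makes the choice measurable.\<close>

definition enum_words :: "int \<Rightarrow> nat \<Rightarrow> nat \<Rightarrow> nat \<Rightarrow> int" where
  "enum_words B E = (SOME en. en ` {..<card (words B E)} = words B E)"

lemma enum_words: "enum_words B E ` {..<card (words B E)} = words B E"
  unfolding enum_words_def
proof (rule someI_ex[where P="\<lambda>en. en ` {..<card (words B E)} = words B E"])
  obtain f where "bij_betw f {0..<card (words B E)} (words B E)"
    using ex_bij_betw_nat_finite[OF finite_words] by blast
  then show "\<exists>en. en ` {..<card (words B E)} = words B E"
    by (auto simp: bij_betw_def atLeast0LessThan)
qed

definition cost :: "nat \<Rightarrow> nat \<Rightarrow> nat \<Rightarrow> int \<Rightarrow> nat \<Rightarrow> real \<Rightarrow> cmat \<Rightarrow> cmat \<Rightarrow> nat \<Rightarrow> real" where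
  "cost Mt Mr k B E \<rho> y H n = (\<Sum>p\<in>{..<Mt + k - 1} \<times> {..<Mr}. (cmod (y (Suc (fst p), snd p) - chan_sig Mt k \<rho> H (word_sym B E k (enum_words B E n)) p))\<^sup>2)"

definition best :: "nat \<Rightarrow> nat \<Rightarrow> nat \<Rightarrow> int \<Rightarrow> nat \<Rightarrow> real \<Rightarrow> cmat \<Rightarrow> cmat \<Rightarrow> nat" where
  "best Mt Mr k B E \<rho> y H = (LEAST n. n < card (words B E) \<and> (\<forall>n'<card (words B E). cost Mt Mr k B E \<rho> y H n \<le> cost Mt Mr k B E \<rho> y H n'))"

lemma best:
  assumes "words B E \<noteq> {}"
  shows "best Mt Mr k B E \<rho> y H < card (words B E)"
    "n' < card (words B E) \<Longrightarrow> cost Mt Mr k B E \<rho> y H (best Mt Mr k B E \<rho> y H) \<le> cost Mt Mr k B E \<rho> y H n'"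
proof -
  let ?c = "cost Mt Mr k B E \<rho> y H" and ?m = "card (words B E)"
  have m: "0 < ?m" using assms finite_words by (simp add: card_gt_0_iff)
  have "Min (?c ` {..<?m}) \<in> ?c ` {..<?m}" using m by (intro Min_in) (auto simp: lessThan_empty_iff)
  then obtain n where n: "n < ?m" "?c n = Min (?c ` {..<?m})" by auto
  have "\<exists>n. n < ?m \<and> (\<forall>n'<?m. ?c n \<le> ?c n')"
    using n by (intro exI[of _ n]) (auto intro!: Min_le)
  from LeastI_ex[OF this] show "best Mt Mr k B E \<rho> y H < ?m" "n' < ?m \<Longrightarrow> ?c (best Mt Mr k B E \<rho> y H) \<le> ?c n'"
    unfolding best_def by auto
qed

lemma measurable_best:
  "(\<lambda>(y, H). best Mt Mr k B E \<rho> y H) \<in> measurable (PiM ({..<Suc (Mt + k - 1)} \<times> {..<Mr}) (\<lambda>_. borel) \<Otimes>\<^sub>M PiM ({..<Mr} \<times> {..<Mt}) (\<lambda>_. borel)) (count_space UNIV)"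
proof -
  let ?M = "PiM ({..<Suc (Mt + k - 1)} \<times> {..<Mr}) (\<lambda>_. borel :: complex measure) \<Otimes>\<^sub>M PiM ({..<Mr} \<times> {..<Mt}) (\<lambda>_. borel :: complex measure)"
  have y: "(\<lambda>x. fst x p) \<in> borel_measurable ?M" if "p \<in> {..<Suc (Mt + k - 1)} \<times> {..<Mr}" for p
    by (rule measurable_compose[OF measurable_fst measurable_component_singleton[OF that]])
  have h: "(\<lambda>x. snd x p) \<in> borel_measurable ?M" if "p \<in> {..<Mr} \<times> {..<Mt}" for p
    by (rule measurable_compose[OF measurable_snd measurable_component_singleton[OF that]])
  have c[measurable]: "(\<lambda>x. cost Mt Mr k B E \<rho> (fst x) (snd x) n) \<in> borel_measurable ?M" for n
    unfolding cost_def chan_sig_def peval_def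
    by (intro borel_measurable_sum borel_measurable_power measurable_compose[OF _ borel_measurable_norm] borel_measurable_diff
        borel_measurable_times borel_measurable_const y h) auto
  show ?thesis unfolding best_def case_prod_beta'
    by (rule measurable_Least) measurable
qed

lemma chan_sig_diff:
  "chan_sig Mt k \<rho> H a p - chan_sig Mt k \<rho> H a' p
   = complex_of_real (sqrt (\<rho> / real Mt) * sym_scale Mt k) * (peval Mt (\<lambda>t. H (snd p, t)) (fst p) * peval k (\<lambda>j. a j - a' j) (fst p))"
  by (simp add: chan_sig_def peval_def left_diff_distrib sum_subtractf algebra_simps)

text \<open>Both the sent and the decoded word explain the output up to squared noise norm, so their
  signals differ by at most twice that norm everywhere. By \<open>peval_product_bound\<close> some
  evaluation point reveals a given channel entry times a given symbol difference, and summing over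
  the entries produces the squared channel norm. \<open>C\<close> is independent of \<open>B\<close>
  and \<open>E\<close>, because the number of digits will later tend to infinity.\<close>

lemma min_distance_bound:
  assumes Mt: "1 \<le> Mt" and k: "1 \<le> k"
  shows "\<exists>C>0. \<forall>(Mr::nat) B E \<rho> H y w j. 0 < \<rho> \<longrightarrow> w \<in> words B E \<longrightarrow> j < k \<longrightarrow>
    (cmod (word_sym B E k w j - word_sym B E k (enum_words B E (best Mt Mr k B E \<rho> y H)) j))\<^sup>2 * (\<rho> * frob Mt Mr H)
    \<le> C * real (Mr * Mt) * (\<Sum>p\<in>{..<Mt + k - 1} \<times> {..<Mr}. (cmod (y (Suc (fst p), snd p) - chan_sig Mt k \<rho> H (word_sym B E k w) p))\<^sup>2)"
proof -
  obtain c where c: "0 < c" "\<And>h a. \<exists>i<Mt + k - 1. \<forall>t<Mt. \<forall>j<k. c * cmod (h t) * cmod (a j) \<le> cmod (peval Mt h i * peval k a i)"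
    using peval_product_bound[OF Mt k] by auto
  have sc: "0 < sym_scale Mt k" using k by (simp add: sym_scale_def)
  show ?thesis
  proof (intro exI[of _ "4 * real Mt / (sym_scale Mt k * c)\<^sup>2"] conjI allI impI)
    show "0 < 4 * real Mt / (sym_scale Mt k * c)\<^sup>2" using Mt sc c(1) by (simp add: zero_less_power)
    fix Mr :: nat and B E \<rho> H y w j assume \<rho>: "(0::real) < \<rho>" and w: "w \<in> words B E" and j: "j < k"
    let ?I = "{..<Mt + k - 1} \<times> {..<Mr}"
    define w' where "w' = enum_words B E (best Mt Mr k B E \<rho> y H)"
    define nsq where "nsq = (\<Sum>p\<in>?I. (cmod (y (Suc (fst p), snd p) - chan_sig Mt k \<rho> H (word_sym B E k w) p))\<^sup>2)"
    define d where "d j = word_sym B E k w j - word_sym B E k w' j" for j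
    define A where "A = sqrt (\<rho> / real Mt) * sym_scale Mt k"
    have A: "0 < A" using \<rho> Mt sc by (simp add: A_def)
    have d': "(\<lambda>j. word_sym B E k w j - word_sym B E k w' j) = d" by (simp add: d_def fun_eq_iff)
    obtain n where n: "n < card (words B E)" "enum_words B E n = w" using enum_words[of B E] w by (metis (no_types, lifting) image_iff lessThan_iff)
    have "cost Mt Mr k B E \<rho> y H (best Mt Mr k B E \<rho> y H) \<le> cost Mt Mr k B E \<rho> y H n"
      using w by (intro best n) auto
    also have "\<dots> = nsq" by (simp add: cost_def nsq_def n)
    finally have cost: "(\<Sum>p\<in>?I. (cmod (y (Suc (fst p), snd p) - chan_sig Mt k \<rho> H (word_sym B E k w') p))\<^sup>2) \<le> nsq"
      by (simp add: cost_def w'_def)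
    have nsq0: "0 \<le> nsq" by (auto simp: nsq_def intro: sum_nonneg)
    have each: "A * cmod (peval Mt (\<lambda>t. H (r, t)) i * peval k d i) \<le> 2 * sqrt nsq" if "i < Mt + k - 1" "r < Mr" for i r
    proof -
      have p: "(i, r) \<in> ?I" using that by auto
      have 1: "(cmod (y (Suc i, r) - chan_sig Mt k \<rho> H (word_sym B E k w) (i, r)))\<^sup>2 \<le> nsq"
        unfolding nsq_def using member_le_sum[OF p, of "\<lambda>p. (cmod (y (Suc (fst p), snd p) - chan_sig Mt k \<rho> H (word_sym B E k w) p))\<^sup>2"] by simp
      have 2: "(cmod (y (Suc i, r) - chan_sig Mt k \<rho> H (word_sym B E k w') (i, r)))\<^sup>2 \<le> nsq"
        using member_le_sum[OF p, of "\<lambda>p. (cmod (y (Suc (fst p), snd p) - chan_sig Mt k \<rho> H (word_sym B E k w') p))\<^sup>2"] cost by simp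
      have "A * cmod (peval Mt (\<lambda>t. H (r, t)) i * peval k d i) = cmod (chan_sig Mt k \<rho> H (word_sym B E k w) (i, r) - chan_sig Mt k \<rho> H (word_sym B E k w') (i, r))"
        unfolding chan_sig_diff d' A_def[symmetric] using A by (simp add: norm_mult)
      also have "\<dots> \<le> cmod (y (Suc i, r) - chan_sig Mt k \<rho> H (word_sym B E k w') (i, r)) + cmod (y (Suc i, r) - chan_sig Mt k \<rho> H (word_sym B E k w) (i, r))"
        using norm_triangle_ineq4[of "y (Suc i, r) - chan_sig Mt k \<rho> H (word_sym B E k w') (i, r)" "y (Suc i, r) - chan_sig Mt k \<rho> H (word_sym B E k w) (i, r)"] by simp
      also have "\<dots> \<le> sqrt nsq + sqrt nsq" using 1 2 by (intro add_mono real_le_rsqrt)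
      finally show ?thesis by simp
    qed
    have ent: "(A * c)\<^sup>2 * (cmod (H p))\<^sup>2 * (cmod (d j))\<^sup>2 \<le> 4 * nsq" if pI: "p \<in> {..<Mr} \<times> {..<Mt}" for p
    proof -
      obtain r t where p: "p = (r, t)" "r < Mr" "t < Mt" using pI by auto
      obtain i where i: "i < Mt + k - 1" "c * cmod (H (r, t)) * cmod (d j) \<le> cmod (peval Mt (\<lambda>t. H (r, t)) i * peval k d i)"
        using c(2)[of "\<lambda>t. H (r, t)" d] p j by auto
      have "A * (c * cmod (H (r, t)) * cmod (d j)) \<le> 2 * sqrt nsq"
        using order_trans[OF mult_left_mono[OF i(2), of A] each[OF i(1) p(2)]] A by simp
      then have "(A * (c * cmod (H (r, t)) * cmod (d j)))\<^sup>2 \<le> (2 * sqrt nsq)\<^sup>2"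
        using A c(1) by (intro power_mono) auto
      then show ?thesis using nsq0 p by (simp add: power_mult_distrib mult.assoc)
    qed
    have "(A * c)\<^sup>2 * frob Mt Mr H * (cmod (d j))\<^sup>2 = (\<Sum>p\<in>{..<Mr} \<times> {..<Mt}. (A * c)\<^sup>2 * (cmod (H p))\<^sup>2 * (cmod (d j))\<^sup>2)"
      by (simp add: frob_def sum_distrib_left sum_distrib_right)
    also have "\<dots> \<le> (\<Sum>p\<in>{..<Mr} \<times> {..<Mt}. 4 * nsq)" by (intro sum_mono ent)
    also have "\<dots> = real (Mr * Mt) * (4 * nsq)" by simp
    finally have "(A * c)\<^sup>2 * frob Mt Mr H * (cmod (d j))\<^sup>2 \<le> real (Mr * Mt) * (4 * nsq)" .
    from mult_left_mono[OF this, of "real Mt"]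
    have "real Mt * (A * c)\<^sup>2 * frob Mt Mr H * (cmod (d j))\<^sup>2 \<le> real Mt * (real (Mr * Mt) * (4 * nsq))" by (simp add: mult.assoc)
    moreover have "real Mt * (A * c)\<^sup>2 = \<rho> * (sym_scale Mt k * c)\<^sup>2" using \<rho> Mt by (simp add: A_def power_mult_distrib)
    ultimately have "\<rho> * (sym_scale Mt k * c)\<^sup>2 * frob Mt Mr H * (cmod (d j))\<^sup>2 \<le> real Mt * (real (Mr * Mt) * (4 * nsq))"
      by simp
    then have "(cmod (d j))\<^sup>2 * (\<rho> * frob Mt Mr H) \<le> 4 * real Mt / (sym_scale Mt k * c)\<^sup>2 * real (Mr * Mt) * nsq"
      using sc c(1) by (simp add: field_simps)
    then show "(cmod (word_sym B E k w j - word_sym B E k (enum_words B E (best Mt Mr k B E \<rho> y H)) j))\<^sup>2 * (\<rho> * frob Mt Mr H)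
      \<le> 4 * real Mt / (sym_scale Mt k * c)\<^sup>2 * real (Mr * Mt) * (\<Sum>p\<in>?I. (cmod (y (Suc (fst p), snd p) - chan_sig Mt k \<rho> H (word_sym B E k w) p))\<^sup>2)"
      by (simp add: d_def w'_def nsq_def)
  qed
qed

text \<open>The receiver relies on the decoded word when the channel resolves the source better than the
  side information does, and on the side information otherwise.\<close>
definition blk_rx :: "nat \<Rightarrow> nat \<Rightarrow> nat \<Rightarrow> int \<Rightarrow> nat \<Rightarrow> nat \<Rightarrow> real \<Rightarrow> real \<Rightarrow> real \<Rightarrow> real \<Rightarrow> cmat \<Rightarrow> cvec \<Rightarrow> cmat \<Rightarrow> real \<Rightarrow> cvec" where
  "blk_rx Mt Mr k B L q R \<kappa> \<rho> \<rho>s y tt h \<gamma> j =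
    (if j = 0 then 0
     else if \<rho>s \<le> (\<rho> * frob Mt Mr h) powr \<kappa> then word_src B (L * (2 * q)) q R (enum_words B (L * (2 * q)) (best Mt Mr k B (L * (2 * q)) \<rho> y h)) (j - 1)
     else if \<rho>s * \<gamma> < 1 then 0
     else cnj (sgn (tt 0 * cnj (y (0, 0)) * h (0, 0))) * tt j / complex_of_real (sqrt (\<rho>s * \<gamma>)))"

lemma code_measurable_blk:
  assumes Mt: "1 \<le> Mt" and Mr: "1 \<le> Mr"
  shows "code_measurable Mt Mr (Suc q) (Suc (Mt + k - 1)) (blk_tx Mt k B L q R P) (blk_rx Mt Mr k B L q R \<kappa> \<rho> \<rho>s)"
  unfolding code_measurable_def
proof (intro conjI allI impI)
  fix i t assume "i < Suc (Mt + k - 1)" "t < Mt"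
  have S: "(\<lambda>S. S j) \<in> borel_measurable (iid_cvec (Suc q))" if "j < Suc q" for j
    by (rule measurable_iid_cvec_component[OF that])
  have word: "(\<lambda>S. real_of_int (src_word B L q R S e)) \<in> borel_measurable (iid_cvec (Suc q))" for e
  proof (cases "e < L * (2 * q)")
    case True
    then have e: "e mod (2 * q) < 2 * q" by (cases q) auto
    have sc: "(\<lambda>S. src_coord R S (e mod (2 * q))) \<in> borel_measurable (iid_cvec (Suc q))"
    proof -
      have "Suc (e mod (2 * q) div 2) < Suc q" using e by simp
      note [measurable] = S[OF this]
      show ?thesis unfolding src_coord_def clip_def by (cases "even (e mod (2 * q))"; simp; measurable)
    qed
    have fl: "(\<lambda>x::real. real_of_int \<lfloor>x\<rfloor>) \<in> borel_measurable borel" by measurable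
    show ?thesis
      unfolding src_word_def quant_def using True
      by (simp only: if_True of_int_diff of_int_mult)
         (intro borel_measurable_diff borel_measurable_times borel_measurable_const measurable_compose[OF _ fl] sc)
  next
    case False
    then show ?thesis by (simp add: src_word_def quant_def)
  qed
  have strand: "(\<lambda>S. strand \<beta> E Q (src_word B L q R S) c) \<in> borel_measurable (iid_cvec (Suc q))" for \<beta> E Q c
    unfolding strand_def dval_def by (intro borel_measurable_sum borel_measurable_divide borel_measurable_const word)
  have sym: "(\<lambda>S. word_sym B E k (src_word B L q R S) j) \<in> borel_measurable (iid_cvec (Suc q))" for E j
    unfolding word_sym_def Complex_eq
    by (intro borel_measurable_add borel_measurable_times borel_measurable_const measurable_compose[OF strand borel_measurable_of_real])
  show "(\<lambda>S. blk_tx Mt k B L q R P S (i, t)) \<in> borel_measurable (iid_cvec (Suc q))"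
  proof (cases "i = 0")
    case True
    then show ?thesis using S[of 0] by (auto simp: blk_tx_def intro!: borel_measurable_times)
  next
    case False
    then show ?thesis unfolding blk_tx_def peval_def
      by (simp only: case_prod_conv if_False)
         (intro borel_measurable_times borel_measurable_const borel_measurable_sum sym)
  qed
next
  fix j assume j: "j < Suc q"
  let ?N = "Suc (Mt + k - 1)" and ?E = "L * (2 * q)"
  let ?O = "obs_space Mt Mr (Suc q) ?N"
  have yM: "fst \<in> measurable ?O (PiM ({..<?N} \<times> {..<Mr}) (\<lambda>_. borel))"
    unfolding obs_space_def by (rule measurable_fst)
  have tM: "(\<lambda>x. fst (snd x)) \<in> measurable ?O (PiM {..<Suc q} (\<lambda>_. borel))"
    unfolding obs_space_def by (rule measurable_compose[OF measurable_snd measurable_fst])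
  have hM: "(\<lambda>x. fst (snd (snd x))) \<in> measurable ?O (PiM ({..<Mr} \<times> {..<Mt}) (\<lambda>_. borel))"
    unfolding obs_space_def by (rule measurable_compose[OF measurable_snd measurable_compose[OF measurable_snd measurable_fst]])
  have gM: "(\<lambda>x. snd (snd (snd x))) \<in> borel_measurable ?O"
    unfolding obs_space_def by (rule measurable_compose[OF measurable_snd measurable_compose[OF measurable_snd measurable_snd]])
  have y: "(\<lambda>x. fst x (0, 0)) \<in> borel_measurable ?O"
    using Mr by (intro measurable_compose[OF yM measurable_component_singleton]) auto
  have t: "(\<lambda>x. fst (snd x) i) \<in> borel_measurable ?O" if "i < Suc q" for i
    using that by (intro measurable_compose[OF tM measurable_component_singleton]) auto
  have h: "(\<lambda>x. fst (snd (snd x)) p) \<in> borel_measurable ?O" if "p \<in> {..<Mr} \<times> {..<Mt}" for p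
    by (rule measurable_compose[OF hM measurable_component_singleton[OF that]])
  have b: "(\<lambda>x. best Mt Mr k B ?E \<rho> (fst x) (fst (snd (snd x)))) \<in> measurable ?O (count_space UNIV)"
    using measurable_compose[OF measurable_Pair[OF yM hM] measurable_best] by simp
  have w: "(\<lambda>x. word_src B ?E q R (enum_words B ?E (best Mt Mr k B ?E \<rho> (fst x) (fst (snd (snd x))))) (j - 1)) \<in> borel_measurable ?O"
    by (rule measurable_compose[OF b]) simp
  have F: "(\<lambda>x. frob Mt Mr (fst (snd (snd x)))) \<in> borel_measurable ?O"
    unfolding frob_def by (intro borel_measurable_sum borel_measurable_power measurable_compose[OF _ borel_measurable_norm] h)
  have F': "(\<lambda>x. (\<rho> * frob Mt Mr (fst (snd (snd x)))) powr \<kappa>) \<in> borel_measurable ?O"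
    using F by (intro powr_real_measurable borel_measurable_times borel_measurable_const)
  have s: "(\<lambda>x. cnj (sgn (fst (snd x) 0 * cnj (fst x (0, 0)) * fst (snd (snd x)) (0, 0))) * fst (snd x) j / complex_of_real (sqrt (\<rho>s * snd (snd (snd x))))) \<in> borel_measurable ?O"
  proof -
    have cnjm: "cnj \<in> borel_measurable borel" by (intro borel_measurable_continuous_onI continuous_intros)
    have sgnm: "(sgn :: complex \<Rightarrow> complex) \<in> borel_measurable borel"
      unfolding sgn_div_norm by measurable
    show ?thesis
      using j Mt Mr
      by (intro borel_measurable_divide borel_measurable_times measurable_compose[OF _ cnjm] measurable_compose[OF _ sgnm]
          measurable_compose[OF _ borel_measurable_of_real] measurable_compose[OF _ borel_measurable_sqrt] borel_measurable_const gM t h y) auto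
  qed
  have P1: "{x \<in> space ?O. \<rho>s \<le> (\<rho> * frob Mt Mr (fst (snd (snd x)))) powr \<kappa>} \<in> sets ?O"
    by (intro borel_measurable_le borel_measurable_const F')
  have P2: "{x \<in> space ?O. \<rho>s * snd (snd (snd x)) < 1} \<in> sets ?O"
    by (intro borel_measurable_less borel_measurable_const borel_measurable_times gM)
  have "(\<lambda>x. if j = 0 then 0
     else if \<rho>s \<le> (\<rho> * frob Mt Mr (fst (snd (snd x)))) powr \<kappa> then word_src B ?E q R (enum_words B ?E (best Mt Mr k B ?E \<rho> (fst x) (fst (snd (snd x))))) (j - 1)
     else if \<rho>s * snd (snd (snd x)) < 1 then 0
     else cnj (sgn (fst (snd x) 0 * cnj (fst x (0, 0)) * fst (snd (snd x)) (0, 0))) * fst (snd x) j / complex_of_real (sqrt (\<rho>s * snd (snd (snd x))))) \<in> borel_measurable ?O"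
  proof (cases "j = 0")
    case True
    show ?thesis unfolding if_P[OF True] by (rule borel_measurable_const)
  next
    case False
    show ?thesis unfolding if_not_P[OF False] by (intro measurable_If w s borel_measurable_const P1 P2)
  qed
  then show "(\<lambda>(y, tt, h, \<gamma>). blk_rx Mt Mr k B L q R \<kappa> \<rho> \<rho>s y tt h \<gamma> j) \<in> borel_measurable ?O"
    unfolding blk_rx_def case_prod_beta' .
qed

lemma chan_out_blk:
  assumes p: "p \<in> {..<Mt + k - 1} \<times> {..<Mr}"
  shows "chan_out Mt Mr (Suc (Mt + k - 1)) \<rho> H (blk_tx Mt k B L q R P S) N (Suc (fst p), snd p)
    = chan_sig Mt k \<rho> (restrict H ({..<Mr} \<times> {..<Mt})) (word_sym B (L * (2 * q)) k (src_word B L q R S)) p + N (Suc (fst p), snd p)"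
proof -
  have r: "peval Mt (\<lambda>t. restrict H ({..<Mr} \<times> {..<Mt}) (snd p, t)) (fst p) = peval Mt (\<lambda>t. H (snd p, t)) (fst p)"
    unfolding peval_def using p by (intro sum.cong) auto
  have s: "(\<Sum>t<Mt. H (snd p, t) * (c * of_nat (fst p) ^ t * X)) = c * (peval Mt (\<lambda>t. H (snd p, t)) (fst p) * X)" for c X
    by (simp add: peval_def sum_distrib_left sum_distrib_right mult_ac)
  have "(Suc (fst p), snd p) \<in> {..<Suc (Mt + k - 1)} \<times> {..<Mr}" using p by auto
  then show ?thesis
    unfolding chan_out_def chan_sig_def r by (simp add: blk_tx_def s)
qed

lemma chan_out_training:
  assumes Mt: "1 \<le> Mt" and Mr: "1 \<le> Mr"
  shows "chan_out Mt Mr (Suc (Mt + k - 1)) \<rho> H (blk_tx Mt k B L q R P S) N (0, 0) = complex_of_real (sqrt (\<rho> / real Mt) * sqrt P) * H (0, 0) * S 0 + N (0, 0)"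
proof -
  have "(\<Sum>t<Mt. H (0, t) * (if t = 0 then complex_of_real (sqrt P) * S 0 else 0)) = H (0, 0) * (complex_of_real (sqrt P) * S 0)"
    using Mt by (subst sum.remove[of _ 0]) (auto intro!: sum.neutral)
  then show ?thesis using Mr by (simp add: chan_out_def blk_tx_def mult_ac)
qed

lemma frob_restrict [simp]: "frob Mt Mr (restrict H ({..<Mr} \<times> {..<Mt})) = frob Mt Mr H"
  unfolding frob_def by (intro sum.cong) auto

section \<open>Expected distortion of the block code\<close>

text \<open>Carries measurability and nonnegativity along with the bound on the mean, so that bounds
  for sums, products and components can be composed without repeating side conditions.\<close>

definition mean_le :: "'a measure \<Rightarrow> ('a \<Rightarrow> real) \<Rightarrow> real \<Rightarrow> bool" where
  "mean_le M f C \<longleftrightarrow> f \<in> borel_measurable M \<and> (\<forall>x. 0 \<le> f x) \<and> (\<integral>\<^sup>+x. ennreal (f x) \<partial>M) \<le> ennreal C \<and> 0 \<le> C"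

lemma mean_le_one: "prob_space M \<Longrightarrow> mean_le M (\<lambda>_. 1) 1"
  by (simp add: mean_le_def prob_space.emeasure_space_1)

lemma mean_le_iid_cvec_component:
  assumes "mean_le cgauss f C" "j < m"
  shows "mean_le (iid_cvec m) (\<lambda>S. f (S j)) C"
proof -
  have f: "f \<in> borel_measurable cgauss" using assms(1) by (simp add: mean_le_def)
  have c: "(\<lambda>S. S j) \<in> measurable (iid_cvec m) cgauss"
    unfolding iid_cvec_def using assms(2) by (intro measurable_component_singleton) simp
  have "distr (iid_cvec m) cgauss (\<lambda>S. S j) = cgauss"
    unfolding iid_cvec_def using assms(2) by (intro distr_PiM_component prob_space_cgauss) simp
  then have "(\<integral>\<^sup>+S. ennreal (f (S j)) \<partial>iid_cvec m) = (\<integral>\<^sup>+z. ennreal (f z) \<partial>cgauss)"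
    using nn_integral_distr[OF c, of "\<lambda>z. ennreal (f z)"] f by simp
  then show ?thesis using assms(1) measurable_compose[OF c f] by (simp add: mean_le_def)
qed

lemma mean_le_iid_cmat_component:
  assumes "mean_le cgauss f C" "i < a" "j < c"
  shows "mean_le (iid_cmat a c) (\<lambda>N. f (N (i, j))) C"
proof -
  have f: "f \<in> borel_measurable cgauss" using assms(1) by (simp add: mean_le_def)
  have c: "(\<lambda>N. N (i, j)) \<in> measurable (iid_cmat a c) cgauss"
    unfolding iid_cmat_def using assms(2,3) by (intro measurable_component_singleton) simp
  have "distr (iid_cmat a c) cgauss (\<lambda>N. N (i, j)) = cgauss"
    unfolding iid_cmat_def using assms(2,3) by (intro distr_PiM_component prob_space_cgauss) simp
  then have "(\<integral>\<^sup>+N. ennreal (f (N (i, j))) \<partial>iid_cmat a c) = (\<integral>\<^sup>+z. ennreal (f z) \<partial>cgauss)"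
    using nn_integral_distr[OF c, of "\<lambda>z. ennreal (f z)"] f by simp
  then show ?thesis using assms(1) measurable_compose[OF c f] by (simp add: mean_le_def)
qed

lemma nn_integral_pair_mult:
  assumes "prob_space N" and [measurable]: "f \<in> borel_measurable M" "g \<in> borel_measurable N"
  shows "(\<integral>\<^sup>+x. f (fst x) * g (snd x) \<partial>(M \<Otimes>\<^sub>M N)) = (\<integral>\<^sup>+x. f x \<partial>M) * (\<integral>\<^sup>+y. g y \<partial>N)"
proof -
  interpret N: prob_space N by fact
  have "(\<integral>\<^sup>+x. f (fst x) * g (snd x) \<partial>(M \<Otimes>\<^sub>M N)) = (\<integral>\<^sup>+x. \<integral>\<^sup>+y. f x * g y \<partial>N \<partial>M)"
    by (subst N.nn_integral_fst[symmetric]) simp_all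
  also have "\<dots> = (\<integral>\<^sup>+x. f x * (\<integral>\<^sup>+y. g y \<partial>N) \<partial>M)" by (simp add: nn_integral_cmult)
  also have "\<dots> = (\<integral>\<^sup>+x. f x \<partial>M) * (\<integral>\<^sup>+y. g y \<partial>N)" by (simp add: nn_integral_multc)
  finally show ?thesis .
qed

lemma mean_le_pair:
  assumes N: "prob_space N" and f: "mean_le M f C" and g: "mean_le N g D"
  shows "mean_le (M \<Otimes>\<^sub>M N) (\<lambda>x. f (fst x) * g (snd x)) (C * D)"
proof -
  have m: "f \<in> borel_measurable M" "g \<in> borel_measurable N" using f g by (auto simp: mean_le_def)
  have "(\<lambda>x. f (fst x) * g (snd x)) \<in> borel_measurable (M \<Otimes>\<^sub>M N)"
    by (intro borel_measurable_times measurable_compose[OF measurable_fst m(1)] measurable_compose[OF measurable_snd m(2)])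
  moreover have "(\<integral>\<^sup>+x. ennreal (f (fst x) * g (snd x)) \<partial>(M \<Otimes>\<^sub>M N)) \<le> ennreal (C * D)"
  proof -
    have "(\<integral>\<^sup>+x. ennreal (f (fst x) * g (snd x)) \<partial>(M \<Otimes>\<^sub>M N)) = (\<integral>\<^sup>+x. ennreal (f (fst x)) * ennreal (g (snd x)) \<partial>(M \<Otimes>\<^sub>M N))"
      using f g by (intro nn_integral_cong ennreal_mult) (auto simp: mean_le_def)
    also have "\<dots> = (\<integral>\<^sup>+x. ennreal (f x) \<partial>M) * (\<integral>\<^sup>+y. ennreal (g y) \<partial>N)"
      using m by (intro nn_integral_pair_mult N measurable_compose[OF _ measurable_ennreal])
    also have "\<dots> \<le> ennreal C * ennreal D" using f g by (intro mult_mono) (auto simp: mean_le_def)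
    also have "\<dots> = ennreal (C * D)" using f g by (simp add: mean_le_def ennreal_mult)
    finally show ?thesis .
  qed
  ultimately show ?thesis using f g by (simp add: mean_le_def)
qed

text \<open>All factors but one are functions of separate independent variables. The exception
  couples the training sample with channel and noise through the shift \<open>a\<close>; the source
  is integrated first, with the shift frozen, and the bound for \<psi> is uniform in the
  shift.\<close>

lemma mean_le_joint_term:
  assumes j: "0 < j" "j < m" and \<phi>: "mean_le cgauss \<phi> Cx"
    and \<psi>: "\<And>v. mean_le cgauss (\<lambda>z. \<psi> (v + z)) Cy"
    and a: "a \<in> borel_measurable (iid_cmat Mr Mt \<Otimes>\<^sub>M iid_cmat n Mr)"
    and b: "mean_le (iid_cmat Mr Mt) b Cb" and c: "mean_le (iid_cmat n Mr) c Cc"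
    and d: "mean_le cgauss d Cd" and e: "mean_le (iid_cvec m) e Ce" and K: "0 \<le> K"
  shows "mean_le (joint_space Mt Mr m n)
    (\<lambda>(S, H, N, G, Z). K * (\<phi> (S j) * \<psi> (a (H, N) + S 0) * (b H * (c N * (d G * e Z))))) (K * (Cx * Cy * (Cb * (Cc * (Cd * Ce)))))"
proof -
  let ?A = "iid_cvec m" and ?B = "iid_cmat Mr Mt" and ?C = "iid_cmat n Mr"
  let ?Q = "?B \<Otimes>\<^sub>M (?C \<Otimes>\<^sub>M (cgauss \<Otimes>\<^sub>M ?A))"
  interpret PA: prob_space ?A by (rule prob_space_iid_cvec)
  interpret PQ: prob_space ?Q
    by (intro prob_space_pair prob_space_iid_cmat prob_space_cgauss prob_space_iid_cvec)
  interpret AQ: pair_sigma_finite ?A ?Q ..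
  define w where "w y = b (fst y) * (c (fst (snd y)) * (d (fst (snd (snd y))) * e (snd (snd (snd y)))))" for y
  define f where "f x = K * (\<phi> (fst x j) * \<psi> (a (fst (snd x), fst (snd (snd x))) + fst x 0) * w (snd x))" for x
  have w: "mean_le ?Q w (Cb * (Cc * (Cd * Ce)))"
    unfolding w_def
    using mean_le_pair[OF _ b mean_le_pair[OF _ c mean_le_pair[OF _ d e]]]
    by (auto intro!: prob_space_pair prob_space_iid_cmat prob_space_cgauss prob_space_iid_cvec)
  have wm: "w \<in> borel_measurable ?Q" and w0: "0 \<le> w y" for y using w unfolding mean_le_def by blast+
  have \<psi>m: "\<psi> \<in> borel_measurable borel" using \<psi>[of 0] by (simp add: mean_le_def cong: measurable_cong_sets)
  have \<psi>0: "0 \<le> \<psi> z" for z using \<psi>[of 0] by (simp add: mean_le_def)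
  have \<phi>m: "\<phi> \<in> borel_measurable borel" using \<phi> by (simp add: mean_le_def cong: measurable_cong_sets)
  have \<phi>0: "0 \<le> \<phi> z" for z using \<phi> by (simp add: mean_le_def)
  have Sm: "(\<lambda>x. fst x i) \<in> borel_measurable (?A \<Otimes>\<^sub>M ?Q)" if "i < m" for i
    by (rule measurable_compose[OF measurable_fst measurable_iid_cvec_component[OF that]])
  have am: "(\<lambda>x. a (fst (snd x), fst (snd (snd x)))) \<in> borel_measurable (?A \<Otimes>\<^sub>M ?Q)"
    by (rule measurable_compose[OF _ a])
      (intro measurable_Pair measurable_compose[OF measurable_snd measurable_fst]
        measurable_compose[OF measurable_snd measurable_compose[OF measurable_snd measurable_fst]])
  have fm: "f \<in> borel_measurable (?A \<Otimes>\<^sub>M ?Q)"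
    unfolding f_def using j
    by (intro borel_measurable_times borel_measurable_const measurable_compose[OF Sm \<phi>m]
        measurable_compose[OF borel_measurable_add[OF am Sm] \<psi>m] measurable_compose[OF measurable_snd wm]) auto
  have inner: "(\<integral>\<^sup>+S. ennreal (f (S, y)) \<partial>?A) \<le> ennreal (K * Cx * Cy) * ennreal (w y)" for y
  proof -
    define v where "v = a (fst y, fst (snd y))"
    \<comment> \<open>Written as a product over all source coordinates: \<psi> at the training
      sample, \<phi> at sample \<open>j\<close>, and 1 elsewhere. The hypothesis
      \<open>0 < j\<close> keeps the two apart.\<close>
    define g where "g l z = (if l = 0 then ennreal (\<psi> (v + z)) else if l = j then ennreal (\<phi> z) else 1)" for l z
    have g01: "g l z = 1" if "l \<notin> {0, j}" for l z using that by (simp add: g_def)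
    have gm: "g l \<in> borel_measurable cgauss" for l
      unfolding g_def using \<psi>[of v] \<phi> by (cases "l = 0"; cases "l = j") (auto simp: mean_le_def)
    have two: "(\<Prod>l\<in>{..<m}. u l) = u 0 * u j" if "\<And>l. l \<notin> {0, j} \<Longrightarrow> u l = 1" for u :: "nat \<Rightarrow> ennreal"
    proof -
      have "(\<Prod>l\<in>{..<m}. u l) = (\<Prod>l\<in>{0, j}. u l)" using j that by (intro prod.mono_neutral_right) auto
      then show ?thesis using j by simp
    qed
    have "(\<integral>\<^sup>+S. ennreal (f (S, y)) \<partial>?A) = (\<integral>\<^sup>+S. ennreal (K * w y) * (\<Prod>l\<in>{..<m}. g l (S l)) \<partial>?A)"
    proof (rule nn_integral_cong)
      fix S
      have "(\<Prod>l\<in>{..<m}. g l (S l)) = ennreal (\<psi> (v + S 0)) * ennreal (\<phi> (S j))"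
        using two[of "\<lambda>l. g l (S l)"] g01 j by (simp add: g_def)
      then show "ennreal (f (S, y)) = ennreal (K * w y) * (\<Prod>l\<in>{..<m}. g l (S l))"
        using K \<psi>0 \<phi>0 w0 by (simp add: f_def v_def mult_ac flip: ennreal_mult)
    qed
    also have "\<dots> = ennreal (K * w y) * (\<integral>\<^sup>+S. (\<Prod>l\<in>{..<m}. g l (S l)) \<partial>?A)"
    proof (rule nn_integral_cmult)
      show "(\<lambda>S. \<Prod>l\<in>{..<m}. g l (S l)) \<in> borel_measurable ?A"
        unfolding iid_cvec_def by (intro borel_measurable_prod_ennreal measurable_compose[OF _ gm] measurable_component_singleton) simp
    qed
    also have "(\<integral>\<^sup>+S. (\<Prod>l\<in>{..<m}. g l (S l)) \<partial>?A) = (\<Prod>l\<in>{..<m}. \<integral>\<^sup>+z. g l z \<partial>cgauss)"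
      unfolding iid_cvec_def by (rule PG.product_nn_integral_prod) (auto intro: gm)
    also have "\<dots> = (\<integral>\<^sup>+z. g 0 z \<partial>cgauss) * (\<integral>\<^sup>+z. g j z \<partial>cgauss)"
    proof (rule two)
      fix l assume "l \<notin> {0, j}"
      then show "(\<integral>\<^sup>+z. g l z \<partial>cgauss) = 1" using cgauss.emeasure_space_1 by (simp add: g01)
    qed
    also have "\<dots> \<le> ennreal Cy * ennreal Cx"
      using \<psi>[of v] \<phi> j by (intro mult_mono) (auto simp: mean_le_def g_def)
    finally have "(\<integral>\<^sup>+S. ennreal (f (S, y)) \<partial>?A) \<le> ennreal (K * w y) * (ennreal Cy * ennreal Cx)"
      by (simp add: mult_left_mono)
    also have "\<dots> = ennreal (K * Cx * Cy) * ennreal (w y)"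
      using K w0[of y] \<psi>[of 0] \<phi> by (simp add: mean_le_def mult_ac flip: ennreal_mult)
    finally show ?thesis .
  qed
  have "(\<integral>\<^sup>+x. ennreal (f x) \<partial>(?A \<Otimes>\<^sub>M ?Q)) = (\<integral>\<^sup>+y. \<integral>\<^sup>+S. ennreal (f (S, y)) \<partial>?A \<partial>?Q)"
    by (rule AQ.nn_integral_snd[symmetric]) (rule measurable_compose[OF fm measurable_ennreal])
  also have "\<dots> \<le> (\<integral>\<^sup>+y. ennreal (K * Cx * Cy) * ennreal (w y) \<partial>?Q)" by (intro nn_integral_mono inner)
  also have "\<dots> = ennreal (K * Cx * Cy) * (\<integral>\<^sup>+y. ennreal (w y) \<partial>?Q)"
    by (rule nn_integral_cmult) (rule measurable_compose[OF wm measurable_ennreal])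
  also have "\<dots> \<le> ennreal (K * Cx * Cy) * ennreal (Cb * (Cc * (Cd * Ce)))"
    using w by (intro mult_left_mono) (auto simp: mean_le_def)
  also have "\<dots> = ennreal (K * (Cx * Cy * (Cb * (Cc * (Cd * Ce)))))"
    using K \<psi>[of 0] \<phi> w by (simp add: mean_le_def mult.assoc flip: ennreal_mult)
  finally have "(\<integral>\<^sup>+x. ennreal (f x) \<partial>(?A \<Otimes>\<^sub>M ?Q)) \<le> ennreal (K * (Cx * Cy * (Cb * (Cc * (Cd * Ce)))))" .
  moreover have "0 \<le> f x" for x unfolding f_def using K \<phi>0 \<psi>0 w0 by simp
  moreover have "0 \<le> K * (Cx * Cy * (Cb * (Cc * (Cd * Ce))))" using K \<psi>[of 0] \<phi> w by (simp add: mean_le_def)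
  ultimately have "mean_le (?A \<Otimes>\<^sub>M ?Q) f (K * (Cx * Cy * (Cb * (Cc * (Cd * Ce)))))"
    using fm by (simp add: mean_le_def)
  moreover have "f = (\<lambda>(S, H, N, G, Z). K * (\<phi> (S j) * \<psi> (a (H, N) + S 0) * (b H * (c N * (d G * e Z)))))"
    by (auto simp: f_def w_def)
  ultimately show ?thesis by (simp add: joint_space_def)
qed

lemma mean_le_add:
  assumes "mean_le M f C" "mean_le M g D"
  shows "mean_le M (\<lambda>x. f x + g x) (C + D)"
proof -
  have "(\<integral>\<^sup>+x. ennreal (f x + g x) \<partial>M) = (\<integral>\<^sup>+x. ennreal (f x) \<partial>M) + (\<integral>\<^sup>+x. ennreal (g x) \<partial>M)"
    using assms by (subst nn_integral_add[symmetric]) (auto simp: mean_le_def intro!: nn_integral_cong)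
  also have "\<dots> \<le> ennreal C + ennreal D" using assms by (intro add_mono) (auto simp: mean_le_def)
  finally show ?thesis using assms by (simp add: mean_le_def borel_measurable_add)
qed

lemma mean_le_AE_zero:
  assumes "mean_le M f 0"
  shows "AE x in M. f x = 0"
proof -
  have m: "(\<lambda>x. ennreal (f x)) \<in> borel_measurable M" using assms by (simp add: mean_le_def)
  have "(\<integral>\<^sup>+x. ennreal (f x) \<partial>M) = 0" using assms by (simp add: mean_le_def)
  then have "AE x in M. ennreal (f x) = 0" using nn_integral_0_iff_AE[OF m] by simp
  then show ?thesis using assms by (auto simp: mean_le_def ennreal_eq_0_iff intro: order_antisym elim!: AE_mp)
qed

text \<open>A null event phrased as a mean bound 0, so that the exceptional sets of the error
  estimate can be treated by the same product lemma as the moments.\<close>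

lemma mean_le_cgauss_point: "mean_le cgauss (\<lambda>z. indicator {0} (v + z) :: real) 0"
proof -
  have "AE z in cgauss. v + z \<noteq> 0"
  proof -
    have "AE z in lborel. z \<noteq> - v" by (rule AE_lborel_singleton)
    then have "AE z in lborel. 0 < ennreal (exp (- (cmod z)\<^sup>2) / pi) \<longrightarrow> v + z \<noteq> 0"
      by eventually_elim (auto simp: add_eq_0_iff)
    then show ?thesis unfolding cgauss_def by (subst AE_density) auto
  qed
  then have "(\<integral>\<^sup>+z. ennreal (indicator {0} (v + z)) \<partial>cgauss) = (\<integral>\<^sup>+z. 0 \<partial>cgauss)"
    by (intro nn_integral_cong_AE) (auto elim!: AE_mp simp: indicator_def)
  then show ?thesis by (simp add: mean_le_def)
qed

text \<open>\<open>\<mu>\<close> and \<open>\<theta>\<close> trade the exponents of the error terms for integrability: every term is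
  bounded by a fractional power that has a finite expectation.\<close>
lemma block_error_le:
  fixes S Z :: cvec and H N :: cmat and G :: complex and B :: int
  assumes M: "1 \<le> Mt" "1 \<le> Mr" and B: "2 \<le> B" and k: "1 \<le> k" and q: "1 \<le> q"
    and \<kappa>: "0 \<le> \<kappa>" "\<kappa> * ln (2 * real_of_int B) * real (2 * q) \<le> real (2 * k) * ln (real_of_int B)"
    and md: "0 \<le> C" "\<And>E y w j. w \<in> words B E \<Longrightarrow> j < k \<Longrightarrow>
      (cmod (word_sym B E k w j - word_sym B E k (enum_words B E (best Mt Mr k B E \<rho> y (restrict H ({..<Mr} \<times> {..<Mt})))) j))\<^sup>2 * (\<rho> * frob Mt Mr H)
      \<le> C * (\<Sum>p\<in>{..<Mt + k - 1} \<times> {..<Mr}. (cmod (y (Suc (fst p), snd p) - chan_sig Mt k \<rho> (restrict H ({..<Mr} \<times> {..<Mt})) (word_sym B E k w) p))\<^sup>2)"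
    and R: "0 < R" and g: "0 \<le> g" and c: "c < q" and \<mu>: "0 \<le> \<mu>" "\<mu> \<le> 1" and \<theta>: "0 \<le> \<theta>" "\<theta> \<le> 1"
    and \<rho>: "0 < \<rho>" and \<rho>s: "0 < \<rho>s" and P: "0 < P"
    and A: "A = sqrt (\<rho> / real Mt) * sqrt P"
    and nz: "G \<noteq> 0" "H (0, 0) \<noteq> 0" "N (0, 0) / (complex_of_real A * H (0, 0)) + S 0 \<noteq> 0"
    and w: "w = \<rho> powr (- (\<kappa> * \<theta>)) * \<rho>s powr (- (1 - \<theta>))"
    and F: "F = frob Mt Mr H powr (- (\<kappa> * \<theta>))"
    and V: "V = cmod (N (0, 0) / (complex_of_real A * H (0, 0)) + S 0)"
    and nsq: "nsq = (\<Sum>p\<in>{..<Mt + k - 1} \<times> {..<Mr}. (cmod (N (Suc (fst p), snd p)))\<^sup>2)"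
  shows "(cmod (S (Suc c) - recon Mt Mr \<rho> \<rho>s (Suc q) (Suc (Mt + k - 1)) (blk_tx Mt k B L q R P) (blk_rx Mt Mr k B L q R \<kappa> \<rho> \<rho>s) (S, H, N, G, Z) (Suc c)))\<^sup>2
    \<le> 4 * R powr (- g) * cmod (S (Suc c)) powr (2 + g) + 128 * R\<^sup>2 * (1 / real_of_int B ^ L)\<^sup>2
      + 128 * R\<^sup>2 * (real_of_int B * (4 * real_of_int B) powr \<kappa>)\<^sup>2 * C powr \<kappa> * w * (F * nsq powr \<kappa>)
      + \<rho>s powr (1 - \<mu>) * w * ((cmod (S (Suc c)))\<^sup>2 * (F * cmod G powr (- (2 * \<mu>))))
      + 2 * \<rho>s powr (1 - \<mu>) * w * (F * (cmod G powr (- (2 * \<mu>)) * (cmod (Z (Suc c)))\<^sup>2))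
      + 32 * A powr (- (2 * \<mu>)) * ((cmod (S (Suc c)))\<^sup>2 * V powr (- (2 * \<mu>)) * (cmod (H (0, 0)) powr (- (2 * \<mu>)) * cmod (N (0, 0)) powr (2 * \<mu>)))
      + 32 * \<rho>s powr (1 - \<mu>) * w * ((cmod (S (Suc c)))\<^sup>2 * V powr (- (2 * \<mu>)) * (F * (cmod G powr (- (2 * \<mu>)) * cmod (Z 0) powr (2 * \<mu>))))"
    (is "?err \<le> ?T1 + ?T2 + ?T3 + ?T4 + ?T5 + ?T6 + ?T7")
proof -
  define n m where "n = Suc (Mt + k - 1)" and "m = Suc q"
  define E where "E = L * (2 * q)"
  define h where "h = restrict H ({..<Mr} \<times> {..<Mt})"
  define y where "y = chan_out Mt Mr n \<rho> H (blk_tx Mt k B L q R P S) N"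
  define tt where "tt = side_out m \<rho>s G S Z"
  define s where "s = \<rho>s * (cmod G)\<^sup>2"
  define x where "x = cmod (S (Suc c))"
  define f where "f = \<rho> * frob Mt Mr H"
  have s0: "0 < s" using \<rho>s nz(1) by (simp add: s_def)
  have A0: "0 < A" using \<rho> P M by (simp add: A)
  have w0: "0 \<le> w" and F0: "0 \<le> F" and nsq0: "0 \<le> nsq" by (auto simp: w F nsq intro: sum_nonneg)
  have f0: "0 < f"
  proof -
    have "0 < (cmod (H (0, 0)))\<^sup>2" using nz(2) by simp
    also have "\<dots> \<le> frob Mt Mr H" unfolding frob_def using M by (intro member_le_sum) auto
    finally show ?thesis using \<rho> by (simp add: f_def)
  qed
  \<comment> \<open>This is the weighted geometric mean of the channel bound
    \<open>f powr (- \<kappa>)\<close>, weight \<theta>, and of \<open>1 / \<rho>s\<close>, weight 1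
    - \<theta>. The threshold of the receiver ensures that the smaller of the two is the one in
    use.\<close>
  have wF: "w * F = f powr (- (\<kappa> * \<theta>)) * \<rho>s powr (- (1 - \<theta>))"
    using frob_nonneg[of Mt Mr H] \<rho> by (simp add: w F f_def powr_mult mult_ac)
  have T: "0 \<le> ?T1" "0 \<le> ?T2" "0 \<le> ?T3" "0 \<le> ?T4" "0 \<le> ?T5" "0 \<le> ?T6" "0 \<le> ?T7"
    using w0 F0 by (auto intro!: mult_nonneg_nonneg)
  have rx: "recon Mt Mr \<rho> \<rho>s (Suc q) (Suc (Mt + k - 1)) (blk_tx Mt k B L q R P) (blk_rx Mt Mr k B L q R \<kappa> \<rho> \<rho>s) (S, H, N, G, Z) (Suc c)
    = (if \<rho>s \<le> f powr \<kappa> then word_src B E q R (enum_words B E (best Mt Mr k B E \<rho> y h)) c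
       else if s < 1 then 0 else cnj (sgn (tt 0 * cnj (y (0, 0)) * h (0, 0))) * tt (Suc c) / complex_of_real (sqrt s))"
    by (simp add: recon_def blk_rx_def E_def y_def h_def tt_def n_def m_def f_def s_def)
  show ?thesis
  proof (cases "\<rho>s \<le> f powr \<kappa>")
    case True
    define w1 where "w1 = enum_words B E (best Mt Mr k B E \<rho> y h)"
    have w0E: "src_word B L q R S \<in> words B E" unfolding src_word_def E_def by (rule quant_words[OF B])
    have "best Mt Mr k B E \<rho> y h < card (words B E)" using w0E by (intro best) auto
    then have w1: "w1 \<in> words B E" unfolding w1_def using enum_words[of B E] by blast
    define t where "t = sqrt (C * nsq / f)"
    have t0: "0 \<le> t" using md(1) nsq0 f0 by (simp add: t_def)
    have e: "?err = (cmod (S (Suc c) - word_src B E q R w1 c))\<^sup>2" unfolding rx using True by (simp add: w1_def)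
    have "\<dots> \<le> 4 * (cmod (S (Suc c)) powr (2 + g) * R powr (- g)) + 128 * R\<^sup>2 * (1 / real_of_int B ^ L)\<^sup>2
       + 128 * R\<^sup>2 * (real_of_int B * (4 * real_of_int B) powr \<kappa>)\<^sup>2 * t powr (2 * \<kappa>)"
      unfolding E_def
    proof (rule word_src_error[OF B k q \<kappa> R g w1[unfolded E_def] c t0])
      fix j assume j: "j < k"
      let ?a = "word_sym B E k (src_word B L q R S)"
      have "(\<Sum>p\<in>{..<Mt + k - 1} \<times> {..<Mr}. (cmod (y (Suc (fst p), snd p) - chan_sig Mt k \<rho> h ?a p))\<^sup>2) = nsq"
        unfolding nsq
      proof (intro sum.cong refl)
        fix p assume p: "p \<in> {..<Mt + k - 1} \<times> {..<Mr}"
        have "y (Suc (fst p), snd p) = chan_sig Mt k \<rho> h ?a p + N (Suc (fst p), snd p)"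
          unfolding y_def n_def h_def E_def by (rule chan_out_blk[OF p])
        then show "(cmod (y (Suc (fst p), snd p) - chan_sig Mt k \<rho> h ?a p))\<^sup>2 = (cmod (N (Suc (fst p), snd p)))\<^sup>2" by simp
      qed
      then have "(cmod (?a j - word_sym B E k w1 j))\<^sup>2 * f \<le> C * nsq"
        using md(2)[OF w0E j, of y] by (simp add: w1_def h_def f_def)
      then have "(cmod (?a j - word_sym B E k w1 j))\<^sup>2 \<le> C * nsq / f" using f0 by (simp add: field_simps)
      then show "cmod (word_sym B (L * (2 * q)) k (src_word B L q R S) j - word_sym B (L * (2 * q)) k w1 j) \<le> t"
        unfolding t_def E_def by (rule real_le_rsqrt)
    qed
    moreover have "t powr (2 * \<kappa>) \<le> C powr \<kappa> * w * (F * nsq powr \<kappa>)"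
    proof -
      have "t powr (2 * \<kappa>) = (C * nsq / f) powr \<kappa>"
        unfolding t_def using md(1) nsq0 f0 by (simp add: powr_powr flip: powr_half_sqrt)
      also have "\<dots> = C powr \<kappa> * nsq powr \<kappa> * f powr (- \<kappa>)"
        using md(1) nsq0 f0 by (simp add: powr_divide powr_mult powr_minus_divide)
      also have "\<dots> \<le> C powr \<kappa> * nsq powr \<kappa> * (w * F)"
      proof (intro mult_left_mono)
        \<comment> \<open>In this branch \<open>f powr \<kappa>\<close> is at least \<rho>s, so the
          part of the channel bound with weight 1 - \<theta> may be replaced by the side information
          bound.\<close>
        have "f powr (- \<kappa>) = f powr (- (\<kappa> * \<theta>)) * (f powr \<kappa>) powr (- (1 - \<theta>))"
          using f0 by (simp add: powr_powr algebra_simps flip: powr_add)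
        also have "\<dots> \<le> f powr (- (\<kappa> * \<theta>)) * \<rho>s powr (- (1 - \<theta>))"
          using True \<rho>s \<theta> by (intro mult_left_mono powr_mono2') auto
        finally show "f powr (- \<kappa>) \<le> w * F" unfolding wF .
      qed simp
      finally show ?thesis by (simp add: mult_ac)
    qed
    then have "128 * R\<^sup>2 * (real_of_int B * (4 * real_of_int B) powr \<kappa>)\<^sup>2 * t powr (2 * \<kappa>)
      \<le> 128 * R\<^sup>2 * (real_of_int B * (4 * real_of_int B) powr \<kappa>)\<^sup>2 * (C powr \<kappa> * w * (F * nsq powr \<kappa>))"
      by (intro mult_left_mono) auto
    ultimately have "?err \<le> ?T1 + ?T2 + ?T3" unfolding e by (simp add: mult_ac)
    then show ?thesis using T by linarith
  next
    case False
    \<comment> \<open>The mirror image of the previous branch: now \<rho>s exceeds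
      \<open>f powr \<kappa>\<close>, so the part of \<open>1 / \<rho>s\<close> with weight \<theta>
      is replaced by the channel bound. The factor \<open>\<rho>s powr (1 - \<mu>)\<close> is the
      price for using \<open>s powr (- \<mu>)\<close>, whose mean over the fading is finite, instead
      of \<open>1 / s\<close>.\<close>
    have \<Phi>: "s powr (- \<mu>) \<le> \<rho>s powr (1 - \<mu>) * w * F * cmod G powr (- (2 * \<mu>))"
    proof -
      have "\<rho>s powr (- \<mu>) = \<rho>s powr (1 - \<mu>) * (\<rho>s powr (- (1 - \<theta>)) * \<rho>s powr (- \<theta>))"
        by (simp only: powr_add[symmetric]) simp
      also have "\<dots> \<le> \<rho>s powr (1 - \<mu>) * (\<rho>s powr (- (1 - \<theta>)) * (f powr \<kappa>) powr (- \<theta>))"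
        using False f0 \<theta> by (intro mult_left_mono powr_mono2') auto
      also have "\<dots> = \<rho>s powr (1 - \<mu>) * (w * F)" unfolding wF by (simp add: powr_powr mult_ac)
      finally have "\<rho>s powr (- \<mu>) \<le> \<rho>s powr (1 - \<mu>) * (w * F)" .
      moreover have "s powr (- \<mu>) = \<rho>s powr (- \<mu>) * cmod G powr (- (2 * \<mu>))"
        using nz(1) \<rho>s powr_powr[of "cmod G" 2 "- \<mu>"] by (simp add: s_def powr_mult powr_numeral)
      ultimately show ?thesis by (simp add: mult_right_mono mult.assoc[symmetric])
    qed
    show ?thesis
    proof (cases "s < 1")
      case s1: True
      \<comment> \<open>Below noise level the receiver outputs 0, and the whole sample is the error;
        the bound absorbs it because the negative power is at least 1 here.\<close>
      have "1 \<le> s powr (- \<mu>)" using powr_mono'[of "- \<mu>" 0 s] s0 s1 \<mu> by simp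
      then have "x\<^sup>2 * 1 \<le> x\<^sup>2 * (\<rho>s powr (1 - \<mu>) * w * F * cmod G powr (- (2 * \<mu>)))"
        using \<Phi> by (intro mult_left_mono) auto
      moreover have "?err = x\<^sup>2" unfolding rx using False s1 by (simp add: x_def)
      ultimately have "?err \<le> ?T4" by (simp add: x_def mult_ac)
      then show ?thesis using T by linarith
    next
      case s1: False
      define cc where "cc = complex_of_real (sqrt \<rho>s) * G"
      have cc: "cc \<noteq> 0" "cmod cc = sqrt s" using \<rho>s nz(1) by (auto simp: cc_def s_def norm_mult real_sqrt_mult)
      define u v where "u = sgn cc" and "v = sgn (tt 0 * cnj (y (0, 0)) * h (0, 0))"
      have y0: "y (0, 0) = A * H (0, 0) * S 0 + N (0, 0)"
        unfolding y_def n_def A chan_out_training[OF M] by simp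
      have h0: "h (0, 0) = H (0, 0)" using M by (simp add: h_def)
      have tj: "tt j = cc * S j + Z j" if "j < Suc q" for j using that by (simp add: tt_def m_def side_out_def cc_def)
      have "(cmod (u - v))\<^sup>2 \<le> 16 * (cmod (N (0, 0) / (A * H (0, 0))) powr (2 * \<mu>) + cmod (Z 0) powr (2 * \<mu>) * cmod cc powr (- (2 * \<mu>))) * V powr (- (2 * \<mu>))"
        unfolding u_def v_def y0 h0 V tj[OF zero_less_Suc]
        by (rule phase_error[OF cc(1) nz(2) A0 \<mu>]) (use nz(3) in \<open>auto simp: add.commute\<close>)
      also have "cmod cc powr (- (2 * \<mu>)) = s powr (- \<mu>)"
        unfolding cc(2) using s0 by (simp add: powr_powr flip: powr_half_sqrt)
      also have "cmod (N (0, 0) / (A * H (0, 0))) powr (2 * \<mu>) = A powr (- (2 * \<mu>)) * cmod (H (0, 0)) powr (- (2 * \<mu>)) * cmod (N (0, 0)) powr (2 * \<mu>)"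
        using A0 by (simp add: norm_divide norm_mult powr_divide powr_mult powr_minus_divide)
      finally have uv: "(cmod (u - v))\<^sup>2 \<le> 16 * (A powr (- (2 * \<mu>)) * cmod (H (0, 0)) powr (- (2 * \<mu>)) * cmod (N (0, 0)) powr (2 * \<mu>) + cmod (Z 0) powr (2 * \<mu>) * s powr (- \<mu>)) * V powr (- (2 * \<mu>))" .
      have u1: "cmod u = 1" using cc(1) by (simp add: u_def norm_sgn)
      have "cc = complex_of_real (sqrt s) * u" using cc s0 by (simp add: u_def sgn_eq)
      then have t1: "tt (Suc c) / complex_of_real (sqrt s) = u * S (Suc c) + Z (Suc c) / complex_of_real (sqrt s)"
        using tj[of "Suc c"] c s0 by (simp add: add_divide_distrib)
      have rx': "recon Mt Mr \<rho> \<rho>s (Suc q) (Suc (Mt + k - 1)) (blk_tx Mt k B L q R P) (blk_rx Mt Mr k B L q R \<kappa> \<rho> \<rho>s) (S, H, N, G, Z) (Suc c)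
        = cnj v * (u * S (Suc c) + Z (Suc c) / complex_of_real (sqrt s))"
        unfolding rx t1[symmetric] using False s1 by (simp add: v_def)
      have "?err \<le> 2 * (x\<^sup>2 * (cmod (u - v))\<^sup>2) + 2 * ((cmod (Z (Suc c)))\<^sup>2 * s powr (- \<mu>))"
      proof (cases "v = 0")
        case True
        \<comment> \<open>A vanishing statistic has \<open>sgn\<close> 0, so the output is 0. The
          phase term then equals \<open>2 * x\<^sup>2\<close>, since \<open>u\<close> has modulus 1,
          and covers the error.\<close>
        have "?err = x\<^sup>2" unfolding rx' using True by (simp add: x_def)
        moreover have "0 \<le> 2 * ((cmod (Z (Suc c)))\<^sup>2 * s powr (- \<mu>))" by simp
        moreover have "2 * (x\<^sup>2 * (cmod (u - v))\<^sup>2) = 2 * x\<^sup>2" using True u1 by simp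
        ultimately show ?thesis using zero_le_power2[of x] by linarith
      next
        case v: False
        have v1: "cmod v = 1"
        proof -
          have "tt 0 * cnj (y (0, 0)) * h (0, 0) \<noteq> 0" using v by (auto simp: v_def)
          then show ?thesis unfolding v_def norm_sgn by simp
        qed
        then have vv: "cnj v * v = 1" using complex_norm_square[of v] by (simp add: mult.commute)
        have "S (Suc c) - cnj v * (u * S (Suc c) + Z (Suc c) / complex_of_real (sqrt s))
          = cnj v * ((v - u) * S (Suc c) - Z (Suc c) / complex_of_real (sqrt s))"
          using vv by (simp add: algebra_simps)
        then have "cmod (S (Suc c) - cnj v * (u * S (Suc c) + Z (Suc c) / complex_of_real (sqrt s)))
          = cmod ((v - u) * S (Suc c) - Z (Suc c) / complex_of_real (sqrt s))"
          using v1 by (simp add: norm_mult)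
        also have "\<dots> \<le> x * cmod (u - v) + cmod (Z (Suc c)) / sqrt s"
          using norm_triangle_ineq4[of "(v - u) * S (Suc c)" "Z (Suc c) / complex_of_real (sqrt s)"] s0
          by (simp add: norm_mult norm_divide x_def norm_minus_commute mult.commute)
        finally have "?err \<le> (x * cmod (u - v) + cmod (Z (Suc c)) / sqrt s)\<^sup>2"
          unfolding rx' by (intro power_mono) auto
        also have "\<dots> \<le> 2 * (x * cmod (u - v))\<^sup>2 + 2 * (cmod (Z (Suc c)) / sqrt s)\<^sup>2"
          using sum_squares_bound[of "x * cmod (u - v)" "cmod (Z (Suc c)) / sqrt s"] by (simp add: power2_sum)
        also have "(cmod (Z (Suc c)) / sqrt s)\<^sup>2 \<le> (cmod (Z (Suc c)))\<^sup>2 * s powr (- \<mu>)"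
        proof -
          have "s powr (- 1) \<le> s powr (- \<mu>)" using s1 \<mu> by (intro powr_mono) auto
          then have "(cmod (Z (Suc c)))\<^sup>2 * s powr (- 1) \<le> (cmod (Z (Suc c)))\<^sup>2 * s powr (- \<mu>)" by (intro mult_left_mono) auto
          then show ?thesis using s0 by (simp add: power_divide powr_minus_divide)
        qed
        finally show ?thesis by (simp add: power_mult_distrib)
      qed
      also have "\<dots> \<le> 2 * (x\<^sup>2 * (16 * (A powr (- (2 * \<mu>)) * cmod (H (0, 0)) powr (- (2 * \<mu>)) * cmod (N (0, 0)) powr (2 * \<mu>) + cmod (Z 0) powr (2 * \<mu>) * (\<rho>s powr (1 - \<mu>) * w * F * cmod G powr (- (2 * \<mu>)))) * V powr (- (2 * \<mu>))))
         + 2 * ((cmod (Z (Suc c)))\<^sup>2 * (\<rho>s powr (1 - \<mu>) * w * F * cmod G powr (- (2 * \<mu>))))"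
        by (intro add_mono mult_left_mono order_trans[OF uv] mult_right_mono \<Phi> order_refl) auto
      also have "\<dots> = ?T5 + ?T6 + ?T7" by (simp add: x_def algebra_simps)
      finally show ?thesis using T by linarith
    qed
  qed
qed

lemma mean_le_mono:
  assumes "mean_le M g C" "f \<in> borel_measurable M" "\<And>x. 0 \<le> f x" "\<And>x. f x \<le> g x"
  shows "mean_le M f C"
proof -
  have "(\<integral>\<^sup>+x. ennreal (f x) \<partial>M) \<le> (\<integral>\<^sup>+x. ennreal (g x) \<partial>M)" using assms(4) by (intro nn_integral_mono ennreal_leI)
  then show ?thesis using assms by (auto simp: mean_le_def intro: order_trans)
qed

lemma mean_le_cmult:
  assumes "mean_le M f C" "0 \<le> K"
  shows "mean_le M (\<lambda>x. K * f x) (K * C)"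
proof -
  have m: "(\<lambda>x. ennreal (f x)) \<in> borel_measurable M" using assms(1) by (simp add: mean_le_def)
  have "(\<integral>\<^sup>+x. ennreal (K * f x) \<partial>M) = (\<integral>\<^sup>+x. ennreal K * ennreal (f x) \<partial>M)"
    using assms by (intro nn_integral_cong ennreal_mult) (auto simp: mean_le_def)
  also have "\<dots> = ennreal K * (\<integral>\<^sup>+x. ennreal (f x) \<partial>M)" by (rule nn_integral_cmult[OF m])
  also have "\<dots> \<le> ennreal K * ennreal C" using assms by (intro mult_left_mono) (auto simp: mean_le_def)
  finally show ?thesis using assms by (simp add: mean_le_def ennreal_mult borel_measurable_times)
qed

lemma mean_le_sum:
  assumes "finite I" "\<And>p. p \<in> I \<Longrightarrow> mean_le M (f p) C"
  shows "mean_le M (\<lambda>x. \<Sum>p\<in>I. f p x) (real (card I) * C)"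
  using assms
proof (induction I rule: finite_induct)
  case empty
  then show ?case by (simp add: mean_le_def)
next
  case (insert p I)
  have "mean_le M (\<lambda>x. f p x + (\<Sum>p\<in>I. f p x)) (C + real (card I) * C)"
    using insert by (intro mean_le_add) auto
  then show ?case using insert by (simp add: algebra_simps)
qed

text \<open>The sum is at most its number of terms times the largest one. This works for every
  \<kappa> \<ge> 0, below and above 1 alike.\<close>

lemma sum_powr_le:
  fixes a :: "'a \<Rightarrow> real"
  assumes I: "finite I" and a: "\<And>p. 0 \<le> a p" and \<kappa>: "0 \<le> \<kappa>"
  shows "(\<Sum>p\<in>I. a p) powr \<kappa> \<le> (\<Sum>p\<in>I. (real (card I) * a p) powr \<kappa>)"
proof (cases "I = {}")
  case False
  have "Max (a ` I) \<in> a ` I" using I False by (intro Max_in) auto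
  then obtain p0 where p0: "p0 \<in> I" "a p0 = Max (a ` I)" by auto
  have "(\<Sum>p\<in>I. a p) \<le> real (card I) * a p0"
    using I p0 by (intro sum_bounded_above) auto
  then have "(\<Sum>p\<in>I. a p) powr \<kappa> \<le> (real (card I) * a p0) powr \<kappa>"
    using \<kappa> a by (intro powr_mono2 sum_nonneg) auto
  also have "\<dots> \<le> (\<Sum>p\<in>I. (real (card I) * a p) powr \<kappa>)"
    using I p0 member_le_sum[of p0 I "\<lambda>p. (real (card I) * a p) powr \<kappa>"] by simp
  finally show ?thesis .
qed simp

lemma borel_measurable_frob: "frob Mt Mr \<in> borel_measurable (iid_cmat Mr Mt)"
  unfolding frob_def[abs_def]
proof (intro borel_measurable_sum borel_measurable_power measurable_compose[OF _ borel_measurable_norm])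
  fix p assume "p \<in> {..<Mr} \<times> {..<Mt}"
  then show "(\<lambda>H. H p) \<in> borel_measurable (iid_cmat Mr Mt)"
    by (cases p) (auto intro: measurable_iid_cmat_component)
qed

text \<open>Each of the seven terms of the pointwise bound is a product to which
  \<open>mean_le_joint_term\<close> applies. The constant depends on none of \<open>\<rho>\<close>,
  \<open>\<rho>s\<close>, \<open>R\<close>, \<open>L\<close>, \<open>P\<close>, \<open>c\<close>,
  which leaves all of them free for the limits that follow.\<close>

lemma block_error_integral:
  fixes B :: int
  assumes M: "1 \<le> Mt" "1 \<le> Mr" and B: "2 \<le> B" and k: "1 \<le> k" and q: "1 \<le> q"
    and \<kappa>: "0 \<le> \<kappa>" "\<kappa> * ln (2 * real_of_int B) * real (2 * q) \<le> real (2 * k) * ln (real_of_int B)"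
    and g: "0 \<le> g" and \<mu>: "0 \<le> \<mu>" "\<mu> < 1" and \<theta>: "0 \<le> \<theta>" "\<theta> \<le> 1" and lt: "\<kappa> * \<theta> < real (Mr * Mt)"
  shows "\<exists>C>0. \<forall>\<rho> \<rho>s R L P c. 0 < \<rho> \<longrightarrow> 0 < \<rho>s \<longrightarrow> 0 < R \<longrightarrow> 0 < P \<longrightarrow> c < q \<longrightarrow>
    (\<integral>\<^sup>+\<omega>. ennreal ((cmod (fst \<omega> (Suc c) - recon Mt Mr \<rho> \<rho>s (Suc q) (Suc (Mt + k - 1)) (blk_tx Mt k B L q R P) (blk_rx Mt Mr k B L q R \<kappa> \<rho> \<rho>s) \<omega> (Suc c)))\<^sup>2)
      \<partial>joint_space Mt Mr (Suc q) (Suc (Mt + k - 1)))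
    \<le> ennreal (C * (R powr (- g) + R\<^sup>2 * (1 / real_of_int B ^ L)\<^sup>2 + (R\<^sup>2 + \<rho>s powr (1 - \<mu>)) * (\<rho> powr (- (\<kappa> * \<theta>)) * \<rho>s powr (- (1 - \<theta>)))
        + (sqrt (\<rho> / real Mt) * sqrt P) powr (- (2 * \<mu>))))"
proof -
  let ?m = "Suc q" and ?n = "Suc (Mt + k - 1)" and ?I = "{..<Mt + k - 1} \<times> {..<Mr}"
  let ?J = "joint_space Mt Mr ?m ?n"
  obtain Cd where Cd1: "0 < Cd" and Cd2: "\<forall>(Mr::nat) B E \<rho> H y w j. 0 < \<rho> \<longrightarrow> w \<in> words B E \<longrightarrow> j < k \<longrightarrow>
      (cmod (word_sym B E k w j - word_sym B E k (enum_words B E (best Mt Mr k B E \<rho> y H)) j))\<^sup>2 * (\<rho> * frob Mt Mr H)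
      \<le> Cd * real (Mr * Mt) * (\<Sum>p\<in>{..<Mt + k - 1} \<times> {..<Mr}. (cmod (y (Suc (fst p), snd p) - chan_sig Mt k \<rho> H (word_sym B E k w) p))\<^sup>2)"
    using min_distance_bound[OF M(1) k] by (elim exE conjE) (rule that)
  note Cd = Cd1 Cd2[rule_format]
  define C where "C = Cd * real (Mr * Mt)"
  have C0: "0 \<le> C" using Cd(1) by (simp add: C_def)
  obtain C1 where C1: "0 < C1" "mean_le cgauss (\<lambda>z. cmod z powr (2 + g)) C1"
    using cgauss_moment_finite[of "2 + g"] g by (auto simp: mean_le_def)
  have C2: "mean_le cgauss (\<lambda>z. (cmod z)\<^sup>2) 1"
    using nn_integral_cgauss_shift_square[of 0] by (simp add: mean_le_def)
  obtain C3 where C3: "0 < C3" "\<And>v. mean_le cgauss (\<lambda>z. cmod (v + z) powr (- (2 * \<mu>))) C3"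
    using cgauss_shift_negative_moment[of "2 * \<mu>"] \<mu> by (auto simp: mean_le_def)
  have C3': "mean_le cgauss (\<lambda>z. cmod z powr (- (2 * \<mu>))) C3" using C3(2)[of 0] by simp
  obtain C4 where C4: "0 < C4" "mean_le (iid_cmat Mr Mt) (\<lambda>H. frob Mt Mr H powr (- (\<kappa> * \<theta>))) C4"
    using frob_negative_moment[of "\<kappa> * \<theta>" Mr Mt] lt \<kappa> \<theta> borel_measurable_frob[of Mt Mr]
    by (auto simp: mean_le_def intro!: powr_real_measurable)
  obtain C5 where C5: "0 < C5" "mean_le cgauss (\<lambda>z. cmod z powr (2 * \<mu>)) C5"
    using cgauss_moment_finite[of "2 * \<mu>"] \<mu> by (auto simp: mean_le_def)
  obtain C7 where C7: "0 < C7" "mean_le cgauss (\<lambda>z. cmod z powr (2 * \<kappa>)) C7"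
    using cgauss_moment_finite[of "2 * \<kappa>"] \<kappa> by (auto simp: mean_le_def)
  define C6 where "C6 = real (card ?I) * (real (card ?I) powr \<kappa> * C7)"
  have C6: "0 \<le> C6" "mean_le (iid_cmat ?n Mr) (\<lambda>N. (\<Sum>p\<in>?I. (cmod (N (Suc (fst p), snd p)))\<^sup>2) powr \<kappa>) C6"
  proof -
    show "0 \<le> C6" using C7(1) by (simp add: C6_def)
    show "mean_le (iid_cmat ?n Mr) (\<lambda>N. (\<Sum>p\<in>?I. (cmod (N (Suc (fst p), snd p)))\<^sup>2) powr \<kappa>) C6"
    proof (rule mean_le_mono)
      show "mean_le (iid_cmat ?n Mr) (\<lambda>N. \<Sum>p\<in>?I. real (card ?I) powr \<kappa> * cmod (N (Suc (fst p), snd p)) powr (2 * \<kappa>)) C6"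
        unfolding C6_def by (intro mean_le_sum mean_le_cmult mean_le_iid_cmat_component[OF C7(2)]) auto
      show "(\<lambda>N. (\<Sum>p\<in>?I. (cmod (N (Suc (fst p), snd p)))\<^sup>2) powr \<kappa>) \<in> borel_measurable (iid_cmat ?n Mr)"
        by (intro powr_real_measurable borel_measurable_const borel_measurable_sum borel_measurable_power
            measurable_compose[OF _ borel_measurable_norm] measurable_iid_cmat_component) auto
      fix N :: cmat
      have "(\<Sum>p\<in>?I. (cmod (N (Suc (fst p), snd p)))\<^sup>2) powr \<kappa> \<le> (\<Sum>p\<in>?I. (real (card ?I) * (cmod (N (Suc (fst p), snd p)))\<^sup>2) powr \<kappa>)"
        using \<kappa> by (intro sum_powr_le) auto
      also have "\<dots> = (\<Sum>p\<in>?I. real (card ?I) powr \<kappa> * cmod (N (Suc (fst p), snd p)) powr (2 * \<kappa>))"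
      proof (intro sum.cong refl)
        fix p
        let ?z = "N (Suc (fst p), snd p)"
        show "(real (card ?I) * (cmod ?z)\<^sup>2) powr \<kappa> = real (card ?I) powr \<kappa> * cmod ?z powr (2 * \<kappa>)"
          using powr_powr[of "cmod ?z" 2 \<kappa>] by (cases "?z = 0") (simp_all add: powr_mult powr_numeral)
      qed
      finally show "(\<Sum>p\<in>?I. (cmod (N (Suc (fst p), snd p)))\<^sup>2) powr \<kappa> \<le> (\<Sum>p\<in>?I. real (card ?I) powr \<kappa> * cmod (N (Suc (fst p), snd p)) powr (2 * \<kappa>))" .
    qed simp
  qed
  define Kd where "Kd = 128 * (real_of_int B * (4 * real_of_int B) powr \<kappa>)\<^sup>2 * C powr \<kappa>"
  define CC where "CC = 4 * C1 + 128 + Kd * (C4 * C6) + C4 * C3 + 2 * (C4 * C3) + 32 * (C3 * (C3 * C5)) + 32 * (C3 * (C4 * (C3 * C5)))"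
  have Kd: "0 \<le> Kd" by (simp add: Kd_def)
  show ?thesis
  proof (intro exI[of _ CC] conjI allI impI)
    show "0 < CC"
      unfolding CC_def using Kd C1(1) C3(1) C4(1) C5(1) C6(1) by (simp add: add_pos_nonneg)
    fix \<rho> \<rho>s R P :: real and L c :: nat
    assume \<rho>: "0 < \<rho>" and \<rho>s: "0 < \<rho>s" and R: "0 < R" and P: "0 < P" and c: "c < q"
    define A where "A = sqrt (\<rho> / real Mt) * sqrt P"
    define w where "w = \<rho> powr (- (\<kappa> * \<theta>)) * \<rho>s powr (- (1 - \<theta>))"
    define a where "a = (\<lambda>x :: cmat \<times> cmat. snd x (0, 0) / (complex_of_real A * fst x (0, 0)))"
    have am: "a \<in> borel_measurable (iid_cmat Mr Mt \<Otimes>\<^sub>M iid_cmat ?n Mr)"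
      unfolding a_def using M
      by (intro borel_measurable_divide borel_measurable_times borel_measurable_const
          measurable_compose[OF measurable_snd measurable_iid_cmat_component]
          measurable_compose[OF measurable_fst measurable_iid_cmat_component]) auto
    have w0: "0 \<le> w" by (simp add: w_def)
    note cj = zero_less_Suc[of c] Suc_less_eq[THEN iffD2, OF c]
    note one = mean_le_one[OF prob_space_cgauss] mean_le_one[OF prob_space_iid_cmat] mean_le_one[OF prob_space_iid_cvec]
    let ?F = "\<lambda>H. frob Mt Mr H powr (- (\<kappa> * \<theta>))" and ?ns = "\<lambda>N. (\<Sum>p\<in>?I. (cmod (N (Suc (fst p), snd p)))\<^sup>2) powr \<kappa>"
    let ?neg = "\<lambda>z. cmod z powr (- (2 * \<mu>))" and ?pos = "\<lambda>z. cmod z powr (2 * \<mu>)"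
    have h00: "mean_le (iid_cmat Mr Mt) (\<lambda>H. ?neg (H (0, 0))) C3"
      using M by (intro mean_le_iid_cmat_component[OF C3']) auto
    have n00: "mean_le (iid_cmat ?n Mr) (\<lambda>N. ?pos (N (0, 0))) C5"
      using M by (intro mean_le_iid_cmat_component[OF C5(2)]) auto
    have z0: "mean_le (iid_cvec ?m) (\<lambda>Z. ?pos (Z 0)) C5" by (intro mean_le_iid_cvec_component[OF C5(2)]) auto
    have zj: "mean_le (iid_cvec ?m) (\<lambda>Z. (cmod (Z (Suc c)))\<^sup>2) 1" using c by (intro mean_le_iid_cvec_component[OF C2]) auto
    let ?K1 = "4 * R powr (- g)" and ?K2 = "128 * R\<^sup>2 * (1 / real_of_int B ^ L)\<^sup>2" and ?K3 = "Kd * R\<^sup>2 * w"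
      and ?K4 = "\<rho>s powr (1 - \<mu>) * w" and ?K6 = "32 * A powr (- (2 * \<mu>))"
    have K: "0 \<le> ?K1" "0 \<le> ?K2" "0 \<le> ?K3" "0 \<le> ?K4" "0 \<le> 2 * ?K4" "0 \<le> ?K6" "0 \<le> 32 * ?K4" using w0 Kd by auto
    note T1 = mean_le_joint_term[where \<psi>="\<lambda>_. 1" and a=a, OF cj C1(2) one(1) am one(2) one(2) one(1) one(3) K(1)]
    note T2 = mean_le_joint_term[where \<psi>="\<lambda>_. 1" and a=a, OF cj one(1) one(1) am one(2) one(2) one(1) one(3) K(2)]
    note T3 = mean_le_joint_term[where \<psi>="\<lambda>_. 1" and a=a, OF cj one(1) one(1) am C4(2) C6(2) one(1) one(3) K(3)]
    note T4 = mean_le_joint_term[where \<psi>="\<lambda>_. 1" and a=a, OF cj C2 one(1) am C4(2) one(2) C3' one(3) K(4)]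
    note T5 = mean_le_joint_term[where \<psi>="\<lambda>_. 1" and a=a, OF cj one(1) one(1) am C4(2) one(2) C3' zj K(5)]
    note T6 = mean_le_joint_term[where \<psi>="?neg" and a=a, OF cj C2 C3(2) am h00 n00 one(1) one(3) K(6)]
    note T7 = mean_le_joint_term[where \<psi>="?neg" and a=a, OF cj C2 C3(2) am C4(2) one(2) C3' z0 K(7)]
    note Ts = mean_le_add[OF mean_le_add[OF mean_le_add[OF mean_le_add[OF mean_le_add[OF mean_le_add[OF T1 T2] T3] T4] T5] T6] T7]
    \<comment> \<open>The pointwise bound divides by the side information gain, by a channel entry
      and by \<open>V\<close>. Each exceptional event is an indicator inserted into the product
      lemma with mean bound 0.\<close>
    have pt0: "mean_le cgauss (\<lambda>z. indicator {0} z :: real) 0" using mean_le_cgauss_point[of 0] by simp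
    have pth: "mean_le (iid_cmat Mr Mt) (\<lambda>H. indicator {0} (H (0, 0)) :: real) 0"
      using M by (intro mean_le_iid_cmat_component[OF pt0]) auto
    note nzG = mean_le_AE_zero[OF mean_le_joint_term[where \<psi>="\<lambda>_. 1" and a=a and K=1, OF cj one(1) one(1) am one(2) one(2) pt0 one(3) zero_le_one, unfolded mult_1_left mult_1_right mult_zero_left mult_zero_right]]
    note nzH = mean_le_AE_zero[OF mean_le_joint_term[where \<psi>="\<lambda>_. 1" and a=a and K=1, OF cj one(1) one(1) am pth one(2) one(1) one(3) zero_le_one, unfolded mult_1_left mult_1_right mult_zero_left mult_zero_right]]
    note nzV = mean_le_AE_zero[OF mean_le_joint_term[where \<psi>="\<lambda>z. indicator {0} z" and a=a and K=1, OF cj one(1) mean_le_cgauss_point am one(2) one(2) one(1) one(3) zero_le_one, unfolded mult_1_left mult_1_right mult_zero_left mult_zero_right]]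
    let ?e = "\<lambda>\<omega>. (cmod (fst \<omega> (Suc c) - recon Mt Mr \<rho> \<rho>s ?m ?n (blk_tx Mt k B L q R P) (blk_rx Mt Mr k B L q R \<kappa> \<rho> \<rho>s) \<omega> (Suc c)))\<^sup>2"
    obtain U D where Ts': "mean_le ?J U D"
      and U: "\<And>S H N G Z. U (S, H, N, G, Z) = ?K1 * cmod (S (Suc c)) powr (2 + g) + ?K2 + ?K3 * (?F H * ?ns N)
        + ?K4 * ((cmod (S (Suc c)))\<^sup>2 * (?F H * ?neg G)) + 2 * ?K4 * (?F H * (?neg G * (cmod (Z (Suc c)))\<^sup>2))
        + ?K6 * ((cmod (S (Suc c)))\<^sup>2 * ?neg (a (H, N) + S 0) * (?neg (H (0, 0)) * ?pos (N (0, 0))))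
        + 32 * ?K4 * ((cmod (S (Suc c)))\<^sup>2 * ?neg (a (H, N) + S 0) * (?F H * (?neg G * ?pos (Z 0))))"
      and D: "D = ?K1 * C1 + ?K2 + ?K3 * (C4 * C6) + ?K4 * (C4 * C3) + 2 * ?K4 * (C4 * C3) + ?K6 * (C3 * (C3 * C5)) + 32 * ?K4 * (C3 * (C4 * (C3 * C5)))"
      by (rule that[OF Ts]) simp_all
    have "AE \<omega> in ?J. ?e \<omega> \<le> U \<omega>"
      using nzG nzH nzV
    proof eventually_elim
      case (elim \<omega>)
      obtain S H N G Z where \<omega>: "\<omega> = (S, H, N, G, Z)" by (cases \<omega>) auto
      have nz: "G \<noteq> 0" "H (0, 0) \<noteq> 0" "N (0, 0) / (complex_of_real A * H (0, 0)) + S 0 \<noteq> 0"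
        using elim by (auto simp: \<omega> a_def indicator_def split: if_splits)
      have md: "(cmod (word_sym B E k w j - word_sym B E k (enum_words B E (best Mt Mr k B E \<rho> y (restrict H ({..<Mr} \<times> {..<Mt})))) j))\<^sup>2 * (\<rho> * frob Mt Mr H)
        \<le> C * (\<Sum>p\<in>?I. (cmod (y (Suc (fst p), snd p) - chan_sig Mt k \<rho> (restrict H ({..<Mr} \<times> {..<Mt})) (word_sym B E k w) p))\<^sup>2)"
        if "w \<in> words B E" "j < k" for E y w j
        using Cd(2)[OF \<rho> that, where H="restrict H ({..<Mr} \<times> {..<Mt})" and Mr=Mr and y=y] unfolding frob_restrict C_def .
      have "?e (S, H, N, G, Z) \<le> U (S, H, N, G, Z)"
        unfolding U a_def fst_conv snd_conv
        using block_error_le[where S=S and H=H and N=N and G=G and Z=Z and L=L, OF M B k q \<kappa> C0 md R g c \<mu>(1) less_imp_le[OF \<mu>(2)] \<theta> \<rho> \<rho>s P A_def nz w_def refl refl refl]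
        by (simp add: Kd_def mult_ac)
      then show ?case by (simp add: \<omega>)
    qed
    then have "(\<integral>\<^sup>+\<omega>. ennreal (?e \<omega>) \<partial>?J) \<le> (\<integral>\<^sup>+\<omega>. ennreal (U \<omega>) \<partial>?J)"
      by (intro nn_integral_mono_AE) (auto elim!: AE_mp intro!: ennreal_leI)
    also have "\<dots> \<le> ennreal D" using Ts' by (simp add: mean_le_def)
    also have "\<dots> \<le> ennreal (CC * (R powr (- g) + R\<^sup>2 * (1 / real_of_int B ^ L)\<^sup>2 + (R\<^sup>2 + \<rho>s powr (1 - \<mu>)) * w + A powr (- (2 * \<mu>))))"
    proof (rule ennreal_leI)
      define X where "X = R powr (- g) + R\<^sup>2 * (1 / real_of_int B ^ L)\<^sup>2 + (R\<^sup>2 + \<rho>s powr (1 - \<mu>)) * w + A powr (- (2 * \<mu>))"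
      have p: "0 \<le> R powr (- g)" "0 \<le> R\<^sup>2 * (1 / real_of_int B ^ L)\<^sup>2" "0 \<le> R\<^sup>2 * w" "0 \<le> \<rho>s powr (1 - \<mu>) * w" "0 \<le> A powr (- (2 * \<mu>))"
        using w0 by auto
      have "(R\<^sup>2 + \<rho>s powr (1 - \<mu>)) * w = R\<^sup>2 * w + \<rho>s powr (1 - \<mu>) * w" by (simp add: distrib_right)
      then have X: "R powr (- g) \<le> X" "R\<^sup>2 * (1 / real_of_int B ^ L)\<^sup>2 \<le> X" "R\<^sup>2 * w \<le> X" "\<rho>s powr (1 - \<mu>) * w \<le> X" "A powr (- (2 * \<mu>)) \<le> X"
        unfolding X_def using p by linarith+
      have s: "0 \<le> Kd * (C4 * C6)" "0 \<le> C4 * C3" "0 \<le> C3 * (C3 * C5)" "0 \<le> C3 * (C4 * (C3 * C5))" "0 \<le> C1"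
        using Kd C1(1) C3(1) C4(1) C5(1) C6(1) by auto
      have "D = C1 * (4 * R powr (- g)) + 128 * (R\<^sup>2 * (1 / real_of_int B ^ L)\<^sup>2) + Kd * (C4 * C6) * (R\<^sup>2 * w) + C4 * C3 * (3 * (\<rho>s powr (1 - \<mu>) * w))
         + C3 * (C3 * C5) * (32 * A powr (- (2 * \<mu>))) + C3 * (C4 * (C3 * C5)) * (32 * (\<rho>s powr (1 - \<mu>) * w))"
        by (simp add: D algebra_simps)
      also have "\<dots> \<le> C1 * (4 * X) + 128 * X + Kd * (C4 * C6) * X + C4 * C3 * (3 * X) + C3 * (C3 * C5) * (32 * X) + C3 * (C4 * (C3 * C5)) * (32 * X)"
        using s X by (intro add_mono mult_left_mono) auto
      also have "\<dots> = CC * X" by (simp add: CC_def algebra_simps)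
      finally show "D \<le> CC * (R powr (- g) + R\<^sup>2 * (1 / real_of_int B ^ L)\<^sup>2 + (R\<^sup>2 + \<rho>s powr (1 - \<mu>)) * w + A powr (- (2 * \<mu>)))"
        by (simp add: X_def)
    qed
    finally show "(\<integral>\<^sup>+\<omega>. ennreal (?e \<omega>) \<partial>?J) \<le> ennreal (CC * (R powr (- g) + R\<^sup>2 * (1 / real_of_int B ^ L)\<^sup>2 + (R\<^sup>2 + \<rho>s powr (1 - \<mu>)) * (\<rho> powr (- (\<kappa> * \<theta>)) * \<rho>s powr (- (1 - \<theta>)))
        + (sqrt (\<rho> / real Mt) * sqrt P) powr (- (2 * \<mu>))))"
      by (simp add: w_def A_def)
  qed
qed

text \<open>\<open>J\<close> copies of a block code share its training use (sample and channel use \<open>0\<close>), whose power is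
  therefore free to grow with \<open>J\<close>.\<close>
lemma opt_dist_repeat_le:
  assumes M: "1 \<le> Mt" "1 \<le> Mr" and q: "1 \<le> q" and N: "1 \<le> N"
    and c: "code_measurable Mt Mr (Suc q) (Suc N) f' g'"
    and f0: "\<And>S t. f' S (0, t) = (if t = 0 then complex_of_real (sqrt P) * S 0 else 0)" and P: "0 \<le> P"
    and f1: "\<And>S i t. 1 \<le> i \<Longrightarrow> i \<le> N \<Longrightarrow> t < Mt \<Longrightarrow> (cmod (f' S (i, t)))\<^sup>2 \<le> 1 / 4"
    and power: "P + real (N * J) * real Mt / 4 \<le> real (Suc (N * J)) * real Mt"
    and rate: "real (Suc (N * J)) \<le> real (Suc (q * J)) * b" and D: "0 \<le> D"
    and err: "\<And>c. c < q \<Longrightarrow> (\<integral>\<^sup>+\<omega>. ennreal ((cmod (fst \<omega> (Suc c) - recon Mt Mr \<rho> \<rho>s (Suc q) (Suc N) f' g' \<omega> (Suc c)))\<^sup>2)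
      \<partial>joint_space Mt Mr (Suc q) (Suc N)) \<le> ennreal D"
  shows "opt_dist Mt Mr b \<rho> \<rho>s (Suc (q * J)) \<le> ennreal (1 / real (Suc (q * J)) + D)"
proof -
  let ?m = "Suc (q * J)" and ?n = "Suc (N * J)"
  \<comment> \<open>Copy \<open>a\<close> owns the indices \<open>a * q + 1\<close> to
    \<open>a * q + q\<close> and borrows index 0, so the copies overlap exactly in the training
    sample. Their dependence is harmless, as expected errors add coordinate by coordinate.\<close>
  define \<iota> where "\<iota> a i = (if i = 0 then 0 else a * q + i)" for a i :: nat
  define \<kappa> where "\<kappa> a i = (if i = 0 then 0 else a * N + i)" for a i :: nat
  define f where "f S = (\<lambda>(i, t). f' (pull_vec (\<iota> ((i - 1) div N)) (Suc q) S) (if i = 0 then 0 else Suc ((i - 1) mod N), t))" for S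
  define g where "g y tt h \<gamma> j = (if j = 0 then 0 else g' (pull_mat (\<kappa> ((j - 1) div q)) (Suc N) Mr y) (pull_vec (\<iota> ((j - 1) div q)) (Suc q) tt) h \<gamma> (Suc ((j - 1) mod q)))" for y tt h \<gamma> j
  have inj: "inj_on (\<iota> a) X" "inj_on (\<kappa> a) X" for a X by (auto simp: inj_on_def \<iota>_def \<kappa>_def)
  have range: "\<iota> a \<in> {..<Suc q} \<rightarrow> {..<?m}" "\<kappa> a \<in> {..<Suc N} \<rightarrow> {..<?n}" if "a < J" for a
  proof -
    have *: "a * x + i < Suc (x * J)" if "i < Suc x" for x i
    proof -
      have "Suc a * x \<le> J * x" using \<open>a < J\<close> by (intro mult_le_mono) auto
      then show ?thesis using that by (simp add: mult.commute)
    qed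
    show "\<iota> a \<in> {..<Suc q} \<rightarrow> {..<?m}" "\<kappa> a \<in> {..<Suc N} \<rightarrow> {..<?n}" using *[of _ q] *[of _ N] by (auto simp: \<iota>_def \<kappa>_def)
  qed
  have dj: "i div x < J" if "i < x * J" for i x :: nat using that by (simp add: less_mult_imp_div_less mult.commute)
  have S0: "(\<integral>\<^sup>+S. ennreal ((cmod (S 0))\<^sup>2) \<partial>iid_cvec ?m) \<le> 1"
  proof -
    have "mean_le cgauss (\<lambda>z. (cmod z)\<^sup>2) 1"
      using nn_integral_cgauss_shift_square[of 0] by (simp add: mean_le_def)
    from mean_le_iid_cvec_component[OF this zero_less_Suc] show ?thesis by (simp add: mean_le_def)
  qed
  have fz: "f S (0, t) = (if t = 0 then complex_of_real (sqrt P) * S 0 else 0)" for S t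
    by (simp add: f_def f0 pull_vec_def \<iota>_def)
  have J0: "q * J = 0 \<or> 0 < J" "N * J = 0 \<or> 0 < J" by auto
  have cm: "code_measurable Mt Mr ?m ?n f g"
    unfolding code_measurable_def
  proof (intro conjI allI impI)
    fix i t assume it: "i < ?n" "t < Mt"
    show "(\<lambda>S. f S (i, t)) \<in> borel_measurable (iid_cvec ?m)"
    proof (cases i)
      case 0
      show ?thesis unfolding 0 fz
        by (cases "t = 0") (auto intro!: borel_measurable_times measurable_iid_cvec_component)
    next
      case (Suc i')
      then have "i' div N < J" using it by (intro dj) auto
      note r = range[OF this]
      have "Suc (i' mod N) < Suc N" using N by simp
      from measurable_code_pull(1)[OF r c this it(2)] show ?thesis by (simp add: f_def Suc)
    qed
  next
    fix j assume j: "j < ?m"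
    show "(\<lambda>(y,tt,h,\<gamma>). g y tt h \<gamma> j) \<in> borel_measurable (obs_space Mt Mr ?m ?n)"
    proof (cases j)
      case 0
      then show ?thesis by (simp add: g_def)
    next
      case (Suc j')
      then have "j' div q < J" using j by (intro dj) auto
      note r = range[OF this]
      have "Suc (j' mod q) < Suc q" using q by simp
      from measurable_code_pull(2)[OF r c this] show ?thesis by (simp add: g_def Suc)
    qed
  qed
  have adm: "admissible Mt Mr b ?m ?n f g"
    unfolding admissible_def
  proof (intro conjI)
    show "real ?n \<le> real ?m * b" by (rule rate)
    show "\<forall>i<?n. \<forall>t<Mt. (\<lambda>S. f S (i, t)) \<in> borel_measurable (iid_cvec ?m)"
      "\<forall>j<?m. (\<lambda>(y,tt,h,\<gamma>). g y tt h \<gamma> j) \<in> borel_measurable (obs_space Mt Mr ?m ?n)"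
      using cm by (auto simp: code_measurable_def)
    have bound: "(\<Sum>i<?n. \<Sum>t<Mt. (cmod (f S (i, t)))\<^sup>2) \<le> P * (cmod (S 0))\<^sup>2 + real (N * J) * real Mt / 4" for S
    proof -
      have "(\<Sum>i<?n. \<Sum>t<Mt. (cmod (f S (i, t)))\<^sup>2) = (\<Sum>t<Mt. (cmod (f S (0, t)))\<^sup>2) + (\<Sum>i<N * J. \<Sum>t<Mt. (cmod (f S (Suc i, t)))\<^sup>2)"
        by (rule sum.lessThan_Suc_shift)
      also have "(\<Sum>t<Mt. (cmod (f S (0, t)))\<^sup>2) = (\<Sum>t\<in>{0}. (cmod (f S (0, t)))\<^sup>2)"
        using M by (intro sum.mono_neutral_right) (auto simp: fz)
      also have "\<dots> = P * (cmod (S 0))\<^sup>2" using P by (simp add: fz norm_mult power_mult_distrib)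
      also have "(\<Sum>i<N * J. \<Sum>t<Mt. (cmod (f S (Suc i, t)))\<^sup>2) \<le> (\<Sum>i<N * J. \<Sum>t<Mt. 1 / 4)"
      proof (intro sum_mono)
        fix i t assume "i \<in> {..<N * J}" "t \<in> {..<Mt}"
        then show "(cmod (f S (Suc i, t)))\<^sup>2 \<le> 1 / 4"
          using f1[of "Suc (i mod N)" t "pull_vec (\<iota> (i div N)) (Suc q) S"] N by (simp add: f_def Suc_le_eq)
      qed
      finally show ?thesis by simp
    qed
    have "(\<integral>\<^sup>+S. ennreal (\<Sum>i<?n. \<Sum>t<Mt. (cmod (f S (i, t)))\<^sup>2) \<partial>iid_cvec ?m)
      \<le> (\<integral>\<^sup>+S. ennreal P * ennreal ((cmod (S 0))\<^sup>2) + ennreal (real (N * J) * real Mt / 4) \<partial>iid_cvec ?m)"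
    proof (intro nn_integral_mono)
      fix S :: cvec
      have "ennreal (\<Sum>i<?n. \<Sum>t<Mt. (cmod (f S (i, t)))\<^sup>2) \<le> ennreal (P * (cmod (S 0))\<^sup>2 + real (N * J) * real Mt / 4)"
        by (intro ennreal_leI bound)
      also have "\<dots> = ennreal P * ennreal ((cmod (S 0))\<^sup>2) + ennreal (real (N * J) * real Mt / 4)"
        using P by (simp add: ennreal_plus ennreal_mult del: of_nat_mult)
      finally show "ennreal (\<Sum>i<?n. \<Sum>t<Mt. (cmod (f S (i, t)))\<^sup>2) \<le> ennreal P * ennreal ((cmod (S 0))\<^sup>2) + ennreal (real (N * J) * real Mt / 4)" .
    qed
    also have "\<dots> = ennreal P * (\<integral>\<^sup>+S. ennreal ((cmod (S 0))\<^sup>2) \<partial>iid_cvec ?m) + ennreal (real (N * J) * real Mt / 4)"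
    proof -
      have m: "(\<lambda>S. ennreal ((cmod (S 0))\<^sup>2)) \<in> borel_measurable (iid_cvec ?m)"
        by (intro measurable_compose[OF _ measurable_ennreal] borel_measurable_power measurable_compose[OF _ borel_measurable_norm] measurable_iid_cvec_component) simp
      then have m': "(\<lambda>S. ennreal P * ennreal ((cmod (S 0))\<^sup>2)) \<in> borel_measurable (iid_cvec ?m)" by (intro borel_measurable_times_ennreal borel_measurable_const)
      show ?thesis
        unfolding nn_integral_add[OF m' borel_measurable_const] nn_integral_cmult[OF m]
        by (simp add: prob_space.emeasure_space_1[OF prob_space_iid_cvec] del: of_nat_mult)
    qed
    also have "\<dots> \<le> ennreal P * 1 + ennreal (real (N * J) * real Mt / 4)"
      by (intro add_mono mult_left_mono S0) auto
    also have "\<dots> = ennreal (P + real (N * J) * real Mt / 4)" using P by (simp add: ennreal_plus del: of_nat_mult)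
    also have "\<dots> \<le> ennreal (real ?n * real Mt)" by (rule ennreal_leI[OF power])
    finally show "(\<integral>\<^sup>+S. ennreal (\<Sum>i<?n. \<Sum>t<Mt. (cmod (f S (i, t)))\<^sup>2) \<partial>iid_cvec ?m) \<le> ennreal (real ?n * real Mt)" .
  qed
  let ?e = "\<lambda>j. \<integral>\<^sup>+\<omega>. ennreal ((cmod (fst \<omega> j - recon Mt Mr \<rho> \<rho>s ?m ?n f g \<omega> j))\<^sup>2) \<partial>joint_space Mt Mr ?m ?n"
  \<comment> \<open>The training sample is not reconstructed at all. It costs its variance once per
    block, a share that vanishes as the number of copies grows.\<close>
  have e0: "?e 0 \<le> 1"
  proof -
    let ?Q = "iid_cmat Mr Mt \<Otimes>\<^sub>M (iid_cmat ?n Mr \<Otimes>\<^sub>M (cgauss \<Otimes>\<^sub>M iid_cvec ?m))"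
    have Q: "prob_space ?Q" by (intro prob_space_pair prob_space_iid_cmat prob_space_cgauss prob_space_iid_cvec)
    have m: "(\<lambda>S. ennreal ((cmod (S 0))\<^sup>2)) \<in> borel_measurable (iid_cvec ?m)"
      by (intro measurable_compose[OF _ measurable_ennreal] borel_measurable_power measurable_compose[OF _ borel_measurable_norm] measurable_iid_cvec_component) simp
    have "recon Mt Mr \<rho> \<rho>s ?m ?n f g \<omega> 0 = 0" for \<omega> by (simp add: recon_def g_def split: prod.splits)
    then have "?e 0 = (\<integral>\<^sup>+\<omega>. ennreal ((cmod (fst \<omega> 0))\<^sup>2) * 1 \<partial>(iid_cvec ?m \<Otimes>\<^sub>M ?Q))" by (simp add: joint_space_def)
    also have "\<dots> = (\<integral>\<^sup>+S. ennreal ((cmod (S 0))\<^sup>2) \<partial>iid_cvec ?m) * (\<integral>\<^sup>+y. 1 \<partial>?Q)"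
      by (rule nn_integral_pair_mult[OF Q m borel_measurable_const])
    also have "(\<integral>\<^sup>+y. 1 \<partial>?Q) = 1" using prob_space.emeasure_space_1[OF Q] by simp
    finally show ?thesis using S0 by simp
  qed
  have e1: "?e (Suc j) \<le> ennreal D" if j: "j < q * J" for j
  proof -
    define a c' where "a = j div q" and "c' = j mod q"
    have a: "a < J" unfolding a_def by (rule dj[OF j])
    have c': "c' < q" using q by (simp add: c'_def)
    have "j = a * q + c'" by (simp add: a_def c'_def)
    then have ij: "Suc j = \<iota> a (Suc c')" by (simp add: \<iota>_def)
    have "?e (Suc j) = (\<integral>\<^sup>+\<omega>. ennreal ((cmod (fst \<omega> (Suc c') - recon Mt Mr \<rho> \<rho>s (Suc q) (Suc N) f' g' \<omega> (Suc c')))\<^sup>2) \<partial>joint_space Mt Mr (Suc q) (Suc N))"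
      unfolding ij
    proof (rule nn_integral_err_pull[OF inj(1) range(1)[OF a] inj(2) range(2)[OF a] c])
      show "Suc c' < Suc q" using c' by simp
      fix S i t assume i: "i < Suc N" "t < Mt"
      show "f S (\<kappa> a i, t) = f' (pull_vec (\<iota> a) (Suc q) S) (i, t)"
      proof (cases i)
        case 0
        have "pull_vec (\<iota> a) (Suc q) S 0 = S 0" by (simp add: pull_vec_def \<iota>_def)
        then show ?thesis by (simp add: 0 \<kappa>_def fz f0)
      next
        case (Suc i')
        then have "(a * N + i') div N = a" "(a * N + i') mod N = i'" using i N by auto
        then show ?thesis by (simp add: Suc \<kappa>_def f_def)
      qed
    next
      fix y tt h \<gamma>
      have "(a * q + c') div q = a" "(a * q + c') mod q = c'" using c' by auto
      then show "g y tt h \<gamma> (\<iota> a (Suc c')) = g' (pull_mat (\<kappa> a) (Suc N) Mr y) (pull_vec (\<iota> a) (Suc q) tt) h \<gamma> (Suc c')"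
        by (simp add: \<iota>_def g_def)
    qed
    also have "\<dots> \<le> ennreal D" by (rule err[OF c'])
    finally show ?thesis .
  qed
  have "ennreal (real ?m) * exp_dist Mt Mr \<rho> \<rho>s ?m ?n f g = ?e 0 + (\<Sum>j<q * J. ?e (Suc j))"
    unfolding exp_dist_alt[OF cm] by (rule sum.lessThan_Suc_shift)
  also have "\<dots> \<le> 1 + (\<Sum>j<q * J. ennreal D)" using e0 e1 by (intro add_mono sum_mono) auto
  also have "\<dots> = ennreal (1 + real (q * J) * D)" using D by (simp add: ennreal_plus ennreal_mult ennreal_of_nat_eq_real_of_nat del: of_nat_mult)
  also have "\<dots> \<le> ennreal (real ?m * (1 / real ?m + D))"
    using D by (intro ennreal_leI) (simp add: distrib_left del: of_nat_mult of_nat_Suc, simp add: algebra_simps)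
  also have "\<dots> = ennreal (real ?m) * ennreal (1 / real ?m + D)" using D by (intro ennreal_mult) auto
  finally have "exp_dist Mt Mr \<rho> \<rho>s ?m ?n f g \<le> ennreal (1 / real ?m + D)"
    by (subst (asm) ennreal_mult_le_mult_iff) (auto simp del: of_nat_Suc of_nat_mult)
  then show ?thesis using opt_dist_le_exp_dist[OF adm] by (rule order_trans[rotated])
qed

text \<open>One parameter \<open>J\<close> serves three purposes: the number of copies, the number
  of digits and, halved, the training power. As it tends to infinity the cost of the training
  sample, the truncation error and the error from training noise at the channel output vanish
  together, at fixed \<rho>. Clipping at \<open>R\<close> remains and is tuned to \<rho>
  afterwards.\<close>

lemma ED_star_upper_bound:
  assumes M: "1 \<le> Mt" "1 \<le> Mr" and b: "0 < b" and \<kappa>: "0 \<le> \<kappa>" "\<kappa> < b"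
    and g: "0 \<le> g" and \<mu>: "0 < \<mu>" "\<mu> < 1" and \<theta>: "0 \<le> \<theta>" "\<theta> \<le> 1" and lt: "\<kappa> * \<theta> < real (Mr * Mt)"
  shows "\<exists>C>0. \<forall>\<rho> \<rho>s R. 0 < \<rho> \<longrightarrow> 0 < \<rho>s \<longrightarrow> 0 < R \<longrightarrow>
    ED_star Mt Mr b \<rho> \<rho>s \<le> C * (R powr (- g) + (R\<^sup>2 + \<rho>s powr (1 - \<mu>)) * (\<rho> powr (- (\<kappa> * \<theta>)) * \<rho>s powr (- (1 - \<theta>))))"
proof -
  \<comment> \<open>The excess \<open>q * (b - \<kappa>)\<close> in channel uses pays for rounding
    \<open>k\<close> up, for the \<open>Mt - 1\<close> additional evaluation points, and for the
    shared training use.\<close>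
  obtain q where q: "real Mt + 2 < real q * (b - \<kappa>)"
    using reals_Archimedean3[of "b - \<kappa>"] \<kappa> by auto
  have q1: "1 \<le> q" using q by (cases q) auto
  define k where "k = nat \<lfloor>real q * \<kappa>\<rfloor> + 1"
  have k: "1 \<le> k" "real q * \<kappa> < real k" "real k \<le> real q * \<kappa> + 1"
    using \<kappa> by (auto simp: k_def) linarith+
  have "\<kappa> < real k / real q" using k q1 by (simp add: field_simps)
  then obtain B where B: "2 \<le> B" "\<kappa> * ln (2 * real_of_int B) \<le> real k / real q * ln (real_of_int B)"
    using ex_base[OF \<kappa>(1)] by blast
  have \<kappa>2: "\<kappa> * ln (2 * real_of_int B) * real (2 * q) \<le> real (2 * k) * ln (real_of_int B)"
    using mult_right_mono[OF B(2), of "real (2 * q)"] q1 by (simp add: field_simps)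
  define N where "N = Mt + k - 1"
  have N: "1 \<le> N" "real N \<le> real q * b - 1"
    using M k q by (auto simp: N_def of_nat_diff algebra_simps)
  obtain C where C1: "0 < C" and C2: "\<forall>\<rho> \<rho>s R L P c. 0 < \<rho> \<longrightarrow> 0 < \<rho>s \<longrightarrow> 0 < R \<longrightarrow> 0 < P \<longrightarrow> c < q \<longrightarrow>
    (\<integral>\<^sup>+\<omega>. ennreal ((cmod (fst \<omega> (Suc c) - recon Mt Mr \<rho> \<rho>s (Suc q) (Suc N) (blk_tx Mt k B L q R P) (blk_rx Mt Mr k B L q R \<kappa> \<rho> \<rho>s) \<omega> (Suc c)))\<^sup>2)
      \<partial>joint_space Mt Mr (Suc q) (Suc N))
    \<le> ennreal (C * (R powr (- g) + R\<^sup>2 * (1 / real_of_int B ^ L)\<^sup>2 + (R\<^sup>2 + \<rho>s powr (1 - \<mu>)) * (\<rho> powr (- (\<kappa> * \<theta>)) * \<rho>s powr (- (1 - \<theta>)))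
        + (sqrt (\<rho> / real Mt) * sqrt P) powr (- (2 * \<mu>))))"
    using block_error_integral[OF M B(1) k(1) q1 \<kappa>(1) \<kappa>2 g less_imp_le[OF \<mu>(1)] \<mu>(2) \<theta> lt] by (elim exE conjE) (rule that[unfolded N_def])
  note C = C1 C2[rule_format]
  show ?thesis
  proof (intro exI[of _ C] conjI allI impI)
    fix \<rho> \<rho>s R :: real assume \<rho>: "0 < \<rho>" and \<rho>s: "0 < \<rho>s" and R: "0 < R"
    let ?X = "R powr (- g)" and ?Y = "(R\<^sup>2 + \<rho>s powr (1 - \<mu>)) * (\<rho> powr (- (\<kappa> * \<theta>)) * \<rho>s powr (- (1 - \<theta>)))"
    define D where "D J = C * (?X + R\<^sup>2 * (1 / real_of_int B ^ J)\<^sup>2 + ?Y + (sqrt (\<rho> / real Mt) * sqrt (real J / 2)) powr (- (2 * \<mu>)))" for J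
    have D0: "0 \<le> D J" for J unfolding D_def using C(1) by (intro mult_nonneg_nonneg add_nonneg_nonneg) auto
    have le: "ED_star Mt Mr b \<rho> \<rho>s \<le> 1 / real (Suc (q * J)) + D J" if J: "1 \<le> J" for J
    proof -
      have "opt_dist Mt Mr b \<rho> \<rho>s (Suc (q * J)) \<le> ennreal (1 / real (Suc (q * J)) + D J)"
      proof (rule opt_dist_repeat_le[OF M q1 N(1)])
        show "code_measurable Mt Mr (Suc q) (Suc N) (blk_tx Mt k B J q R (real J / 2)) (blk_rx Mt Mr k B J q R \<kappa> \<rho> \<rho>s)"
          unfolding N_def by (rule code_measurable_blk[OF M])
        show "blk_tx Mt k B J q R (real J / 2) S (0, t) = (if t = 0 then complex_of_real (sqrt (real J / 2)) * S 0 else 0)" for S t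
          by (simp add: blk_tx_def)
        show "(cmod (blk_tx Mt k B J q R (real J / 2) S (i, t)))\<^sup>2 \<le> 1 / 4" if "1 \<le> i" "i \<le> N" "t < Mt" for S i t
          using that M by (intro cmod_blk_tx_le[OF B(1) k(1)]) (auto simp: N_def)
        have "1 * real J \<le> real N * real J" using N by (intro mult_right_mono) auto
        then have "real J * 1 \<le> real (N * J) * real Mt" using M N by (intro mult_mono) auto
        moreover have "real (Suc (N * J)) * real Mt = real Mt + real (N * J) * real Mt" by (simp add: algebra_simps)
        ultimately show "real J / 2 + real (N * J) * real Mt / 4 \<le> real (Suc (N * J)) * real Mt" by linarith
        have "real N * real J \<le> (real q * b - 1) * real J" using N by (intro mult_right_mono) auto
        moreover have "1 \<le> real J" using J by simp
        ultimately show "real (Suc (N * J)) \<le> real (Suc (q * J)) * b" using b by (simp add: algebra_simps)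
        show "0 \<le> D J" by (rule D0)
        show "(\<integral>\<^sup>+\<omega>. ennreal ((cmod (fst \<omega> (Suc c) - recon Mt Mr \<rho> \<rho>s (Suc q) (Suc N) (blk_tx Mt k B J q R (real J / 2)) (blk_rx Mt Mr k B J q R \<kappa> \<rho> \<rho>s) \<omega> (Suc c)))\<^sup>2)
          \<partial>joint_space Mt Mr (Suc q) (Suc N)) \<le> ennreal (D J)" if "c < q" for c
          unfolding D_def using J by (intro C(2) \<rho> \<rho>s R that) simp
      qed (use J in simp)
      then have "enn2real (opt_dist Mt Mr b \<rho> \<rho>s (Suc (q * J))) \<le> 1 / real (Suc (q * J)) + D J"
        using D0[of J] by (intro enn2real_leI) auto
      moreover have "ED_star Mt Mr b \<rho> \<rho>s \<le> enn2real (opt_dist Mt Mr b \<rho> \<rho>s (Suc (q * J)))"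
        unfolding ED_star_eq_INF[OF less_imp_le[OF b]] by (rule cINF_lower) (auto intro!: bdd_belowI[of _ 0])
      ultimately show ?thesis by linarith
    qed
    have l1: "(\<lambda>J. 1 / real (Suc (q * J))) \<longlonglongrightarrow> 0"
    proof (rule tendsto_sandwich[OF _ _ tendsto_const LIMSEQ_inverse_real_of_nat])
      show "\<forall>\<^sub>F J in sequentially. 1 / real (Suc (q * J)) \<le> inverse (real (Suc J))"
      proof (rule always_eventually, rule allI)
        fix J
        have "1 * J \<le> q * J" using q1 by (intro mult_le_mono) auto
        then show "1 / real (Suc (q * J)) \<le> inverse (real (Suc J))"
          by (simp add: inverse_eq_divide frac_le del: of_nat_Suc)
      qed
    qed simp
    have l2: "(\<lambda>J. (1 / real_of_int B ^ J)\<^sup>2) \<longlonglongrightarrow> 0\<^sup>2"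
    proof (intro tendsto_power)
      have "(\<lambda>J. (1 / real_of_int B) ^ J) \<longlonglongrightarrow> 0" using B(1) by (intro LIMSEQ_realpow_zero) auto
      then show "(\<lambda>J. 1 / real_of_int B ^ J) \<longlonglongrightarrow> 0" by (simp add: power_divide)
    qed
    have l3: "(\<lambda>J. (sqrt (\<rho> / real Mt) * sqrt (real J / 2)) powr (- (2 * \<mu>))) \<longlonglongrightarrow> 0"
    proof (rule tendsto_neg_powr)
      have "filterlim (\<lambda>J. real J * (1 / 2)) at_top sequentially"
        by (intro filterlim_at_top_mult_tendsto_pos[OF tendsto_const] filterlim_real_sequentially) simp
      then have "filterlim (\<lambda>J. sqrt (real J / 2)) at_top sequentially"
        using filterlim_compose[OF sqrt_at_top] by simp
      then show "filterlim (\<lambda>J. sqrt (\<rho> / real Mt) * sqrt (real J / 2)) at_top sequentially"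
        using \<rho> M by (intro filterlim_tendsto_pos_mult_at_top[OF tendsto_const]) auto
    qed (use \<mu> in simp)
    have "(\<lambda>J. 1 / real (Suc (q * J)) + D J) \<longlonglongrightarrow> 0 + C * (?X + R\<^sup>2 * 0\<^sup>2 + ?Y + 0)"
      unfolding D_def by (intro tendsto_intros l1 l2 l3)
    then have "(\<lambda>J. 1 / real (Suc (q * J)) + D J) \<longlonglongrightarrow> C * (?X + ?Y)" by simp
    then show "ED_star Mt Mr b \<rho> \<rho>s \<le> C * (?X + ?Y)"
      by (rule LIMSEQ_le_const) (use le in blast)
  qed (rule C(1))
qed

section \<open>Distortion exponents\<close>

lemma exponent_ge:
  fixes \<rho> D C M :: real
  assumes "1 < \<rho>" "0 < D" "0 < C" "D \<le> C * \<rho> powr (- M)"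
  shows "M - ln C / ln \<rho> \<le> - ln D / ln \<rho>"
proof -
  have l: "0 < ln \<rho>" using assms(1) by simp
  have "ln D \<le> ln (C * \<rho> powr (- M))" using assms by (intro ln_mono) auto
  also have "\<dots> = ln C - M * ln \<rho>" using assms by (simp add: ln_mult ln_powr)
  finally have "M * ln \<rho> - ln C \<le> - ln D" by simp
  then have "(M * ln \<rho> - ln C) / ln \<rho> \<le> - ln D / ln \<rho>" using l by (intro divide_right_mono) auto
  then show ?thesis using l by (simp add: diff_divide_distrib)
qed

text \<open>At the level \<open>\<rho> powr (- \<alpha>)\<close> the fade probability contributes
  \<open>Mr * Mt * \<alpha>\<close> to the exponent and the ladder bound the larger of \<nu> and
  \<open>b * (1 - \<alpha>)\<close>, up to terms that vanish with \<open>1 / ln \<rho>\<close>.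
  Positivity of \<open>D\<close> is part of the claim because \<open>ln\<close> is applied to
  it.\<close>

lemma converse_exponent_le:
  assumes M: "1 \<le> Mt" "1 \<le> Mr" and b: "0 \<le> b" and \<rho>: "1 < \<rho>" and \<rho>s: "0 < \<rho>s" and \<alpha>: "0 \<le> \<alpha>" "\<alpha> \<le> 1"
    and D: "converse_bound Mt Mr b \<rho> \<rho>s (\<rho> powr (- \<alpha>)) \<le> D"
  shows "0 < D"
    and "- ln D / ln \<rho> \<le> (ln 2000 + real (Mr * Mt) * ln 100) / ln \<rho> + real (Mr * Mt) * \<alpha>
      + max (ln \<rho>s / ln \<rho>) (max 0 (b * ((1 - \<alpha>) + (ln (1 + real (Mr * Mt)) + real Mr * ln 2) / ln \<rho>)))"
proof -
  define c where "c = real (Mr * Mt)"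
  define K where "K = ln (1 + c) + real Mr * ln 2"
  define m where "m = max (ln \<rho>s / ln \<rho>) (max 0 (b * ((1 - \<alpha>) + K / ln \<rho>)))"
  have c: "0 \<le> c" by (simp add: c_def)
  have l: "0 < ln \<rho>" using \<rho> by simp
  have m: "ln \<rho>s \<le> m * ln \<rho>" "0 \<le> m * ln \<rho>" "b * ((1 - \<alpha>) * ln \<rho> + K) \<le> m * ln \<rho>"
  proof -
    have "ln \<rho>s / ln \<rho> \<le> m" by (simp add: m_def)
    then show "ln \<rho>s \<le> m * ln \<rho>" using l by (simp add: field_simps)
    show "0 \<le> m * ln \<rho>" using l by (simp add: m_def)
    have "b * ((1 - \<alpha>) + K / ln \<rho>) \<le> m" by (simp add: m_def)
    from mult_right_mono[OF this, of "ln \<rho>"] show "b * ((1 - \<alpha>) * ln \<rho> + K) \<le> m * ln \<rho>" using l by (simp add: algebra_simps)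
  qed
  have "ln (1 + \<rho> * (c * \<rho> powr (- \<alpha>))) \<le> ln ((1 + c) * \<rho> powr (1 - \<alpha>))"
  proof (rule ln_mono)
    have "1 \<le> \<rho> powr (1 - \<alpha>)" using \<rho> \<alpha> by (intro ge_one_powr_ge_zero) auto
    moreover have e: "\<rho> * (c * \<rho> powr (- \<alpha>)) = c * \<rho> powr (1 - \<alpha>)" using \<rho> by (simp add: powr_diff powr_minus_divide)
    ultimately show "1 + \<rho> * (c * \<rho> powr (- \<alpha>)) \<le> (1 + c) * \<rho> powr (1 - \<alpha>)" unfolding e distrib_right by simp
    show "0 < 1 + \<rho> * (c * \<rho> powr (- \<alpha>))" using c \<rho> by (simp add: add_pos_nonneg)
  qed
  also have "\<dots> = ln (1 + c) + (1 - \<alpha>) * ln \<rho>" using c \<rho> by (simp add: ln_mult ln_powr add_pos_nonneg)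
  finally have "b * (ln (1 + \<rho> * (c * \<rho> powr (- \<alpha>))) + real Mr * ln 2) \<le> b * ((1 - \<alpha>) * ln \<rho> + K)"
    unfolding K_def using b by (intro mult_left_mono) auto
  then have 1: "exp (- (m * ln \<rho>)) \<le> exp (- (b * (ln (1 + \<rho> * (c * \<rho> powr (- \<alpha>))) + real Mr * ln 2)))"
    using m(3) by simp
  have 2: "exp (- (m * ln \<rho>)) \<le> 1 / \<rho>s"
  proof -
    have "exp (- (m * ln \<rho>)) \<le> exp (- ln \<rho>s)" using m(1) by simp
    then show ?thesis using \<rho>s by (simp add: exp_minus inverse_eq_divide)
  qed
  have 3: "exp (- (m * ln \<rho>)) \<le> 1" using m(2) by simp
  have 4: "(\<rho> powr (- \<alpha>) / 100) ^ (Mr * Mt) = exp (- (c * (\<alpha> * ln \<rho> + ln 100)))"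
  proof -
    have "\<rho> powr (- \<alpha>) / 100 = exp (- (\<alpha> * ln \<rho> + ln 100))"
      using \<rho> by (simp add: powr_def exp_diff exp_minus exp_add field_simps)
    then show ?thesis by (simp only: exp_of_nat_mult[symmetric] c_def mult_minus_right)
  qed
  have "1 / 2000 * exp (- (m * ln \<rho>)) * exp (- (c * (\<alpha> * ln \<rho> + ln 100))) \<le> converse_bound Mt Mr b \<rho> \<rho>s (\<rho> powr (- \<alpha>))"
    unfolding converse_bound_def 4 c_def[symmetric]
    using 1 2 3 by (intro mult_right_mono mult_left_mono) auto
  also note D
  finally have D': "1 / 2000 * exp (- (m * ln \<rho>)) * exp (- (c * (\<alpha> * ln \<rho> + ln 100))) \<le> D" .
  have "0 < 1 / 2000 * exp (- (m * ln \<rho>)) * exp (- (c * (\<alpha> * ln \<rho> + ln 100)))" by simp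
  then show D0: "0 < D" using D' by linarith
  have "ln (1 / 2000 * exp (- (m * ln \<rho>)) * exp (- (c * (\<alpha> * ln \<rho> + ln 100)))) \<le> ln D"
    using D' by (intro ln_mono) auto
  also have "ln (1 / 2000 * exp (- (m * ln \<rho>)) * exp (- (c * (\<alpha> * ln \<rho> + ln 100)))) = - ln 2000 - m * ln \<rho> - c * (\<alpha> * ln \<rho> + ln 100)"
    by (simp add: ln_mult ln_divide_pos)
  finally have "- ln D \<le> ln 2000 + c * ln 100 + c * \<alpha> * ln \<rho> + m * ln \<rho>" by (simp add: algebra_simps)
  then have "- ln D / ln \<rho> \<le> (ln 2000 + c * ln 100 + c * \<alpha> * ln \<rho> + m * ln \<rho>) / ln \<rho>" using l by (intro divide_right_mono) auto
  also have "\<dots> = (ln 2000 + c * ln 100) / ln \<rho> + c * \<alpha> + m" using l by (simp add: add_divide_distrib)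
  finally show "- ln D / ln \<rho> \<le> (ln 2000 + real (Mr * Mt) * ln 100) / ln \<rho> + real (Mr * Mt) * \<alpha>
      + max (ln \<rho>s / ln \<rho>) (max 0 (b * ((1 - \<alpha>) + (ln (1 + real (Mr * Mt)) + real Mr * ln 2) / ln \<rho>)))"
    by (simp only: c_def m_def K_def)
qed

lemma tendsto_const_div_ln: "((\<lambda>\<rho>::real. c / ln \<rho>) \<longlongrightarrow> 0) at_top" for c :: real
  by (intro tendsto_divide_0[OF tendsto_const] filterlim_at_top_imp_at_infinity ln_at_top)

text \<open>Each of the three summands is a power of \<rho> once \<rho>s is written as
  \<open>\<rho> powr t\<close>; their sum is at most three times the largest.\<close>

lemma exponent_ge_min:
  fixes \<rho> \<rho>s D C p e r u v t :: real
  assumes \<rho>: "1 < \<rho>" and \<rho>s: "0 < \<rho>s" and D: "0 < D" and C: "0 < C"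
    and le: "D \<le> C * (\<rho> powr (- p) + (\<rho> powr e + \<rho>s powr r) * (\<rho> powr (- u) * \<rho>s powr (- v)))"
    and t: "t = ln \<rho>s / ln \<rho>"
  shows "min p (min (u + v * t - e) (u + v * t - r * t)) - ln (3 * C) / ln \<rho> \<le> - ln D / ln \<rho>"
proof (rule exponent_ge[OF \<rho> D])
  let ?M = "min p (min (u + v * t - e) (u + v * t - r * t))"
  have s: "\<rho>s powr x = \<rho> powr (x * t)" for x
  proof -
    have "ln \<rho> \<noteq> 0" using \<rho> by simp
    then show ?thesis using \<rho> \<rho>s by (simp add: powr_def t)
  qed
  have 1: "\<rho> powr e * (\<rho> powr (- u) * \<rho> powr (- v * t)) = \<rho> powr (- (u + v * t - e))"
    "\<rho> powr (r * t) * (\<rho> powr (- u) * \<rho> powr (- v * t)) = \<rho> powr (- (u + v * t - r * t))"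
    by (simp_all only: powr_add[symmetric]) (simp_all add: algebra_simps)
  have "\<rho> powr (- p) + (\<rho> powr e + \<rho>s powr r) * (\<rho> powr (- u) * \<rho>s powr (- v))
    = \<rho> powr (- p) + \<rho> powr (- (u + v * t - e)) + \<rho> powr (- (u + v * t - r * t))"
    unfolding s distrib_right 1 by simp
  also have "\<dots> \<le> \<rho> powr (- ?M) + \<rho> powr (- ?M) + \<rho> powr (- ?M)"
    using \<rho> by (intro add_mono powr_mono) auto
  finally have "C * (\<rho> powr (- p) + (\<rho> powr e + \<rho>s powr r) * (\<rho> powr (- u) * \<rho>s powr (- v))) \<le> C * (3 * \<rho> powr (- ?M))"
    using C by (intro mult_left_mono) auto
  then show "D \<le> 3 * C * \<rho> powr (- ?M)" using le by simp
qed (use C in simp)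

section \<open>The exponents when \<rho>s grows like a power \<nu> of \<rho>\<close>

context
  fixes Mt Mr :: nat and b \<nu> :: real and \<rho>s :: "real \<Rightarrow> real"
  assumes M: "1 \<le> Mt" "1 \<le> Mr" "min Mt Mr = 1" and b: "0 < b" and \<nu>: "0 \<le> \<nu>"
    and \<rho>s: "\<forall>\<rho>>0. 0 < \<rho>s \<rho>" and lim: "((\<lambda>\<rho>. ln (\<rho>s \<rho>) / ln \<rho>) \<longlongrightarrow> \<nu>) at_top"
begin

text \<open>One function \<open>U\<close> bounds the exponents of all codes and of all BS-LD
  parameters at each \<rho>. Its independence of \<open>L\<close>, \<open>r\<close> and \<xi> lets
  it pass through the supremum in \<open>bsld_best_exponent\<close>.\<close>

lemma converse_exponent:
  obtains U where "(U \<longlongrightarrow> Delta_formula Mt Mr b \<nu>) at_top"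
    "\<And>\<rho>. 1 < \<rho> \<Longrightarrow> 0 < ED_star Mt Mr b \<rho> (\<rho>s \<rho>) \<and> - ln (ED_star Mt Mr b \<rho> (\<rho>s \<rho>)) / ln \<rho> \<le> U \<rho>"
    "\<And>\<rho> L r \<xi>. 1 < \<rho> \<Longrightarrow> bsld_params L r \<xi> \<Longrightarrow> 0 < bsld_exp_dist Mt Mr b \<rho> (\<rho>s \<rho>) L r \<xi> \<and> - ln (bsld_exp_dist Mt Mr b \<rho> (\<rho>s \<rho>) L r \<xi>) / ln \<rho> \<le> U \<rho>"
proof -
  obtain \<alpha> where \<alpha>: "0 \<le> \<alpha>" "\<alpha> \<le> 1" "real (Mr * Mt) * \<alpha> + max \<nu> (b * (1 - \<alpha>)) = Delta_formula Mt Mr b \<nu>"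
    using Delta_formula_eq_theta(2)[OF b \<nu> M] by blast
  define U where "U \<rho> = (ln 2000 + real (Mr * Mt) * ln 100) / ln \<rho> + real (Mr * Mt) * \<alpha>
      + max (ln (\<rho>s \<rho>) / ln \<rho>) (max 0 (b * ((1 - \<alpha>) + (ln (1 + real (Mr * Mt)) + real Mr * ln 2) / ln \<rho>)))" for \<rho>
  have "(U \<longlongrightarrow> 0 + real (Mr * Mt) * \<alpha> + max \<nu> (max 0 (b * ((1 - \<alpha>) + 0)))) at_top"
    unfolding U_def[abs_def]
    by (intro tendsto_add tendsto_max tendsto_mult tendsto_const tendsto_const_div_ln lim)
  moreover have "0 + real (Mr * Mt) * \<alpha> + max \<nu> (max 0 (b * ((1 - \<alpha>) + 0))) = Delta_formula Mt Mr b \<nu>"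
    using \<alpha> b \<nu> by (simp add: max.absorb2 flip: \<alpha>(3))
  ultimately have "(U \<longlongrightarrow> Delta_formula Mt Mr b \<nu>) at_top" by simp
  moreover have a: "0 < \<rho> powr (- \<alpha>)" "\<rho> powr (- \<alpha>) \<le> 1" if "1 < \<rho>" for \<rho>
    using that \<alpha> powr_mono[of "- \<alpha>" 0 \<rho>] by auto
  have "0 < ED_star Mt Mr b \<rho> (\<rho>s \<rho>) \<and> - ln (ED_star Mt Mr b \<rho> (\<rho>s \<rho>)) / ln \<rho> \<le> U \<rho>" if \<rho>: "1 < \<rho>" for \<rho>
  proof -
    have s: "0 < \<rho>s \<rho>" using \<rho>s \<rho> by simp
    have "converse_bound Mt Mr b \<rho> (\<rho>s \<rho>) (\<rho> powr (- \<alpha>)) \<le> ED_star Mt Mr b \<rho> (\<rho>s \<rho>)"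
      using \<rho> b s a[OF \<rho>] by (intro ED_star_ge_converse_bound M) auto
    from converse_exponent_le[OF M(1,2) less_imp_le[OF b] \<rho> s \<alpha>(1,2) this] show ?thesis unfolding U_def by blast
  qed
  moreover have "0 < bsld_exp_dist Mt Mr b \<rho> (\<rho>s \<rho>) L r \<xi> \<and> - ln (bsld_exp_dist Mt Mr b \<rho> (\<rho>s \<rho>) L r \<xi>) / ln \<rho> \<le> U \<rho>"
    if \<rho>: "1 < \<rho>" and p: "bsld_params L r \<xi>" for \<rho> L r \<xi>
  proof -
    have s: "0 < \<rho>s \<rho>" using \<rho>s \<rho> by simp
    from converse_exponent_le[OF M(1,2) less_imp_le[OF b] \<rho> s \<alpha>(1,2) bsld_exp_dist_ge_converse_bound[OF M b \<rho> s p a[OF \<rho>]]]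
    show ?thesis unfolding U_def by blast
  qed
  ultimately show ?thesis using that by blast
qed

lemma ED_star_exponent: "((\<lambda>\<rho>. - ln (ED_star Mt Mr b \<rho> (\<rho>s \<rho>)) / ln \<rho>) \<longlongrightarrow> Delta_formula Mt Mr b \<nu>) at_top"
proof (rule order_tendstoI)
  let ?\<Delta> = "Delta_formula Mt Mr b \<nu>" and ?f = "\<lambda>\<rho>. - ln (ED_star Mt Mr b \<rho> (\<rho>s \<rho>)) / ln \<rho>"
  obtain U where U: "(U \<longlongrightarrow> ?\<Delta>) at_top"
    "\<And>\<rho>. 1 < \<rho> \<Longrightarrow> 0 < ED_star Mt Mr b \<rho> (\<rho>s \<rho>) \<and> ?f \<rho> \<le> U \<rho>"
    using converse_exponent by metis
  show "\<forall>\<^sub>F \<rho> in at_top. ?f \<rho> < x" if "?\<Delta> < x" for x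
    using order_tendstoD(2)[OF U(1) that] eventually_gt_at_top[of 1]
  proof eventually_elim
    case (elim \<rho>)
    then show ?case using U(2)[of \<rho>] by linarith
  qed
  show "\<forall>\<^sub>F \<rho> in at_top. x < ?f \<rho>" if x: "x < ?\<Delta>" for x
  proof -
    obtain \<theta> where \<theta>: "0 \<le> \<theta>" "\<theta> \<le> 1" "b * \<theta> \<le> real (Mr * Mt)" "?\<Delta> = b * \<theta> + \<nu> * (1 - \<theta>)"
      using Delta_formula_eq_theta(1)[OF b \<nu> M] by blast
    \<comment> \<open>The total loss of exponent is at most \<epsilon> times this:
      \<open>b * \<theta>\<close> from taking \<kappa> below \<open>b\<close>, 2 from the factor
      \<open>R\<^sup>2\<close> with \<open>R = \<rho> powr \<epsilon>\<close>, and \<nu> from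
      \<open>1 - \<mu> = \<epsilon>\<close>.\<close>
    define K where "K = b * \<theta> + 2 + \<nu>"
    have K: "0 < K" using b \<theta> \<nu> by (simp add: K_def add_nonneg_pos add_pos_nonneg)
    define \<epsilon> where "\<epsilon> = min (1 / 2) ((?\<Delta> - x) / (2 * K))"
    have \<epsilon>: "0 < \<epsilon>" "\<epsilon> < 1" "\<epsilon> * K < ?\<Delta> - x"
    proof -
      show "0 < \<epsilon>" "\<epsilon> < 1" using x K by (auto simp: \<epsilon>_def)
      have "\<epsilon> * K \<le> (?\<Delta> - x) / (2 * K) * K" using K by (intro mult_right_mono) (auto simp: \<epsilon>_def)
      also have "\<dots> < ?\<Delta> - x" using x K by simp
      finally show "\<epsilon> * K < ?\<Delta> - x" .
    qed
    define \<kappa> where "\<kappa> = b * (1 - \<epsilon>)"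
    have \<Delta>0: "0 \<le> ?\<Delta>" using \<theta> b \<nu> by (simp add: mult_nonneg_nonneg)
    have \<kappa>: "0 \<le> \<kappa>" "\<kappa> < b" using b \<epsilon> by (auto simp: \<kappa>_def)
    have lt: "\<kappa> * \<theta> < real (Mr * Mt)"
    proof -
      have pos: "0 < real (Mr * Mt)" using M by simp
      have "\<kappa> * \<theta> = (1 - \<epsilon>) * (b * \<theta>)" by (simp add: \<kappa>_def)
      also have "\<dots> \<le> (1 - \<epsilon>) * real (Mr * Mt)" using \<epsilon> \<theta>(3) by (intro mult_left_mono) auto
      also have "\<dots> < 1 * real (Mr * Mt)" using \<epsilon> pos by (intro mult_strict_right_mono) auto
      finally show ?thesis by simp
    qed
    \<comment> \<open>The moment order is \<open>?\<Delta> / \<epsilon>\<close>, so that clipping at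
      \<open>\<rho> powr \<epsilon>\<close> costs exactly
      \<open>\<rho> powr (- ?\<Delta>)\<close>.\<close>
    obtain C where C: "0 < C" "\<And>\<rho> s R. 0 < \<rho> \<Longrightarrow> 0 < s \<Longrightarrow> 0 < R \<Longrightarrow>
      ED_star Mt Mr b \<rho> s \<le> C * (R powr (- (?\<Delta> / \<epsilon>)) + (R\<^sup>2 + s powr (1 - (1 - \<epsilon>))) * (\<rho> powr (- (\<kappa> * \<theta>)) * s powr (- (1 - \<theta>))))"
      using ED_star_upper_bound[OF M(1,2) b \<kappa>, of "?\<Delta> / \<epsilon>" "1 - \<epsilon>", OF _ _ _ \<theta>(1,2) lt] \<epsilon> \<Delta>0 by auto
    define t where "t \<rho> = ln (\<rho>s \<rho>) / ln \<rho>" for \<rho>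
    define W where "W \<rho> = min ?\<Delta> (min (\<kappa> * \<theta> + (1 - \<theta>) * t \<rho> - 2 * \<epsilon>) (\<kappa> * \<theta> + (1 - \<theta>) * t \<rho> - \<epsilon> * t \<rho>)) - ln (3 * C) / ln \<rho>" for \<rho>
    have "(W \<longlongrightarrow> min ?\<Delta> (min (\<kappa> * \<theta> + (1 - \<theta>) * \<nu> - 2 * \<epsilon>) (\<kappa> * \<theta> + (1 - \<theta>) * \<nu> - \<epsilon> * \<nu>)) - 0) at_top"
      unfolding W_def[abs_def] t_def by (intro tendsto_diff tendsto_min tendsto_add tendsto_mult tendsto_const tendsto_const_div_ln lim)
    moreover have "x < min ?\<Delta> (min (\<kappa> * \<theta> + (1 - \<theta>) * \<nu> - 2 * \<epsilon>) (\<kappa> * \<theta> + (1 - \<theta>) * \<nu> - \<epsilon> * \<nu>)) - 0"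
    proof -
      have e: "\<kappa> * \<theta> + (1 - \<theta>) * \<nu> = ?\<Delta> - \<epsilon> * (b * \<theta>)" by (simp add: \<theta>(4) \<kappa>_def algebra_simps)
      have "\<epsilon> * K = \<epsilon> * (b * \<theta>) + 2 * \<epsilon> + \<epsilon> * \<nu>" by (simp add: K_def algebra_simps)
      moreover have "0 \<le> \<epsilon> * (b * \<theta>)" "0 \<le> \<epsilon> * \<nu>" using \<epsilon> b \<theta> \<nu> by auto
      ultimately show ?thesis unfolding e using \<epsilon> x by (simp add: min_def)
    qed
    ultimately have "\<forall>\<^sub>F \<rho> in at_top. x < W \<rho>" by (rule order_tendstoD(1))
    then show ?thesis using eventually_gt_at_top[of 1]
    proof eventually_elim
      case (elim \<rho>)
      have s: "0 < \<rho>s \<rho>" using \<rho>s elim by simp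
      have "ED_star Mt Mr b \<rho> (\<rho>s \<rho>) \<le> C * (\<rho> powr (- ?\<Delta>) + (\<rho> powr (2 * \<epsilon>) + \<rho>s \<rho> powr \<epsilon>) * (\<rho> powr (- (\<kappa> * \<theta>)) * \<rho>s \<rho> powr (- (1 - \<theta>))))"
        using C(2)[of \<rho> "\<rho>s \<rho>" "\<rho> powr \<epsilon>"] s elim \<epsilon> by (simp add: powr_powr powr_power mult.commute)
      from exponent_ge_min[OF elim(2) s _ C(1) this refl] have "W \<rho> \<le> ?f \<rho>"
        using U(2)[OF elim(2)] unfolding W_def t_def by blast
      then show ?case using elim by linarith
    qed
  qed
qed

lemma bsld_best_exponent_le: "bsld_best_exponent Mt Mr b \<rho>s L \<le> ereal (Delta_formula Mt Mr b \<nu>)"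
  unfolding bsld_best_exponent_def
proof (rule SUP_least, clarify)
  fix r \<xi> :: "nat \<Rightarrow> real" assume p: "bsld_params L r \<xi>"
  obtain U where U: "(U \<longlongrightarrow> Delta_formula Mt Mr b \<nu>) at_top"
    "\<And>\<rho>. 1 < \<rho> \<Longrightarrow> - ln (bsld_exp_dist Mt Mr b \<rho> (\<rho>s \<rho>) L r \<xi>) / ln \<rho> \<le> U \<rho>"
    using converse_exponent p by metis
  have "bsld_exponent Mt Mr b \<rho>s L r \<xi> \<le> Liminf at_top (\<lambda>\<rho>. ereal (U \<rho>))"
    unfolding bsld_exponent_def
  proof (rule Liminf_mono)
    show "\<forall>\<^sub>F \<rho> in at_top. ereal (- ln (bsld_exp_dist Mt Mr b \<rho> (\<rho>s \<rho>) L r \<xi>) / ln \<rho>) \<le> ereal (U \<rho>)"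
      using eventually_gt_at_top[of 1] by eventually_elim (use U(2) in auto)
  qed
  also have "\<dots> = ereal (Delta_formula Mt Mr b \<nu>)"
    using U(1) by (intro lim_imp_Liminf tendsto_ereal) auto
  finally show "bsld_exponent Mt Mr b \<rho>s L r \<xi> \<le> ereal (Delta_formula Mt Mr b \<nu>)" .
qed

text \<open>The rate slack is tied to the number of layers by \<delta> = 1/L. One factor
  \<open>1 - 1 / real L\<close> comes from this slack, the other from rounding to whole
  layers.\<close>

lemma bsld_best_exponent_ge:
  assumes L: "2 \<le> L"
  shows "ereal ((1 - 1 / real L)\<^sup>2 * Delta_formula Mt Mr b \<nu>) \<le> bsld_best_exponent Mt Mr b \<rho>s L"
proof -
  let ?\<Delta> = "Delta_formula Mt Mr b \<nu>"
  define \<delta> where "\<delta> = 1 / real L"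
  have \<delta>: "0 < \<delta>" "\<delta> < 1" using L by (auto simp: \<delta>_def)
  have L1: "1 \<le> L" using L by simp
  define r \<xi> :: "nat \<Rightarrow> real" where "r = (\<lambda>_. (1 - \<delta>) / real L)" and "\<xi> = (\<lambda>l. 1 - real l / real L)"
  have p: "bsld_params L r \<xi>" unfolding bsld_params_def r_def \<xi>_def using L \<delta> by (auto simp: field_simps)
  obtain \<theta> where \<theta>: "0 \<le> \<theta>" "\<theta> \<le> 1" "b * \<theta> \<le> real (Mr * Mt)" "?\<Delta> = b * \<theta> + \<nu> * (1 - \<theta>)"
    using Delta_formula_eq_theta(1)[OF b \<nu> M] by blast
  \<comment> \<open>The natural weight \<open>1 - \<theta>\<close> of the side information equals 1
    when \<theta> = 0, where the inverse fading has infinite mean; shrinking it by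
    \<open>1 - \<delta>\<close> keeps the moment finite.\<close>
  define \<tau> where "\<tau> = (1 - \<delta>) * (1 - \<theta>)"
  have \<tau>: "0 \<le> \<tau>" "\<tau> < 1" "\<tau> + \<theta> \<le> 1"
  proof -
    show "0 \<le> \<tau>" using \<delta> \<theta> by (simp add: \<tau>_def)
    have "\<tau> \<le> (1 - \<delta>) * 1" unfolding \<tau>_def using \<delta> \<theta> by (intro mult_left_mono) auto
    then show "\<tau> < 1" using \<delta> by simp
    have "\<tau> \<le> 1 * (1 - \<theta>)" unfolding \<tau>_def using \<delta> \<theta> by (intro mult_right_mono) auto
    then show "\<tau> + \<theta> \<le> 1" by simp
  qed
  have lt: "b * (1 - \<delta>) * \<theta> < real (Mr * Mt)"
  proof -
    have pos: "0 < real (Mr * Mt)" using M by simp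
    have "b * (1 - \<delta>) * \<theta> = (1 - \<delta>) * (b * \<theta>)" by simp
    also have "\<dots> \<le> (1 - \<delta>) * real (Mr * Mt)" using \<delta> \<theta>(3) by (intro mult_left_mono) auto
    also have "\<dots> < 1 * real (Mr * Mt)" using \<delta> pos by (intro mult_strict_right_mono) auto
    finally show ?thesis by simp
  qed
  define u where "u = (1 - 1 / real L) * (b * (1 - \<delta>) * \<theta>)"
  obtain C where C: "0 < C" "\<And>\<rho> s. 2 powr (real L / \<delta>) < \<rho> \<Longrightarrow> 0 < s \<Longrightarrow>
    bsld_exp_dist Mt Mr b \<rho> s L r \<xi> \<le> C * s powr (- \<tau>) * \<rho> powr (- u)"
    using bsld_exp_dist_le[OF M b \<delta> L1 r_def \<xi>_def \<tau>(1,2) \<theta>(1) \<tau>(3) lt] unfolding u_def by blast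
  obtain U where U: "\<And>\<rho>. 1 < \<rho> \<Longrightarrow> 0 < bsld_exp_dist Mt Mr b \<rho> (\<rho>s \<rho>) L r \<xi>"
    using converse_exponent p by metis
  define W where "W \<rho> = \<tau> * (ln (\<rho>s \<rho>) / ln \<rho>) + u - ln C / ln \<rho>" for \<rho>
  have "(W \<longlongrightarrow> \<tau> * \<nu> + u - 0) at_top"
    unfolding W_def[abs_def] by (intro tendsto_diff tendsto_add tendsto_mult tendsto_const tendsto_const_div_ln lim)
  then have "Liminf at_top (\<lambda>\<rho>. ereal (W \<rho>)) = ereal (\<tau> * \<nu> + u)"
    by (intro lim_imp_Liminf tendsto_ereal) auto
  moreover have "Liminf at_top (\<lambda>\<rho>. ereal (W \<rho>)) \<le> bsld_exponent Mt Mr b \<rho>s L r \<xi>"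
    unfolding bsld_exponent_def
  proof (rule Liminf_mono)
    show "\<forall>\<^sub>F \<rho> in at_top. ereal (W \<rho>) \<le> ereal (- ln (bsld_exp_dist Mt Mr b \<rho> (\<rho>s \<rho>) L r \<xi>) / ln \<rho>)"
      using eventually_gt_at_top[of 1] eventually_gt_at_top[of "2 powr (real L / \<delta>)"]
    proof eventually_elim
      case (elim \<rho>)
      have s: "0 < \<rho>s \<rho>" using \<rho>s elim by simp
      have "ln \<rho> \<noteq> 0" using elim by simp
      then have "\<rho>s \<rho> powr (- \<tau>) = \<rho> powr (- (\<tau> * (ln (\<rho>s \<rho>) / ln \<rho>)))" using s elim by (simp add: powr_def)
      then have "bsld_exp_dist Mt Mr b \<rho> (\<rho>s \<rho>) L r \<xi> \<le> C * \<rho> powr (- (\<tau> * (ln (\<rho>s \<rho>) / ln \<rho>) + u))"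
        using C(2)[OF elim(2) s] by (simp add: mult.assoc flip: powr_add)
      from exponent_ge[OF elim(1) U[OF elim(1)] C(1) this] show ?case by (simp add: W_def)
    qed
  qed
  moreover have "bsld_exponent Mt Mr b \<rho>s L r \<xi> \<le> bsld_best_exponent Mt Mr b \<rho>s L"
    unfolding bsld_best_exponent_def by (rule SUP_upper2[of "(r, \<xi>)"]) (use p in auto)
  moreover have "(1 - 1 / real L)\<^sup>2 * ?\<Delta> \<le> \<tau> * \<nu> + u"
  proof -
    have "(1 - \<delta>) * (\<nu> * (1 - \<theta>)) * (1 - \<delta>) \<le> (1 - \<delta>) * (\<nu> * (1 - \<theta>)) * 1"
      using \<delta> \<nu> \<theta> by (intro mult_left_mono) auto
    then have "(1 - \<delta>)\<^sup>2 * (\<nu> * (1 - \<theta>)) \<le> \<tau> * \<nu>" by (simp add: \<tau>_def power2_eq_square mult_ac)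
    moreover have "(1 - \<delta>)\<^sup>2 * (b * \<theta>) = u" by (simp add: u_def \<delta>_def power2_eq_square mult_ac)
    ultimately have "(1 - \<delta>)\<^sup>2 * (b * \<theta>) + (1 - \<delta>)\<^sup>2 * (\<nu> * (1 - \<theta>)) \<le> \<tau> * \<nu> + u" by linarith
    then show ?thesis by (simp only: \<theta>(4) distrib_left \<delta>_def)
  qed
  ultimately show ?thesis by (metis ereal_less_eq(3) order_trans)
qed

end

text \<open>The first conjunct gives \<open>ED_star\<close> its meaning, since \<open>lim\<close> of
  a divergent sequence would be an unspecified number. The hypothesis on the logarithms is the
  exponential equality of \<rho>s with the power \<nu> of \<rho>.\<close>

theorem theorem6:
  fixes Mt Mr :: nat and b \<nu> :: real and \<rho>s :: "real \<Rightarrow> real"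
  assumes "1 \<le> Mt" and "1 \<le> Mr" and "min Mt Mr = 1"
    and "0 < b" and "0 \<le> \<nu>"
    and "\<forall>\<rho>>0. 0 < \<rho>s \<rho>"
    and "((\<lambda>\<rho>. ln (\<rho>s \<rho>) / ln \<rho>) \<longlongrightarrow> \<nu>) at_top"
  shows "(\<forall>\<^sub>F \<rho> in at_top. convergent (\<lambda>m. enn2real (opt_dist Mt Mr b \<rho> (\<rho>s \<rho>) m)))
    \<and> ((\<lambda>\<rho>. - ln (ED_star Mt Mr b \<rho> (\<rho>s \<rho>)) / ln \<rho>) \<longlongrightarrow> Delta_formula Mt Mr b \<nu>) at_top
    \<and> ((\<lambda>L. bsld_best_exponent Mt Mr b \<rho>s L) \<longlonglongrightarrow> ereal (Delta_formula Mt Mr b \<nu>))"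
proof (intro conjI)
  show "\<forall>\<^sub>F \<rho> in at_top. convergent (\<lambda>m. enn2real (opt_dist Mt Mr b \<rho> (\<rho>s \<rho>) m))"
    using assms(4) by (intro always_eventually allI convergent_opt_dist) simp
  show "((\<lambda>\<rho>. - ln (ED_star Mt Mr b \<rho> (\<rho>s \<rho>)) / ln \<rho>) \<longlongrightarrow> Delta_formula Mt Mr b \<nu>) at_top"
    by (rule ED_star_exponent[OF assms])
  let ?\<Delta> = "Delta_formula Mt Mr b \<nu>"
  have "(\<lambda>L. (1 - 1 / real L)\<^sup>2 * ?\<Delta>) \<longlonglongrightarrow> (1 - 0)\<^sup>2 * ?\<Delta>"
    by (intro tendsto_mult tendsto_power tendsto_diff tendsto_const lim_1_over_n)
  then have "(\<lambda>L. ereal ((1 - 1 / real L)\<^sup>2 * ?\<Delta>)) \<longlonglongrightarrow> ereal ?\<Delta>" by simp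
  then show "(\<lambda>L. bsld_best_exponent Mt Mr b \<rho>s L) \<longlonglongrightarrow> ereal ?\<Delta>"
  proof (rule tendsto_sandwich[OF _ _ _ tendsto_const, rotated 2])
    show "\<forall>\<^sub>F L in sequentially. ereal ((1 - 1 / real L)\<^sup>2 * ?\<Delta>) \<le> bsld_best_exponent Mt Mr b \<rho>s L"
      using eventually_ge_at_top[of 2] by eventually_elim (rule bsld_best_exponent_ge[OF assms])
    show "\<forall>\<^sub>F L in sequentially. bsld_best_exponent Mt Mr b \<rho>s L \<le> ereal ?\<Delta>"
      by (intro always_eventually allI bsld_best_exponent_le[OF assms])
  qed
qed

end
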